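(* Let $d\in\omega$, let $\kappa$ be an inaccessible cardinal and let $\lambda$ be an infinite cardinal such that $\lambda\to(\kappa)^{2d}_{2^\kappa}$ (or, in the case $d=1$, $\lambda=(2^\kappa)^+$). Suppose further that $\kappa$ is measurable in the forcing extension by $\mathrm{Add}(\kappa,\lambda)$. Then: (1) for every $\delta<\kappa$ and every $f:\mathbb{Q}_\kappa^{d+1}\to\delta$ there exist $X_0,\dots,X_d\subseteq\mathbb{Q}_\kappa$, each of order type $\eta_\kappa$, such that $|f''\prod_{j\le d}X_j|\le (d+1)!$; (2) the number $(d+1)!$ cannot be lowered: there exist $\delta<\kappa$ and $f:\mathbb{Q}_\kappa^{d+1}\to\delta$ such that for all $X_0,\dots,X_d\subseteq\mathbb{Q}_\kappa$ of order type $\eta_\kappa$ we have $|f''\prod_{j\le d}X_j|> (d+1)!-1$.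
   Context: A linear order $(X,<)$ is $\kappa$-saturated if for all $A,B\subseteq X$ with $|A|,|B|<\kappa$ and $A<B$ there is $c\in X$ with $A<c<B$. Since $\kappa$ is inaccessible, $\kappa^{<\kappa}=\kappa$ and there is, up to isomorphism, a unique $\kappa$-saturated linear order of size $\kappa$; it is denoted $\mathbb{Q}_\kappa$ and its order type is denoted $\eta_\kappa$. $\lambda\to(\kappa)^{2d}_{2^\kappa}$ is the Erdős–Rado arrow: every coloring of $[\lambda]^{2d}$ with $2^\kappa$ colors has a homogeneous set of size $\kappa$. $\mathrm{Add}(\kappa,\lambda)$ is the forcing adding $\lambda$ Cohen subsets of $\kappa$ with conditions of size $<\kappa$. *)

theory Defs
  imports Main "HOL-Library.FuncSet" "HOL-Library.Ramsey"
begin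

unbundle cardinal_syntax

section \<open>Cardinals\<close>

text \<open>
  Cardinals are relations \<open>\<kappa>\<close> with \<^term>\<open>Card_order \<kappa>\<close>. Since such a relation is a well-order of its
  field of initial type, the ordinals below \<open>\<kappa>\<close> are represented by the elements \<open>\<alpha>\<close> of
  \<^term>\<open>Field \<kappa>\<close>, and the ordinal \<open>\<alpha>\<close> as a set by \<^term>\<open>underS \<kappa> \<alpha>\<close>.
\<close>

definition inaccessible :: "'k rel \<Rightarrow> bool" where
  "inaccessible \<kappa> \<longleftrightarrow> Card_order \<kappa> \<and> natLeq <o \<kappa> \<and> regularCard \<kappa> \<and>
     (\<forall>A \<subseteq> Field \<kappa>. |A| <o \<kappa> \<longrightarrow> |Pow A| <o \<kappa>)"

text \<open>The partition relation \<open>lam \<rightarrow> (\<kappa>)\<^sup>n\<^sub>\<mu>\<close>.\<close>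

definition arrows :: "'l rel \<Rightarrow> 'k rel \<Rightarrow> nat \<Rightarrow> 'm rel \<Rightarrow> bool" where
  "arrows lam \<kappa> n \<mu> \<longleftrightarrow>
     (\<forall>c \<in> [Field lam]\<^bsup>n\<^esup> \<rightarrow> Field \<mu>.
        \<exists>H \<subseteq> Field lam. |H| =o \<kappa> \<and> (\<exists>i \<in> Field \<mu>. \<forall>s \<in> [H]\<^bsup>n\<^esup>. c s = i))"

section \<open>Saturated linear orders\<close>

definition saturated :: "'k rel \<Rightarrow> 'q::linorder set \<Rightarrow> bool" where
  "saturated \<kappa> X \<longleftrightarrow>
     (\<forall>A \<subseteq> X. \<forall>B \<subseteq> X. |A| <o \<kappa> \<and> |B| <o \<kappa> \<and> (\<forall>a\<in>A. \<forall>b\<in>B. a < b) \<longrightarrow>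
        (\<exists>c\<in>X. (\<forall>a\<in>A. a < c) \<and> (\<forall>b\<in>B. c < b)))"

text \<open>The linear order on the type \<^typ>\<open>'q\<close> is (a copy of) \<open>\<rat>\<^sub>\<kappa>\<close>.\<close>

definition is_Q_kappa :: "'k rel \<Rightarrow> 'q::linorder itself \<Rightarrow> bool" where
  "is_Q_kappa \<kappa> _ \<longleftrightarrow> saturated \<kappa> (UNIV :: 'q set) \<and> |UNIV :: 'q set| =o \<kappa>"

text \<open>
  If \<^typ>\<open>'q\<close> is \<open>\<rat>\<^sub>\<kappa>\<close>, then \<open>\<eta>\<^sub>\<kappa>\<close> is the order type of \<^typ>\<open>'q\<close>, so a subset has order type
  \<open>\<eta>\<^sub>\<kappa>\<close> iff it is order-isomorphic to \<^typ>\<open>'q\<close>.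
\<close>

definition has_type_eta :: "'q::linorder set \<Rightarrow> bool" where
  "has_type_eta X \<longleftrightarrow> (\<exists>g :: 'q \<Rightarrow> 'q. strict_mono g \<and> range g = X)"

section \<open>Forcing\<close>

text \<open>
  A notion of forcing is a reflexive partial order \<open>P\<close>, where \<^term>\<open>(q, p) \<in> P\<close> means that \<open>q\<close> is
  stronger than \<open>p\<close>. A sentence of the forcing language is identified with the predicate
  ``\<open>p\<close> forces the sentence'' on conditions, so the connectives below are the usual recursive clauses
  of the forcing relation.

  In a \<open>P\<close>-name for a set of elements of the ground model the check signs are left out: a set \<open>X\<close> of
  pairs \<open>(a, p)\<close> stands for the name whose elements are the pairs (check name of \<open>a\<close>, \<open>p\<close>). Every
  subset of a ground model set \<open>A\<close> that lies in the extension has a name contained in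
  \<^term>\<open>A \<times> Field P\<close>, and every family of such subsets has a name that is a set of pairs \<open>(Y, p)\<close>
  with \<open>Y\<close> such a name. Hence quantifiers over these names are quantifiers over all subsets of \<open>A\<close>,
  respectively all families of subsets of \<open>A\<close>, of the extension.
\<close>

type_synonym 'p sentence = "'p \<Rightarrow> bool"
type_synonym ('a, 'p) name = "('a \<times> 'p) set"

definition dense_below :: "'p rel \<Rightarrow> 'p \<Rightarrow> ('p \<Rightarrow> bool) \<Rightarrow> bool" where
  "dense_below P p D \<longleftrightarrow> (\<forall>q. (q, p) \<in> P \<longrightarrow> (\<exists>r. (r, q) \<in> P \<and> D r))"

subsection \<open>Connectives and quantifiers\<close>

definition fNot :: "'p rel \<Rightarrow> 'p sentence \<Rightarrow> 'p sentence" where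
  "fNot P \<phi> = (\<lambda>p. \<forall>q. (q, p) \<in> P \<longrightarrow> \<not> \<phi> q)"

definition fAnd :: "'p sentence \<Rightarrow> 'p sentence \<Rightarrow> 'p sentence" where
  "fAnd \<phi> \<psi> = (\<lambda>p. \<phi> p \<and> \<psi> p)"

definition fOr :: "'p rel \<Rightarrow> 'p sentence \<Rightarrow> 'p sentence \<Rightarrow> 'p sentence" where
  "fOr P \<phi> \<psi> = (\<lambda>p. dense_below P p (\<lambda>q. \<phi> q \<or> \<psi> q))"

definition fImp :: "'p rel \<Rightarrow> 'p sentence \<Rightarrow> 'p sentence \<Rightarrow> 'p sentence" where
  "fImp P \<phi> \<psi> = (\<lambda>p. \<forall>q. (q, p) \<in> P \<longrightarrow> \<phi> q \<longrightarrow> \<psi> q)"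

definition fAll :: "'x set \<Rightarrow> ('x \<Rightarrow> 'p sentence) \<Rightarrow> 'p sentence" where
  "fAll N \<phi> = (\<lambda>p. \<forall>x\<in>N. \<phi> x p)"

definition fEx :: "'p rel \<Rightarrow> 'x set \<Rightarrow> ('x \<Rightarrow> 'p sentence) \<Rightarrow> 'p sentence" where
  "fEx P N \<phi> = (\<lambda>p. dense_below P p (\<lambda>q. \<exists>x\<in>N. \<phi> x q))"

subsection \<open>Names and atomic sentences\<close>

definition subset_names :: "'p rel \<Rightarrow> 'a set \<Rightarrow> ('a, 'p) name set" where
  "subset_names P A = Pow (A \<times> Field P)"

definition family_names :: "'p rel \<Rightarrow> 'a set \<Rightarrow> (('a, 'p) name, 'p) name set" where
  "family_names P A = Pow (subset_names P A \<times> Field P)"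

text \<open>\<open>a \<in> X\<close> for an element \<open>a\<close> of the ground model\<close>

definition fElem :: "'p rel \<Rightarrow> 'a \<Rightarrow> ('a, 'p) name \<Rightarrow> 'p sentence" where
  "fElem P a X = (\<lambda>p. dense_below P p (\<lambda>q. \<exists>r. (a, r) \<in> X \<and> (q, r) \<in> P))"

definition fSubset :: "'p rel \<Rightarrow> ('a, 'p) name \<Rightarrow> ('a, 'p) name \<Rightarrow> 'p sentence" where
  "fSubset P X Y = fAll UNIV (\<lambda>a. fImp P (fElem P a X) (fElem P a Y))"

definition fEq :: "'p rel \<Rightarrow> ('a, 'p) name \<Rightarrow> ('a, 'p) name \<Rightarrow> 'p sentence" where
  "fEq P X Y = fAnd (fSubset P X Y) (fSubset P Y X)"

text \<open>\<open>X \<in> U\<close> for a name \<open>X\<close> of a set and a name \<open>U\<close> of a family of sets\<close>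

definition fIn :: "'p rel \<Rightarrow> ('a, 'p) name \<Rightarrow> (('a, 'p) name, 'p) name \<Rightarrow> 'p sentence" where
  "fIn P X U =
     (\<lambda>p. dense_below P p (\<lambda>q. \<exists>Y r. (Y, r) \<in> U \<and> (q, r) \<in> P \<and> fEq P X Y q))"

text \<open>The canonical name of \<open>{a \<in> A. \<phi> a}\<close>, and the check name of a ground model set \<open>A\<close>\<close>

definition fCollect :: "'p rel \<Rightarrow> 'a set \<Rightarrow> ('a \<Rightarrow> 'p sentence) \<Rightarrow> ('a, 'p) name" where
  "fCollect P A \<phi> = {(a, p). a \<in> A \<and> p \<in> Field P \<and> \<phi> a p}"

definition check :: "'p rel \<Rightarrow> 'a set \<Rightarrow> ('a, 'p) name" where
  "check P A = A \<times> Field P"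

subsection \<open>Measurability in the extension\<close>

text \<open>
  In the extension, a sequence \<open>\<langle>X\<^sub>\<xi>. \<xi> < \<beta>\<rangle>\<close> of subsets of \<open>\<kappa>\<close> is the same as a subset \<open>S\<close> of
  \<open>\<beta> \<times> \<kappa>\<close>; \<open>X\<^sub>\<xi>\<close> is then the section of \<open>S\<close> at \<open>\<xi>\<close>.
\<close>

definition section_name :: "('b \<times> 'a, 'p) name \<Rightarrow> 'b \<Rightarrow> ('a, 'p) name" where
  "section_name S \<xi> = {(\<alpha>, p). ((\<xi>, \<alpha>), p) \<in> S}"

text \<open>
  ``\<open>U\<close> is a nonprincipal \<open>\<kappa>\<close>-complete ultrafilter on \<open>\<kappa>\<close>''. Closure under binary intersections
  and \<open>\<kappa> \<in> U\<close> are the cases \<open>\<beta> = 2\<close> and \<open>\<beta> = 0\<close> of \<open>\<kappa>\<close>-completeness.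
\<close>

definition fNonprincipal_complete_ultrafilter ::
    "'p rel \<Rightarrow> 'k rel \<Rightarrow> (('k, 'p) name, 'p) name \<Rightarrow> 'p sentence" where
  "fNonprincipal_complete_ultrafilter P \<kappa> U =
     (let Sub = subset_names P (Field \<kappa>) in
      fAnd (fNot P (fIn P (check P {}) U))
     (fAnd (fAll Sub (\<lambda>X. fAll Sub (\<lambda>Y.
              fImp P (fAnd (fIn P X U) (fSubset P X Y)) (fIn P Y U))))
     (fAnd (fAll Sub (\<lambda>X.
              fOr P (fIn P X U)
                    (fIn P (fCollect P (Field \<kappa>) (\<lambda>\<alpha>. fNot P (fElem P \<alpha> X))) U)))
     (fAnd (fAll (Field \<kappa>) (\<lambda>\<alpha>. fNot P (fIn P (check P {\<alpha>}) U)))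
           (fAll (Field \<kappa>) (\<lambda>\<beta>. fAll (subset_names P (underS \<kappa> \<beta> \<times> Field \<kappa>)) (\<lambda>S.
              fImp P (fAll (underS \<kappa> \<beta>) (\<lambda>\<xi>. fIn P (section_name S \<xi>) U))
                     (fIn P (fCollect P (Field \<kappa>) (\<lambda>\<alpha>.
                        fAll (underS \<kappa> \<beta>) (\<lambda>\<xi>. fElem P \<alpha> (section_name S \<xi>)))) U))))))))"

text \<open>
  ``\<open>\<kappa>\<close> is measurable'', for an ordinal \<open>\<kappa>\<close> greater than \<open>\<omega>\<close>. That \<open>\<kappa>\<close> is an uncountable cardinal of
  the extension need not be added: a map from some \<open>\<beta> < \<kappa>\<close> onto \<open>\<kappa>\<close> would make \<open>\<emptyset>\<close> an intersection
  of \<open>\<beta>\<close> many complements of singletons, all of which lie in \<open>U\<close>.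
\<close>

definition fMeasurable :: "'p rel \<Rightarrow> 'k rel \<Rightarrow> 'p sentence" where
  "fMeasurable P \<kappa> =
     fEx P (family_names P (Field \<kappa>)) (\<lambda>U. fNonprincipal_complete_ultrafilter P \<kappa> U)"

subsection \<open>Adding Cohen subsets\<close>

text \<open>
  \<open>Add(\<kappa>, lam)\<close>: partial functions from \<open>lam \<times> \<kappa>\<close> to \<open>2\<close> of size less than \<open>\<kappa>\<close>, ordered by reverse
  inclusion. The weakest condition is the empty map.
\<close>

definition Add_conditions :: "'k rel \<Rightarrow> 'l rel \<Rightarrow> ('l \<times> 'k \<rightharpoonup> bool) set" where
  "Add_conditions \<kappa> lam = {p. dom p \<subseteq> Field lam \<times> Field \<kappa> \<and> |dom p| <o \<kappa>}"

definition Add :: "'k rel \<Rightarrow> 'l rel \<Rightarrow> ('l \<times> 'k \<rightharpoonup> bool) rel" where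
  "Add \<kappa> lam = {(q, p). q \<in> Add_conditions \<kappa> lam \<and> p \<in> Add_conditions \<kappa> lam \<and> p \<subseteq>\<^sub>m q}"

definition measurable_in_Add_extension :: "'k rel \<Rightarrow> 'l rel \<Rightarrow> bool" where
  "measurable_in_Add_extension \<kappa> lam \<longleftrightarrow> fMeasurable (Add \<kappa> lam) \<kappa> Map.empty"

end

theory Submission
  imports Defs "HOL-Combinatorics.Permutations"
begin

text \<open>
  Let \<open>b\<^sub>l\<close>, for \<open>l < lam\<close>, be the Cohen branches of the tree \<open>T\<close> of all \<open>01\<close>-sequences of length less
  than \<open>\<kappa>\<close>. A colouring of the \<open>n\<close>-tuples of nodes of equal level, with fewer than \<open>\<kappa>\<close> colours, has for every \<open>n\<close>-tuple of
  branches an ultrafilter limit in the extension, and any condition that decides fewer than \<open>\<kappa>\<close> limits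
  extends to one that realizes all of them at a common level. Nothing else of the measurability is needed.
  The partition relation (for \<open>d = 1\<close>, a delta system argument) yields many indices for which the
  deciding conditions are isomorphic and compatible, and a fusion along \<open>\<kappa>\<close> turns these into
  strong subtrees of \<open>T\<close>: for \<open>d\<close> coordinates, subtrees on which fewer than \<open>\<kappa>\<close> colourings at a time depend
  only on the restrictions to a lower level; for \<open>d + 1\<close> coordinates, where only one additional branch varies
  over \<open>2\<^sup>\<kappa>\<close> many, subtrees on which a colouring is constant.

  Iterating this, a colouring of \<open>d + 1\<close> nodes of arbitrary distinct levels is reduced to one that depends only on the
  order of the levels, which leaves \<open>(d + 1)!\<close> cases. The tree is mapped into \<open>\<rat>\<^sub>\<kappa>\<close> by saturation, and \<open>\<rat>\<^sub>\<kappa>\<close> is coded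
  in the tree by \<open>d + 1\<close> antichains with pairwise disjoint sets of levels. For the lower bound, a tuple is
  coloured by the order of its components in a well-order of \<open>\<rat>\<^sub>\<kappa>\<close> of type \<open>\<kappa>\<close>: every set of type \<open>\<eta>\<^sub>\<kappa>\<close> is
  unbounded in it, so all orders occur.
\<close>

section \<open>Closing off and delta systems\<close>

text \<open>The partition relation controls only \<open>d\<close> coordinates, whereas
  \<open>d + 1\<close> nodes are to be coloured. The count works out because dependence on the nodes
  is removed from the top down: as long as a nonempty set \<open>J\<close> of nodes is frozen, at
  most \<open>d\<close> nodes vary, and there are fewer than \<kappa> ways to freeze nodes up to a
  given level. This is why the subtrees for \<open>d\<close> coordinates have to serve fewer than
  \<kappa> colourings at every level. All \<open>d + 1\<close> nodes vary only once the lowest node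
  is reached, and there a single colouring is left. The exponent \<open>2 d\<close> comes from
  comparing two \<open>d\<close>-tuples at a time. The \<open>2^\<kappa>\<close> colours come from
  recording, for a tuple, how the conditions on \<kappa> many rows decide limits, which is a subset
  of a set of size \<kappa>. The Cohen indices used at different stages of a fusion are unrelated to
  each other: what persists in the \<open>d\<close>-dimensional fusion are conditions on abstract
  rows, i.e. positions in an enumeration, and every stage transports them to a new block of
  indices.\<close>

lemma card_UN_bound:
  assumes "|I| \<le>o |M|" "\<And>i. i \<in> I \<Longrightarrow> |A i| \<le>o |M|" "infinite M"
  shows "|\<Union>i\<in>I. A i| \<le>o |M|"
  using assms by (intro card_of_UNION_ordLeq_infinite) auto

lemma card_Un_bound: "|A| \<le>o |M| \<Longrightarrow> |B| \<le>o |M| \<Longrightarrow> infinite M \<Longrightarrow> |A \<union> B| \<le>o |M|"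
  by (rule card_of_Un_ordLeq_infinite_Field) (simp_all add: Field_card_of card_of_card_order_on)

text \<open>Iterating \<open>\<Phi>\<close> along \<open>r\<close> gives an increasing chain of sets
  of size at most \<open>M\<close>. As \<open>r\<close> is regular, a subset of the union of size
  less than \<open>r\<close> lies in one stage already, and the next stage absorbs its image. The
  result plays the role of an elementary submodel of size \<open>M\<close> that is closed under
  sequences shorter than \<open>r\<close>.\<close>

lemma closing_off:
  fixes r :: "'r rel" and \<Phi> :: "'x set \<Rightarrow> 'x set" and M :: "'m set"
  assumes r: "Card_order r" "regularCard r" "infinite (Field r)" "r \<le>o |M|"
    and pw: "\<And>A :: 'x set. |A| \<le>o |M| \<Longrightarrow> |{B. B \<subseteq> A \<and> |B| <o r}| \<le>o |M|"
    and \<Phi>: "\<And>B. |B| <o r \<Longrightarrow> |\<Phi> B| \<le>o |M|"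
    and R0: "|R0| \<le>o |M|"
  shows "\<exists>R. R0 \<subseteq> R \<and> |R| \<le>o |M| \<and> (\<forall>B \<subseteq> R. |B| <o r \<longrightarrow> \<Phi> B \<subseteq> R)"
proof -
  have wo: "wo_rel r" using r(1) by (simp add: card_order_on_def wo_rel_def)
  have Mr: "|Field r| \<le>o |M|"
    using r(1,4) card_of_Field_ordIso ordIso_ordLeq_trans by blast
  have Minf: "infinite M" using Mr r(3) by (metis card_of_ordLeq_infinite)
  have wfr: "wf (r - Id)" using wo unfolding wo_rel_def well_order_on_def by blast
  define H where "H f i = R0 \<union> (\<Union>j\<in>underS r i. f j \<union> \<Union> (\<Phi> ` {B. B \<subseteq> f j \<and> |B| <o r}))"
    for f :: "'r \<Rightarrow> 'x set" and i
  have "\<exists>As. \<forall>i. As i = H As i"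
  proof (rule dependent_wf_choice[OF wfr, where P = "\<lambda>f i A. A = H f i"])
    fix f g :: "'r \<Rightarrow> 'x set" and i A assume "\<And>j. (j, i) \<in> r - Id \<Longrightarrow> f j = g j"
    then have "H f i = H g i" unfolding H_def by (intro arg_cong2[where f = "(\<union>)"] SUP_cong refl) (auto simp: underS_def)
    then show "(A = H f i) = (A = H g i)" by simp
  qed simp
  then obtain As where As: "\<And>i. As i = H As i" by blast
  have size: "|As i| \<le>o |M|" for i
    using wfr
  proof (induction i rule: wf_induct_rule)
    case (less i)
    have u: "|underS r i| \<le>o |M|"
    proof (rule ordLeq_transitive[OF card_of_mono1 Mr])
      show "underS r i \<subseteq> Field r" by (auto simp: underS_def Field_def)
    qed
    have "|As j \<union> \<Union> (\<Phi> ` {B. B \<subseteq> As j \<and> |B| <o r})| \<le>o |M|" if "j \<in> underS r i" for j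
    proof -
      have j: "|As j| \<le>o |M|" using less that by (auto simp: underS_def)
      have "|\<Union> (\<Phi> ` {B. B \<subseteq> As j \<and> |B| <o r})| \<le>o |M|"
        by (rule card_UN_bound[OF pw[OF j] _ Minf]) (auto intro: \<Phi>)
      then show ?thesis using j Minf by (intro card_Un_bound)
    qed
    then have "|\<Union>j\<in>underS r i. As j \<union> \<Union> (\<Phi> ` {B. B \<subseteq> As j \<and> |B| <o r})| \<le>o |M|"
      by (intro card_UN_bound[OF u _ Minf])
    then show ?case unfolding As[of i] H_def
      using R0 Minf by (intro card_Un_bound)
  qed
  define R where "R = (\<Union>i\<in>Field r. As i)"
  have step: "As j \<subseteq> As i" "B \<subseteq> As j \<Longrightarrow> |B| <o r \<Longrightarrow> \<Phi> B \<subseteq> As i" if "j \<in> underS r i" for i j B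
    using that unfolding As[of i] H_def by blast+
  have chain: "relChain r As"
    unfolding relChain_def
  proof (intro allI impI)
    fix i j assume "(i, j) \<in> r"
    then show "As i \<subseteq> As j" using step(1)[of i j] by (cases "i = j") (auto simp: underS_def)
  qed
  have "\<Phi> B \<subseteq> R" if B: "B \<subseteq> R" "|B| <o r" for B
  proof -
    obtain i where i: "i \<in> Field r" "B \<subseteq> As i"
      using regularCard_UNION[OF r(1,2) chain B(1)[unfolded R_def] B(2)] by blast
    obtain k where "k \<in> Field r" "i \<noteq> k" "(i,k) \<in> r"
      using infinite_Card_order_limit[OF r(1,3) i(1)] by blast
    then show ?thesis using step(2)[of i k B] i B unfolding R_def by (auto simp: underS_def)
  qed
  moreover have "R0 \<subseteq> R"
  proof -
    have "Field r \<noteq> {}" using r(3) by auto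
    then obtain i where i: "i \<in> Field r" by blast
    have "R0 \<subseteq> As i" by (subst As) (simp add: H_def)
    with i show ?thesis unfolding R_def by blast
  qed
  moreover have "|R| \<le>o |M|" unfolding R_def by (rule card_UN_bound[OF Mr size Minf])
  ultimately show ?thesis by blast
qed

text \<open>For each possible root and each value of \<open>dat\<close> a maximal family with this
  root is taken. If none of them reaches size \<open>K\<close>, all have size at most
  \<open>M\<close>, and some \<open>R\<close> of size at most \<open>M\<close> is closed off under
  them. An index outside \<open>R\<close>, with the part of its set located in \<open>R\<close> as
  root, could then be added to the corresponding maximal family. Overlaps are measured by the
  locations \<open>loc\<close>: disjointness off the root concerns whole rows, while the root fixes
  the elements themselves.\<close>

lemma delta_system:
  fixes r :: "'r rel" and M :: "'m set" and S :: "'i \<Rightarrow> 'x set" and loc :: "'x \<Rightarrow> 'i"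
    and dat :: "'i \<Rightarrow> 'o" and K :: "'k set"
  assumes r: "Card_order r" "regularCard r" "infinite (Field r)" "r \<le>o |M|"
    and pw: "\<And>A :: 'i set. |A| \<le>o |M| \<Longrightarrow> |{B. B \<subseteq> A \<and> |B| <o r}| \<le>o |M|"
    and pw': "\<And>A :: 'x set. |A| \<le>o |M| \<Longrightarrow> |{B. B \<subseteq> A \<and> |B| <o r}| \<le>o |M|"
    and X: "\<And>R. |R| \<le>o |M| \<Longrightarrow> |{x \<in> X. loc x \<in> R}| \<le>o |M|"
    and S: "\<And>i. i \<in> I \<Longrightarrow> S i \<subseteq> X \<and> |S i| <o r \<and> i \<in> loc ` S i"
    and dat: "|dat ` I| \<le>o |M|" and I: "|M| <o |I|" and K: "|K| \<le>o |M|"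
  shows "\<exists>N \<subseteq> I. \<exists>rt. |K| \<le>o |N| \<and> (\<forall>i\<in>N. \<forall>i'\<in>N. dat i = dat i') \<and>
     (\<forall>i\<in>N. {x \<in> S i. loc x \<in> loc ` rt} = rt \<and> i \<notin> loc ` rt) \<and>
     (\<forall>i\<in>N. \<forall>i'\<in>N. i \<noteq> i' \<longrightarrow> loc ` S i \<inter> loc ` S i' \<subseteq> loc ` rt)" (is ?goal)
proof (rule ccontr)
  assume no: "\<not> ?goal"
  define ok where "ok rt c i \<longleftrightarrow> i \<in> I \<and> dat i = c \<and> {x \<in> S i. loc x \<in> loc ` rt} = rt \<and> i \<notin> loc ` rt"
    for rt c i
  define off where "off rt i i' \<longleftrightarrow> i = i' \<or> loc ` S i \<inter> loc ` S i' \<subseteq> loc ` rt" for rt i i'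
  define fam where "fam rt c N \<longleftrightarrow> (\<forall>i\<in>N. ok rt c i \<and> (\<forall>i'\<in>N. off rt i i'))" for rt c N
  have Mr: "|Field r| \<le>o |M|"
    using r(1,4) card_of_Field_ordIso ordIso_ordLeq_trans by blast
  have Minf: "infinite M" using Mr r(3) by (metis card_of_ordLeq_infinite)
  have "\<exists>N. fam rt c N \<and> (\<forall>N'. fam rt c N' \<longrightarrow> N \<subseteq> N' \<longrightarrow> N' = N)" for rt c
  proof -
    have "\<exists>N\<in>Collect (fam rt c). \<forall>N'\<in>Collect (fam rt c). N \<subseteq> N' \<longrightarrow> N' = N"
    proof (rule subset_Zorn_nonempty)
      have "fam rt c {}" by (simp add: fam_def)
      then show "Collect (fam rt c) \<noteq> {}" by blast
      fix C assume "C \<noteq> {}" and C: "subset.chain (Collect (fam rt c)) C"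
      have f: "fam rt c N" if "N \<in> C" for N using C that by (auto simp: subset.chain_def)
      have two: "\<exists>N\<in>C. i \<in> N \<and> i' \<in> N" if "i \<in> \<Union>C" "i' \<in> \<Union>C" for i i'
      proof -
        obtain N N' where N: "N \<in> C" "i \<in> N" "N' \<in> C" "i' \<in> N'" using \<open>i \<in> \<Union>C\<close> \<open>i' \<in> \<Union>C\<close> by blast
        then have "N \<subseteq> N' \<or> N' \<subseteq> N" using C unfolding subset.chain_def by blast
        then show ?thesis using N by blast
      qed
      show "\<Union>C \<in> Collect (fam rt c)"
        using f two unfolding fam_def mem_Collect_eq by blast
    qed
    then show ?thesis by blast
  qed
  note ex = this
  define Mx where "Mx rt c = (SOME N. fam rt c N \<and> (\<forall>N'. fam rt c N' \<longrightarrow> N \<subseteq> N' \<longrightarrow> N' = N))" for rt c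
  have Mx: "fam rt c (Mx rt c)" "fam rt c N' \<Longrightarrow> Mx rt c \<subseteq> N' \<Longrightarrow> N' = Mx rt c" for rt c N'
    using someI_ex[OF ex[of rt c], folded Mx_def] by simp_all
  have Mxs: "|Mx rt c| \<le>o |M|" for rt c
  proof -
    have "\<not> |K| \<le>o |Mx rt c|"
    proof
      assume a: "|K| \<le>o |Mx rt c|"
      have 1: "ok rt c i" and 2: "off rt i i'" if "i \<in> Mx rt c" "i' \<in> Mx rt c" for i i'
        using Mx(1)[of rt c] that unfolding fam_def by auto
      have ?goal
      proof (intro exI[of _ "Mx rt c"] exI[of _ rt] conjI ballI impI)
        show "Mx rt c \<subseteq> I" using 1 by (auto simp: ok_def)
        fix i assume i: "i \<in> Mx rt c"
        show "{x \<in> S i. loc x \<in> loc ` rt} = rt" "i \<notin> loc ` rt"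
          using 1[OF i i] unfolding ok_def by simp_all
        fix i' assume i': "i' \<in> Mx rt c"
        show "dat i = dat i'" using 1[OF i i] 1[OF i' i'] by (simp add: ok_def)
        show "loc ` S i \<inter> loc ` S i' \<subseteq> loc ` rt" if "i \<noteq> i'"
          using 2[OF i i'] that by (simp add: off_def)
      qed (rule a)
      with no show False ..
    qed
    then show ?thesis
      using K by (meson card_of_Well_order not_ordLeq_iff_ordLess ordLess_imp_ordLeq ordLeq_transitive)
  qed
  define \<Phi> where "\<Phi> B = (\<Union>rt\<in>{rt. rt \<subseteq> {x \<in> X. loc x \<in> B} \<and> |rt| <o r}. \<Union>c\<in>dat ` I.
     \<Union>i\<in>Mx rt c. loc ` S i)" for B
  have Ss: "|loc ` S i| \<le>o |M|" if "i \<in> I" for i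
    using S[OF that] r(4) by (meson card_of_image ordLeq_transitive ordLess_imp_ordLeq)
  have "|\<Phi> B| \<le>o |M|" if B: "|B| <o r" for B
  proof -
    have "|B| \<le>o |M|" using B r(4) by (meson ordLeq_transitive ordLess_imp_ordLeq)
    then have "|{rt. rt \<subseteq> {x \<in> X. loc x \<in> B} \<and> |rt| <o r}| \<le>o |M|" by (intro pw' X)
    then show ?thesis unfolding \<Phi>_def
      using Mx(1) Ss by (intro card_UN_bound Minf dat Mxs) (auto simp: fam_def ok_def)
  qed
  then obtain R where R: "|R| \<le>o |M|" "\<And>B. B \<subseteq> R \<Longrightarrow> |B| <o r \<Longrightarrow> \<Phi> B \<subseteq> R"
    using closing_off[OF r pw, of \<Phi> "{}"] card_of_empty by blast
  have "\<not> I \<subseteq> R" using R(1) I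
    by (meson card_of_mono1 not_ordLess_ordLeq ordLeq_transitive)
  then obtain i where i: "i \<in> I" "i \<notin> R" by blast
  \<comment> \<open>The locations of this part form a small subset of \<open>R\<close>, so
    \<open>rt\<close> is one of the roots for which \<open>R\<close> has been closed off, and the
    maximal family for it is located inside \<open>R\<close>.\<close>
  define rt where "rt = {x \<in> S i. loc x \<in> R}"
  have rts: "|rt| <o r"
    using S[OF i(1)] by (metis (no_types, lifting) card_of_mono1 mem_Collect_eq ordLeq_ordLess_trans rt_def subsetI)
  have "loc ` rt \<subseteq> R" by (auto simp: rt_def)
  moreover have "|loc ` rt| <o r" using rts card_of_image ordLeq_ordLess_trans by blast
  ultimately have "\<Phi> (loc ` rt) \<subseteq> R" by (rule R(2))
  moreover have "rt \<subseteq> {x \<in> X. loc x \<in> loc ` rt}" using S[OF i(1)] by (auto simp: rt_def)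
  ultimately have sub: "loc ` S j \<subseteq> R" if "j \<in> Mx rt (dat i)" for j
    using that i rts unfolding \<Phi>_def by blast
  have iM: "i \<notin> Mx rt (dat i)" using sub S[OF i(1)] i(2) by blast
  have "fam rt (dat i) (insert i (Mx rt (dat i)))"
  proof -
    have "ok rt (dat i) i"
      using i(1,2) \<open>loc ` rt \<subseteq> R\<close> unfolding ok_def rt_def by auto
    moreover have "off rt i m \<and> off rt m i" if "m \<in> Mx rt (dat i)" for m
      using sub[OF that] by (auto simp: rt_def off_def)
    moreover have "off rt i i" by (simp add: off_def)
    ultimately show ?thesis using Mx(1)[of rt "dat i"] unfolding fam_def by blast
  qed
  then have "insert i (Mx rt (dat i)) = Mx rt (dat i)" by (rule Mx(2)) blast
  with iM show False by blast
qed

section \<open>An inaccessible well-order on a type\<close>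

text \<open>The cardinal is carried by a whole type, so that quantifiers over the ordinals below
  \<kappa> need no bounds. In the end this is the type of the saturated order: its points then serve
  as ordinals, as levels of the tree and as colours.\<close>

locale inacc_wo =
  fixes r :: "'a rel"
  assumes inacc: "inaccessible r" and Field_r: "Field r = UNIV"
begin

abbreviation small :: "'x set \<Rightarrow> bool" where "small A \<equiv> |A| <o r"

definition lt :: "'a \<Rightarrow> 'a \<Rightarrow> bool" (infix "\<lhd>" 50) where "x \<lhd> y \<longleftrightarrow> x \<noteq> y \<and> (x, y) \<in> r"

section \<open>Elementary properties of the well-order, and small sets\<close>

lemma kappa_card: "Card_order r" "infinite (Field r)"
proof -
  show 1: "Card_order r" using inacc by (simp add: inaccessible_def)
  have "natLeq \<le>o r" using inacc ordLess_imp_ordLeq by (auto simp: inaccessible_def)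
  then show "infinite (Field r)" using 1
    by (meson card_order_on_well_order_on infinite_iff_natLeq_ordLeq card_of_Field_ordIso ordIso_symmetric ordLeq_ordIso_trans)
qed

lemma infinite_UNIV: "infinite (UNIV :: 'a set)"
  using kappa_card(2) by (simp add: Field_r)

lemma r_ordIso: "r =o |UNIV :: 'a set|" "|UNIV :: 'a set| =o r"
  using card_of_Field_ordIso[OF kappa_card(1)] by (auto simp: Field_r ordIso_symmetric)

lemma regular: "regularCard r" and uncountable: "natLeq <o r"
  using inacc by (auto simp: inaccessible_def)

lemma strong_limit: "small A \<Longrightarrow> small (Pow A)" for A :: "'a set"
  using inacc by (auto simp: inaccessible_def Field_r)

lemma wo: "Well_order r" "wf (r - Id)" "trans r" "total_on UNIV r" "antisym r"
  using kappa_card(1) unfolding card_order_on_def well_order_on_def linear_order_on_def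
    partial_order_on_def preorder_on_def Field_r by auto

lemma wf_lt: "wf {(x, y). x \<lhd> y}"
  by (rule wf_subset[OF wo(2)]) (auto simp: lt_def)

lemma lt_trans: "x \<lhd> y \<Longrightarrow> y \<lhd> z \<Longrightarrow> x \<lhd> z"
  using wo(3,5) unfolding lt_def by (metis antisymD transD)

lemma lt_total: "x \<noteq> y \<Longrightarrow> x \<lhd> y \<or> y \<lhd> x"
  using wo(4) unfolding lt_def total_on_def by auto

lemma underS_lt: "underS r x = {y. y \<lhd> x}"
  by (auto simp: underS_def lt_def)

lemma small_seg: "small {y. y \<lhd> x}"
  using card_of_underS[OF kappa_card(1), of x] by (simp add: Field_r underS_lt)

lemma small_iff: "small A \<longleftrightarrow> |A| <o |UNIV :: 'a set|"
  using r_ordIso ordLess_ordIso_trans by blast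

lemma small_imp_le: "small A \<Longrightarrow> |A| \<le>o |UNIV :: 'a set|"
  using small_iff ordLess_imp_ordLeq by blast

definition le :: "'a \<Rightarrow> 'a \<Rightarrow> bool" (infix "\<unlhd>" 50) where "x \<unlhd> y \<longleftrightarrow> x = y \<or> x \<lhd> y"

lemma irrefl: "\<not> x \<lhd> x"
  using wf_lt by (auto elim: wf_irrefl)

sublocale O: wellorder le lt
proof
  show "x \<lhd> y \<longleftrightarrow> x \<unlhd> y \<and> \<not> y \<unlhd> x" for x y
    using irrefl lt_trans unfolding le_def by blast
  show "x \<unlhd> z" if "x \<unlhd> y" "y \<unlhd> z" for x y z
    using lt_trans that unfolding le_def by blast
  show "x = y" if "x \<unlhd> y" "y \<unlhd> x" for x y
    using irrefl lt_trans that unfolding le_def by blast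
  show "x \<unlhd> y \<or> y \<unlhd> x" for x y using lt_total unfolding le_def by blast
  show "P a" if "\<And>x. (\<And>y. y \<lhd> x \<Longrightarrow> P y) \<Longrightarrow> P x" for P a
    using wf_induct[OF wf_lt, of P a] that by simp
qed (auto simp: le_def)

lemma stable_kappa: "stable r"
  using regularCard_stable[OF kappa_card regular] .

lemma small_mono: "A \<subseteq> B \<Longrightarrow> small B \<Longrightarrow> small A"
  by (meson card_of_mono1 ordLeq_ordLess_trans)

lemma small_image: "small A \<Longrightarrow> small (f ` A)"
  by (meson card_of_image ordLeq_ordLess_trans)

lemma small_surj: "small A \<Longrightarrow> B \<subseteq> f ` A \<Longrightarrow> small B"
  by (meson small_image small_mono)

lemma small_inj: "inj_on f A \<Longrightarrow> f ` A \<subseteq> B \<Longrightarrow> small B \<Longrightarrow> small A"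
  by (meson card_of_ordLeq ordLeq_ordLess_trans)

lemma small_finite: "finite A \<Longrightarrow> small A"
  using kappa_card wo(1) finite_ordLess_infinite[OF card_of_Well_order, of r A]
  by (simp add: Field_card_of)

lemma small_countable: "small (A :: nat set)"
proof -
  have "|A| \<le>o natLeq"
    using card_of_mono1[of A UNIV] card_of_nat ordLeq_ordIso_trans by blast
  then show ?thesis using uncountable ordLeq_ordLess_trans by blast
qed

lemma small_UN: "small I \<Longrightarrow> (\<And>i. i \<in> I \<Longrightarrow> small (A i)) \<Longrightarrow> small (\<Union>i\<in>I. A i)"
  by (rule stable_UNION[OF stable_kappa])

lemma small_Un: "small A \<Longrightarrow> small B \<Longrightarrow> small (A \<union> B)"
  by (rule card_of_Un_ordLess_infinite_Field[OF kappa_card(2,1)])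

lemma small_Sigma: "small A \<Longrightarrow> (\<And>a. a \<in> A \<Longrightarrow> small (B a)) \<Longrightarrow> small (Sigma A B)"
  by (rule stable_elim[OF stable_kappa])

lemma small_Pow:
  fixes A :: "'x set"
  assumes "small A" shows "small (Pow A)"
proof -
  obtain f :: "'x \<Rightarrow> 'a" where f: "inj_on f A"
    using small_imp_le[OF assms] by (meson card_of_ordLeq)
  have "inj_on ((`) f) (Pow A)" using f by (simp add: inj_on_image_Pow)
  moreover have "(`) f ` Pow A \<subseteq> Pow (f ` A)" by auto
  moreover have "small (Pow (f ` A))" by (intro strong_limit small_image assms)
  ultimately show ?thesis by (rule small_inj)
qed

lemma small_PiE: "small A \<Longrightarrow> (\<And>a. a \<in> A \<Longrightarrow> small (B a)) \<Longrightarrow> small (PiE A B)"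
proof -
  assume *: "small A" "\<And>a. a \<in> A \<Longrightarrow> small (B a)"
  let ?g = "\<lambda>f. {(a, f a) | a. a \<in> A}"
  have "inj_on ?g (PiE A B)"
  proof (rule inj_onI)
    fix f f' assume "f \<in> PiE A B" "f' \<in> PiE A B" "?g f = ?g f'"
    then show "f = f'" by (intro PiE_ext) (auto simp: set_eq_iff)
  qed
  moreover have "?g ` PiE A B \<subseteq> Pow (Sigma A B)" by auto
  moreover have "small (Pow (Sigma A B))" by (intro small_Pow small_Sigma *)
  ultimately show ?thesis by (rule small_inj)
qed

text \<open>By regularity a small union of initial segments is small, hence not everything.\<close>

lemma small_bounded: "small (S :: 'a set) \<Longrightarrow> \<exists>\<eta>. \<forall>x\<in>S. x \<lhd> \<eta>"
proof -
  assume S: "small S"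
  have "small (\<Union>x\<in>S. {y. y \<lhd> x} \<union> {x})"
    by (intro small_UN small_Un S small_seg small_finite) auto
  then have "(\<Union>x\<in>S. {y. y \<lhd> x} \<union> {x}) \<noteq> UNIV" by (metis small_iff ordLess_irreflexive)
  then obtain \<eta> where "\<eta> \<notin> (\<Union>x\<in>S. {y. y \<lhd> x} \<union> {x})" by blast
  then have "x \<lhd> \<eta>" if "x \<in> S" for x using lt_total that by fastforce
  then show ?thesis by blast
qed

lemma small_bounded_fun: "small I \<Longrightarrow> \<exists>\<eta>. \<forall>i\<in>I. (g i :: 'a) \<lhd> \<eta>"
  using small_bounded[OF small_image, of I g] by auto

lemma seg_le: "small {y. y \<unlhd> x}"
proof -
  have "{y. y \<unlhd> x} = {y. y \<lhd> x} \<union> {x}" by (auto simp: le_def)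
  then show ?thesis using small_Un[OF small_seg small_finite, of "{x}" x] by simp
qed

lemma bounded_small: "(\<And>x. x \<in> S \<Longrightarrow> x \<lhd> \<eta>) \<Longrightarrow> small S"
  by (rule small_mono[OF _ small_seg[of \<eta>]]) auto

text \<open>Some larger element, not necessarily the immediate successor: only
  \<open>x \<lhd> sc x\<close> matters. The finite iterates are a supply of increasing levels above
  a given one.\<close>

definition sc :: "'a \<Rightarrow> 'a" where "sc x = (SOME y. x \<lhd> y)"

lemma sc_gt: "x \<lhd> sc x"
proof -
  have "\<exists>y. x \<lhd> y" using small_bounded[of "{x}"] small_finite[of "{x}"] by auto
  then show ?thesis unfolding sc_def by (rule someI_ex)
qed

lemma sc_pow_mono: "m < n \<Longrightarrow> (sc ^^ m) x \<lhd> (sc ^^ n) x"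
proof (induction n)
  case (Suc n)
  then show ?case using sc_gt[of "(sc ^^ n) x"] lt_trans by (cases "m = n") auto
qed simp

lemma sc_pow_less_iff: "(sc ^^ m) x \<lhd> (sc ^^ n) x \<longleftrightarrow> m < n"
  by (metis sc_pow_mono O.less_asym irrefl linorder_neqE_nat)

lemma sc_pow_ge: "x \<unlhd> (sc ^^ n) x"
  using sc_pow_mono[of 0 n x] by (cases n) (auto simp: le_def)

definition base_point :: 'a where "base_point = undefined"

text \<open>This is \<open>\<kappa>^(<\<kappa>) \<le> \<kappa>\<close>: small sets of ordinals are
  bounded, and each of the \<kappa> many initial segments has fewer than \<kappa> subsets.\<close>

lemma small_subsets_bound:
  fixes A :: "'x set"
  assumes "|A| \<le>o |UNIV :: 'a set|"
  shows "|{B. B \<subseteq> A \<and> small B}| \<le>o |UNIV :: 'a set|"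
proof -
  obtain f :: "'x \<Rightarrow> 'a" where f: "inj_on f A"
    using assms by (meson card_of_ordLeq)
  let ?U = "\<Union>\<eta>\<in>UNIV :: 'a set. Pow {y. y \<lhd> \<eta>}"
  have "inj_on ((`) f) {B. B \<subseteq> A \<and> small B}"
    by (rule inj_on_subset[OF inj_on_image_Pow[OF f]]) auto
  moreover have "(`) f ` {B. B \<subseteq> A \<and> small B} \<subseteq> ?U"
  proof safe
    fix B :: "'x set" assume "small B"
    then show "f ` B \<in> ?U" using small_bounded[OF small_image, of B f] by auto
  qed
  ultimately have "|{B. B \<subseteq> A \<and> small B}| \<le>o |?U|"
    by (auto simp: card_of_ordLeq[symmetric])
  also have "|?U| \<le>o |UNIV :: 'a set|"
  proof (rule card_UN_bound[OF _ _ infinite_UNIV])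
    show "|Pow {y. y \<lhd> i}| \<le>o |UNIV :: 'a set|" for i
      by (intro small_imp_le small_Pow small_seg)
  qed (rule card_of_mono1, simp)
  finally show ?thesis .
qed

section \<open>Nodes of the binary tree\<close>

text \<open>A node of level \<open>\<gamma>\<close> is represented by a predicate that is false from \<open>\<gamma>\<close> on.\<close>

definition cut :: "'a \<Rightarrow> ('a \<Rightarrow> bool) \<Rightarrow> 'a \<Rightarrow> bool" where "cut \<gamma> x = (\<lambda>\<zeta>. \<zeta> \<lhd> \<gamma> \<and> x \<zeta>)"

definition node :: "'a \<Rightarrow> ('a \<Rightarrow> bool) set" where "node \<gamma> = {x. \<forall>\<zeta>. x \<zeta> \<longrightarrow> \<zeta> \<lhd> \<gamma>}"

lemma cut_node [simp]: "cut \<gamma> x \<in> node \<gamma>"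
  by (simp add: cut_def node_def)

lemma cut_id: "x \<in> node \<gamma> \<Longrightarrow> \<gamma> \<unlhd> \<delta> \<Longrightarrow> cut \<delta> x = x"
  unfolding cut_def node_def le_def using lt_trans by fastforce

lemma cut_cut: "\<gamma> \<unlhd> \<delta> \<Longrightarrow> cut \<gamma> (cut \<delta> x) = cut \<gamma> x"
  unfolding cut_def le_def using lt_trans by fastforce

lemma cut_eqD: "cut \<gamma> x = cut \<gamma> y \<Longrightarrow> \<zeta> \<lhd> \<gamma> \<Longrightarrow> x \<zeta> = y \<zeta>"
  unfolding cut_def by metis

lemma cut_eqI: "(\<And>\<zeta>. \<zeta> \<lhd> \<gamma> \<Longrightarrow> x \<zeta> = y \<zeta>) \<Longrightarrow> cut \<gamma> x = cut \<gamma> y"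
  unfolding cut_def by auto

lemma node_mono: "\<gamma> \<unlhd> \<delta> \<Longrightarrow> x \<in> node \<gamma> \<Longrightarrow> x \<in> node \<delta>"
  unfolding node_def le_def using lt_trans by auto

lemma small_node: "small (node \<gamma>)"
proof (rule small_inj)
  show "inj_on Collect (node \<gamma>)" by (auto intro: inj_onI)
  show "Collect ` node \<gamma> \<subseteq> Pow {y. y \<lhd> \<gamma>}" by (auto simp: node_def)
  show "small (Pow {y. y \<lhd> \<gamma>})" by (intro small_Pow small_seg)
qed

end

section \<open>The forced ultrafilter\<close>

lemma inaccessible_infinite: "inaccessible \<kappa> \<Longrightarrow> infinite (Field \<kappa>)"
  by (meson inaccessible_def card_order_on_well_order_on infinite_iff_natLeq_ordLeq card_of_Field_ordIso
      ordIso_symmetric ordLeq_ordIso_trans ordLess_imp_ordLeq)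

text \<open>All statements about the extension are made at conditions below \<open>p0\<close>, which
  forces the name \<open>U\<close> to be a suitable ultrafilter; no generic filter appears.\<close>

locale forced_ultrafilter =
  fixes P :: "'p rel" and \<kappa> :: "'k rel" and U :: "(('k, 'p) name, 'p) name" and p0 :: 'p
  assumes reflP: "p \<in> Field P \<Longrightarrow> (p, p) \<in> P" and transP: "trans P" and p0: "p0 \<in> Field P"
    and inacc: "inaccessible \<kappa>"
    and forced: "fNonprincipal_complete_ultrafilter P \<kappa> U p0"
begin

text \<open>Sets of conditions of this kind are the regular open ones, which is what the set of
  conditions forcing a sentence looks like. For them, forced membership in the canonical name
  \<open>fCollect\<close> is the sentence itself.\<close>

definition regular_sentence :: "'p sentence \<Rightarrow> bool" where
  "regular_sentence \<phi> \<longleftrightarrow> (\<forall>p q. (q, p) \<in> P \<longrightarrow> \<phi> p \<longrightarrow> \<phi> q) \<and>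
     (\<forall>p \<in> Field P. dense_below P p \<phi> \<longrightarrow> \<phi> p)"

definition measure_one :: "('k \<Rightarrow> 'p sentence) \<Rightarrow> 'p sentence" where
  "measure_one \<phi> = fIn P (fCollect P (Field \<kappa>) \<phi>) U"

lemma P_trans: "(r, q) \<in> P \<Longrightarrow> (q, p) \<in> P \<Longrightarrow> (r, p) \<in> P"
  using transP by (meson transD)

lemma P_Field: "(q, p) \<in> P \<Longrightarrow> q \<in> Field P" "(q, p) \<in> P \<Longrightarrow> p \<in> Field P"
  by (auto simp: Field_def)

lemma fIn_open: "fIn P X V p \<Longrightarrow> (q, p) \<in> P \<Longrightarrow> fIn P X V q"
  unfolding fIn_def dense_below_def using P_trans by blast

lemma fIn_dense: "dense_below P p (fIn P X V) \<Longrightarrow> fIn P X V p"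
  unfolding fIn_def dense_below_def
  by (meson P_Field(1) P_trans reflP)

lemma regular_fNot: "regular_sentence (fNot P \<phi>)" if "\<And>p q. (q, p) \<in> P \<Longrightarrow> \<phi> p \<Longrightarrow> \<phi> q"
  unfolding regular_sentence_def fNot_def dense_below_def
  using that by (meson P_Field(1) P_trans reflP)

lemma regular_Ball: "(\<And>i. i \<in> I \<Longrightarrow> regular_sentence (\<phi> i)) \<Longrightarrow> regular_sentence (\<lambda>p. \<forall>i\<in>I. \<phi> i p)"
  unfolding regular_sentence_def dense_below_def by meson

lemma regular_const: "regular_sentence (\<lambda>q. b)"
  using reflP by (auto simp: regular_sentence_def dense_below_def)

lemma fElem_fCollect:
  assumes "\<alpha> \<in> A" "regular_sentence (\<phi> \<alpha>)" "p \<in> Field P"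
  shows "fElem P \<alpha> (fCollect P A \<phi>) p \<longleftrightarrow> \<phi> \<alpha> p"
proof
  assume "\<phi> \<alpha> p"
  then show "fElem P \<alpha> (fCollect P A \<phi>) p"
    using assms reflP unfolding fElem_def dense_below_def fCollect_def
    by (auto intro: P_Field)
next
  assume "fElem P \<alpha> (fCollect P A \<phi>) p"
  then have "dense_below P p (\<phi> \<alpha>)"
    using assms unfolding fElem_def dense_below_def fCollect_def regular_sentence_def by blast
  then show "\<phi> \<alpha> p" using assms by (auto simp: regular_sentence_def)
qed

lemma fElem_fCollect_mem: "fElem P \<alpha> (fCollect P A \<phi>) p \<Longrightarrow> p \<in> Field P \<Longrightarrow> \<alpha> \<in> A"
  using reflP unfolding fElem_def dense_below_def fCollect_def by blast

lemma fCollect_name: "fCollect P A \<phi> \<in> subset_names P A"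
  by (auto simp: fCollect_def subset_names_def)

lemma fCollect_cong: "(\<And>\<alpha> p. \<alpha> \<in> A \<Longrightarrow> p \<in> Field P \<Longrightarrow> \<phi> \<alpha> p \<longleftrightarrow> \<psi> \<alpha> p) \<Longrightarrow> fCollect P A \<phi> = fCollect P A \<psi>"
  by (auto simp: fCollect_def)

lemma
  shows no_empty: "(q, p0) \<in> P \<Longrightarrow> \<not> fIn P {} U q"
    and upward: "X \<in> subset_names P (Field \<kappa>) \<Longrightarrow> Y \<in> subset_names P (Field \<kappa>) \<Longrightarrow> (q, p0) \<in> P \<Longrightarrow>
       fIn P X U q \<Longrightarrow> fSubset P X Y q \<Longrightarrow> fIn P Y U q"
    and ultra: "X \<in> subset_names P (Field \<kappa>) \<Longrightarrow> dense_below P p0 (\<lambda>q. fIn P X U q \<or>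
        fIn P (fCollect P (Field \<kappa>) (\<lambda>\<alpha>. fNot P (fElem P \<alpha> X))) U q)"
    and nonprincipal: "\<alpha> \<in> Field \<kappa> \<Longrightarrow> (q, p0) \<in> P \<Longrightarrow> \<not> fIn P (check P {\<alpha>}) U q"
    and complete: "\<beta> \<in> Field \<kappa> \<Longrightarrow> S \<in> subset_names P (underS \<kappa> \<beta> \<times> Field \<kappa>) \<Longrightarrow> (q, p0) \<in> P \<Longrightarrow>
       (\<And>\<xi>. \<xi> \<in> underS \<kappa> \<beta> \<Longrightarrow> fIn P (section_name S \<xi>) U q) \<Longrightarrow>
       fIn P (fCollect P (Field \<kappa>) (\<lambda>\<alpha>. fAll (underS \<kappa> \<beta>) (\<lambda>\<xi>. fElem P \<alpha> (section_name S \<xi>)))) U q"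
proof -
  note cl = forced[unfolded fNonprincipal_complete_ultrafilter_def Let_def fAnd_def]
  note cl2 = cl[THEN conjunct2] note cl3 = cl2[THEN conjunct2] note cl4 = cl3[THEN conjunct2]
  show "(q, p0) \<in> P \<Longrightarrow> \<not> fIn P {} U q"
    using cl[THEN conjunct1] by (simp add: fNot_def check_def)
  show "X \<in> subset_names P (Field \<kappa>) \<Longrightarrow> Y \<in> subset_names P (Field \<kappa>) \<Longrightarrow> (q, p0) \<in> P \<Longrightarrow>
       fIn P X U q \<Longrightarrow> fSubset P X Y q \<Longrightarrow> fIn P Y U q"
    using cl2[THEN conjunct1, unfolded fAll_def fImp_def] by blast
  show "X \<in> subset_names P (Field \<kappa>) \<Longrightarrow> dense_below P p0 (\<lambda>q. fIn P X U q \<or>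
        fIn P (fCollect P (Field \<kappa>) (\<lambda>\<alpha>. fNot P (fElem P \<alpha> X))) U q)"
    using cl3[THEN conjunct1, unfolded fAll_def fOr_def] by blast
  show "\<alpha> \<in> Field \<kappa> \<Longrightarrow> (q, p0) \<in> P \<Longrightarrow> \<not> fIn P (check P {\<alpha>}) U q"
    using cl4[THEN conjunct1, unfolded fAll_def fNot_def] by blast
  show "\<beta> \<in> Field \<kappa> \<Longrightarrow> S \<in> subset_names P (underS \<kappa> \<beta> \<times> Field \<kappa>) \<Longrightarrow> (q, p0) \<in> P \<Longrightarrow>
       (\<And>\<xi>. \<xi> \<in> underS \<kappa> \<beta> \<Longrightarrow> fIn P (section_name S \<xi>) U q) \<Longrightarrow>
       fIn P (fCollect P (Field \<kappa>) (\<lambda>\<alpha>. fAll (underS \<kappa> \<beta>) (\<lambda>\<xi>. fElem P \<alpha> (section_name S \<xi>)))) U q"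
    using cl4[THEN conjunct2] unfolding fAll_def[of "Field \<kappa>"] fAll_def[of "subset_names P B" for B] fImp_def
    by (auto simp: fAll_def[of "underS \<kappa> \<beta>" "\<lambda>\<xi>. fIn P (section_name S \<xi>) U"])
qed

lemma measure_one_open: "measure_one \<phi> p \<Longrightarrow> (q, p) \<in> P \<Longrightarrow> measure_one \<phi> q"
  unfolding measure_one_def by (rule fIn_open)

lemma measure_one_dense: "dense_below P p (measure_one \<phi>) \<Longrightarrow> measure_one \<phi> p"
  unfolding measure_one_def by (rule fIn_dense)

text \<open>If no extension put any ordinal into the set, the set would be forced to be a subset of
  the empty set, which would then belong to \<open>U\<close>.\<close>

lemma measure_one_meets:
  assumes "measure_one \<phi> p" "(p, p0) \<in> P" and reg: "\<And>\<alpha>. regular_sentence (\<phi> \<alpha>)"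
  shows "\<exists>q \<alpha>. (q, p) \<in> P \<and> \<alpha> \<in> Field \<kappa> \<and> \<phi> \<alpha> q"
proof (rule ccontr)
  assume no: "\<not> ?thesis"
  have "fSubset P (fCollect P (Field \<kappa>) \<phi>) {} p"
    unfolding fSubset_def fAll_def fImp_def
  proof (intro ballI allI impI)
    fix \<alpha> q assume q: "(q, p) \<in> P" and e: "fElem P \<alpha> (fCollect P (Field \<kappa>) \<phi>) q"
    have \<alpha>: "\<alpha> \<in> Field \<kappa>" using fElem_fCollect_mem[OF e] P_Field(1)[OF q] by blast
    have "\<phi> \<alpha> q" using fElem_fCollect[where \<phi> = \<phi>, OF \<alpha> reg P_Field(1)[OF q]] e by blast
    with no q \<alpha> show "fElem P \<alpha> {} q" by blast
  qed
  then have "fIn P {} U p"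
    using upward[OF fCollect_name[of "Field \<kappa>" \<phi>] _ assms(2), of "{}"] assms(1)
    by (auto simp: measure_one_def subset_names_def)
  then show False using no_empty assms(2) by blast
qed

lemma measure_one_ultra:
  assumes "(p, p0) \<in> P" and reg: "\<And>\<alpha>. regular_sentence (\<phi> \<alpha>)"
  shows "\<exists>q. (q, p) \<in> P \<and> (measure_one \<phi> q \<or> measure_one (\<lambda>\<alpha>. fNot P (\<phi> \<alpha>)) q)"
proof -
  have "fCollect P (Field \<kappa>) (\<lambda>\<alpha>. fNot P (fElem P \<alpha> (fCollect P (Field \<kappa>) \<phi>))) =
      fCollect P (Field \<kappa>) (\<lambda>\<alpha>. fNot P (\<phi> \<alpha>))"
    by (rule fCollect_cong) (simp add: fNot_def fElem_fCollect[where \<phi> = \<phi>, OF _ reg] P_Field(1) cong: conj_cong imp_cong)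
  then show ?thesis using ultra[OF fCollect_name[of "Field \<kappa>" \<phi>]] assms(1)
    unfolding measure_one_def dense_below_def by force
qed

text \<open>The forced completeness speaks of sequences indexed by some \<beta> below \<kappa> and
  given by a single name for a subset of \<beta> \<times> \<kappa>. A ground model bijection of
  \<open>I\<close> with such a \<beta> turns the family into this form.\<close>

lemma measure_one_complete:
  assumes p: "(p, p0) \<in> P" and I: "|I| <o \<kappa>"
    and reg: "\<And>i \<alpha>. i \<in> I \<Longrightarrow> regular_sentence (\<phi> i \<alpha>)"
    and m: "\<And>i. i \<in> I \<Longrightarrow> measure_one (\<phi> i) p"
  shows "measure_one (\<lambda>\<alpha> q. \<forall>i\<in>I. \<phi> i \<alpha> q) p"
proof -
  have Well: "Well_order \<kappa>" using inacc by (simp add: inaccessible_def card_order_on_well_order_on)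
  obtain \<beta> where \<beta>: "\<beta> \<in> Field \<kappa>" "|I| =o Restr \<kappa> (underS \<kappa> \<beta>)"
    using internalize_ordLess[of "|I|" \<kappa>] I ordLess_iff_ordIso_Restr[OF Well card_of_Well_order] by auto
  have "|I| =o |Field (Restr \<kappa> (underS \<kappa> \<beta>))|"
    using \<beta>(2) card_of_cong[OF \<beta>(2)] by (simp add: Field_card_of)
  moreover have "Field (Restr \<kappa> (underS \<kappa> \<beta>)) = underS \<kappa> \<beta>"
    using Well by (intro Refl_Field_Restr2) (auto simp: order_on_defs underS_def Field_def)
  ultimately have "|underS \<kappa> \<beta>| =o |I|" by (simp add: ordIso_symmetric)
  then obtain g where g: "bij_betw g (underS \<kappa> \<beta>) I"
    using card_of_ordIso by blast
  define S where "S = {((\<xi>, \<alpha>), q). \<xi> \<in> underS \<kappa> \<beta> \<and> \<alpha> \<in> Field \<kappa> \<and> q \<in> Field P \<and> \<phi> (g \<xi>) \<alpha> q}"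
  have sec: "section_name S \<xi> = fCollect P (Field \<kappa>) (\<phi> (g \<xi>))" if "\<xi> \<in> underS \<kappa> \<beta>" for \<xi>
    using that by (auto simp: section_name_def S_def fCollect_def)
  have gI: "g \<xi> \<in> I" if "\<xi> \<in> underS \<kappa> \<beta>" for \<xi> using g that by (auto simp: bij_betw_def)
  have "fIn P (fCollect P (Field \<kappa>) (\<lambda>\<alpha>. fAll (underS \<kappa> \<beta>) (\<lambda>\<xi>. fElem P \<alpha> (section_name S \<xi>)))) U p"
  proof (rule complete[OF \<beta>(1) _ p])
    show "S \<in> subset_names P (underS \<kappa> \<beta> \<times> Field \<kappa>)" by (auto simp: S_def subset_names_def)
    fix \<xi> assume "\<xi> \<in> underS \<kappa> \<beta>"
    then show "fIn P (section_name S \<xi>) U p" using m[OF gI] by (simp add: sec measure_one_def)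
  qed
  moreover have "fCollect P (Field \<kappa>) (\<lambda>\<alpha>. fAll (underS \<kappa> \<beta>) (\<lambda>\<xi>. fElem P \<alpha> (section_name S \<xi>))) =
      fCollect P (Field \<kappa>) (\<lambda>\<alpha> q. \<forall>i\<in>I. \<phi> i \<alpha> q)"
  proof (rule fCollect_cong)
    fix \<alpha> q assume \<alpha>: "\<alpha> \<in> Field \<kappa>" "q \<in> Field P"
    have I: "I = g ` underS \<kappa> \<beta>" using g by (auto simp: bij_betw_def)
    have "fElem P \<alpha> (section_name S \<xi>) q \<longleftrightarrow> \<phi> (g \<xi>) \<alpha> q" if "\<xi> \<in> underS \<kappa> \<beta>" for \<xi>
      unfolding sec[OF that] by (rule fElem_fCollect[OF \<alpha>(1) reg[OF gI[OF that]] \<alpha>(2)])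
    then show "fAll (underS \<kappa> \<beta>) (\<lambda>\<xi>. fElem P \<alpha> (section_name S \<xi>)) q = (\<forall>i\<in>I. \<phi> i \<alpha> q)"
      unfolding I fAll_def by simp
  qed
  ultimately show ?thesis by (simp add: measure_one_def)
qed

text \<open>If no extension put a piece into the ultrafilter, all complements would be forced to
  have measure one, hence also their intersection, which contains no ordinal by
  \<open>tot\<close>.\<close>

lemma measure_one_decides:
  assumes p: "(p, p0) \<in> P" and I: "|I| <o \<kappa>"
    and reg: "\<And>i \<alpha>. i \<in> I \<Longrightarrow> regular_sentence (\<phi> i \<alpha>)"
    and tot: "\<And>\<alpha> q. \<alpha> \<in> Field \<kappa> \<Longrightarrow> (q, p) \<in> P \<Longrightarrow> \<exists>q' i. (q', q) \<in> P \<and> i \<in> I \<and> \<phi> i \<alpha> q'"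
  shows "\<exists>q i. (q, p) \<in> P \<and> i \<in> I \<and> measure_one (\<phi> i) q"
proof (rule ccontr)
  assume no: "\<not> ?thesis"
  have op: "\<And>i \<alpha> p q. i \<in> I \<Longrightarrow> (q, p) \<in> P \<Longrightarrow> \<phi> i \<alpha> p \<Longrightarrow> \<phi> i \<alpha> q"
    using reg unfolding regular_sentence_def by blast
  have "measure_one (\<lambda>\<alpha>. fNot P (\<phi> i \<alpha>)) p" if iI: "i \<in> I" for i
  proof (rule measure_one_dense)
    show "dense_below P p (measure_one (\<lambda>\<alpha>. fNot P (\<phi> i \<alpha>)))"
      unfolding dense_below_def
    proof (intro allI impI)
      fix q assume q: "(q, p) \<in> P"
      obtain q' where q': "(q', q) \<in> P" "measure_one (\<phi> i) q' \<or> measure_one (\<lambda>\<alpha>. fNot P (\<phi> i \<alpha>)) q'"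
        using measure_one_ultra[where \<phi> = "\<phi> i", OF P_trans[OF q p] reg[OF iI]] by blast
      have "\<not> measure_one (\<phi> i) q'" using no iI P_trans[OF q'(1) q] by blast
      then show "\<exists>q'. (q', q) \<in> P \<and> measure_one (\<lambda>\<alpha>. fNot P (\<phi> i \<alpha>)) q'" using q' by blast
    qed
  qed
  moreover have regN: "regular_sentence (fNot P (\<phi> i \<alpha>))" if "i \<in> I" for i \<alpha>
    by (rule regular_fNot) (rule op[OF that])
  ultimately have "measure_one (\<lambda>\<alpha> q. \<forall>i\<in>I. fNot P (\<phi> i \<alpha>) q) p"
    by (intro measure_one_complete[OF p I])
  then obtain q \<alpha> where "(q, p) \<in> P" "\<alpha> \<in> Field \<kappa>" "\<forall>i\<in>I. fNot P (\<phi> i \<alpha>) q"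
    using measure_one_meets[OF _ p, of "\<lambda>\<alpha> q. \<forall>i\<in>I. fNot P (\<phi> i \<alpha>) q"]
      regular_Ball[of I "\<lambda>i. fNot P (\<phi> i \<alpha>)" for \<alpha>, OF regN] by blast
  then show False using tot unfolding fNot_def by blast
qed

text \<open>The ordinals to be avoided are treated as further sentences
  \<open>\<alpha> \<noteq> z\<close>, fewer than \<kappa> many, which have measure one because
  \<open>U\<close> is nonprincipal. One application of completeness covers both families.\<close>

lemma measure_one_pick:
  assumes p: "(p, p0) \<in> P" and I: "|I| <o \<kappa>" and Z: "|Z| <o \<kappa>" "Z \<subseteq> Field \<kappa>"
    and reg: "\<And>i \<alpha>. i \<in> I \<Longrightarrow> regular_sentence (\<phi> i \<alpha>)"
    and m: "\<And>i. i \<in> I \<Longrightarrow> measure_one (\<phi> i) p"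
  shows "\<exists>q \<alpha>. (q, p) \<in> P \<and> \<alpha> \<in> Field \<kappa> - Z \<and> (\<forall>i\<in>I. \<phi> i \<alpha> q)"
proof -
  have ne: "measure_one (\<lambda>\<alpha> q. \<alpha> \<noteq> z) p" if z: "z \<in> Z" for z
  proof (rule measure_one_dense)
    have reg: "regular_sentence (\<lambda>q. (\<alpha> :: 'k) = z)" "regular_sentence (\<lambda>q. (\<alpha> :: 'k) \<noteq> z)" for \<alpha>
      by (rule regular_const)+
    have "fCollect P (Field \<kappa>) (\<lambda>\<alpha> q. \<alpha> = z) = check P {z}"
      using z Z by (auto simp: fCollect_def check_def)
    then have no: "\<not> measure_one (\<lambda>\<alpha> q. \<alpha> = z) q" if "(q, p) \<in> P" for q
      using nonprincipal[of z q] z Z P_trans[OF that p] by (auto simp: measure_one_def)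
    have imp: "measure_one (\<lambda>\<alpha>. fNot P (\<lambda>q. \<alpha> = z)) q \<Longrightarrow> measure_one (\<lambda>\<alpha> q. \<alpha> \<noteq> z) q" for q
    proof -
      have "fCollect P (Field \<kappa>) (\<lambda>\<alpha>. fNot P (\<lambda>q. \<alpha> = z)) = fCollect P (Field \<kappa>) (\<lambda>\<alpha> q. \<alpha> \<noteq> z)"
        by (rule fCollect_cong) (use reflP in \<open>auto simp: fNot_def\<close>)
      then show "measure_one (\<lambda>\<alpha>. fNot P (\<lambda>q. \<alpha> = z)) q \<Longrightarrow> measure_one (\<lambda>\<alpha> q. \<alpha> \<noteq> z) q"
        by (simp add: measure_one_def)
    qed
    then show "dense_below P p (measure_one (\<lambda>\<alpha> q. \<alpha> \<noteq> z))"
      unfolding dense_below_def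
    proof (intro allI impI)
      fix q assume q: "(q, p) \<in> P"
      obtain q' where q': "(q', q) \<in> P"
         "measure_one (\<lambda>\<alpha> q. \<alpha> = z) q' \<or> measure_one (\<lambda>\<alpha>. fNot P (\<lambda>q. \<alpha> = z)) q'"
        using measure_one_ultra[where \<phi> = "\<lambda>\<alpha> q. \<alpha> = z", OF P_trans[OF q p] reg(1)] by blast
      then show "\<exists>q'. (q', q) \<in> P \<and> measure_one (\<lambda>\<alpha> q. \<alpha> \<noteq> z) q'"
        using no[OF P_trans[OF q'(1) q]] imp by blast
    qed
  qed
  define \<psi> where "\<psi> s = (case s of Inl i \<Rightarrow> \<phi> i | Inr z \<Rightarrow> (\<lambda>\<alpha> q. \<alpha> \<noteq> z))" for s
  have reg\<psi>: "regular_sentence (\<psi> s \<alpha>)" if "s \<in> I <+> Z" for s \<alpha>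
    using that reg regular_const by (auto simp: \<psi>_def split: sum.split)
  have "|I <+> Z| <o \<kappa>"
    using card_of_Plus_ordLess_infinite_Field[OF inaccessible_infinite[OF inacc] _ I Z(1)] inacc
    by (simp add: inaccessible_def)
  then have "measure_one (\<lambda>\<alpha> q. \<forall>s\<in>I <+> Z. \<psi> s \<alpha> q) p"
    by (rule measure_one_complete[OF p _ reg\<psi>]) (use ne m in \<open>auto simp: \<psi>_def\<close>)
  then obtain q \<alpha> where "(q, p) \<in> P" "\<alpha> \<in> Field \<kappa>" "\<forall>s\<in>I <+> Z. \<psi> s \<alpha> q"
    using measure_one_meets[OF _ p, of "\<lambda>\<alpha> q. \<forall>s\<in>I <+> Z. \<psi> s \<alpha> q"]
      regular_Ball[of "I <+> Z" "\<lambda>s. \<psi> s \<alpha>" for \<alpha>, OF reg\<psi>] by blast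
  moreover have "\<alpha> \<notin> Z" using calculation(3) by (force simp: \<psi>_def)
  moreover have "\<phi> i \<alpha> q" if "i \<in> I" for i
    using calculation(3)[rule_format, OF InlI[OF that]] by (simp add: \<psi>_def)
  ultimately show ?thesis by blast
qed

end

section \<open>Ultrafilter limits along Cohen branches\<close>

definition fill :: "('x \<rightharpoonup> bool) \<Rightarrow> 'x set \<Rightarrow> ('x \<rightharpoonup> bool)" where
  "fill p S = (\<lambda>x. if p x = None \<and> x \<in> S then Some False else p x)"

lemma fill_le: "p \<subseteq>\<^sub>m fill p S"
  by (auto simp: fill_def map_le_def dom_def)

lemma dom_fill: "dom (fill p S) = dom p \<union> S"
  by (auto simp: fill_def dom_def split: if_splits)

context inacc_wo
begin

text \<open>Besides the forcing itself this covers its conditions on a smaller set of rows and, with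
  the whole type \<open>'a\<close> for \<open>Lam\<close>, conditions on abstract rows.\<close>

definition conditions :: "'l set \<Rightarrow> ('l \<times> 'a \<rightharpoonup> bool) set" where
  "conditions Lam = {p. dom p \<subseteq> Lam \<times> UNIV \<and> small (dom p)}"

definition row :: "('l \<times> 'a \<rightharpoonup> bool) \<Rightarrow> 'l \<Rightarrow> 'a \<Rightarrow> 'a \<Rightarrow> bool" where
  "row p l \<xi> = (\<lambda>\<zeta>. \<zeta> \<lhd> \<xi> \<and> p (l, \<zeta>) = Some True)"

definition full :: "('l \<times> 'a \<rightharpoonup> bool) \<Rightarrow> 'l \<Rightarrow> 'a \<Rightarrow> bool" where
  "full p l \<xi> \<longleftrightarrow> (\<forall>\<zeta>. \<zeta> \<lhd> \<xi> \<longrightarrow> (l, \<zeta>) \<in> dom p)"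

text \<open>The existence of \<open>D\<close> says that there are fewer than \<kappa> colours. Nodes
  enter as plain predicates, which do not know their level, so the level \<open>\<xi>\<close> is a
  separate argument.\<close>

definition colouring :: "nat \<Rightarrow> ('a \<Rightarrow> (nat \<Rightarrow> 'a \<Rightarrow> bool) \<Rightarrow> 'a) \<Rightarrow> bool" where
  "colouring n F \<longleftrightarrow> (\<forall>\<xi> t t'. (\<forall>j<n. t j = t' j) \<longrightarrow> F \<xi> t = F \<xi> t') \<and> (\<exists>D. \<forall>\<xi> t. F \<xi> t \<lhd> D)"

lemma colouring_cong: "colouring n F \<Longrightarrow> (\<And>j. j < n \<Longrightarrow> t j = t' j) \<Longrightarrow> F \<xi> t = F \<xi> t'"
  unfolding colouring_def by simp

lemma row_mono: "p \<subseteq>\<^sub>m q \<Longrightarrow> full p l \<xi> \<Longrightarrow> row q l \<xi> = row p l \<xi>"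
  unfolding row_def full_def map_le_def by (metis)

end

text \<open>\<open>L F \<alpha> c p\<close> stands for ``\<open>p\<close> forces that the ultrafilter limit of \<open>F(b\<^sub>\<alpha>\<restriction>\<xi>)\<close> as
  \<open>\<xi> \<rightarrow> \<kappa>\<close> is \<open>c\<close>'', where \<open>b\<^sub>\<alpha>\<close> is the tuple of Cohen branches with indices \<open>\<alpha>\<close>. The set \<open>N0\<close> absorbs
  the rows of the condition that forces the ultrafilter.\<close>

locale branch_limits = inacc_wo r for r :: "'a rel" +
  fixes Lam N0 :: "'l set" and n :: nat
    and L :: "('a \<Rightarrow> (nat \<Rightarrow> 'a \<Rightarrow> bool) \<Rightarrow> 'a) \<Rightarrow> (nat \<Rightarrow> 'l) \<Rightarrow> 'a \<Rightarrow> ('l \<times> 'a \<rightharpoonup> bool) \<Rightarrow> bool"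
  assumes N0: "small N0"
    and L_open: "\<lbrakk>colouring n F; \<forall>j<n. \<alpha> j \<in> Lam - N0; L F \<alpha> c p; p \<subseteq>\<^sub>m q; q \<in> conditions Lam\<rbrakk> \<Longrightarrow> L F \<alpha> c q"
    and L_dense: "\<lbrakk>colouring n F; \<forall>j<n. \<alpha> j \<in> Lam - N0; p \<in> conditions Lam;
        \<And>q. q \<in> conditions Lam \<Longrightarrow> p \<subseteq>\<^sub>m q \<Longrightarrow> \<exists>q'\<in>conditions Lam. q \<subseteq>\<^sub>m q' \<and> L F \<alpha> c q'\<rbrakk> \<Longrightarrow> L F \<alpha> c p"
    and L_decides: "\<lbrakk>colouring n F; \<forall>j<n. \<alpha> j \<in> Lam - N0; p \<in> conditions Lam\<rbrakk> \<Longrightarrow>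
        \<exists>q\<in>conditions Lam. \<exists>c. p \<subseteq>\<^sub>m q \<and> L F \<alpha> c q"
    and L_pick: "\<lbrakk>p \<in> conditions Lam; small I;
        \<forall>(F, \<alpha>, c)\<in>I. colouring n F \<and> (\<forall>j<n. \<alpha> j \<in> Lam - N0) \<and> L F \<alpha> c p\<rbrakk> \<Longrightarrow>
        \<exists>q\<in>conditions Lam. \<exists>\<xi>. p \<subseteq>\<^sub>m q \<and> \<eta> \<lhd> \<xi> \<and>
          (\<forall>(F, \<alpha>, c)\<in>I. (\<forall>j<n. full q (\<alpha> j) \<xi>) \<and> F \<xi> (\<lambda>j. row q (\<alpha> j) \<xi>) = c)"

lemma Field_Add: "p \<in> Field (Add \<kappa> lam) \<longleftrightarrow> p \<in> Add_conditions \<kappa> lam"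
  by (auto simp: Add_def Field_def)

text \<open>\<open>L F \<alpha> c q\<close> is to say that \<open>q\<close>, moved to the columns of
  \<kappa> and put below \<open>p0\<close>, forces the set of levels at which the branches get
  colour \<open>c\<close> to be in \<open>U\<close>. A limit can be decided because there are fewer
  than \<kappa> colours; fewer than \<kappa> limits are realized at one level above \<eta> by
  completeness and nonprincipality.\<close>

lemma (in inacc_wo) branch_limits_exist:
  fixes \<kappa> :: "'k rel" and lam :: "'l rel"
  assumes inacc\<kappa>: "inaccessible \<kappa>" and r\<kappa>: "r =o \<kappa>"
    and meas: "measurable_in_Add_extension \<kappa> lam"
    and bij: "bij_betw i UNIV (Field \<kappa>)" and ord: "\<And>x y. x \<lhd> y \<longleftrightarrow> i x \<in> underS \<kappa> (i y)"
  shows "\<exists>N0 L. branch_limits r (Field lam) N0 n L"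
proof -
  let ?P = "Add \<kappa> lam" and ?C = "Add_conditions \<kappa> lam" and ?Lam = "Field lam"
  have small\<kappa>: "|A| <o \<kappa> \<longleftrightarrow> small A" for A :: "'x set"
    using r\<kappa> by (meson ordIso_symmetric ordLess_ordIso_trans)
  have small_underS: "|underS \<kappa> k| <o \<kappa>" if "k \<in> Field \<kappa>" for k
    using inacc\<kappa> that by (simp add: card_of_underS inaccessible_def)
  have "Map.empty \<in> ?C" by (simp add: Add_conditions_def small\<kappa> small_finite)
  then have "(Map.empty, Map.empty) \<in> ?P" by (simp add: Add_def)
  then obtain p0 U where p0C: "p0 \<in> ?C" and U: "fNonprincipal_complete_ultrafilter ?P \<kappa> U p0"
    using meas unfolding measurable_in_Add_extension_def fMeasurable_def fEx_def dense_below_def Add_def by blast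
  interpret forced_ultrafilter ?P \<kappa> U p0
    by unfold_locales (use p0C U inacc\<kappa> Field_Add[of _ \<kappa> lam] in \<open>auto simp: Add_def trans_def intro: map_le_trans\<close>)
  define j where "j = the_inv_into UNIV i"
  have ji [simp]: "j (i a) = a" for a
    using bij unfolding j_def bij_betw_def by (simp add: the_inv_into_f_f)
  have ij [simp]: "i (j k) = k" if "k \<in> Field \<kappa>" for k
    using bij that unfolding j_def bij_betw_def by (simp add: f_the_inv_into_f)
  have iF [simp]: "i a \<in> Field \<kappa>" for a using bij by (auto simp: bij_betw_def)
  have i_eq [simp]: "i a = i b \<longleftrightarrow> a = b" for a b by (metis ji)
  define N0 where "N0 = fst ` dom p0"
  \<comment> \<open>On its domain \<open>p0\<close> overrides \<open>q\<close>, so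
    \<open>e q\<close> is below \<open>p0\<close> for every \<open>q\<close>. Rows on which this may
    contradict \<open>q\<close> belong to \<open>N0\<close> and are excluded from the tuples of
    indices.\<close>
  define e where "e q = (\<lambda>(l, k). if k \<in> Field \<kappa> then q (l, j k) else None) ++ p0" for q :: "'l \<times> 'a \<rightharpoonup> bool"
  \<comment> \<open>A right inverse of \<open>e\<close>: an extension \<open>r'\<close> of
    \<open>e q\<close> is the image of \<open>b q r'\<close>, which extends \<open>q\<close>. At the
    overridden places the values of \<open>q\<close> are kept.\<close>
  define b where "b q r' = (\<lambda>(l, a). if (l, i a) \<in> dom p0 then q (l, a) else r' (l, i a))"
    for q :: "'l \<times> 'a \<rightharpoonup> bool" and r'
  have e_cond: "e q \<in> ?C" if "q \<in> conditions ?Lam" for q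
  proof -
    have d: "dom (e q) \<subseteq> (\<lambda>(l, a). (l, i a)) ` dom q \<union> dom p0"
      by (force simp: e_def map_add_def dom_def split: if_splits option.splits)
    moreover have "small ((\<lambda>(l, a). (l, i a)) ` dom q \<union> dom p0)"
      using that p0C by (intro small_Un small_image) (auto simp: conditions_def Add_conditions_def small\<kappa>)
    ultimately have "small (dom (e q))" by (rule small_mono)
    moreover have "dom (e q) \<subseteq> ?Lam \<times> Field \<kappa>"
      using d p0C that by (force simp: conditions_def Add_conditions_def)
    ultimately show ?thesis by (auto simp: Add_conditions_def small\<kappa>)
  qed
  have e_p0: "(e q, p0) \<in> ?P" if "q \<in> conditions ?Lam" for q
    using e_cond[OF that] p0C by (auto simp: Add_def e_def)
  have e_mono: "(e q, e p) \<in> ?P" if "p \<in> conditions ?Lam" "q \<in> conditions ?Lam" "p \<subseteq>\<^sub>m q" for p q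
  proof -
    have "e p \<subseteq>\<^sub>m e q"
      using that(3) by (auto simp: e_def map_le_def map_add_def dom_def split: option.splits if_splits)
    then show ?thesis using that e_cond by (auto simp: Add_def)
  qed
  have b: "b q r' \<in> conditions ?Lam" "q \<subseteq>\<^sub>m b q r'" "e (b q r') = r'"
    if q: "q \<in> conditions ?Lam" and r': "(r', e q) \<in> ?P" for q r'
  proof -
    have r'C: "r' \<in> ?C" and le: "e q \<subseteq>\<^sub>m r'" using r' by (auto simp: Add_def)
    have p0r: "p0 \<subseteq>\<^sub>m r'" using le map_le_trans[OF map_le_map_add] unfolding e_def by blast
    have sub: "dom (b q r') \<subseteq> dom q \<union> (\<lambda>(l, k). (l, j k)) ` dom r'"
    proof
      fix x assume "x \<in> dom (b q r')"
      then obtain l a where x: "x = (l, a)" "(l, a) \<in> dom (b q r')" by (cases x) auto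
      show "x \<in> dom q \<union> (\<lambda>(l, k). (l, j k)) ` dom r'"
      proof (cases "(l, i a) \<in> dom p0")
        case True
        then have "b q r' (l, a) = q (l, a)" by (simp add: b_def)
        then show ?thesis using x by (simp add: domIff)
      next
        case False
        then have "b q r' (l, a) = r' (l, i a)" by (simp add: b_def)
        then have "(l, i a) \<in> dom r'" using x by (simp add: domIff)
        then have "(\<lambda>(l, k). (l, j k)) (l, i a) \<in> (\<lambda>(l, k). (l, j k)) ` dom r'" by (rule imageI)
        then show ?thesis using x by simp
      qed
    qed
    have "small (dom q \<union> (\<lambda>(l, k). (l, j k)) ` dom r')"
      using q r'C by (intro small_Un small_image) (auto simp: conditions_def Add_conditions_def small\<kappa>)
    with sub have "small (dom (b q r'))" by (rule small_mono)
    moreover have "dom q \<union> (\<lambda>(l, k). (l, j k)) ` dom r' \<subseteq> ?Lam \<times> UNIV"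
      using q r'C by (auto simp: conditions_def Add_conditions_def)
    then have "dom (b q r') \<subseteq> ?Lam \<times> UNIV" using sub by (rule subset_trans[rotated])
    ultimately show "b q r' \<in> conditions ?Lam" by (simp add: conditions_def)
    show "q \<subseteq>\<^sub>m b q r'"
    proof (unfold map_le_def, safe)
      fix l a v assume v: "q (l, a) = Some v"
      show "q (l, a) = b q r' (l, a)"
      proof (cases "(l, i a) \<in> dom p0")
        case False
        then have "e q (l, i a) = Some v" using v by (auto simp: e_def map_add_def dom_def)
        then have "r' (l, i a) = Some v" using le by (auto simp: map_le_def dom_def)
        then show ?thesis using False v by (auto simp: b_def)
      qed (auto simp: b_def)
    qed
    show "e (b q r') = r'"
    proof (rule ext, safe)
      fix l k
      show "e (b q r') (l, k) = r' (l, k)"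
      proof (cases "(l, k) \<in> dom p0")
        case True
        then show ?thesis using p0r by (auto simp: e_def map_le_def dom_def map_add_def)
      next
        case False
        have "r' (l, k) = None" if "k \<notin> Field \<kappa>"
          using r'C that by (auto simp: Add_conditions_def dom_def)
        with False show ?thesis
          by (cases "k \<in> Field \<kappa>") (auto simp: e_def b_def map_add_def dom_def split: option.splits)
      qed
    qed
  qed
  \<comment> \<open>\<open>p\<close> forces colour \<open>c\<close> at level \<open>k\<close> if
    every extension that knows all relevant bits below \<open>k\<close> computes \<open>c\<close>;
    \<open>p\<close> itself need not know these bits. This form makes the sentence regular.\<close>
  define Dd where "Dd F \<alpha> c k p \<longleftrightarrow> (\<forall>q. (q, p) \<in> ?P \<longrightarrow> (\<forall>m<n. \<forall>k'\<in>underS \<kappa> k. (\<alpha> m, k') \<in> dom q) \<longrightarrow>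
     F (j k) (\<lambda>m \<zeta>. i \<zeta> \<in> underS \<kappa> k \<and> q (\<alpha> m, i \<zeta>) = Some True) = c)"
    for F :: "'a \<Rightarrow> (nat \<Rightarrow> 'a \<Rightarrow> bool) \<Rightarrow> 'a" and \<alpha> :: "nat \<Rightarrow> 'l" and c k p
  have dec: "F (j k) (\<lambda>m \<zeta>. i \<zeta> \<in> underS \<kappa> k \<and> q (\<alpha> m, i \<zeta>) = Some True) =
      F (j k) (\<lambda>m \<zeta>. i \<zeta> \<in> underS \<kappa> k \<and> p (\<alpha> m, i \<zeta>) = Some True)"
    if F: "colouring n F" and f: "\<forall>m<n. \<forall>k'\<in>underS \<kappa> k. (\<alpha> m, k') \<in> dom p" and le: "p \<subseteq>\<^sub>m q" for F k \<alpha> p q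
  proof -
    have "q (\<alpha> m, k') = p (\<alpha> m, k')" if "m < n" "k' \<in> underS \<kappa> k" for m k'
      using f le that unfolding map_le_def by metis
    then show ?thesis by (intro colouring_cong[OF F] ext) (auto cong: conj_cong)
  qed
  have fill_cond: "(fill q S, q) \<in> ?P" "fill q S \<in> ?C"
    if "q \<in> ?C" "small S" "S \<subseteq> ?Lam \<times> Field \<kappa>" for q S
  proof -
    have "dom q \<union> S \<subseteq> ?Lam \<times> Field \<kappa>" "small (dom q \<union> S)"
      using that small_Un[OF _ that(2)] by (simp_all add: Add_conditions_def small\<kappa>)
    then show "fill q S \<in> ?C" by (simp add: Add_conditions_def small\<kappa> dom_fill)
    then show "(fill q S, q) \<in> ?P" using that by (auto simp: Add_def fill_le)
  qed
  have reg: "regular_sentence (Dd F \<alpha> c k)" if F: "colouring n F" for F \<alpha> c k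
    unfolding regular_sentence_def
  proof (intro conjI allI impI ballI)
    show "Dd F \<alpha> c k q" if "(q, p) \<in> ?P" "Dd F \<alpha> c k p" for p q
      using that P_trans unfolding Dd_def by blast
    fix p assume p: "dense_below ?P p (Dd F \<alpha> c k)"
    show "Dd F \<alpha> c k p" unfolding Dd_def
    proof (intro allI impI)
      fix q assume q: "(q, p) \<in> ?P" and f: "\<forall>m<n. \<forall>k'\<in>underS \<kappa> k. (\<alpha> m, k') \<in> dom q"
      obtain r' where r': "(r', q) \<in> ?P" "Dd F \<alpha> c k r'" using p q unfolding dense_below_def by blast
      then have le: "q \<subseteq>\<^sub>m r'" by (simp add: Add_def)
      have "\<forall>m<n. \<forall>k'\<in>underS \<kappa> k. (\<alpha> m, k') \<in> dom r'"
        using f map_le_implies_dom_le[OF le] by blast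
      moreover have "(r', r') \<in> ?P" using r' P_Field reflP by blast
      ultimately have "F (j k) (\<lambda>m \<zeta>. i \<zeta> \<in> underS \<kappa> k \<and> r' (\<alpha> m, i \<zeta>) = Some True) = c"
        using r'(2) unfolding Dd_def by blast
      then show "F (j k) (\<lambda>m \<zeta>. i \<zeta> \<in> underS \<kappa> k \<and> q (\<alpha> m, i \<zeta>) = Some True) = c"
        using dec[OF F f le] by simp
    qed
  qed
  define L where "L F \<alpha> c q \<longleftrightarrow> measure_one (Dd F \<alpha> c) (e q)" for F \<alpha> c q
  have "branch_limits r ?Lam N0 n L"
  proof (unfold_locales)
    show "small N0" using p0C by (auto simp: N0_def Add_conditions_def small\<kappa> intro: small_image)
  next
    fix F \<alpha> c and p q :: "'l \<times> 'a \<rightharpoonup> bool" assume "L F \<alpha> c p" and pq: "p \<subseteq>\<^sub>m q" and q: "q \<in> conditions ?Lam"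
    have "p \<in> conditions ?Lam"
      using q small_mono subset_trans unfolding conditions_def mem_Collect_eq
      by (meson map_le_implies_dom_le[OF pq])
    then show "L F \<alpha> c q" using \<open>L F \<alpha> c p\<close> measure_one_open e_mono pq q unfolding L_def by blast
  next
    fix F \<alpha> c and p :: "'l \<times> 'a \<rightharpoonup> bool"
    assume p: "p \<in> conditions ?Lam" and d: "\<And>q. q \<in> conditions ?Lam \<Longrightarrow> p \<subseteq>\<^sub>m q \<Longrightarrow> \<exists>q'\<in>conditions ?Lam. q \<subseteq>\<^sub>m q' \<and> L F \<alpha> c q'"
    show "L F \<alpha> c p" unfolding L_def
    proof (rule measure_one_dense, unfold dense_below_def, intro allI impI)
      fix r' assume r': "(r', e p) \<in> ?P"
      obtain q' where "q' \<in> conditions ?Lam" "b p r' \<subseteq>\<^sub>m q'" "L F \<alpha> c q'"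
        using d[OF b(1,2)[OF p r']] by blast
      then show "\<exists>r. (r, r') \<in> ?P \<and> measure_one (Dd F \<alpha> c) r"
        using e_mono[OF b(1)[OF p r'], of q'] b(3)[OF p r'] unfolding L_def by metis
    qed
  next
    fix F \<alpha> and p :: "'l \<times> 'a \<rightharpoonup> bool"
    assume F: "colouring n F" and \<alpha>: "\<forall>m<n. \<alpha> m \<in> ?Lam - N0" and p: "p \<in> conditions ?Lam"
    obtain D where D: "\<And>\<xi> t. F \<xi> t \<lhd> D" using F unfolding colouring_def by blast
    have "\<exists>q c. (q, e p) \<in> ?P \<and> c \<in> {c. c \<lhd> D} \<and> measure_one (Dd F \<alpha> c) q"
    proof (rule measure_one_decides[OF e_p0[OF p]])
      show "|{c. c \<lhd> D}| <o \<kappa>" by (simp add: small\<kappa> small_seg)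
      show "regular_sentence (Dd F \<alpha> c k)" for c k by (rule reg[OF F])
      fix k q assume k: "k \<in> Field \<kappa>" and q: "(q, e p) \<in> ?P"
      have qC: "q \<in> ?C" using q by (simp add: Add_def)
      \<comment> \<open>Fewer than \<kappa> missing bits are filled in; after that the colour at
        level \<open>k\<close> is computed and no extension can change it.\<close>
      let ?S = "\<alpha> ` {..<n} \<times> underS \<kappa> k"
      have "small ?S" using small_underS[OF k] by (intro small_Sigma) (simp_all add: small\<kappa> small_finite)
      moreover have "?S \<subseteq> ?Lam \<times> Field \<kappa>" using \<alpha> by (auto simp: underS_def Field_def)
      ultimately have f: "(fill q ?S, q) \<in> ?P" using fill_cond[OF qC] by blast
      let ?c = "F (j k) (\<lambda>m \<zeta>. i \<zeta> \<in> underS \<kappa> k \<and> fill q ?S (\<alpha> m, i \<zeta>) = Some True)"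
      have "Dd F \<alpha> ?c k (fill q ?S)" unfolding Dd_def
        by (intro allI impI dec[OF F]) (simp_all add: dom_fill Add_def)
      then show "\<exists>q' c. (q', q) \<in> ?P \<and> c \<in> {c. c \<lhd> D} \<and> Dd F \<alpha> c k q'"
        using f D by blast
    qed
    then obtain q c where q: "(q, e p) \<in> ?P" "measure_one (Dd F \<alpha> c) q" by blast
    then show "\<exists>q\<in>conditions ?Lam. \<exists>c. p \<subseteq>\<^sub>m q \<and> L F \<alpha> c q"
      using b[OF p q(1)] unfolding L_def by metis
  next
    fix p :: "'l \<times> 'a \<rightharpoonup> bool" and I \<eta>
    assume p: "p \<in> conditions ?Lam" and I: "small I"
      and all: "\<forall>(F, \<alpha>, c)\<in>I. colouring n F \<and> (\<forall>j<n. \<alpha> j \<in> ?Lam - N0) \<and> L F \<alpha> c p"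
    \<comment> \<open>Avoiding the initial segment up to \<eta> is what makes the level exceed
      \<eta>.\<close>
    let ?Z = "i ` {\<zeta>. \<zeta> \<unlhd> \<eta>}"
    have "\<exists>q k. (q, e p) \<in> ?P \<and> k \<in> Field \<kappa> - ?Z \<and> (\<forall>x\<in>I. (case x of (F, \<alpha>, c) \<Rightarrow> Dd F \<alpha> c) k q)"
    proof (rule measure_one_pick[OF e_p0[OF p]])
      show "|I| <o \<kappa>" "|?Z| <o \<kappa>" by (simp_all add: small\<kappa> I small_image seg_le)
      show "?Z \<subseteq> Field \<kappa>" by auto
      show "regular_sentence ((case x of (F, \<alpha>, c) \<Rightarrow> Dd F \<alpha> c) k)" if "x \<in> I" for x k
        using all that reg by (auto split: prod.split)
      show "measure_one (case x of (F, \<alpha>, c) \<Rightarrow> Dd F \<alpha> c) (e p)" if "x \<in> I" for x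
        using all that by (auto simp: L_def split: prod.split)
    qed
    then obtain q k where q: "(q, e p) \<in> ?P" and k: "k \<in> Field \<kappa>" "k \<notin> ?Z"
      and Dq: "\<And>F \<alpha> c. (F, \<alpha>, c) \<in> I \<Longrightarrow> Dd F \<alpha> c k q" by fastforce
    let ?S = "(\<Union>(F, \<alpha>, c)\<in>I. \<alpha> ` {..<n}) \<times> underS \<kappa> k"
    have "small ?S"
    proof (rule small_Sigma)
      show "small (\<Union>(F, \<alpha>, c)\<in>I. \<alpha> ` {..<n})"
        by (intro small_UN I) (auto intro: small_finite)
      show "small (underS \<kappa> k)" using small_underS[OF k(1)] by (simp add: small\<kappa>)
    qed
    moreover have "?S \<subseteq> ?Lam \<times> Field \<kappa>" using all by (fastforce simp: underS_def Field_def)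
    moreover have "q \<in> ?C" using q by (simp add: Add_def)
    ultimately have f: "(fill q ?S, q) \<in> ?P" using fill_cond by blast
    then have f': "(fill q ?S, e p) \<in> ?P" using P_trans q by blast
    have ff: "(fill q ?S, fill q ?S) \<in> ?P" using f P_Field reflP by blast
    let ?q = "b p (fill q ?S)"
    have key: "(\<forall>m<n. full ?q (\<alpha> m) (j k)) \<and> F (j k) (\<lambda>m. row ?q (\<alpha> m) (j k)) = c" if F: "(F, \<alpha>, c) \<in> I" for F \<alpha> c
    proof -
      have \<alpha>: "\<alpha> m \<in> ?Lam - N0" if "m < n" for m using all F that by fastforce
      have bq: "?q (\<alpha> m, a) = fill q ?S (\<alpha> m, i a)" if "m < n" for m a
        using \<alpha>[OF that] by (force simp: b_def N0_def)
      have fd: "\<forall>m<n. \<forall>k'\<in>underS \<kappa> k. (\<alpha> m, k') \<in> dom (fill q ?S)"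
        unfolding dom_fill by (intro allI impI ballI UnI2 SigmaI UN_I[OF F]) auto
      have "full ?q (\<alpha> m) (j k)" if m: "m < n" for m
        unfolding full_def
      proof (intro allI impI)
        fix \<zeta> assume "\<zeta> \<lhd> j k"
        then have "(\<alpha> m, i \<zeta>) \<in> dom (fill q ?S)" using fd m k(1) unfolding ord by simp
        then show "(\<alpha> m, \<zeta>) \<in> dom ?q" unfolding domIff bq[OF m] .
      qed
      moreover have "F (j k) (\<lambda>m \<zeta>. i \<zeta> \<in> underS \<kappa> k \<and> fill q ?S (\<alpha> m, i \<zeta>) = Some True) = c"
        using Dq[OF F] f fd unfolding Dd_def by blast
      moreover have "\<forall>m<n. (\<lambda>\<zeta>. i \<zeta> \<in> underS \<kappa> k \<and> fill q ?S (\<alpha> m, i \<zeta>) = Some True) = row ?q (\<alpha> m) (j k)"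
        using bq k(1) by (auto simp: row_def ord)
      moreover have "colouring n F" using all F by fastforce
      ultimately have "F (j k) (\<lambda>m. row ?q (\<alpha> m) (j k)) = c"
        using colouring_cong[of n F "\<lambda>m. row ?q (\<alpha> m) (j k)"
          "\<lambda>m \<zeta>. i \<zeta> \<in> underS \<kappa> k \<and> fill q ?S (\<alpha> m, i \<zeta>) = Some True" "j k"] by simp
      then show ?thesis using \<open>\<And>m. m < n \<Longrightarrow> full ?q (\<alpha> m) (j k)\<close> by blast
    qed
    have "\<not> j k \<unlhd> \<eta>"
    proof
      assume "j k \<unlhd> \<eta>"
      then have "i (j k) \<in> ?Z" by blast
      then show False using k by simp
    qed
    then have "\<eta> \<lhd> j k" by (simp add: O.not_le)
    then show "\<exists>q\<in>conditions ?Lam. \<exists>\<xi>. p \<subseteq>\<^sub>m q \<and> \<eta> \<lhd> \<xi> \<and>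
          (\<forall>(F, \<alpha>, c)\<in>I. (\<forall>j<n. full q (\<alpha> j) \<xi>) \<and> F \<xi> (\<lambda>j. row q (\<alpha> j) \<xi>) = c)"
      using key b(1,2)[OF p f'] by (intro bexI[of _ ?q] exI[of _ "j k"]) auto
  qed
  then show ?thesis by blast
qed

section \<open>Homogeneous families of supports\<close>

lemma card_image_pattern:
  assumes "\<And>p q. p \<in> X \<Longrightarrow> q \<in> X \<Longrightarrow> v p = v q \<longleftrightarrow> v' p = v' q"
  shows "card (v ` X) = card (v' ` X)"
proof -
  let ?f = "\<lambda>y. v' (inv_into X v y)"
  have f: "?f (v p) = v' p" if "p \<in> X" for p
    using assms[of "inv_into X v (v p)" p] that by (simp add: inv_into_into f_inv_into_f)
  have "v' ` X = ?f ` (v ` X)" unfolding image_image by (rule image_cong) (simp_all add: f)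
  moreover have "inj_on ?f (v ` X)" using assms by (auto intro!: inj_onI simp: f)
  ultimately show ?thesis by (simp add: card_image)
qed

definition tuple :: "nat \<Rightarrow> (nat \<Rightarrow> 'i \<Rightarrow> 'l) \<Rightarrow> (nat \<Rightarrow> 'i) \<Rightarrow> nat \<Rightarrow> 'l" where
  "tuple d h u = (\<lambda>j\<in>{..<d}. h j (u j))"

definition index_tuples :: "nat \<Rightarrow> 'l set \<Rightarrow> (nat \<Rightarrow> 'l) set" where
  "index_tuples d A = {\<alpha> \<in> {..<d} \<rightarrow>\<^sub>E A. inj_on \<alpha> {..<d}}"

definition agree :: "nat \<Rightarrow> (nat \<Rightarrow> 'i) \<Rightarrow> (nat \<Rightarrow> 'i) \<Rightarrow> nat set" where
  "agree d u u' = {j. j < d \<and> u j = u' j}"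

context inacc_wo
begin

section \<open>Cardinal arithmetic of \<kappa> and its power set\<close>

lemma square: "|UNIV :: ('a \<times> 'a) set| \<le>o |UNIV :: 'a set|"
  using card_of_Times_same_infinite[OF infinite_UNIV] ordIso_imp_ordLeq by fastforce

lemma power_mono: "|B| \<le>o |UNIV :: 'a set| \<Longrightarrow> |Pow B| \<le>o |UNIV :: 'a set set|"
  using card_of_ordLeq[of B "UNIV :: 'a set"] inj_on_image_Pow
  by (metis Pow_UNIV card_of_ordLeq image_Pow_mono subset_UNIV)

lemma infinite_power: "infinite (UNIV :: 'a set set)"
  using infinite_UNIV by (simp add: Finite_Set.finite_set)

lemma power_Times: "|A| \<le>o |UNIV :: 'a set| \<Longrightarrow> |B| \<le>o |UNIV :: 'a set| \<Longrightarrow> |A \<times> B| \<le>o |UNIV :: 'a set|"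
  by (rule card_of_Times_ordLeq_infinite_Field[OF kappa_card(2), THEN ordLeq_ordIso_trans[OF _ r_ordIso(1)]])
    (auto intro: ordLeq_ordIso_trans[OF _ r_ordIso(2)] kappa_card)

text \<open>This is \<open>(2^\<kappa>)^\<kappa> = 2^\<kappa>\<close>: a nonempty set of size at
  most \<kappa> is the range of a \<kappa>-sequence of subsets of \<kappa>, and such a sequence is a
  binary relation on \<kappa>, decoded by \<open>\<psi>\<close>.\<close>

lemma subsets_of_power:
  fixes A :: "'x set"
  assumes "|A| \<le>o |UNIV :: 'a set set|"
  shows "|{B. B \<subseteq> A \<and> |B| \<le>o |UNIV :: 'a set| }| \<le>o |UNIV :: 'a set set|"
proof -
  obtain f :: "'x \<Rightarrow> 'a set" where f: "inj_on f A" using assms by (meson card_of_ordLeq)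
  define \<psi> where "\<psi> R = range (\<lambda>x. inv_into A f {y. (x, y) \<in> R})" for R :: "('a \<times> 'a) set"
  have "{B. B \<subseteq> A \<and> |B| \<le>o |UNIV :: 'a set| } \<subseteq> insert {} (range \<psi>)"
  proof
    fix B assume "B \<in> {B. B \<subseteq> A \<and> |B| \<le>o |UNIV :: 'a set| }"
    then have B: "B \<subseteq> A" "|B| \<le>o |UNIV :: 'a set|" by auto
    show "B \<in> insert {} (range \<psi>)"
    proof (cases "B = {}")
      case False
      then obtain g :: "'a \<Rightarrow> 'x" where g: "g ` UNIV = B" using B(2) card_of_ordLeq2[of B "UNIV :: 'a set"] by auto
      have "inv_into A f (f (g x)) = g x" for x using f g B(1) by (intro inv_into_f_f) auto
      then have "\<psi> {(x, y). y \<in> f (g x)} = B" unfolding \<psi>_def using g by simp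
      then show ?thesis by blast
    qed simp
  qed
  then have "|{B. B \<subseteq> A \<and> |B| \<le>o |UNIV :: 'a set| }| \<le>o |insert {} (range \<psi>)|" by (rule card_of_mono1)
  also have "|insert {} (range \<psi>)| \<le>o |UNIV :: 'a set set|"
  proof (subst insert_is_Un, rule card_Un_bound[OF _ _ infinite_power])
    show "|{{}}| \<le>o |UNIV :: 'a set set|" by (rule card_of_singl_ordLeq) simp
    have "|range \<psi>| \<le>o |UNIV :: ('a \<times> 'a) set set|" by (rule card_of_image)
    also have "|UNIV :: ('a \<times> 'a) set set| \<le>o |UNIV :: 'a set set|"
      using power_mono[OF square] by simp
    finally show "|range \<psi>| \<le>o |UNIV :: 'a set set|" .
  qed
  finally show ?thesis .
qed

text \<open>A delta system for \<open>d\<close>-dimensional tuples of indices.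
  \<open>w \<alpha>\<close> enumerates in type \<kappa> the rows needed for the tuple
  \<open>\<alpha>\<close>. Two tuples built from \<open>h\<close> share a row only at the same
  position \<open>e\<close>, and whether they do depends on nothing but the set of coordinates in
  which they agree; \<open>\<F> e\<close> is the family of those agreement sets for which position
  \<open>e\<close> is shared.\<close>

definition homogeneous_supports ::
    "nat \<Rightarrow> 'l set \<Rightarrow> ((nat \<Rightarrow> 'l) \<Rightarrow> 'a \<Rightarrow> 'l) \<Rightarrow> ((nat \<Rightarrow> 'l) \<Rightarrow> 'o) \<Rightarrow> 'o \<Rightarrow> ('a \<Rightarrow> nat set set) \<Rightarrow> 'i set \<Rightarrow> (nat \<Rightarrow> 'i \<Rightarrow> 'l) \<Rightarrow> bool" where
  "homogeneous_supports d A w Ty ty \<F> I h \<longleftrightarrow>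
     (\<forall>u \<in> {..<d} \<rightarrow>\<^sub>E I. tuple d h u \<in> index_tuples d A \<and> Ty (tuple d h u) = ty) \<and>
     (\<forall>j<d. \<forall>j'<d. \<forall>i\<in>I. \<forall>i'\<in>I. h j i = h j' i' \<longrightarrow> j = j' \<and> i = i') \<and>
     (\<forall>u \<in> {..<d} \<rightarrow>\<^sub>E I. \<forall>u' \<in> {..<d} \<rightarrow>\<^sub>E I. \<forall>e e'.
        w (tuple d h u) e = w (tuple d h u') e' \<longleftrightarrow> e = e' \<and> agree d u u' \<in> \<F> e)"

text \<open>The supports have size \<kappa>, so the delta system is formed with the successor of
  \<kappa> as bound for the sets and \<open>2^\<kappa>\<close> as size of the closed-off set. The
  sets are the graphs of the enumerations and not their ranges: a common root then fixes the
  positions of its rows as well.\<close>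

lemma homogeneous_successor:
  fixes w :: "(nat \<Rightarrow> 'l) \<Rightarrow> 'a \<Rightarrow> 'l" and Ty :: "(nat \<Rightarrow> 'l) \<Rightarrow> 'o"
  assumes big: "|UNIV :: 'a set set| <o |A|"
    and inj: "\<And>\<alpha>. \<alpha> \<in> index_tuples 1 A \<Longrightarrow> inj (w \<alpha>)"
    and mem: "\<And>\<alpha>. \<alpha> \<in> index_tuples 1 A \<Longrightarrow> \<alpha> 0 \<in> range (w \<alpha>)"
    and Ty: "|Ty ` index_tuples 1 A| \<le>o |UNIV :: 'a set set|"
  shows "\<exists>ty \<F>. (\<forall>e E E'. E \<in> \<F> e \<longrightarrow> E \<subseteq> E' \<longrightarrow> E' \<subseteq> {..<1} \<longrightarrow> E' \<in> \<F> e) \<and>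
     (\<forall>I :: 'i set. small I \<longrightarrow> (\<exists>h. homogeneous_supports 1 A w Ty ty \<F> I h))"
proof -
  define s where "s a = (\<lambda>j\<in>{..<1 :: nat}. a)" for a :: 'l
  have sT: "s a \<in> index_tuples 1 A \<longleftrightarrow> a \<in> A" for a
    by (auto simp: s_def index_tuples_def inj_on_def)
  define S where "S a = range (\<lambda>e. (e, w (s a) e))" for a
  have reg: "regularCard (cardSuc r)" and cs: "Card_order (cardSuc r)" "infinite (Field (cardSuc r))"
    using kappa_card infinite_cardSuc_regularCard cardSuc_Card_order cardSuc_finite by auto
  have csr: "|B| <o cardSuc r \<longleftrightarrow> |B| \<le>o |UNIV :: 'a set|" for B :: "'x set"
    using cardSuc_ordLeq_ordLess[OF kappa_card(1) card_of_Card_order, of B] r_ordIso ordLeq_ordIso_trans by blast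
  have rP: "cardSuc r \<le>o |UNIV :: 'a set set|"
  proof (rule cardSuc_least[OF kappa_card(1) card_of_Card_order])
    show "r <o |UNIV :: 'a set set|"
      using card_of_Pow[of "UNIV :: 'a set"] r_ordIso(1) ordIso_ordLess_trans by auto
  qed
  have "\<exists>N \<subseteq> A. \<exists>rt. |UNIV :: 'a set| \<le>o |N| \<and> (\<forall>i\<in>N. \<forall>i'\<in>N. Ty (s i) = Ty (s i')) \<and>
     (\<forall>i\<in>N. {x \<in> S i. snd x \<in> snd ` rt} = rt \<and> i \<notin> snd ` rt) \<and>
     (\<forall>i\<in>N. \<forall>i'\<in>N. i \<noteq> i' \<longrightarrow> snd ` S i \<inter> snd ` S i' \<subseteq> snd ` rt)"
  proof (rule delta_system[OF cs(1) reg cs(2) rP, where X = UNIV])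
    show "|{B. B \<subseteq> X \<and> |B| <o cardSuc r}| \<le>o |UNIV :: 'a set set|"
      if "|X| \<le>o |UNIV :: 'a set set|" for X :: "'l set"
      using subsets_of_power[OF that] by (simp add: csr)
    show "|{B. B \<subseteq> X \<and> |B| <o cardSuc r}| \<le>o |UNIV :: 'a set set|"
      if "|X| \<le>o |UNIV :: 'a set set|" for X :: "('a \<times> 'l) set"
      using subsets_of_power[OF that] by (simp add: csr)
    show "|{x \<in> UNIV :: ('a \<times> 'l) set. snd x \<in> R}| \<le>o |UNIV :: 'a set set|"
      if "|R| \<le>o |UNIV :: 'a set set|" for R
    proof -
      have "{x \<in> UNIV :: ('a \<times> 'l) set. snd x \<in> R} = UNIV \<times> R" by auto
      moreover have "|UNIV :: 'a set| \<le>o |UNIV :: 'a set set|"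
        using card_of_Pow[of "UNIV :: 'a set"] ordLess_imp_ordLeq by auto
      ultimately show ?thesis using that infinite_power
        by (auto intro!: card_of_Times_ordLeq_infinite_Field card_of_Card_order simp: Field_card_of)
    qed
    show "S i \<subseteq> UNIV \<and> |S i| <o cardSuc r \<and> i \<in> snd ` S i" if "i \<in> A" for i
    proof -
      have "|S i| \<le>o |UNIV :: 'a set|" unfolding S_def by (rule card_of_image)
      moreover have "i \<in> snd ` S i" using mem[of "s i"] that sT[of i] by (auto simp: S_def s_def image_image)
      ultimately show ?thesis by (simp add: csr)
    qed
    have "(\<lambda>i. Ty (s i)) ` A \<subseteq> Ty ` index_tuples 1 A" using sT by auto
    then show "|(\<lambda>i. Ty (s i)) ` A| \<le>o |UNIV :: 'a set set|"
      using Ty card_of_mono1 ordLeq_transitive by blast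
    show "|UNIV :: 'a set set| <o |A|" by (rule big)
    show "|UNIV :: 'a set| \<le>o |UNIV :: 'a set set|"
      using card_of_Pow[of "UNIV :: 'a set"] ordLess_imp_ordLeq by auto
  qed
  then obtain N rt where N: "N \<subseteq> A" "|UNIV :: 'a set| \<le>o |N|"
    and ty': "\<forall>i\<in>N. \<forall>i'\<in>N. Ty (s i) = Ty (s i')"
    and rt': "\<forall>i\<in>N. {x \<in> S i. snd x \<in> snd ` rt} = rt \<and> i \<notin> snd ` rt"
    and off': "\<forall>i\<in>N. \<forall>i'\<in>N. i \<noteq> i' \<longrightarrow> snd ` S i \<inter> snd ` S i' \<subseteq> snd ` rt"
    by (elim exE conjE) (rule that)
  note ty = ty'[rule_format] and rt = rt'[rule_format, THEN conjunct1] and off = off'[rule_format]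
  have "N \<noteq> {}" using N(2) card_of_empty3[of "UNIV :: 'a set"] by auto
  then obtain i0 where i0: "i0 \<in> N" by blast
  \<comment> \<open>Distinct indices share a row iff it is in the root; an index shares every row
    with itself, and this is the agreement set \<open>{0}\<close>.\<close>
  define \<F> where "\<F> e = {E. E \<subseteq> {..<1} \<and> (E = {0 :: nat} \<or> e \<in> fst ` rt)}" for e
  have rtS: "(e, l) \<in> rt \<longleftrightarrow> l = w (s i) e \<and> l \<in> snd ` rt" if "i \<in> N" for i e l
  proof -
    have "(e, l) \<in> rt \<longleftrightarrow> (e, l) \<in> {x \<in> S i. snd x \<in> snd ` rt}" using rt[OF that] by simp
    also have "\<dots> \<longleftrightarrow> l = w (s i) e \<and> l \<in> snd ` rt" unfolding S_def by auto
    finally show ?thesis .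
  qed
  have weq: "w (s i) e = w (s i') e' \<longleftrightarrow> e = e' \<and> (i = i' \<or> e \<in> fst ` rt)" if i: "i \<in> N" "i' \<in> N" for i i' e e'
  proof (cases "i = i'")
    case True
    then show ?thesis using inj[of "s i"] i N(1) sT[of i] by (auto simp: inj_def)
  next
    case False
    show ?thesis
    proof
      assume eq: "w (s i) e = w (s i') e'"
      have "w (s i) e \<in> snd ` S i" by (auto simp: S_def image_image)
      moreover have "w (s i) e \<in> snd ` S i'" unfolding eq by (auto simp: S_def image_image)
      ultimately have "w (s i) e \<in> snd ` rt" using off[OF i False] by blast
      then have "(e, w (s i) e) \<in> rt" "(e', w (s i) e) \<in> rt" using rtS[OF i(1)] rtS[OF i(2)] eq by auto
      then have "w (s i) e = w (s i) e'" using rtS[OF i(1)] by auto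
      moreover have "inj (w (s i))" using inj[of "s i"] i N(1) sT[of i] by auto
      ultimately show "e = e' \<and> (i = i' \<or> e \<in> fst ` rt)" using \<open>(e, w (s i) e) \<in> rt\<close> by (force simp: inj_def)
    next
      assume "e = e' \<and> (i = i' \<or> e \<in> fst ` rt)"
      then obtain l where "e = e'" "(e, l) \<in> rt" using False by auto
      then show "w (s i) e = w (s i') e'" using rtS[OF i(1)] rtS[OF i(2)] by auto
    qed
  qed
  have "\<exists>h. homogeneous_supports 1 A w Ty (Ty (s i0)) \<F> I h" if I: "small I" for I :: "'i set"
  proof -
    have "|I| \<le>o |N|" using small_imp_le[OF I] N(2) ordLeq_transitive by blast
    then obtain g where g: "inj_on g I" "g ` I \<subseteq> N" by (meson card_of_ordLeq)
    have t: "tuple 1 (\<lambda>_. g) u = s (g (u 0))" for u :: "nat \<Rightarrow> 'i" by (auto simp: tuple_def s_def)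
    have uI: "g (u 0) \<in> N" "u 0 \<in> I" if "u \<in> {..<1} \<rightarrow>\<^sub>E I" for u :: "nat \<Rightarrow> 'i"
    proof -
      show "u 0 \<in> I" using that by (auto simp: PiE_iff)
      then show "g (u 0) \<in> N" using g(2) by auto
    qed
    have ag: "agree 1 u u' = (if u 0 = u' 0 then {0} else {})" for u u' :: "nat \<Rightarrow> 'i"
      by (auto simp: agree_def)
    have "homogeneous_supports 1 A w Ty (Ty (s i0)) \<F> I (\<lambda>_. g)"
      unfolding homogeneous_supports_def t
    proof (intro conjI ballI allI impI)
      fix u :: "nat \<Rightarrow> 'i" assume u: "u \<in> {..<1} \<rightarrow>\<^sub>E I"
      show "s (g (u 0)) \<in> index_tuples 1 A" using sT uI[OF u] N(1) by blast
      show "Ty (s (g (u 0))) = Ty (s i0)" using ty uI[OF u] i0 by blast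
      fix u' :: "nat \<Rightarrow> 'i" and e e' assume u': "u' \<in> {..<1} \<rightarrow>\<^sub>E I"
      have "g (u 0) = g (u' 0) \<longleftrightarrow> u 0 = u' 0" using g(1) uI(2)[OF u] uI(2)[OF u'] by (auto simp: inj_on_def)
      then show "w (s (g (u 0))) e = w (s (g (u' 0))) e' \<longleftrightarrow> e = e' \<and> agree 1 u u' \<in> \<F> e"
        unfolding weq[OF uI(1)[OF u] uI(1)[OF u']] ag \<F>_def by auto
    qed (use g in \<open>auto simp: inj_on_def\<close>)
    then show ?thesis by blast
  qed
  moreover have "\<forall>e E E'. E \<in> \<F> e \<longrightarrow> E \<subseteq> E' \<longrightarrow> E' \<subseteq> {..<1} \<longrightarrow> E' \<in> \<F> e"
    unfolding \<F>_def by auto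
  ultimately show ?thesis by blast
qed

end

section \<open>Configurations of pairs of tuples, and homogeneity from the partition
  relation\<close>

context inacc_wo
begin

text \<open>Entries with the same coordinate form a block, and the blocks follow each other. Only
  the order of \<open>\<alpha> j\<close> and \<open>\<alpha>' j\<close> within a block is left open;
  this is the information compared by \<open>same_config\<close>.\<close>

definition block_pair :: "nat \<Rightarrow> (nat \<Rightarrow> 'a) \<Rightarrow> (nat \<Rightarrow> 'a) \<Rightarrow> bool" where
  "block_pair d \<alpha> \<alpha>' \<longleftrightarrow> (\<forall>j j'. j < j' \<longrightarrow> j' < d \<longrightarrow>
     \<alpha> j \<lhd> \<alpha> j' \<and> \<alpha> j \<lhd> \<alpha>' j' \<and> \<alpha>' j \<lhd> \<alpha> j' \<and> \<alpha>' j \<lhd> \<alpha>' j')"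

definition same_config :: "nat \<Rightarrow> (nat \<Rightarrow> 'a) \<Rightarrow> (nat \<Rightarrow> 'a) \<Rightarrow> (nat \<Rightarrow> 'a) \<Rightarrow> (nat \<Rightarrow> 'a) \<Rightarrow> bool" where
  "same_config d \<alpha> \<alpha>' \<beta> \<beta>' \<longleftrightarrow>
     (\<forall>j<d. (\<alpha> j \<lhd> \<alpha>' j \<longleftrightarrow> \<beta> j \<lhd> \<beta>' j) \<and> (\<alpha>' j \<lhd> \<alpha> j \<longleftrightarrow> \<beta>' j \<lhd> \<beta> j))"

definition pair_entry :: "(nat \<Rightarrow> 'a) \<Rightarrow> (nat \<Rightarrow> 'a) \<Rightarrow> nat \<times> bool \<Rightarrow> 'a" where
  "pair_entry \<alpha> \<alpha>' = (\<lambda>(j, b). if b then \<alpha>' j else \<alpha> j)"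

definition pair_rank :: "nat \<Rightarrow> (nat \<Rightarrow> 'a) \<Rightarrow> (nat \<Rightarrow> 'a) \<Rightarrow> 'a \<Rightarrow> nat" where
  "pair_rank d \<alpha> \<alpha>' x = card {y \<in> pair_entry \<alpha> \<alpha>' ` ({..<d} \<times> UNIV). y \<lhd> x}"

lemma pair_entry_less_iff:
  assumes "block_pair d \<alpha> \<alpha>'" "block_pair d \<beta> \<beta>'" "same_config d \<alpha> \<alpha>' \<beta> \<beta>'"
    and "p \<in> {..<d} \<times> UNIV" "q \<in> {..<d} \<times> UNIV"
  shows "pair_entry \<alpha> \<alpha>' p \<lhd> pair_entry \<alpha> \<alpha>' q \<longleftrightarrow> pair_entry \<beta> \<beta>' p \<lhd> pair_entry \<beta> \<beta>' q"
proof -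
  obtain j b j' b' where p: "p = (j, b)" "q = (j', b')" "j < d" "j' < d" using assms(4,5) by auto
  show ?thesis
  proof (cases j j' rule: linorder_cases)
    case less
    then have "pair_entry \<alpha> \<alpha>' p \<lhd> pair_entry \<alpha> \<alpha>' q" "pair_entry \<beta> \<beta>' p \<lhd> pair_entry \<beta> \<beta>' q"
      using assms(1,2) p unfolding block_pair_def pair_entry_def by auto
    then show ?thesis by simp
  next
    case greater
    then have "pair_entry \<alpha> \<alpha>' q \<lhd> pair_entry \<alpha> \<alpha>' p" "pair_entry \<beta> \<beta>' q \<lhd> pair_entry \<beta> \<beta>' p"
      using assms(1,2) p unfolding block_pair_def pair_entry_def by auto
    then show ?thesis using irrefl lt_trans by blast
  next
    case equal
    then show ?thesis using assms(3) p irrefl unfolding same_config_def pair_entry_def by auto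
  qed
qed

text \<open>Blocks and configuration determine the order of all \<open>2 d\<close> entries,
  coincidences included, so corresponding entries have equally many distinct predecessors.\<close>

lemma pair_rank_eq:
  assumes "block_pair d \<alpha> \<alpha>'" "block_pair d \<beta> \<beta>'" "same_config d \<alpha> \<alpha>' \<beta> \<beta>'" "q \<in> {..<d} \<times> UNIV"
  shows "pair_rank d \<alpha> \<alpha>' (pair_entry \<alpha> \<alpha>' q) = pair_rank d \<beta> \<beta>' (pair_entry \<beta> \<beta>' q)"
proof -
  note less = pair_entry_less_iff[OF assms(1,2,3)]
  let ?X = "{p \<in> {..<d} \<times> UNIV. pair_entry \<alpha> \<alpha>' p \<lhd> pair_entry \<alpha> \<alpha>' q}"
  have X: "?X = {p \<in> {..<d} \<times> UNIV. pair_entry \<beta> \<beta>' p \<lhd> pair_entry \<beta> \<beta>' q}"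
    using less[OF _ assms(4)] by blast
  have "card (pair_entry \<alpha> \<alpha>' ` ?X) = card (pair_entry \<beta> \<beta>' ` ?X)"
  proof (rule card_image_pattern)
    fix p p' assume "p \<in> ?X" "p' \<in> ?X"
    then have "p \<in> {..<d} \<times> UNIV" "p' \<in> {..<d} \<times> UNIV" by auto
    then show "pair_entry \<alpha> \<alpha>' p = pair_entry \<alpha> \<alpha>' p' \<longleftrightarrow> pair_entry \<beta> \<beta>' p = pair_entry \<beta> \<beta>' p'"
      using less[of p p'] less[of p' p] lt_total irrefl by metis
  qed
  moreover have "pair_entry \<alpha> \<alpha>' ` ?X = {y \<in> pair_entry \<alpha> \<alpha>' ` ({..<d} \<times> UNIV). y \<lhd> pair_entry \<alpha> \<alpha>' q}"
    by auto
  moreover have "pair_entry \<beta> \<beta>' ` ?X = {y \<in> pair_entry \<beta> \<beta>' ` ({..<d} \<times> UNIV). y \<lhd> pair_entry \<beta> \<beta>' q}"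
    unfolding X by auto
  ultimately show ?thesis unfolding pair_rank_def by simp
qed

text \<open>\<open>h x\<close> is the least element of \<open>H\<close> that has not been used
  before; as \<open>H\<close> is not small, the recursion never runs out of elements.\<close>

lemma increasing_embedding:
  fixes lam :: "'l rel"
  assumes lam: "Well_order lam" and H: "H \<subseteq> Field lam" "\<not> small H"
  shows "\<exists>h :: 'a \<Rightarrow> 'l. range h \<subseteq> H \<and> (\<forall>x y. x \<lhd> y \<longrightarrow> (h x, h y) \<in> lam \<and> h x \<noteq> h y)"
proof -
  have wo: "wo_rel lam" using lam by (simp add: wo_rel_def)
  define R where "R f x = wo_rel.minim lam (H - f ` {y. y \<lhd> x})" for f :: "'a \<Rightarrow> 'l" and x
  have "\<exists>h. \<forall>x. h x = R h x"
  proof (rule dependent_wf_choice[OF wf_lt, where P = "\<lambda>f x y. y = R f x"])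
    fix f g :: "'a \<Rightarrow> 'l" and x y assume "\<And>z. (z, x) \<in> {(x, y). x \<lhd> y} \<Longrightarrow> f z = g z"
    then have "f ` {y. y \<lhd> x} = g ` {y. y \<lhd> x}" by (intro image_cong) auto
    then show "(y = R f x) = (y = R g x)" by (simp add: R_def)
  qed simp
  then obtain h where h: "\<And>x. h x = R h x" by blast
  have ne: "H - h ` {y. y \<lhd> x} \<noteq> {}" for x
    using H(2) small_mono[of H "h ` {y. y \<lhd> x}"] small_image[OF small_seg[of x]] by blast
  have sub: "H - h ` {y. y \<lhd> x} \<subseteq> Field lam" for x using H(1) by blast
  have mem: "h x \<in> H - h ` {y. y \<lhd> x}" for x
    by (subst h) (simp only: R_def wo_rel.minim_in[OF wo sub ne])
  have "(h x, h y) \<in> lam" if "x \<lhd> y" for x y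
  proof -
    have "h y \<in> H - h ` {z. z \<lhd> x}" using mem[of y] lt_trans that by blast
    then show ?thesis
      by (subst (1) h) (simp only: R_def wo_rel.minim_least[OF wo sub])
  qed
  moreover have "h x \<noteq> h y" if "x \<lhd> y" for x y using mem[of y] that by (metis DiffD2 imageI mem_Collect_eq)
  ultimately show ?thesis using mem by (intro exI[of _ h]) blast
qed

text \<open>The copies of \<open>I\<close> lie strictly inside their blocks, so the end points
  \<open>lo j\<close> and \<open>hi j\<close> remain free as tuple entries that are below,
  respectively above, every element of the copy.\<close>

lemma blocks_exist:
  assumes "small (I :: 'i set)"
  shows "\<exists>(lo :: nat \<Rightarrow> 'a) hi f. \<forall>j. inj_on (f j) I \<and> hi j \<lhd> lo (Suc j) \<and> lo j \<lhd> hi j \<and>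
     (\<forall>i\<in>I. lo j \<lhd> f j i \<and> f j i \<lhd> hi j)"
proof -
  have "\<exists>f hi. inj_on f I \<and> lo \<lhd> hi \<and> (\<forall>i\<in>I. lo \<lhd> f i \<and> f i \<lhd> hi)" for lo :: 'a
  proof -
    have "UNIV - {y. y \<unlhd> lo} \<union> {y. y \<unlhd> lo} = UNIV" by auto
    then have "\<not> small (UNIV - {y. y \<unlhd> lo})"
      using small_Un[OF _ seg_le[of lo], of "UNIV - {y. y \<unlhd> lo}"] small_iff[of "UNIV :: 'a set"] ordLess_irreflexive
      by metis
    then have "r \<le>o |UNIV - {y. y \<unlhd> lo}|"
      using not_ordLess_iff_ordLeq[OF wo(1) card_of_Well_order] by blast
    then have "|I| \<le>o |UNIV - {y. y \<unlhd> lo}|"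
      using assms ordLess_imp_ordLeq ordLeq_transitive by blast
    then obtain f where f: "inj_on f I" "f ` I \<subseteq> UNIV - {y. y \<unlhd> lo}" by (meson card_of_ordLeq)
    have "small ({lo} \<union> f ` I)" by (intro small_Un small_finite small_image assms) simp
    then obtain hi where "\<forall>x\<in>{lo} \<union> f ` I. x \<lhd> hi" using small_bounded by blast
    then show ?thesis using f by (intro exI[of _ f] exI[of _ hi]) auto
  qed
  then obtain f hi where fh: "\<And>lo :: 'a. inj_on (f lo) I \<and> lo \<lhd> hi lo \<and> (\<forall>i\<in>I. lo \<lhd> f lo i \<and> f lo i \<lhd> hi lo)"
    by metis
  define lo where "lo j = ((\<lambda>x. sc (hi x)) ^^ j) base_point" for j
  have "lo (Suc j) = sc (hi (lo j))" for j by (simp add: lo_def)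
  then show ?thesis using fh sc_gt
    by (intro exI[of _ lo] exI[of _ "\<lambda>j. hi (lo j)"] exI[of _ "\<lambda>j. f (lo j)"]) simp
qed

lemma power_cexp:
  assumes "r =o \<kappa>"
  shows "|UNIV :: 'a set set| =o ctwo ^c \<kappa>"
proof -
  have "|UNIV :: 'a set| =o |Field \<kappa>|" using card_of_cong[OF assms] by (simp add: Field_r)
  then obtain g :: "'a \<Rightarrow> 'b" where g: "bij_betw g UNIV (Field \<kappa>)" using card_of_ordIso by blast
  have "|Pow (UNIV :: 'a set)| =o |Pow (Field \<kappa>)|" using bij_betw_Pow[OF g] card_of_ordIso by blast
  also have "|Pow (Field \<kappa>)| =o ctwo ^c \<kappa>"
    unfolding cexp_def ctwo_def Field_card_of by (rule card_of_Pow_Func)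
  finally show ?thesis by simp
qed

text \<open>A set of \<open>2 d\<close> ordinals is coloured by what can be said about the pairs of
  \<open>d\<close>-tuples drawn from it: which positions of which tuples carry the same row, and
  what the types are. As there are finitely many ways to draw tuples, this is a subset of a set of
  size \<kappa>, whence the \<open>2^\<kappa>\<close> colours. On a homogeneous set the coincidence
  of rows depends only on the configuration of the pair; to see that it depends only on the
  agreement set, both tuples are compared with a third one.\<close>

lemma homogeneous_arrow:
  fixes lam :: "'l rel" and \<kappa> :: "'k rel" and w :: "(nat \<Rightarrow> 'l) \<Rightarrow> 'a \<Rightarrow> 'l" and Ty :: "(nat \<Rightarrow> 'l) \<Rightarrow> 'o"
  assumes lam: "Card_order lam" and \<kappa>: "r =o \<kappa>" and arr: "arrows lam \<kappa> (2 * d) (ctwo ^c \<kappa>)"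
    and N0: "small N0"
    and inj: "\<And>\<alpha>. \<alpha> \<in> index_tuples d (Field lam - N0) \<Longrightarrow> inj (w \<alpha>)"
    and Ty: "|Ty ` index_tuples d (Field lam - N0)| \<le>o |UNIV :: 'a set set|"
  shows "\<exists>ty \<F>. (\<forall>e E E'. E \<in> \<F> e \<longrightarrow> E \<subseteq> E' \<longrightarrow> E' \<subseteq> {..<d} \<longrightarrow> E' \<in> \<F> e) \<and>
     (\<forall>I :: 'i set. small I \<longrightarrow> (\<exists>h. homogeneous_supports d (Field lam - N0) w Ty ty \<F> I h))"
proof -
  let ?A = "Field lam - N0"
  have Well: "Well_order lam" using lam by (simp add: card_order_on_well_order_on)
  define lx where "lx x y \<longleftrightarrow> (x, y) \<in> lam \<and> x \<noteq> y" for x y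
  have lx_trans: "lx x y \<Longrightarrow> lx y z \<Longrightarrow> lx x z" and lx_irrefl: "\<not> lx x x" and lx_asym: "lx x y \<Longrightarrow> \<not> lx y x" for x y z
    using Well unfolding lx_def well_order_on_def linear_order_on_def partial_order_on_def preorder_on_def
    by (metis antisymD transD)+
  have lx_total: "lx x y \<or> lx y x" if "x \<in> Field lam" "y \<in> Field lam" "x \<noteq> y" for x y
    using Well that unfolding lx_def well_order_on_def linear_order_on_def total_on_def by blast
  define rk where "rk s x = card {y \<in> s. lx y x}" for s x
  define \<gamma> where "\<gamma> s k = inv_into s (rk s) k" for s k
  have \<gamma>_rk: "\<gamma> s (rk s x) = x" if s: "finite s" "s \<subseteq> Field lam" "x \<in> s" for s x
  proof -
    have "rk s y < rk s z" if "y \<in> s" "z \<in> s" "lx y z" for y z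
      unfolding rk_def
    proof (rule psubset_card_mono)
      show "{x \<in> s. lx x y} \<subset> {x \<in> s. lx x z}" using that lx_trans lx_irrefl by blast
    qed (use s in auto)
    then have "inj_on (rk s) s"
      using lx_total s(2) by (intro inj_onI) (metis less_irrefl subsetD)
    then show ?thesis using s(3) by (simp add: \<gamma>_def)
  qed
  define At where "At = {..<d} \<rightarrow>\<^sub>E {..<2 * d}"
  define tp where "tp s a = (\<lambda>j\<in>{..<d}. \<gamma> s (a j))" for s and a :: "nat \<Rightarrow> nat"
  obtain enc :: "'o \<Rightarrow> 'a set" where enc: "inj_on enc (Ty ` index_tuples d ?A)"
    using Ty by (meson card_of_ordLeq)
  define col where "col s = Inl ` {(a, a', e, e'). a \<in> At \<and> a' \<in> At \<and> w (tp s a) e = w (tp s a') e'} \<union>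
      Inr ` {(a, x). a \<in> At \<and> x \<in> enc (Ty (tp s a))}" for s
  let ?B = "(At \<times> At \<times> (UNIV :: 'a set) \<times> (UNIV :: 'a set)) <+> (At \<times> (UNIV :: 'a set))"
  have colB: "col s \<in> Pow ?B" for s unfolding col_def by auto
  have "finite At" unfolding At_def by (intro finite_PiE) auto
  then have At: "|At| \<le>o |UNIV :: 'a set|" by (intro small_imp_le small_finite)
  have U: "|UNIV :: 'a set| \<le>o |UNIV :: 'a set|" by (rule card_of_mono1) simp
  have "|?B| \<le>o |UNIV :: 'a set|"
    unfolding Plus_def
    by (intro card_Un_bound infinite_UNIV ordLeq_transitive[OF card_of_image] power_Times At U)
  then have "|Pow ?B| \<le>o |UNIV :: 'a set set|" by (rule power_mono)
  also have "|UNIV :: 'a set set| =o ctwo ^c \<kappa>" by (rule power_cexp[OF \<kappa>])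
  finally have "|Pow ?B| \<le>o |Field (ctwo ^c \<kappa>)|"
    using card_of_Field_ordIso[OF Card_order_cexp] ordIso_symmetric ordLeq_ordIso_trans by blast
  then obtain en where en: "inj_on en (Pow ?B)" "en ` Pow ?B \<subseteq> Field (ctwo ^c \<kappa>)" by (meson card_of_ordLeq)
  have "(\<lambda>s. en (col s)) \<in> [Field lam]\<^bsup>(2 * d)\<^esup> \<rightarrow> Field (ctwo ^c \<kappa>)" using en colB by blast
  with arr have "\<exists>H\<subseteq>Field lam. |H| =o \<kappa> \<and>
      (\<exists>i\<in>Field (ctwo ^c \<kappa>). \<forall>s\<in>[H]\<^bsup>(2 * d)\<^esup>. (\<lambda>s. en (col s)) s = i)"
    unfolding arrows_def by (rule bspec)
  then obtain H i where H: "H \<subseteq> Field lam" "|H| =o \<kappa>" and hom: "\<forall>s \<in> [H]\<^bsup>(2 * d)\<^esup>. en (col s) = i"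
    by auto
  have col: "col s = col s'" if "s \<in> [H]\<^bsup>(2 * d)\<^esup>" "s' \<in> [H]\<^bsup>(2 * d)\<^esup>" for s s'
    by (rule inj_onD[OF en(1) _ colB colB]) (simp add: hom[rule_format, OF that(1)] hom[rule_format, OF that(2)])
  have nH: "\<not> small (H - N0)"
  proof
    assume "small (H - N0)"
    then have "small H" using small_mono[OF _ small_Un[OF _ N0]] by blast
    moreover have "r =o |H|" using H(2) \<kappa> by (meson ordIso_symmetric ordIso_transitive)
    ultimately show False using not_ordLess_ordIso ordIso_symmetric by blast
  qed
  obtain h :: "'a \<Rightarrow> 'l" where h: "range h \<subseteq> H - N0" and hl: "\<And>x y. x \<lhd> y \<Longrightarrow> lx (h x) (h y)"
    using increasing_embedding[OF Well _ nH] H(1) unfolding lx_def by blast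
  have h_iff: "lx (h x) (h y) \<longleftrightarrow> x \<lhd> y" for x y
    using hl lt_total lx_asym lx_irrefl by metis
  have h_inj: "inj h" using hl lt_total lx_irrefl unfolding inj_def by metis
  define ht where "ht \<alpha> = tuple d (\<lambda>_. h) \<alpha>" for \<alpha>
  define ar where "ar \<alpha> \<alpha>' b = (\<lambda>j\<in>{..<d}. pair_rank d \<alpha> \<alpha>' (pair_entry \<alpha> \<alpha>' (j, b)))" for \<alpha> \<alpha>' b
  have pos: "\<exists>s \<in> [H]\<^bsup>(2 * d)\<^esup>. tp s (ar \<alpha> \<alpha>' False) = ht \<alpha> \<and> tp s (ar \<alpha> \<alpha>' True) = ht \<alpha>' \<and>
      ar \<alpha> \<alpha>' False \<in> At \<and> ar \<alpha> \<alpha>' True \<in> At" for \<alpha> \<alpha>'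
  proof -
    define S where "S = pair_entry \<alpha> \<alpha>' ` ({..<d} \<times> UNIV)"
    have fS: "finite S" by (simp add: S_def)
    have cS: "card S \<le> 2 * d"
      using card_image_le[of "{..<d} \<times> (UNIV :: bool set)" "pair_entry \<alpha> \<alpha>'"] by (simp add: card_cartesian_product S_def)
    obtain \<eta> where \<eta>: "\<forall>x\<in>S. x \<lhd> \<eta>" using small_bounded[OF small_finite[OF fS]] by blast
    \<comment> \<open>If entries of the two tuples coincide, there are fewer than \<open>2 d\<close>
      of them. Larger elements make up the number without changing the ranks.\<close>
    define Q where "Q = (\<lambda>k. (sc ^^ k) \<eta>) ` {..<2 * d - card S}"
    have P: "x \<lhd> y" if "x \<in> S" "y \<in> Q" for x y
      using \<eta> that sc_pow_ge[of \<eta>] O.less_le_trans unfolding Q_def by blast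
    have cP: "card Q = 2 * d - card S"
    proof -
      have "inj_on (\<lambda>k. (sc ^^ k) \<eta>) {..<2 * d - card S}"
        by (intro inj_onI) (metis sc_pow_less_iff irrefl linorder_neqE_nat)
      then show ?thesis by (simp add: card_image Q_def)
    qed
    have "finite Q" by (simp add: Q_def)
    have "S \<inter> Q = {}" using P irrefl by blast
    then have "card (S \<union> Q) = 2 * d" using cS cP fS \<open>finite Q\<close> by (simp add: card_Un_disjoint)
    let ?s = "h ` (S \<union> Q)"
    have cs: "card ?s = 2 * d" using \<open>card (S \<union> Q) = 2 * d\<close> h_inj by (metis card_image inj_on_subset subset_UNIV)
    have s: "finite ?s" "?s \<subseteq> Field lam" using h H(1) fS \<open>finite Q\<close> by auto
    have sH: "?s \<in> [H]\<^bsup>(2 * d)\<^esup>" using cs s h by (auto simp: nsets_def)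
    have rk: "rk ?s (h x) = pair_rank d \<alpha> \<alpha>' x" if "x \<in> S" for x
    proof -
      have "{y \<in> h ` T. lx y (h x)} = h ` {y \<in> T. y \<lhd> x}" for T using h_iff by auto
      moreover have "{y \<in> S \<union> Q. y \<lhd> x} = {y \<in> S. y \<lhd> x}"
      proof -
        have "\<not> y \<lhd> x" if "y \<in> Q" for y using P[OF \<open>x \<in> S\<close> that] O.less_asym by blast
        then show ?thesis by blast
      qed
      ultimately have "{y \<in> ?s. lx y (h x)} = h ` {y \<in> S. y \<lhd> x}" by simp
      then show ?thesis unfolding rk_def pair_rank_def S_def[symmetric] using h_inj by (metis card_image inj_on_subset subset_UNIV)
    qed
    have rk2: "pair_rank d \<alpha> \<alpha>' x < 2 * d" if "x \<in> S" for x
    proof -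
      have "h x \<in> ?s" using that by blast
      then have "{y \<in> ?s. lx y (h x)} \<subset> ?s" using lx_irrefl by (intro psubsetI) auto
      then have "rk ?s (h x) < card ?s" unfolding rk_def using s(1) by (rule psubset_card_mono[rotated])
      then show ?thesis using rk[OF that] cs by simp
    qed
    have e: "pair_entry \<alpha> \<alpha>' (j, b) \<in> S" if "j < d" for j b using that by (auto simp: S_def)
    have A: "ar \<alpha> \<alpha>' b \<in> At" for b unfolding ar_def At_def using rk2[OF e] by auto
    have "tp ?s (ar \<alpha> \<alpha>' b) = ht (\<lambda>j. pair_entry \<alpha> \<alpha>' (j, b))" for b
      unfolding tp_def ht_def tuple_def
    proof (rule restrict_ext)
      fix j assume "j \<in> {..<d}"
      then have j: "j < d" by simp
      have m: "h (pair_entry \<alpha> \<alpha>' (j, b)) \<in> ?s" using e[OF j] by blast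
      show "\<gamma> ?s (ar \<alpha> \<alpha>' b j) = h (pair_entry \<alpha> \<alpha>' (j, b))"
        using \<gamma>_rk[OF s m] unfolding rk[OF e[OF j]] using j by (simp add: ar_def)
    qed
    from this[of True] this[of False] show ?thesis using A sH by (intro bexI[of _ ?s]) (auto simp: pair_entry_def)
  qed
  have key: "(w (ht \<alpha>) e = w (ht \<alpha>') e' \<longleftrightarrow> w (ht \<beta>) e = w (ht \<beta>') e')"
      "x \<in> enc (Ty (ht \<alpha>)) \<longleftrightarrow> x \<in> enc (Ty (ht \<beta>))"
    if bp: "block_pair d \<alpha> \<alpha>'" "block_pair d \<beta> \<beta>'" "same_config d \<alpha> \<alpha>' \<beta> \<beta>'" for \<alpha> \<alpha>' \<beta> \<beta>' e e' x
  proof -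
    have ar: "ar \<alpha> \<alpha>' b = ar \<beta> \<beta>' b" for b
      unfolding ar_def using pair_rank_eq[OF bp] by (intro restrict_ext) auto
    obtain s where s: "s \<in> [H]\<^bsup>(2 * d)\<^esup>" "tp s (ar \<alpha> \<alpha>' False) = ht \<alpha>" "tp s (ar \<alpha> \<alpha>' True) = ht \<alpha>'"
      "ar \<alpha> \<alpha>' False \<in> At" "ar \<alpha> \<alpha>' True \<in> At" using pos by blast
    obtain s' where s': "s' \<in> [H]\<^bsup>(2 * d)\<^esup>" "tp s' (ar \<beta> \<beta>' False) = ht \<beta>" "tp s' (ar \<beta> \<beta>' True) = ht \<beta>'"
      using pos by blast
    have c: "col s = col s'" using col s(1) s'(1) by blast
    have "w (ht \<alpha>) e = w (ht \<alpha>') e' \<longleftrightarrow> Inl (ar \<alpha> \<alpha>' False, ar \<alpha> \<alpha>' True, e, e') \<in> col s"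
      using s by (auto simp: col_def)
    also have "\<dots> \<longleftrightarrow> w (ht \<beta>) e = w (ht \<beta>') e'" unfolding c using s s' by (auto simp: col_def ar)
    finally show "w (ht \<alpha>) e = w (ht \<alpha>') e' \<longleftrightarrow> w (ht \<beta>) e = w (ht \<beta>') e'" .
    have "x \<in> enc (Ty (ht \<alpha>)) \<longleftrightarrow> Inr (ar \<alpha> \<alpha>' False, x) \<in> col s" using s by (auto simp: col_def)
    also have "\<dots> \<longleftrightarrow> x \<in> enc (Ty (ht \<beta>))" unfolding c using s s' by (auto simp: col_def ar)
    finally show "x \<in> enc (Ty (ht \<alpha>)) \<longleftrightarrow> x \<in> enc (Ty (ht \<beta>))" .
  qed
  have htT: "ht \<alpha> \<in> index_tuples d ?A" if "block_pair d \<alpha> \<alpha>'" for \<alpha> \<alpha>'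
  proof -
    have "inj_on \<alpha> {..<d}"
      using that irrefl unfolding block_pair_def by (intro inj_onI) (metis lessThan_iff linorder_neqE_nat)
    moreover have "h x \<in> Field lam \<and> h x \<notin> N0" for x using h H(1) by blast
    ultimately show ?thesis using h_inj
      by (auto simp: index_tuples_def ht_def tuple_def inj_on_def)
  qed
  \<comment> \<open>Any block pair may serve as witness, and the agreement sets are closed upwards
    by definition. That all pairs with such an agreement set do share the row is the second half of
    the equivalence shown below.\<close>
  define \<F> where "\<F> e = {E. E \<subseteq> {..<d} \<and> (\<exists>\<alpha> \<alpha>'. block_pair d \<alpha> \<alpha>' \<and> agree d \<alpha> \<alpha>' \<subseteq> E \<and> w (ht \<alpha>) e = w (ht \<alpha>') e)}" for e
  define ty where "ty = Ty (ht (\<lambda>j. (sc ^^ j) base_point))"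
  have tyc: "Ty (ht \<alpha>) = ty" if bp: "block_pair d \<alpha> \<alpha>'" for \<alpha> \<alpha>'
  proof -
    let ?\<beta> = "\<lambda>j. (sc ^^ j) base_point"
    have b1: "block_pair d \<alpha> \<alpha>" using bp unfolding block_pair_def by blast
    have b2: "block_pair d ?\<beta> ?\<beta>" unfolding block_pair_def by (simp add: sc_pow_less_iff)
    have "same_config d \<alpha> \<alpha> ?\<beta> ?\<beta>" using irrefl unfolding same_config_def by blast
    from key(2)[OF b1 b2 this] have "enc (Ty (ht \<alpha>)) = enc (Ty (ht ?\<beta>))" by blast
    then show ?thesis using enc htT[OF b1] htT[OF b2] unfolding ty_def by (meson imageI inj_onD)
  qed
  have "\<exists>h'. homogeneous_supports d ?A w Ty ty \<F> I h'" if I: "small I" for I :: "'i set"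
  proof -
    obtain lo hi :: "nat \<Rightarrow> 'a" and f where f: "\<And>j. inj_on (f j) I" and lohi: "\<And>j. hi j \<lhd> lo (Suc j)" "\<And>j. lo j \<lhd> hi j"
      and fl: "\<And>i j. i \<in> I \<Longrightarrow> lo j \<lhd> f j i \<and> f j i \<lhd> hi j" using blocks_exist[OF I] by metis
    have hilo: "hi j \<lhd> lo j'" if "j < j'" for j j'
      using that
    proof (induction j')
      case (Suc j')
      then show ?case using lohi lt_trans by (cases "j = j'") (auto, meson)
    qed simp
    define slot where "slot \<alpha> \<longleftrightarrow> (\<forall>j<d. lo j \<unlhd> \<alpha> j \<and> \<alpha> j \<unlhd> hi j)" for \<alpha>
    have slot_bp: "block_pair d \<alpha> \<alpha>'" if "slot \<alpha>" "slot \<alpha>'" for \<alpha> \<alpha>'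
      unfolding block_pair_def
    proof (intro allI impI)
      fix j j' assume j: "j < j'" "j' < d"
      then have "j < d" by simp
      then have "\<alpha> j \<unlhd> hi j" "\<alpha>' j \<unlhd> hi j" "lo j' \<unlhd> \<alpha> j'" "lo j' \<unlhd> \<alpha>' j'"
        using that j unfolding slot_def by blast+
      then show "\<alpha> j \<lhd> \<alpha> j' \<and> \<alpha> j \<lhd> \<alpha>' j' \<and> \<alpha>' j \<lhd> \<alpha> j' \<and> \<alpha>' j \<lhd> \<alpha>' j'"
        using hilo[OF j(1)] O.le_less_trans O.less_le_trans by blast
    qed
    define fu where "fu u = (\<lambda>j. f j (u j))" for u :: "nat \<Rightarrow> 'i"
    have tfu: "tuple d (\<lambda>j i. h (f j i)) u = ht (fu u)" for u by (auto simp: tuple_def ht_def fu_def)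
    have fus: "slot (fu u)" if "u \<in> {..<d} \<rightarrow>\<^sub>E I" for u
      using fl that unfolding slot_def fu_def le_def by (auto simp: PiE_iff)
    \<comment> \<open>\<open>u\<close> and \<open>u'\<close> are compared through \<open>\<beta>''\<close>, which is in the position of \<open>(\<alpha>, \<alpha>')\<close> with both.\<close>
    have third: "\<exists>\<beta>''. slot \<beta>'' \<and> same_config d \<alpha> \<alpha>' (fu u) \<beta>'' \<and> same_config d \<alpha> \<alpha>' (fu u') \<beta>''"
      if u: "u \<in> {..<d} \<rightarrow>\<^sub>E I" "u' \<in> {..<d} \<rightarrow>\<^sub>E I" and ag: "agree d \<alpha> \<alpha>' \<subseteq> agree d (fu u) (fu u')" for \<alpha> \<alpha>' u u'
    proof -
      \<comment> \<open>Where \<open>\<alpha>\<close> and \<open>\<alpha>'\<close> differ, the end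
        point of the block on the side of \<open>\<alpha>'\<close> lies on that side of both
        \<open>fu u\<close> and \<open>fu u'\<close>. Where they agree, so do \<open>fu u\<close>
        and \<open>fu u'\<close>, and the common value is taken.\<close>
      let ?\<beta> = "\<lambda>j. if \<alpha> j \<lhd> \<alpha>' j then hi j else if \<alpha>' j \<lhd> \<alpha> j then lo j else fu u j"
      have "slot ?\<beta>" using fus[OF u(1)] lohi(2) unfolding slot_def le_def by auto
      moreover have "same_config d \<alpha> \<alpha>' (fu v) ?\<beta>" if v: "v \<in> {u, u'}" for v
        unfolding same_config_def
      proof (intro allI impI)
        fix j assume j: "j < d"
        have vI: "v j \<in> I" using v u j by (auto simp: PiE_iff)
        then have "lo j \<lhd> fu v j" "fu v j \<lhd> hi j" using fl by (auto simp: fu_def)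
        moreover have "fu v j = fu u j" if "\<not> \<alpha> j \<lhd> \<alpha>' j" "\<not> \<alpha>' j \<lhd> \<alpha> j"
        proof -
          have "\<alpha> j = \<alpha>' j" using lt_total that by blast
          then show ?thesis using ag j v by (auto simp: agree_def)
        qed
        ultimately show "(\<alpha> j \<lhd> \<alpha>' j \<longleftrightarrow> fu v j \<lhd> ?\<beta> j) \<and> (\<alpha>' j \<lhd> \<alpha> j \<longleftrightarrow> ?\<beta> j \<lhd> fu v j)"
          using irrefl O.less_asym by (smt (verit))
      qed
      ultimately show ?thesis by blast
    qed
    have fu_eq: "fu u j = fu u' j \<longleftrightarrow> u j = u' j"
      if "u \<in> {..<d} \<rightarrow>\<^sub>E I" "u' \<in> {..<d} \<rightarrow>\<^sub>E I" "j < d" for u u' j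
      using f[of j] that unfolding fu_def inj_on_def by (auto simp: PiE_iff)
    have agf: "agree d (fu u) (fu u') = agree d u u'"
      if "u \<in> {..<d} \<rightarrow>\<^sub>E I" "u' \<in> {..<d} \<rightarrow>\<^sub>E I" for u u'
      using fu_eq[OF that] unfolding agree_def by blast
    have "homogeneous_supports d ?A w Ty ty \<F> I (\<lambda>j i. h (f j i))"
      unfolding homogeneous_supports_def tfu
    proof (intro conjI ballI allI impI)
      fix u assume u: "u \<in> {..<d} \<rightarrow>\<^sub>E I"
      show "ht (fu u) \<in> index_tuples d ?A" "Ty (ht (fu u)) = ty"
        using htT tyc slot_bp[OF fus[OF u] fus[OF u]] by blast+
    next
      fix j j' i i' assume j: "j < d" "j' < d" and i: "i \<in> I" "i' \<in> I" and eq: "h (f j i) = h (f j' i')"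
      have ff: "f j i = f j' i'" using eq h_inj by (auto simp: inj_def)
      have lt: "f k x \<lhd> f k' x'" if "k < k'" "x \<in> I" "x' \<in> I" for k k' x x'
        using fl that hilo lt_trans by meson
      show "j = j'" using lt[of j j' i i'] lt[of j' j i' i] ff i irrefl by (metis linorder_neqE_nat)
      then show "i = i'" using ff f i by (auto simp: inj_on_def)
    next
      fix u u' e e' assume u: "u \<in> {..<d} \<rightarrow>\<^sub>E I" "u' \<in> {..<d} \<rightarrow>\<^sub>E I"
      note s = fus[OF u(1)] fus[OF u(2)]
      show "w (ht (fu u)) e = w (ht (fu u')) e' \<longleftrightarrow> e = e' \<and> agree d u u' \<in> \<F> e"
      proof
        assume eq: "w (ht (fu u)) e = w (ht (fu u')) e'"
        \<comment> \<open>The pair of \<open>fu u\<close> and \<open>fu u'\<close> is itself the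
          pattern: \<open>\<beta>\<close> is situated to both of them as \<open>fu u'\<close> is to
          \<open>fu u\<close>. So the row of \<open>\<beta>\<close> at \<open>e'\<close> is the row
          at \<open>e\<close> of both, and injectivity of the enumeration gives
          \<open>e = e'\<close>.\<close>
        obtain \<beta> where \<beta>: "slot \<beta>" "same_config d (fu u) (fu u') (fu u) \<beta>" "same_config d (fu u) (fu u') (fu u') \<beta>"
          using third[OF u subset_refl] by blast
        have "w (ht (fu u)) e = w (ht \<beta>) e'" "w (ht (fu u')) e = w (ht \<beta>) e'"
          using eq key(1)[OF slot_bp slot_bp \<beta>(2), of e e'] key(1)[OF slot_bp slot_bp \<beta>(3), of e e'] s \<beta>(1) by blast+
        then have "w (ht (fu u')) e = w (ht (fu u')) e'" using eq by simp
        then have ee: "e = e'" using inj[OF htT[OF slot_bp[OF s(2,2)]]] by (auto simp: inj_def)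
        have "agree d u u' \<in> \<F> e" unfolding \<F>_def
          using slot_bp[OF s] eq ee agf[OF u] by (auto simp: agree_def)
        with ee show "e = e' \<and> agree d u u' \<in> \<F> e" by blast
      next
        assume a: "e = e' \<and> agree d u u' \<in> \<F> e"
        then obtain \<alpha> \<alpha>' where \<alpha>: "block_pair d \<alpha> \<alpha>'" "agree d \<alpha> \<alpha>' \<subseteq> agree d u u'" "w (ht \<alpha>) e = w (ht \<alpha>') e"
          unfolding \<F>_def by blast
        then obtain \<beta> where \<beta>: "slot \<beta>" "same_config d \<alpha> \<alpha>' (fu u) \<beta>" "same_config d \<alpha> \<alpha>' (fu u') \<beta>"
          using third[OF u, of \<alpha> \<alpha>'] agf[OF u] by auto
        have "w (ht (fu u)) e = w (ht \<beta>) e" "w (ht (fu u')) e = w (ht \<beta>) e"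
          using \<alpha>(3) key(1)[OF \<alpha>(1) slot_bp \<beta>(2), of e e] key(1)[OF \<alpha>(1) slot_bp \<beta>(3), of e e] s \<beta>(1) by blast+
        then show "w (ht (fu u)) e = w (ht (fu u')) e'" using a by simp
      qed
    qed
    then show ?thesis by blast
  qed
  moreover have "\<forall>e E E'. E \<in> \<F> e \<longrightarrow> E \<subseteq> E' \<longrightarrow> E' \<subseteq> {..<d} \<longrightarrow> E' \<in> \<F> e"
    unfolding \<F>_def by blast
  ultimately show ?thesis by blast
qed

end

section \<open>The tail cone theorem\<close>

definition merge :: "('x \<rightharpoonup> bool) set \<Rightarrow> ('x \<rightharpoonup> bool)" where
  "merge A = (\<lambda>x. if \<exists>f\<in>A. f x \<noteq> None then (SOME f. f \<in> A \<and> f x \<noteq> None) x else None)"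

definition compatible :: "('x \<rightharpoonup> bool) set \<Rightarrow> bool" where
  "compatible A \<longleftrightarrow> (\<forall>f\<in>A. \<forall>g\<in>A. \<forall>x v v'. f x = Some v \<longrightarrow> g x = Some v' \<longrightarrow> v = v')"

lemma mergeD: "merge A x = Some v \<Longrightarrow> \<exists>f\<in>A. f x = Some v"
proof -
  assume a: "merge A x = Some v"
  then have ex: "\<exists>f. f \<in> A \<and> f x \<noteq> None" by (auto simp: merge_def split: if_splits)
  then have "(SOME f. f \<in> A \<and> f x \<noteq> None) \<in> A" using someI_ex[OF ex] by blast
  then show ?thesis using a ex by (auto simp: merge_def split: if_splits)
qed

lemma merge_upper: "compatible A \<Longrightarrow> f \<in> A \<Longrightarrow> f \<subseteq>\<^sub>m merge A"
proof (unfold map_le_def, intro ballI)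
  fix x assume c: "compatible A" and f: "f \<in> A" "x \<in> dom f"
  then have ex: "\<exists>f. f \<in> A \<and> f x \<noteq> None" by auto
  let ?g = "SOME f. f \<in> A \<and> f x \<noteq> None"
  have g: "?g \<in> A" "?g x \<noteq> None" using someI_ex[OF ex] by auto
  then obtain v v' where v: "f x = Some v" "?g x = Some v'" using f(2) by auto
  then have "v = v'" using c f(1) g(1) unfolding compatible_def by blast
  moreover have "merge A x = ?g x" using ex by (auto simp: merge_def)
  ultimately show "f x = merge A x" using v by simp
qed

lemma dom_merge: "dom (merge A) \<subseteq> \<Union> (dom ` A)"
  using mergeD by (fastforce simp: dom_def)

text \<open>\<open>push\<close> and \<open>pull\<close> translate between conditions on abstract
  rows, i.e. positions in an enumeration \<open>w\<close> of a support, and conditions on the rows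
  themselves. Abstract conditions make different tuples of indices comparable.\<close>

definition push :: "('a \<Rightarrow> 'l) \<Rightarrow> ('a \<times> 'b \<rightharpoonup> bool) \<Rightarrow> ('l \<times> 'b \<rightharpoonup> bool)" where
  "push w Q = (\<lambda>(l, z). if l \<in> range w then Q (inv w l, z) else None)"

definition pull :: "('a \<Rightarrow> 'l) \<Rightarrow> ('l \<times> 'b \<rightharpoonup> bool) \<Rightarrow> ('a \<times> 'b \<rightharpoonup> bool)" where
  "pull w p = (\<lambda>(e, z). p (w e, z))"

lemma push_apply: "inj w \<Longrightarrow> push w Q (w e, z) = Q (e, z)"
  by (simp add: push_def)

lemma push_SomeD: "inj w \<Longrightarrow> push w Q (l, z) = Some v \<Longrightarrow> \<exists>e. l = w e \<and> Q (e, z) = Some v"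
  by (auto simp: push_def split: if_splits)

lemma push_mono: "Q \<subseteq>\<^sub>m Q' \<Longrightarrow> push w Q \<subseteq>\<^sub>m push w Q'"
  by (auto simp: push_def map_le_def dom_def split: if_splits)

lemma push_pull: "push w (pull w p) = p |` (range w \<times> UNIV)"
proof (rule ext)
  fix x show "push w (pull w p) x = (p |` (range w \<times> UNIV)) x"
    by (cases x, cases "fst x \<in> range w") (simp_all add: push_def pull_def restrict_map_def f_inv_into_f)
qed

lemma dom_push: "inj w \<Longrightarrow> dom (push w Q) \<subseteq> (\<lambda>(e, z). (w e, z)) ` dom Q"
proof
  fix x assume i: "inj w" and x: "x \<in> dom (push w Q)"
  obtain l z v where xl: "x = (l, z)" "push w Q (l, z) = Some v" using x by (cases x) auto
  obtain e where "l = w e" "Q (e, z) = Some v" using push_SomeD[OF i xl(2)] by (elim exE conjE)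
  then have "x = (w e, z)" "(e, z) \<in> dom Q" using xl(1) by auto
  then show "x \<in> (\<lambda>(e, z). (w e, z)) ` dom Q" by (intro image_eqI[of _ _ "(e, z)"]) simp_all
qed

context inacc_wo
begin

text \<open>For \<open>l = s\<close> these are the usual strong subtrees. In general a node of level
  \<open>l \<gamma>\<close> is continued without branching up to \<open>s \<gamma>\<close>, where
  the bit \<open>x \<gamma>\<close> is written; the last clause says that this continuation does not
  depend on what follows. The gap arises because the fusion fills rows beyond the level at which
  colours are realized.\<close>

definition tree_embedding :: "nat \<Rightarrow> ('a \<Rightarrow> 'a) \<Rightarrow> ('a \<Rightarrow> 'a) \<Rightarrow> (nat \<Rightarrow> 'a \<Rightarrow> ('a \<Rightarrow> bool) \<Rightarrow> 'a \<Rightarrow> bool) \<Rightarrow> bool" where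
  "tree_embedding d l s \<phi> \<longleftrightarrow>
     (\<forall>\<gamma>. l \<gamma> \<unlhd> s \<gamma>) \<and> (\<forall>\<gamma> \<gamma>'. \<gamma> \<lhd> \<gamma>' \<longrightarrow> s \<gamma> \<lhd> l \<gamma>') \<and>
     (\<forall>j<d. \<forall>\<gamma>. \<forall>x\<in>node \<gamma>. \<phi> j \<gamma> x \<in> node (l \<gamma>)) \<and>
     (\<forall>j<d. \<forall>\<gamma> \<gamma>'. \<forall>x\<in>node \<gamma>'. \<gamma> \<lhd> \<gamma>' \<longrightarrow> cut (l \<gamma>) (\<phi> j \<gamma>' x) = \<phi> j \<gamma> (cut \<gamma> x) \<and> \<phi> j \<gamma>' x (s \<gamma>) = x \<gamma>) \<and>
     (\<forall>j<d. \<forall>\<gamma> \<gamma>1 \<gamma>2. \<forall>x1\<in>node \<gamma>1. \<forall>x2\<in>node \<gamma>2. \<gamma> \<lhd> \<gamma>1 \<longrightarrow> \<gamma> \<lhd> \<gamma>2 \<longrightarrow> cut \<gamma> x1 = cut \<gamma> x2 \<longrightarrow>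
        cut (s \<gamma>) (\<phi> j \<gamma>1 x1) = cut (s \<gamma>) (\<phi> j \<gamma>2 x2))"

lemma conditions_fill: "p \<in> conditions Lam \<Longrightarrow> small S \<Longrightarrow> S \<subseteq> Lam \<times> UNIV \<Longrightarrow> fill p S \<in> conditions Lam"
  unfolding conditions_def mem_Collect_eq dom_fill using small_Un by (metis Un_least)

lemma conditions_merge:
  "small A \<Longrightarrow> A \<subseteq> conditions Lam \<Longrightarrow> merge A \<in> conditions Lam"
proof -
  assume A: "small A" "A \<subseteq> conditions Lam"
  have "small (\<Union> (dom ` A))" using A by (intro small_UN) (auto simp: conditions_def)
  moreover have "\<Union> (dom ` A) \<subseteq> Lam \<times> UNIV" using A(2) by (auto simp: conditions_def)
  ultimately show ?thesis using dom_merge[of A] small_mono unfolding conditions_def mem_Collect_eq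
    by (meson subset_trans)
qed

lemma conditions_bound: "|Lam| \<le>o |UNIV :: 'a set| \<Longrightarrow> |conditions Lam :: ('l \<times> 'a \<rightharpoonup> bool) set| \<le>o |UNIV :: 'a set|"
proof -
  assume L: "|Lam| \<le>o |UNIV :: 'a set|"
  let ?g = "\<lambda>p :: 'l \<times> 'a \<rightharpoonup> bool. {(x, b). p x = Some b}"
  let ?U = "(Lam \<times> (UNIV :: 'a set)) \<times> (UNIV :: bool set)"
  have U: "|UNIV :: 'a set| \<le>o |UNIV :: 'a set|" by (rule card_of_mono1) simp
  have "|UNIV :: bool set| \<le>o |UNIV :: 'a set|" by (intro small_imp_le small_finite) simp
  then have "|?U| \<le>o |UNIV :: 'a set|" by (intro power_Times L U)
  then have s: "|{B. B \<subseteq> ?U \<and> small B}| \<le>o |UNIV :: 'a set|" by (rule small_subsets_bound)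
  have "inj ?g"
  proof (rule injI, rule ext)
    fix p q :: "'l \<times> 'a \<rightharpoonup> bool" and x assume "?g p = ?g q"
    then have "(x, b) \<in> ?g p \<longleftrightarrow> (x, b) \<in> ?g q" for b by (rule arg_cong)
    then have "p x = Some b \<longleftrightarrow> q x = Some b" for b by (simp add: split_def)
    from this[of True] this[of False] show "p x = q x"
      by (metis (full_types) not_None_eq)
  qed
  moreover have "?g ` conditions Lam \<subseteq> {B. B \<subseteq> ?U \<and> small B}"
  proof safe
    fix p :: "'l \<times> 'a \<rightharpoonup> bool" assume p: "p \<in> conditions Lam"
    then have d: "small (dom p)" "dom p \<subseteq> Lam \<times> UNIV" by (auto simp: conditions_def)
    have "?g p \<subseteq> (\<lambda>x. (x, the (p x))) ` dom p" by force
    then show "small (?g p)" using small_surj[OF d(1)] by blast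
    show "a \<in> Lam" if "p (a, b) = Some c" for a b c using d(2) that by auto
  qed auto
  ultimately have "|conditions Lam :: ('l \<times> 'a \<rightharpoonup> bool) set| \<le>o |{B. B \<subseteq> ?U \<and> small B}|"
    using card_of_ordLeq[of "conditions Lam" "{B. B \<subseteq> ?U \<and> small B}"] inj_on_subset subset_UNIV by blast
  then show ?thesis using s ordLeq_transitive by blast
qed

end

section \<open>Deciding limits, and supports of size \<kappa>\<close>

context branch_limits
begin

definition valid :: "('a \<Rightarrow> (nat \<Rightarrow> 'a \<Rightarrow> bool) \<Rightarrow> 'a) \<Rightarrow> (nat \<Rightarrow> 'l) \<Rightarrow> bool" where
  "valid F \<alpha> \<longleftrightarrow> colouring n F \<and> (\<forall>j<n. \<alpha> j \<in> Lam - N0)"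

text \<open>Both limits would be realized at one common level, where the branches have a single
  colour.\<close>

lemma L_unique:
  assumes "valid F \<alpha>" "p \<in> conditions Lam" "L F \<alpha> c p" "L F \<alpha> c' p"
  shows "c = c'"
proof -
  have "\<exists>q\<in>conditions Lam. \<exists>\<xi>. p \<subseteq>\<^sub>m q \<and> base_point \<lhd> \<xi> \<and>
      (\<forall>(F, \<alpha>, c)\<in>{(F, \<alpha>, c), (F, \<alpha>, c')}. (\<forall>j<n. full q (\<alpha> j) \<xi>) \<and> F \<xi> (\<lambda>j. row q (\<alpha> j) \<xi>) = c)"
    by (rule L_pick) (use assms in \<open>auto simp: valid_def small_finite\<close>)
  then show ?thesis by auto
qed

text \<open>A recursion along \<kappa> decides the limit coded by \<open>a\<close> at stage
  \<open>a\<close>. Initial segments are small, so the union of the earlier conditions is a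
  condition, and a stage \<open>\<mu>\<close> above all codes has decided every limit.\<close>

lemma decide_many:
  fixes X :: "(('a \<Rightarrow> (nat \<Rightarrow> 'a \<Rightarrow> bool) \<Rightarrow> 'a) \<times> (nat \<Rightarrow> 'l)) set"
  assumes X: "small X" "\<And>F \<alpha>. (F, \<alpha>) \<in> X \<Longrightarrow> valid F \<alpha>" and p: "p \<in> conditions Lam"
  shows "\<exists>q\<in>conditions Lam. p \<subseteq>\<^sub>m q \<and> (\<forall>(F, \<alpha>)\<in>X. \<exists>c. L F \<alpha> c q)"
proof -
  obtain g where g: "inj_on g X" "g ` X \<subseteq> (UNIV :: 'a set)" using small_imp_le[OF X(1)] by (meson card_of_ordLeq)
  define P where "P f a q \<longleftrightarrow> q \<in> conditions Lam \<and> p \<subseteq>\<^sub>m q \<and> (\<forall>b. b \<lhd> a \<longrightarrow> f b \<subseteq>\<^sub>m q) \<and>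
     (\<forall>F \<alpha>. (F, \<alpha>) \<in> X \<longrightarrow> g (F, \<alpha>) = a \<longrightarrow> (\<exists>c. L F \<alpha> c q))" for f and a :: 'a and q
  have "\<exists>f. \<forall>a. P f a (f a)"
  proof (rule dependent_wf_choice[OF wf_lt])
    show "P f a q = P f' a q" if "\<And>z. (z, a) \<in> {(x, y). x \<lhd> y} \<Longrightarrow> f z = f' z" for f f' a q
      using that unfolding P_def by auto
    fix a f assume IH: "\<And>b. (b, a) \<in> {(x, y). x \<lhd> y} \<Longrightarrow> P f b (f b)"
    let ?A = "insert p (f ` {b. b \<lhd> a})"
    have cond: "?A \<subseteq> conditions Lam" using IH p unfolding P_def by blast
    have sm: "small ?A"
      using small_Un[OF small_finite[of "{p}"] small_image[OF small_seg[of a], of f]] by simp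
    have le: "f b \<subseteq>\<^sub>m f b'" if "b \<lhd> b'" "b' \<lhd> a" for b b' using IH[of b'] that unfolding P_def by blast
    have pf: "p \<subseteq>\<^sub>m f b" if "b \<lhd> a" for b using IH[of b] that unfolding P_def by blast
    have chain: "f1 \<subseteq>\<^sub>m f2 \<or> f2 \<subseteq>\<^sub>m f1" if mem: "f1 \<in> ?A" "f2 \<in> ?A" for f1 f2
    proof (cases "f1 = p \<or> f2 = p")
      case True
      then show ?thesis using mem pf by (auto simp: map_le_refl)
    next
      case False
      then obtain b1 b2 where b: "f1 = f b1" "f2 = f b2" "b1 \<lhd> a" "b2 \<lhd> a"
        using mem by auto
      then show ?thesis using le[of b1 b2] le[of b2 b1] lt_total[of b1 b2] by (cases "b1 = b2") auto
    qed
    have "compatible ?A" unfolding compatible_def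
    proof (intro ballI allI impI)
      fix f1 f2 x v v' assume "f1 \<in> ?A" "f2 \<in> ?A" "f1 x = Some v" "f2 x = Some v'"
      then show "v = v'" using chain[of f1 f2] unfolding map_le_def by (metis domI option.inject)
    qed
    note up = merge_upper[OF this]
    have m: "merge ?A \<in> conditions Lam" by (rule conditions_merge[OF sm cond])
    have "\<exists>q\<in>conditions Lam. merge ?A \<subseteq>\<^sub>m q \<and> (\<forall>F \<alpha>. (F, \<alpha>) \<in> X \<longrightarrow> g (F, \<alpha>) = a \<longrightarrow> (\<exists>c. L F \<alpha> c q))"
    proof (cases "\<exists>F \<alpha>. (F, \<alpha>) \<in> X \<and> g (F, \<alpha>) = a")
      case True
      then obtain F \<alpha> where F: "(F, \<alpha>) \<in> X" "g (F, \<alpha>) = a" by blast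
      then obtain q where "q \<in> conditions Lam" "merge ?A \<subseteq>\<^sub>m q" "\<exists>c. L F \<alpha> c q"
        using L_decides[of F \<alpha>, OF _ _ m] X(2)[OF F(1)] unfolding valid_def by blast
      then show ?thesis using g(1) F unfolding inj_on_def by blast
    next
      case False
      then show ?thesis using m by (intro bexI[of _ "merge ?A"]) (auto simp: map_le_refl)
    qed
    then obtain q where q: "q \<in> conditions Lam" "merge ?A \<subseteq>\<^sub>m q"
      "\<forall>F \<alpha>. (F, \<alpha>) \<in> X \<longrightarrow> g (F, \<alpha>) = a \<longrightarrow> (\<exists>c. L F \<alpha> c q)" by blast
    have "P f a q" unfolding P_def
    proof (intro conjI allI impI)
      show "p \<subseteq>\<^sub>m q" using map_le_trans[OF up q(2)] by simp
      show "f b \<subseteq>\<^sub>m q" if "b \<lhd> a" for b using map_le_trans[OF up q(2)] that by simp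
    qed (use q in blast)+
    then show "\<exists>q. P f a q" by blast
  qed
  then obtain f where f: "\<And>a. P f a (f a)" by blast
  obtain \<mu> where \<mu>: "\<And>x. x \<in> X \<Longrightarrow> g x \<lhd> \<mu>" using small_bounded_fun[OF X(1), of g] by blast
  have "\<exists>c. L F \<alpha> c (f \<mu>)" if FX: "(F, \<alpha>) \<in> X" for F \<alpha>
  proof -
    obtain c where "L F \<alpha> c (f (g (F, \<alpha>)))" using f[of "g (F, \<alpha>)"] FX unfolding P_def by blast
    moreover have "f (g (F, \<alpha>)) \<subseteq>\<^sub>m f \<mu>" "f \<mu> \<in> conditions Lam" using f[of \<mu>] \<mu>[OF FX] unfolding P_def by blast+
    ultimately show ?thesis using L_open X(2)[OF FX] unfolding valid_def by blast
  qed
  then show ?thesis using f[of \<mu>] unfolding P_def by blast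
qed

definition support :: "('a \<Rightarrow> (nat \<Rightarrow> 'a \<Rightarrow> bool) \<Rightarrow> 'a) set \<Rightarrow> (nat \<Rightarrow> 'l) \<Rightarrow> 'l set \<Rightarrow> bool" where
  "support Y \<alpha> W \<longleftrightarrow> W \<subseteq> Lam \<and> (\<forall>F\<in>Y. \<forall>p\<in>conditions W. \<exists>q\<in>conditions W. \<exists>c. p \<subseteq>\<^sub>m q \<and> L F \<alpha> c q)"

lemma conditions_subset: "W \<subseteq> Lam \<Longrightarrow> conditions W \<subseteq> conditions Lam"
  by (auto simp: conditions_def)

text \<open>Any extension \<open>q\<close> of the restriction can be continued by a deciding
  condition \<open>q2\<close> on the rows \<open>W\<close>. Since \<open>q2\<close> lives on
  \<open>W\<close> and extends the restriction of \<open>p\<close>, it is compatible with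
  \<open>p\<close> as well as with \<open>q\<close>; the former shows that it decides the same
  colour as \<open>p\<close>, the latter that this colour is decided densely below the
  restriction.\<close>

lemma support_restrict:
  assumes W: "support Y \<alpha> W" and F: "F \<in> Y" "valid F \<alpha>" and p: "p \<in> conditions Lam" "L F \<alpha> c p"
  shows "L F \<alpha> c (p |` (W \<times> UNIV))"
proof (rule L_dense)
  show "colouring n F" "\<forall>j<n. \<alpha> j \<in> Lam - N0" using F(2) by (auto simp: valid_def)
  have res: "s |` (W \<times> UNIV) \<in> conditions W" if "s \<in> conditions Lam" for s
  proof -
    have "dom (s |` (W \<times> UNIV)) \<subseteq> dom s" by auto
    then have "small (dom (s |` (W \<times> UNIV)))" by (rule small_mono) (use that in \<open>simp add: conditions_def\<close>)
    then show ?thesis unfolding conditions_def by auto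
  qed
  have WL: "W \<subseteq> Lam" using W by (simp add: support_def)
  show "p |` (W \<times> UNIV) \<in> conditions Lam" using res[OF p(1)] conditions_subset[OF WL] by blast
  fix q assume q: "q \<in> conditions Lam" and pq: "p |` (W \<times> UNIV) \<subseteq>\<^sub>m q"
  obtain q2 c' where q2: "q2 \<in> conditions W" "q |` (W \<times> UNIV) \<subseteq>\<^sub>m q2" "L F \<alpha> c' q2"
    using W F(1) res[OF q] unfolding support_def by blast
  have add: "s \<subseteq>\<^sub>m s ++ q2 \<and> q2 \<subseteq>\<^sub>m s ++ q2 \<and> s ++ q2 \<in> conditions Lam"
    if s: "s \<in> conditions Lam" and sW: "s |` (W \<times> UNIV) \<subseteq>\<^sub>m q2" for s
  proof (intro conjI)
    show "q2 \<subseteq>\<^sub>m s ++ q2" by (rule map_le_map_add)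
    show "s \<subseteq>\<^sub>m s ++ q2"
    proof (unfold map_le_def, intro ballI)
      fix x assume x: "x \<in> dom s"
      show "s x = (s ++ q2) x"
      proof (cases "x \<in> W \<times> UNIV")
        case True
        then have "(s |` (W \<times> UNIV)) x = s x" "x \<in> dom (s |` (W \<times> UNIV))" using x by auto
        then have "q2 x = s x" using sW by (metis map_le_def)
        then show ?thesis using x by (auto simp: map_add_def split: option.split)
      next
        case False
        then have "q2 x = None" using q2(1) by (auto simp: conditions_def)
        then show ?thesis by (simp add: map_add_def)
      qed
    qed
    show "s ++ q2 \<in> conditions Lam"
      using s q2(1) WL small_Un unfolding conditions_def by (auto simp: Un_commute)
  qed
  have "p |` (W \<times> UNIV) \<subseteq>\<^sub>m q |` (W \<times> UNIV)"
    using pq by (auto simp: map_le_def restrict_map_def dom_def split: if_splits)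
  then have pW: "p |` (W \<times> UNIV) \<subseteq>\<^sub>m q2" using q2(2) by (rule map_le_trans)
  have v: "colouring n F" "\<forall>j<n. \<alpha> j \<in> Lam - N0" using F(2) by (auto simp: valid_def)
  have "L F \<alpha> c (p ++ q2)" "L F \<alpha> c' (p ++ q2)"
    using L_open[OF v] add[OF p(1) pW] p(2) q2(3) by blast+
  then have "c = c'" using L_unique[OF F(2)] add[OF p(1) pW] by blast
  then show "\<exists>q'\<in>conditions Lam. q \<subseteq>\<^sub>m q' \<and> L F \<alpha> c q'"
    using L_open[OF v q2(3)] add[OF q q2(2)] by blast
qed

text \<open>The rows are closed off under a choice of deciding extensions. The size stays \<kappa>,
  because fewer than \<kappa> rows carry at most \<kappa> conditions, each with fewer than \<kappa>
  rows, and there are at most \<kappa> colourings.\<close>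

lemma support_exists:
  assumes Y: "|Y| \<le>o |UNIV :: 'a set|" "\<And>F. F \<in> Y \<Longrightarrow> colouring n F"
    and \<alpha>: "\<And>j. j < n \<Longrightarrow> \<alpha> j \<in> Lam - N0" and R0: "R0 \<subseteq> Lam" "|R0| \<le>o |UNIV :: 'a set|"
  shows "\<exists>W. R0 \<subseteq> W \<and> support Y \<alpha> W \<and> |W| \<le>o |UNIV :: 'a set|"
proof -
  have "\<exists>q. q \<in> conditions Lam \<and> p \<subseteq>\<^sub>m q \<and> (\<exists>c. L F \<alpha> c q)" if "F \<in> Y" "p \<in> conditions Lam" for F p
    using L_decides[of F \<alpha> p] Y(2) \<alpha> that by blast
  then obtain Q where Q: "\<And>F p. F \<in> Y \<Longrightarrow> p \<in> conditions Lam \<Longrightarrow>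
      Q F p \<in> conditions Lam \<and> p \<subseteq>\<^sub>m Q F p \<and> (\<exists>c. L F \<alpha> c (Q F p))" by metis
  define \<Phi> where "\<Phi> B = (\<Union>p\<in>conditions (B \<inter> Lam). \<Union>F\<in>Y. fst ` dom (Q F p))" for B
  have U: "r \<le>o |UNIV :: 'a set|" using r_ordIso(1) ordIso_imp_ordLeq by blast
  have "\<exists>R. R0 \<subseteq> R \<and> |R| \<le>o |UNIV :: 'a set| \<and> (\<forall>B \<subseteq> R. |B| <o r \<longrightarrow> \<Phi> B \<subseteq> R)"
  proof (rule closing_off[OF kappa_card(1) regular kappa_card(2) U small_subsets_bound _ R0(2)])
    fix B :: "'l set" assume "small B"
    then have "small (B \<inter> Lam)" by (rule small_mono[rotated]) blast
    then have c: "|conditions (B \<inter> Lam) :: ('l \<times> 'a \<rightharpoonup> bool) set| \<le>o |UNIV :: 'a set|"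
      by (intro conditions_bound small_imp_le)
    show "|\<Phi> B| \<le>o |UNIV :: 'a set|" unfolding \<Phi>_def
    proof (intro card_UN_bound c Y(1) infinite_UNIV)
      fix p F assume p: "p \<in> conditions (B \<inter> Lam)" "F \<in> Y"
      then have "Q F p \<in> conditions Lam" using Q conditions_subset[of "B \<inter> Lam"] by blast
      then show "|fst ` dom (Q F p)| \<le>o |UNIV :: 'a set|"
        by (intro small_imp_le small_image) (simp add: conditions_def)
    qed
  qed
  then obtain R where R: "R0 \<subseteq> R" "|R| \<le>o |UNIV :: 'a set|" "\<And>B. B \<subseteq> R \<Longrightarrow> small B \<Longrightarrow> \<Phi> B \<subseteq> R" by blast
  have "support Y \<alpha> (R \<inter> Lam)" unfolding support_def
  proof (intro conjI ballI)
    fix F and p :: "'l \<times> 'a \<rightharpoonup> bool" assume F: "F \<in> Y" and p: "p \<in> conditions (R \<inter> Lam)"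
    have pL: "p \<in> conditions Lam" using p conditions_subset[of "R \<inter> Lam"] by blast
    note q = Q[OF F pL]
    let ?B = "fst ` dom p"
    have "?B \<subseteq> R \<inter> Lam" using p by (auto simp: conditions_def)
    moreover have "small ?B" using p by (auto simp: conditions_def intro: small_image)
    ultimately have "\<Phi> ?B \<subseteq> R" using R(3) by blast
    moreover have "p \<in> conditions (?B \<inter> Lam)" using pL by (force simp: conditions_def)
    ultimately have "fst ` dom (Q F p) \<subseteq> R" using F unfolding \<Phi>_def by blast
    then have "Q F p \<in> conditions (R \<inter> Lam)" using q by (force simp: conditions_def)
    then show "\<exists>q\<in>conditions (R \<inter> Lam). \<exists>c. p \<subseteq>\<^sub>m q \<and> L F \<alpha> c q" using q by blast
  qed simp
  moreover have "|R \<inter> Lam| \<le>o |UNIV :: 'a set|" using R(2) card_of_mono1[of "R \<inter> Lam" R] ordLeq_transitive by blast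
  ultimately show ?thesis using R(1) R0(1) by (intro exI[of _ "R \<inter> Lam"]) blast
qed

end

section \<open>The index cardinal, and restrictions of tuples of nodes\<close>

context inacc_wo
begin

text \<open>The inequality \<open>2^\<kappa> < lam\<close> follows from either alternative assumed
  about \<open>lam\<close>. It feeds the delta system for \<open>d = 1\<close> and provides the
  \<open>2^\<kappa>\<close> many indices of the additional branch.\<close>

definition big_index :: "'l rel \<Rightarrow> 'k rel \<Rightarrow> nat \<Rightarrow> bool" where
  "big_index lam \<kappa> d \<longleftrightarrow> Card_order lam \<and> r =o \<kappa> \<and> 1 \<le> d \<and> |UNIV :: 'a set set| <o |Field lam| \<and>
     (arrows lam \<kappa> (2 * d) (ctwo ^c \<kappa>) \<or> d = 1)"

lemma big_minus_small:
  assumes "|UNIV :: 'a set set| <o |A|" "small N"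
  shows "|UNIV :: 'a set set| <o |A - N|"
proof (rule ccontr)
  assume "\<not> ?thesis"
  then have a: "|A - N| \<le>o |UNIV :: 'a set set|"
    by (meson card_of_Well_order not_ordLess_iff_ordLeq)
  have "|UNIV :: 'a set| \<le>o |UNIV :: 'a set set|"
    using card_of_Pow[of "UNIV :: 'a set"] ordLess_imp_ordLeq by auto
  then have "|N| \<le>o |UNIV :: 'a set set|" using small_imp_le[OF assms(2)] ordLeq_transitive by blast
  then have "|A - N \<union> N| \<le>o |UNIV :: 'a set set|" using a by (intro card_Un_bound infinite_power)
  moreover have "|A| \<le>o |A - N \<union> N|" by (rule card_of_mono1) auto
  ultimately show False using assms(1) by (meson not_ordLess_ordLeq ordLeq_transitive)
qed

lemma homogeneous_exists:
  fixes lam :: "'l rel" and \<kappa> :: "'k rel" and w :: "(nat \<Rightarrow> 'l) \<Rightarrow> 'a \<Rightarrow> 'l" and Ty :: "(nat \<Rightarrow> 'l) \<Rightarrow> 'o"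
  assumes big: "big_index lam \<kappa> d" and N0: "small N0"
    and inj: "\<And>\<alpha>. \<alpha> \<in> index_tuples d (Field lam - N0) \<Longrightarrow> inj (w \<alpha>)"
    and mem: "\<And>\<alpha> j. \<alpha> \<in> index_tuples d (Field lam - N0) \<Longrightarrow> j < d \<Longrightarrow> \<alpha> j \<in> range (w \<alpha>)"
    and Ty: "|Ty ` index_tuples d (Field lam - N0)| \<le>o |UNIV :: 'a set set|"
  shows "\<exists>ty \<F>. (\<forall>e E E'. E \<in> \<F> e \<longrightarrow> E \<subseteq> E' \<longrightarrow> E' \<subseteq> {..<d} \<longrightarrow> E' \<in> \<F> e) \<and>
     (\<forall>I :: 'i set. small I \<longrightarrow> (\<exists>h. homogeneous_supports d (Field lam - N0) w Ty ty \<F> I h))"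
proof (cases "arrows lam \<kappa> (2 * d) (ctwo ^c \<kappa>)")
  case True
  then show ?thesis
    using homogeneous_arrow[of lam \<kappa> d N0 w Ty] big N0 inj Ty unfolding big_index_def by blast
next
  case False
  then have d: "d = 1" using big by (auto simp: big_index_def)
  show ?thesis unfolding d
    using big_minus_small[OF _ N0, of "Field lam"] big inj mem[of _ 0] Ty
    by (intro homogeneous_successor) (auto simp: big_index_def d)
qed

lemma nat_le: "|A :: nat set| \<le>o |UNIV :: 'a set|"
  by (intro small_imp_le small_countable)

lemma power_Times2:
  assumes "|A| \<le>o |UNIV :: 'a set set|" "|B| \<le>o |UNIV :: 'a set set|"
  shows "|A \<times> B| \<le>o |UNIV :: 'a set set|"
  using assms infinite_power
  by (intro card_of_Times_ordLeq_infinite_Field) (simp_all add: Field_card_of card_of_card_order_on)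

lemma node_tuples_small: "small ({..<d :: nat} \<rightarrow>\<^sub>E node \<gamma>)"
  by (rule small_PiE[OF small_finite[OF finite_lessThan] small_node])

definition cuts :: "nat \<Rightarrow> 'a \<Rightarrow> (nat \<Rightarrow> 'a \<Rightarrow> bool) \<Rightarrow> nat \<Rightarrow> 'a \<Rightarrow> bool" where
  "cuts d \<gamma> u = (\<lambda>j\<in>{..<d}. cut \<gamma> (u j))"

lemma cuts_node: "cuts d \<gamma> u \<in> {..<d} \<rightarrow>\<^sub>E node \<gamma>"
  by (auto simp: cuts_def)

lemma cuts_cuts: "\<gamma> \<unlhd> \<delta> \<Longrightarrow> cuts d \<gamma> (cuts d \<delta> u) = cuts d \<gamma> u"
  unfolding cuts_def by (rule restrict_ext) (simp add: cut_cut)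

lemma agree_cuts: "agree d u u' \<subseteq> agree d (cuts d \<gamma> u) (cuts d \<gamma> u')"
  by (auto simp: agree_def cuts_def)

lemma exists_above:
  assumes "small S" shows "\<exists>\<eta>. \<xi> \<unlhd> \<eta> \<and> (\<forall>x\<in>S. x \<lhd> \<eta>)"
proof -
  obtain \<eta> where "\<forall>x\<in>{\<xi>} \<union> S. x \<lhd> \<eta>"
    using small_bounded[of "{\<xi>} \<union> S"] small_Un[OF small_finite[of "{\<xi>}"] assms] by auto
  then show ?thesis by (intro exI[of _ \<eta>]) (auto simp: le_def)
qed

end

text \<open>Only abstract conditions survive from stage to stage. At stage \<open>\<gamma>\<close>
  the nodes of level \<open>\<gamma>\<close> receive a new block \<open>hh \<gamma>\<close> of
  indices, the abstract condition of each \<open>d\<close>-tuple of nodes is pushed to the support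
  of its tuple of indices, and homogeneity makes these conditions compatible. In their union the
  limits decided earlier still hold; a level realizing all of them is chosen, new limits are
  decided, and the result is pulled back. The colour at a level above \<open>m\<close> is thus the
  limit decided at stage \<open>m\<close>, where only the restrictions to \<open>m\<close> are
  known.\<close>

lemma (in branch_limits) tail_cone:
  fixes Z :: "'a \<Rightarrow> ('a \<Rightarrow> (nat \<Rightarrow> 'a \<Rightarrow> bool) \<Rightarrow> 'a) set"
  assumes Z: "\<And>\<eta>. small (Z \<eta>)" "\<And>\<eta> F. F \<in> Z \<eta> \<Longrightarrow> colouring n F"
    and lam: "Lam = Field lam" "big_index lam \<kappa> n"
  shows "\<exists>l s \<phi>. tree_embedding n l s \<phi> \<and> (\<forall>m \<mu> \<mu>' F v v'. F \<in> Z (l m) \<longrightarrow> m \<lhd> \<mu> \<longrightarrow> m \<lhd> \<mu>' \<longrightarrow>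
      (\<forall>j<n. v j \<in> node \<mu> \<and> v' j \<in> node \<mu>' \<and> cut m (v j) = cut m (v' j)) \<longrightarrow>
      F (l \<mu>) (\<lambda>j. \<phi> j \<mu> (v j)) = F (l \<mu>') (\<lambda>j. \<phi> j \<mu>' (v' j)))"
proof -
  let ?A = "Lam - N0" and ?T = "index_tuples n (Lam - N0)"
  define Y where "Y = (\<Union>\<eta>. Z \<eta>)"
  have Yc: "|Y| \<le>o |UNIV :: 'a set|" unfolding Y_def
    by (rule card_UN_bound[OF card_of_mono1 small_imp_le[OF Z(1)] infinite_UNIV]) simp
  have YF: "colouring n F" if "F \<in> Y" for F using that Z(2) by (auto simp: Y_def)
  have Tv: "\<alpha> j \<in> ?A" if "\<alpha> \<in> ?T" "j < n" for \<alpha> j using that by (auto simp: index_tuples_def)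
  have valid: "valid F \<alpha>" if "F \<in> Y" "\<alpha> \<in> ?T" for F \<alpha> using Tv[OF that(2)] YF[OF that(1)] by (simp add: valid_def)
  have UP: "|UNIV :: 'a set| \<le>o |UNIV :: 'a set set|"
    using card_of_Pow[of "UNIV :: 'a set"] ordLess_imp_ordLeq by auto
  have "|UNIV :: 'a set| \<le>o |Lam|"
    using lam UP ordLess_imp_ordLeq ordLeq_transitive unfolding big_index_def by blast
  then obtain k where k: "inj_on k (UNIV :: 'a set)" "range k \<subseteq> Lam" by (metis card_of_ordLeq)
  have "\<exists>w :: 'a \<Rightarrow> 'l. inj w \<and> support Y \<alpha> (range w) \<and> (\<forall>j<n. \<alpha> j \<in> range w)" if \<alpha>: "\<alpha> \<in> ?T" for \<alpha>
  proof -
    \<comment> \<open>Adding the rows \<open>range k\<close> gives every support size exactly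
      \<kappa>, so that the whole type can enumerate it injectively.\<close>
    let ?R0 = "range k \<union> \<alpha> ` {..<n}"
    have "|range k| \<le>o |UNIV :: 'a set|" by (rule card_of_image)
    moreover have "|\<alpha> ` {..<n}| \<le>o |UNIV :: 'a set|" by (intro small_imp_le small_finite) simp
    ultimately have "|?R0| \<le>o |UNIV :: 'a set|" by (intro card_Un_bound infinite_UNIV)
    moreover have "?R0 \<subseteq> Lam" using k(2) Tv[OF \<alpha>] by auto
    ultimately have "\<exists>W. ?R0 \<subseteq> W \<and> support Y \<alpha> W \<and> |W| \<le>o |UNIV :: 'a set|"
      by (intro support_exists[OF Yc YF Tv[OF \<alpha>]])
    then obtain W where W: "?R0 \<subseteq> W" "support Y \<alpha> W" "|W| \<le>o |UNIV :: 'a set|"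
      by (elim exE conjE)
    have "|UNIV :: 'a set| \<le>o |W|" using card_of_ordLeqI[OF k(1), of W] W(1) by blast
    then have "|UNIV :: 'a set| =o |W|" using W(3) by (simp add: ordIso_iff_ordLeq)
    then obtain w where w: "bij_betw w (UNIV :: 'a set) W" using card_of_ordIso by blast
    show ?thesis
    proof (intro exI[of _ w] conjI allI impI)
      show "inj w" using w by (simp add: bij_betw_def)
      have rw: "range w = W" using w by (simp add: bij_betw_def)
      show "support Y \<alpha> (range w)" unfolding rw by (rule W(2))
      show "\<alpha> j \<in> range w" if "j < n" for j unfolding rw using W(1) that by blast
    qed
  qed
  then have "\<exists>w :: (nat \<Rightarrow> 'l) \<Rightarrow> 'a \<Rightarrow> 'l. \<forall>\<alpha>\<in>?T. inj (w \<alpha>) \<and> support Y \<alpha> (range (w \<alpha>)) \<and> (\<forall>j<n. \<alpha> j \<in> range (w \<alpha>))"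
    by (intro bchoice ballI)
  then obtain w :: "(nat \<Rightarrow> 'l) \<Rightarrow> 'a \<Rightarrow> 'l" where wi: "\<And>\<alpha>. \<alpha> \<in> ?T \<Longrightarrow> inj (w \<alpha>)"
    and ws: "\<And>\<alpha>. \<alpha> \<in> ?T \<Longrightarrow> support Y \<alpha> (range (w \<alpha>))"
    and wm: "\<And>\<alpha> j. \<alpha> \<in> ?T \<Longrightarrow> j < n \<Longrightarrow> \<alpha> j \<in> range (w \<alpha>)" by blast
  define QQ where "QQ = (conditions UNIV :: ('a \<times> 'a \<rightharpoonup> bool) set)"
  \<comment> \<open>The type consists of the positions of the indices in the enumeration and of the
    relation "decides" transported to abstract conditions. Both are subsets of sets of size
    \<kappa>, so there are at most \<open>2^\<kappa>\<close> types.\<close>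
  define Ty where "Ty \<alpha> = ({(j, e). j < n \<and> w \<alpha> e = \<alpha> j}, {(Q, F, c). Q \<in> QQ \<and> F \<in> Y \<and> L F \<alpha> c (push (w \<alpha>) Q)})" for \<alpha>
  have "|Ty ` ?T| \<le>o |UNIV :: 'a set set|"
  proof -
    have U: "|UNIV :: 'a set| \<le>o |UNIV :: 'a set|" by (rule card_of_mono1) simp
    have "|QQ| \<le>o |UNIV :: 'a set|" unfolding QQ_def by (rule conditions_bound[OF U])
    then have "|Pow (QQ \<times> Y \<times> (UNIV :: 'a set))| \<le>o |UNIV :: 'a set set|"
      by (intro power_mono power_Times Yc U)
    moreover have "|Pow ((UNIV :: nat set) \<times> (UNIV :: 'a set))| \<le>o |UNIV :: 'a set set|"
      by (intro power_mono power_Times nat_le U)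
    ultimately have "|Pow ((UNIV :: nat set) \<times> (UNIV :: 'a set)) \<times> Pow (QQ \<times> Y \<times> (UNIV :: 'a set))| \<le>o |UNIV :: 'a set set|"
      by (intro power_Times2)
    moreover have "Ty ` ?T \<subseteq> Pow ((UNIV :: nat set) \<times> (UNIV :: 'a set)) \<times> Pow (QQ \<times> Y \<times> (UNIV :: 'a set))"
      by (auto simp: Ty_def)
    ultimately show ?thesis by (rule ordLeq_transitive[OF card_of_mono1, rotated])
  qed
  then have "\<exists>ty \<F>. (\<forall>e E E'. E \<in> \<F> e \<longrightarrow> E \<subseteq> E' \<longrightarrow> E' \<subseteq> {..<n} \<longrightarrow> E' \<in> \<F> e) \<and>
     (\<forall>I :: ('a \<Rightarrow> bool) set. small I \<longrightarrow> (\<exists>h. homogeneous_supports n ?A w Ty ty \<F> I h))"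
    using homogeneous_exists[OF lam(2) N0, of w Ty] wi wm unfolding lam(1)[symmetric] by blast
  then obtain ty \<F> where \<F>: "\<And>e E E'. E \<in> \<F> e \<Longrightarrow> E \<subseteq> E' \<Longrightarrow> E' \<subseteq> {..<n} \<Longrightarrow> E' \<in> \<F> e"
    and hom: "\<And>I :: ('a \<Rightarrow> bool) set. small I \<Longrightarrow> \<exists>h. homogeneous_supports n ?A w Ty ty \<F> I h"
    by blast
  define hh where "hh \<gamma> = (SOME h. homogeneous_supports n ?A w Ty ty \<F> (node \<gamma>) h)" for \<gamma>
  have hh: "homogeneous_supports n ?A w Ty ty \<F> (node \<gamma>) (hh \<gamma>)" for \<gamma>
    unfolding hh_def by (rule someI_ex[OF hom[OF small_node]])
  define tp where "tp \<gamma> u = tuple n (hh \<gamma>) u" for \<gamma> u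
  define PN where "PN \<gamma> = ({..<n} \<rightarrow>\<^sub>E node \<gamma>)" for \<gamma>
  have tpT: "tp \<gamma> u \<in> ?T" "Ty (tp \<gamma> u) = ty" if "u \<in> PN \<gamma>" for \<gamma> u
    using hh[of \<gamma>] that unfolding homogeneous_supports_def tp_def PN_def by blast+
  have weq: "w (tp \<gamma> u) e = w (tp \<gamma> u') e' \<longleftrightarrow> e = e' \<and> agree n u u' \<in> \<F> e"
    if "u \<in> PN \<gamma>" "u' \<in> PN \<gamma>" for \<gamma> u u' e e'
    using hh[of \<gamma>] that unfolding homogeneous_supports_def tp_def PN_def by blast
  have hinj: "hh \<gamma> j x = hh \<gamma> j' x' \<Longrightarrow> j = j' \<and> x = x'"
    if "j < n" "j' < n" "x \<in> node \<gamma>" "x' \<in> node \<gamma>" for \<gamma> j j' x x'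
    using hh[of \<gamma>] that unfolding homogeneous_supports_def by blast
  have PNm: "u j \<in> node \<gamma>" if "u \<in> PN \<gamma>" "j < n" for u \<gamma> j using that by (auto simp: PN_def PiE_iff)
  have tpj: "tp \<gamma> u j = hh \<gamma> j (u j)" if "j < n" for \<gamma> u j using that by (simp add: tp_def tuple_def)
  \<comment> \<open>The row of the \<open>j\<close>-th index in the condition for \<open>u\<close>
    will depend only on \<open>u j\<close>; constant tuples serve to read it off.\<close>
  define cst where "cst x = (\<lambda>j\<in>{..<n}. x)" for x :: "'a \<Rightarrow> bool"
  have cstP: "cst x \<in> PN \<gamma>" if "x \<in> node \<gamma>" for x \<gamma> using that by (auto simp: cst_def PN_def)
  \<comment> \<open>The position of the \<open>j\<close>-th index, which is the same for all tuples
    because the type contains it.\<close>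
  define ep where "ep j = (SOME e. (j, e) \<in> fst ty)" for j
  have ep: "w (tp \<gamma> u) (ep j) = hh \<gamma> j (u j)" if u: "u \<in> PN \<gamma>" and j: "j < n" for \<gamma> u j
  proof -
    obtain e where "w (tp \<gamma> u) e = tp \<gamma> u j" using wm[OF tpT(1)[OF u] j] by (metis imageE)
    then have "(j, e) \<in> fst ty" unfolding tpT(2)[OF u, symmetric] Ty_def using j by simp
    then have "(j, ep j) \<in> fst ty" unfolding ep_def by (rule someI)
    then show ?thesis unfolding tpT(2)[OF u, symmetric] Ty_def by (simp add: tpj[OF j])
  qed
  have ep_inj: "j = j'" if "ep j = ep j'" "j < n" "j' < n" for j j'
  proof -
    have c: "cst (\<lambda>_. False) \<in> PN base_point" "(\<lambda>_. False) \<in> node base_point" by (auto simp: cstP node_def)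
    have "hh base_point j (cst (\<lambda>_. False) j) = hh base_point j' (cst (\<lambda>_. False) j')"
      using ep[OF c(1) that(2)] ep[OF c(1) that(3)] that(1) by simp
    then show ?thesis using hinj[OF that(2,3) PNm[OF c(1) that(2)] PNm[OF c(1) that(3)]] by blast
  qed
  have ep_agree: "agree n u u' \<in> \<F> (ep j) \<longleftrightarrow> u j = u' j" if "u \<in> PN \<gamma>" "u' \<in> PN \<gamma>" "j < n" for u u' \<gamma> j
  proof -
    have "agree n u u' \<in> \<F> (ep j) \<longleftrightarrow> w (tp \<gamma> u) (ep j) = w (tp \<gamma> u') (ep j)" using weq[OF that(1,2)] by blast
    also have "\<dots> \<longleftrightarrow> u j = u' j"
      unfolding ep[OF that(1,3)] ep[OF that(2,3)] using hinj[OF that(3,3) PNm[OF that(1,3)] PNm[OF that(2,3)]] by metis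
    finally show ?thesis .
  qed
  define Ls where "Ls F c Q \<longleftrightarrow> (Q, F, c) \<in> snd ty" for F c Q
  have Ls: "Ls F c Q \<longleftrightarrow> Q \<in> QQ \<and> F \<in> Y \<and> L F (tp \<gamma> u) c (push (w (tp \<gamma> u)) Q)" if "u \<in> PN \<gamma>" for \<gamma> u F c Q
    unfolding Ls_def tpT(2)[OF that, symmetric] Ty_def by simp
  have wLam: "range (w \<alpha>) \<subseteq> Lam" if "\<alpha> \<in> ?T" for \<alpha> using ws[OF that] by (simp add: support_def)
  have push_cond: "push (w \<alpha>) Q \<in> conditions Lam" if "\<alpha> \<in> ?T" "Q \<in> QQ" for \<alpha> Q
  proof -
    have d: "dom (push (w \<alpha>) Q) \<subseteq> (\<lambda>(e, z). (w \<alpha> e, z)) ` dom Q" by (rule dom_push[OF wi[OF that(1)]])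
    have "small (dom Q)" using that(2) by (simp add: QQ_def conditions_def)
    then have "small (dom (push (w \<alpha>) Q))" using small_surj d by blast
    moreover have "(\<lambda>(e, z). (w \<alpha> e, z)) ` dom Q \<subseteq> Lam \<times> UNIV" using wLam[OF that(1)] by auto
    ultimately show ?thesis using d unfolding conditions_def by blast
  qed
  have pull_cond: "pull (w \<alpha>) p \<in> QQ" if "\<alpha> \<in> ?T" "p \<in> conditions Lam" for \<alpha> p
  proof -
    have "inj_on (\<lambda>(e, z). (w \<alpha> e, z)) (dom (pull (w \<alpha>) p))"
      using wi[OF that(1)] by (auto simp: inj_on_def inj_def)
    moreover have "(\<lambda>(e, z). (w \<alpha> e, z)) ` dom (pull (w \<alpha>) p) \<subseteq> dom p" by (auto simp: pull_def)
    moreover have "small (dom p)" using that(2) by (simp add: conditions_def)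
    ultimately have "small (dom (pull (w \<alpha>) p))" by (rule small_inj)
    then show ?thesis by (simp add: QQ_def conditions_def)
  qed
  \<comment> \<open>The stages of the fusion: a level \<open>lev\<close>, a splitting level \<open>spl\<close>, and abstract conditions \<open>cn\<close>.\<close>
  define lev where "lev S = fst S" for S :: "'a \<times> 'a \<times> ((nat \<Rightarrow> 'a \<Rightarrow> bool) \<Rightarrow> ('a \<times> 'a \<rightharpoonup> bool))"
  define spl where "spl S = fst (snd S)" for S :: "'a \<times> 'a \<times> ((nat \<Rightarrow> 'a \<Rightarrow> bool) \<Rightarrow> ('a \<times> 'a \<rightharpoonup> bool))"
  define cn where "cn S = snd (snd S)" for S :: "'a \<times> 'a \<times> ((nat \<Rightarrow> 'a \<Rightarrow> bool) \<Rightarrow> ('a \<times> 'a \<rightharpoonup> bool))"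
  \<comment> \<open>The clause on \<open>\<F> e\<close> makes the pushed conditions compatible at
    the next stage. Filling the rows of the indices exactly below \<open>spl S\<close> keeps the
    place of the next bit free and leaves no hole below it. The limits of the colourings in
    \<open>Z (lev S)\<close> are decided here and realized at the levels of all later
    stages.\<close>
  define P where "P f \<gamma> S \<longleftrightarrow>
     ((\<forall>\<delta>. \<delta> \<lhd> \<gamma> \<longrightarrow> spl (f \<delta>) \<lhd> lev S) \<and> lev S \<unlhd> spl S) \<and>
     (\<forall>u\<in>PN \<gamma>. \<forall>\<delta>. \<delta> \<lhd> \<gamma> \<longrightarrow> cn (f \<delta>) (cuts n \<delta> u) \<subseteq>\<^sub>m cn S u \<and>
        (\<forall>j<n. cn S u (ep j, spl (f \<delta>)) = Some (u j \<delta>))) \<and>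
     (\<forall>u\<in>PN \<gamma>. \<forall>j<n. \<forall>\<zeta>. cn S u (ep j, \<zeta>) \<noteq> None \<longleftrightarrow> \<zeta> \<lhd> spl S) \<and>
     (\<forall>u\<in>PN \<gamma>. \<forall>u'\<in>PN \<gamma>. \<forall>e. agree n u u' \<in> \<F> e \<longrightarrow> (\<forall>\<zeta>. cn S u (e, \<zeta>) = cn S u' (e, \<zeta>))) \<and>
     (\<forall>u\<in>PN \<gamma>. \<forall>F\<in>Z (lev S). \<exists>c. Ls F c (cn S u)) \<and>
     (\<forall>u\<in>PN \<gamma>. \<forall>\<delta>. \<delta> \<lhd> \<gamma> \<longrightarrow> (\<forall>F\<in>Z (lev (f \<delta>)). \<forall>c. Ls F c (cn (f \<delta>) (cuts n \<delta> u)) \<longrightarrow>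
        F (lev S) (\<lambda>j. row (cn S u) (ep j) (lev S)) = c)) \<and>
     (\<forall>u\<in>PN \<gamma>. cn S u \<in> QQ)" for f \<gamma> S
  have "\<exists>f. \<forall>\<gamma>. P f \<gamma> (f \<gamma>)"
  proof (rule dependent_wf_choice[OF wf_lt])
    fix f f' :: "'a \<Rightarrow> 'a \<times> 'a \<times> ((nat \<Rightarrow> 'a \<Rightarrow> bool) \<Rightarrow> ('a \<times> 'a \<rightharpoonup> bool))" and \<gamma> S
    assume "\<And>z. (z, \<gamma>) \<in> {(x, y). x \<lhd> y} \<Longrightarrow> f z = f' z"
    then have "\<And>\<delta>. \<delta> \<lhd> \<gamma> \<Longrightarrow> f \<delta> = f' \<delta>" by simp
    then show "P f \<gamma> S = P f' \<gamma> S" unfolding P_def by (simp cong: imp_cong)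
  next
    fix \<gamma> f assume "\<And>\<delta>. (\<delta>, \<gamma>) \<in> {(x, y). x \<lhd> y} \<Longrightarrow> P f \<delta> (f \<delta>)"
    then have IH: "P f \<delta> (f \<delta>)" if "\<delta> \<lhd> \<gamma>" for \<delta> using that by simp
    have i1: "spl (f \<delta>') \<lhd> lev (f \<delta>)" "lev (f \<delta>) \<unlhd> spl (f \<delta>)" if "\<delta>' \<lhd> \<delta>" "\<delta> \<lhd> \<gamma>" for \<delta> \<delta>'
      using IH[OF that(2)] that(1) unfolding P_def by auto
    have i2: "cn (f \<delta>') (cuts n \<delta>' u) \<subseteq>\<^sub>m cn (f \<delta>) u" "j < n \<Longrightarrow> cn (f \<delta>) u (ep j, spl (f \<delta>')) = Some (u j \<delta>')"
      if "\<delta>' \<lhd> \<delta>" "\<delta> \<lhd> \<gamma>" "u \<in> PN \<delta>" for \<delta> \<delta>' u j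
      using IH[OF that(2)] that(1,3) unfolding P_def by auto
    have i3: "cn (f \<delta>) u (ep j, \<zeta>) \<noteq> None \<longleftrightarrow> \<zeta> \<lhd> spl (f \<delta>)" if "\<delta> \<lhd> \<gamma>" "u \<in> PN \<delta>" "j < n" for \<delta> u j \<zeta>
      using IH[OF that(1)] that(2,3) unfolding P_def by auto
    have i5: "cn (f \<delta>) u (e, \<zeta>) = cn (f \<delta>) u' (e, \<zeta>)" if "\<delta> \<lhd> \<gamma>" "u \<in> PN \<delta>" "u' \<in> PN \<delta>" "agree n u u' \<in> \<F> e" for \<delta> u u' e \<zeta>
      using IH[OF that(1)] that(2,3,4) unfolding P_def by auto
    have i6: "\<exists>c. Ls F c (cn (f \<delta>) u)" if "\<delta> \<lhd> \<gamma>" "u \<in> PN \<delta>" "F \<in> Z (lev (f \<delta>))" for \<delta> u F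
      using IH[OF that(1)] that(2,3) unfolding P_def by auto
    have i8: "cn (f \<delta>) u \<in> QQ" if "\<delta> \<lhd> \<gamma>" "u \<in> PN \<delta>" for \<delta> u
      using IH[OF that(1)] that(2) unfolding P_def by auto
    have cP: "cuts n \<delta> u \<in> PN \<delta>" for \<delta> u using cuts_node[of n \<delta> u] by (simp add: PN_def)
    have spl_inj: "\<delta> = \<delta>'" if "spl (f \<delta>) = spl (f \<delta>')" "\<delta> \<lhd> \<gamma>" "\<delta>' \<lhd> \<gamma>" for \<delta> \<delta>'
    proof (rule ccontr)
      assume ne: "\<delta> \<noteq> \<delta>'"
      have "spl (f a) \<lhd> spl (f b)" if "a \<lhd> b" "b \<lhd> \<gamma>" for a b
        using i1[OF that] O.less_le_trans by blast
      then show False using that lt_total[OF ne] irrefl by metis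
    qed
    \<comment> \<open>For the tuple \<open>u\<close> stage \<open>\<gamma>\<close> has to unite the
      conditions of its restrictions at the earlier stages with its bits, written at the earlier
      splitting levels.\<close>
    define A where "A u = (\<lambda>\<delta>. cn (f \<delta>) (cuts n \<delta> u)) ` {\<delta>. \<delta> \<lhd> \<gamma>} \<union>
        (\<lambda>(j, \<delta>). [(ep j, spl (f \<delta>)) \<mapsto> u j \<delta>]) ` ({..<n} \<times> {\<delta>. \<delta> \<lhd> \<gamma>})" for u
    have cc: "cn (f \<delta>') (cuts n \<delta>' u) \<subseteq>\<^sub>m cn (f \<delta>) (cuts n \<delta> u)" if "\<delta>' \<lhd> \<delta>" "\<delta> \<lhd> \<gamma>" for \<delta> \<delta>' u
      using i2(1)[OF that cP[of \<delta> u]] cuts_cuts[of \<delta>' \<delta> n u] that(1) by (simp add: le_def)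
    have compA: "compatible (A u)" if u: "u \<in> PN \<gamma>" for u
    proof -
      have stage: "v = v'" if "cn (f \<delta>) (cuts n \<delta> u) x = Some v" "cn (f \<delta>') (cuts n \<delta>' u) x = Some v'" "\<delta> \<lhd> \<gamma>" "\<delta>' \<lhd> \<gamma>"
        for \<delta> \<delta>' x v v'
      proof (cases "\<delta> = \<delta>'")
        case False
        then show ?thesis using cc[of \<delta> \<delta>' u] cc[of \<delta>' \<delta> u] lt_total[OF False] that unfolding map_le_def
          by (metis domI option.inject)
      qed (use that in simp)
      have bit: "v = u j \<delta>" if "cn (f \<delta>') (cuts n \<delta>' u) (ep j, spl (f \<delta>)) = Some v" "\<delta> \<lhd> \<gamma>" "\<delta>' \<lhd> \<gamma>" "j < n" for \<delta> \<delta>' j v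
      proof -
        have "spl (f \<delta>) \<lhd> spl (f \<delta>')" using i3[OF that(3) cP that(4), of u "spl (f \<delta>)"] that(1) by simp
        then have "\<delta> \<lhd> \<delta>'"
        proof -
          have "\<not> \<delta>' \<unlhd> \<delta>"
          proof
            assume "\<delta>' \<unlhd> \<delta>"
            then have "spl (f \<delta>') \<unlhd> spl (f \<delta>)" using i1[of \<delta>' \<delta>] that(2) unfolding le_def by (metis lt_trans)
            then show False using \<open>spl (f \<delta>) \<lhd> spl (f \<delta>')\<close> irrefl lt_trans unfolding le_def by metis
          qed
          then show ?thesis using lt_total unfolding le_def by blast
        qed
        then have "cn (f \<delta>') (cuts n \<delta>' u) (ep j, spl (f \<delta>)) = Some (cuts n \<delta>' u j \<delta>)"
          using i2(2)[OF _ that(3) cP that(4)] by blast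
        then show ?thesis using that(1,4) \<open>\<delta> \<lhd> \<delta>'\<close> by (simp add: cuts_def cut_def)
      qed
      show ?thesis unfolding compatible_def
      proof (intro ballI allI impI)
        fix g g' x v v' assume g: "g \<in> A u" "g' \<in> A u" "g x = Some v" "g' x = Some v'"
        have two: "(\<exists>\<delta>. \<delta> \<lhd> \<gamma> \<and> g = cn (f \<delta>) (cuts n \<delta> u)) \<or> (\<exists>j \<delta>. j < n \<and> \<delta> \<lhd> \<gamma> \<and> x = (ep j, spl (f \<delta>)) \<and> v = u j \<delta>)"
          if "g \<in> A u" "g x = Some v" for g v
          using that unfolding A_def by (auto split: if_splits)
        from two[OF g(1,3)] two[OF g(2,4)] show "v = v'"
        proof (elim disjE exE conjE)
          fix \<delta> \<delta>' assume "\<delta> \<lhd> \<gamma>" "g = cn (f \<delta>) (cuts n \<delta> u)" "\<delta>' \<lhd> \<gamma>" "g' = cn (f \<delta>') (cuts n \<delta>' u)"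
          then show ?thesis using stage g(3,4) by blast
        next
          fix \<delta> j \<delta>' assume "\<delta> \<lhd> \<gamma>" "g = cn (f \<delta>) (cuts n \<delta> u)" "j < n" "\<delta>' \<lhd> \<gamma>" "x = (ep j, spl (f \<delta>'))" "v' = u j \<delta>'"
          then show ?thesis using bit[of \<delta> j \<delta>' v] g(3) by blast
        next
          fix \<delta> j \<delta>' assume "\<delta> \<lhd> \<gamma>" "g' = cn (f \<delta>) (cuts n \<delta> u)" "j < n" "\<delta>' \<lhd> \<gamma>" "x = (ep j, spl (f \<delta>'))" "v = u j \<delta>'"
          then show ?thesis using bit[of \<delta> j \<delta>' v'] g(4) by blast
        next
          fix j \<delta> j' \<delta>' assume a: "j < n" "\<delta> \<lhd> \<gamma>" "x = (ep j, spl (f \<delta>))" "v = u j \<delta>"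
            "j' < n" "\<delta>' \<lhd> \<gamma>" "x = (ep j', spl (f \<delta>'))" "v' = u j' \<delta>'"
          then have "ep j = ep j'" "spl (f \<delta>) = spl (f \<delta>')" by auto
          then have "j = j'" "\<delta> = \<delta>'" using ep_inj a spl_inj by blast+
          then show ?thesis using a by simp
        qed
      qed
    qed
    define Q where "Q u = merge (A u)" for u
    have QA: "g \<subseteq>\<^sub>m Q u" if "u \<in> PN \<gamma>" "g \<in> A u" for g u
      unfolding Q_def by (rule merge_upper[OF compA[OF that(1)] that(2)])
    have Qcn: "cn (f \<delta>) (cuts n \<delta> u) \<subseteq>\<^sub>m Q u" if "u \<in> PN \<gamma>" "\<delta> \<lhd> \<gamma>" for u \<delta>
      by (rule QA[OF that(1)]) (use that in \<open>auto simp: A_def\<close>)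
    have Qbit: "Q u (ep j, spl (f \<delta>)) = Some (u j \<delta>)" if "u \<in> PN \<gamma>" "\<delta> \<lhd> \<gamma>" "j < n" for u \<delta> j
    proof -
      have "[(ep j, spl (f \<delta>)) \<mapsto> u j \<delta>] \<in> A u" using that unfolding A_def by force
      from QA[OF that(1) this] show ?thesis unfolding map_le_def by auto
    qed
    \<comment> \<open>A position shared by \<open>u\<close> and \<open>u'\<close> is shared by their
      restrictions: these agree in at least as many coordinates, and \<open>\<F> e\<close> is closed
      upwards. This is where the upward closure is needed.\<close>
    have Qimp: "Q u' (e, \<zeta>) = Some v" if u: "u \<in> PN \<gamma>" "u' \<in> PN \<gamma>" "agree n u u' \<in> \<F> e" "Q u (e, \<zeta>) = Some v" for u u' e \<zeta> v
    proof -
      obtain g where g: "g \<in> A u" "g (e, \<zeta>) = Some v"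
        using mergeD[OF u(4)[unfolded Q_def]] by (elim bexE)
      then consider \<delta> where "\<delta> \<lhd> \<gamma>" "g = cn (f \<delta>) (cuts n \<delta> u)" | j \<delta> where "j < n" "\<delta> \<lhd> \<gamma>" "e = ep j" "\<zeta> = spl (f \<delta>)" "v = u j \<delta>"
        unfolding A_def by (auto split: if_splits)
      then show ?thesis
      proof cases
        case 1
        have "agree n (cuts n \<delta> u) (cuts n \<delta> u') \<in> \<F> e"
          by (rule \<F>[OF u(3) agree_cuts]) (auto simp: agree_def)
        then have "cn (f \<delta>) (cuts n \<delta> u') (e, \<zeta>) = Some v" using i5[OF 1(1) cP cP] g(2) 1(2) by metis
        then show ?thesis using Qcn[OF u(2) 1(1)] unfolding map_le_def by (metis domI)
      next
        case 2
        then have "u j = u' j" using ep_agree[OF u(1,2) 2(1)] u(3) by simp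
        then show ?thesis using Qbit[OF u(2) 2(2,1)] 2 by simp
      qed
    qed
    have Qcoh: "Q u (e, \<zeta>) = Q u' (e, \<zeta>)" if "u \<in> PN \<gamma>" "u' \<in> PN \<gamma>" "agree n u u' \<in> \<F> e" for u u' e \<zeta>
    proof -
      have sym: "agree n u' u = agree n u u'" by (auto simp: agree_def)
      have "Q u (e, \<zeta>) = Some v \<longleftrightarrow> Q u' (e, \<zeta>) = Some v" for v
        using Qimp[OF that] Qimp[OF that(2,1)] that(3) unfolding sym by blast
      then show ?thesis by (metis not_None_eq)
    qed
    have QQQ: "Q u \<in> QQ" if u: "u \<in> PN \<gamma>" for u
      unfolding Q_def QQ_def
    proof (rule conditions_merge)
      show "small (A u)" unfolding A_def
        by (intro small_Un small_image small_Sigma small_seg small_finite) auto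
      show "A u \<subseteq> conditions UNIV" unfolding A_def
        using i8[OF _ cP] by (auto simp: QQ_def) (simp add: conditions_def small_finite)
    qed
    \<comment> \<open>Two of these conditions can meet only in a row that has the same position
      \<open>e\<close> for both tuples and whose agreement set is in \<open>\<F> e\<close>; there
      their values coincide by \<open>Qcoh\<close>.\<close>
    let ?B = "(\<lambda>u. push (w (tp \<gamma> u)) (Q u)) ` PN \<gamma>"
    define q0 where "q0 = merge ?B"
    have "compatible ?B" unfolding compatible_def
    proof (intro ballI allI impI)
      fix g g' x v v' assume g: "g \<in> ?B" "g' \<in> ?B" "g x = Some v" "g' x = Some v'"
      obtain u u' where u: "u \<in> PN \<gamma>" "g = push (w (tp \<gamma> u)) (Q u)" "u' \<in> PN \<gamma>" "g' = push (w (tp \<gamma> u')) (Q u')"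
        using g by blast
      obtain a \<zeta> where x: "x = (a, \<zeta>)" by (cases x)
      obtain e where e: "a = w (tp \<gamma> u) e" "Q u (e, \<zeta>) = Some v"
        using push_SomeD[OF wi[OF tpT(1)[OF u(1)]]] g(3) u(2) x by metis
      obtain e' where e': "a = w (tp \<gamma> u') e'" "Q u' (e', \<zeta>) = Some v'"
        using push_SomeD[OF wi[OF tpT(1)[OF u(3)]]] g(4) u(4) x by metis
      have "e = e' \<and> agree n u u' \<in> \<F> e" using weq[OF u(1,3)] e(1) e'(1) by metis
      then show "v = v'" using Qcoh[OF u(1,3)] e e' by (metis option.inject)
    qed
    then have q0u: "push (w (tp \<gamma> u)) (Q u) \<subseteq>\<^sub>m q0" if "u \<in> PN \<gamma>" for u
      unfolding q0_def using that by (intro merge_upper) auto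
    have PNs: "small (PN \<gamma>)" unfolding PN_def by (rule node_tuples_small)
    have q0C: "q0 \<in> conditions Lam" unfolding q0_def
      using push_cond[OF tpT(1) QQQ] by (intro conditions_merge small_image PNs) auto
    define cc where "cc u \<delta> F = (SOME c. Ls F c (cn (f \<delta>) (cuts n \<delta> u)))" for u \<delta> F
    have cc: "Ls F (cc u \<delta> F) (cn (f \<delta>) (cuts n \<delta> u))" if "\<delta> \<lhd> \<gamma>" "F \<in> Z (lev (f \<delta>))" for u \<delta> F
      unfolding cc_def by (rule someI_ex[OF i6[OF that(1) cP that(2)]])
    have cc_uniq: "c = cc u \<delta> F" if "\<delta> \<lhd> \<gamma>" "F \<in> Z (lev (f \<delta>))" "u \<in> PN \<gamma>" "Ls F c (cn (f \<delta>) (cuts n \<delta> u))" for u \<delta> F c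
    proof -
      have F: "F \<in> Y" using that(2) by (auto simp: Y_def)
      show ?thesis
        using L_unique[OF valid[OF F tpT(1)[OF that(3)]] push_cond[OF tpT(1)[OF that(3)] i8[OF that(1) cP[of \<delta> u]]]]
          that(4) cc[OF that(1,2), of u] Ls[OF that(3)] by blast
    qed
    \<comment> \<open>The limits decided at earlier stages, read for the new tuples of indices. They
      hold below \<open>q0\<close> because all tuples have the type \<open>ty\<close>, so an
      abstract condition decides the same for each of them.\<close>
    define I where "I = (\<lambda>(u, \<delta>, F). (F, tp \<gamma> u, cc u \<delta> F)) ` (SIGMA u:PN \<gamma>. SIGMA \<delta>:{\<delta>. \<delta> \<lhd> \<gamma>}. Z (lev (f \<delta>)))"
    have Is: "small I" unfolding I_def by (intro small_image small_Sigma PNs small_seg Z(1))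
    have IL: "\<forall>(F, \<alpha>, c)\<in>I. colouring n F \<and> (\<forall>j<n. \<alpha> j \<in> Lam - N0) \<and> L F \<alpha> c q0"
    proof -
      have "colouring n F \<and> (\<forall>j<n. tp \<gamma> u j \<in> Lam - N0) \<and> L F (tp \<gamma> u) (cc u \<delta> F) q0"
        if u: "u \<in> PN \<gamma>" and \<delta>: "\<delta> \<lhd> \<gamma>" and F: "F \<in> Z (lev (f \<delta>))" for u \<delta> F
      proof -
        have v: "valid F (tp \<gamma> u)" using F by (intro valid tpT(1) u) (auto simp: Y_def)
        have "push (w (tp \<gamma> u)) (cn (f \<delta>) (cuts n \<delta> u)) \<subseteq>\<^sub>m q0"
          using push_mono[OF Qcn[OF u \<delta>]] q0u[OF u] map_le_trans by blast
        moreover have "L F (tp \<gamma> u) (cc u \<delta> F) (push (w (tp \<gamma> u)) (cn (f \<delta>) (cuts n \<delta> u)))"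
          using cc[OF \<delta> F, of u] Ls[OF u] by blast
        ultimately show ?thesis using L_open[OF _ _ _ _ q0C] v unfolding valid_def by blast
      qed
      then show ?thesis unfolding I_def by auto
    qed
    obtain \<eta>0 where \<eta>0: "\<And>\<delta>. \<delta> \<lhd> \<gamma> \<Longrightarrow> spl (f \<delta>) \<lhd> \<eta>0"
      using small_bounded_fun[OF small_seg[of \<gamma>], of "\<lambda>\<delta>. spl (f \<delta>)"] by auto
    obtain q1 \<xi> where q1: "q1 \<in> conditions Lam" "q0 \<subseteq>\<^sub>m q1" "\<eta>0 \<lhd> \<xi>"
      and q1I': "\<forall>(F, \<alpha>, c)\<in>I. (\<forall>j<n. full q1 (\<alpha> j) \<xi>) \<and> F \<xi> (\<lambda>j. row q1 (\<alpha> j) \<xi>) = c"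
      using L_pick[OF q0C Is IL, of \<eta>0] by (elim bexE exE conjE)
    have q1I: "(\<forall>j<n. full q1 (\<alpha> j) \<xi>) \<and> F \<xi> (\<lambda>j. row q1 (\<alpha> j) \<xi>) = c" if "(F, \<alpha>, c) \<in> I" for F \<alpha> c
      using bspec[OF q1I' that] by simp
    define X where "X = (\<lambda>(F, u). (F, tp \<gamma> u)) ` (Z \<xi> \<times> PN \<gamma>)"
    have "small X" unfolding X_def by (intro small_image small_Sigma Z(1) PNs)
    moreover have "valid F \<alpha>" if "(F, \<alpha>) \<in> X" for F \<alpha>
      using that unfolding X_def by (auto intro!: valid tpT(1) simp: Y_def)
    ultimately obtain q2 where q2: "q2 \<in> conditions Lam" "q1 \<subseteq>\<^sub>m q2" and q2X: "\<forall>(F, \<alpha>)\<in>X. \<exists>c. L F \<alpha> c q2"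
      using decide_many[OF _ _ q1(1)] by blast
    have "small (snd ` dom q2)" using q2(1) by (intro small_image) (simp add: conditions_def)
    then obtain \<eta> where \<eta>: "\<xi> \<unlhd> \<eta>" "\<forall>\<zeta>\<in>snd ` dom q2. \<zeta> \<lhd> \<eta>" using exists_above by blast
    \<comment> \<open>The row of every index of this stage is filled up to \<open>\<eta>\<close>,
      which lies beyond all columns used so far and becomes the splitting level.\<close>
    define S where "S = (\<lambda>(j, x). hh \<gamma> j x) ` ({..<n} \<times> node \<gamma>) \<times> {\<zeta>. \<zeta> \<lhd> \<eta>}"
    have hL: "hh \<gamma> j x \<in> Lam" if "j < n" "x \<in> node \<gamma>" for j x
      using tpj[OF that(1), of \<gamma> "cst x"] Tv[OF tpT(1)[OF cstP[OF that(2)]] that(1)] that(1) by (auto simp: cst_def)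
    define q3 where "q3 = fill q2 S"
    have q3C: "q3 \<in> conditions Lam" unfolding q3_def
    proof (rule conditions_fill[OF q2(1)])
      show "small S" unfolding S_def by (intro small_Sigma small_image small_node small_seg small_finite[OF finite_lessThan])
      show "S \<subseteq> Lam \<times> UNIV" unfolding S_def using hL by auto
    qed
    have q23: "q2 \<subseteq>\<^sub>m q3" unfolding q3_def by (rule fill_le)
    have q03: "q0 \<subseteq>\<^sub>m q3" "q1 \<subseteq>\<^sub>m q3" using q1(2) q2(2) q23 map_le_trans by blast+
    define R where "R u = pull (w (tp \<gamma> u)) q3" for u
    have QR: "Q u \<subseteq>\<^sub>m R u" if u: "u \<in> PN \<gamma>" for u
    proof (unfold map_le_def, intro ballI)
      fix x assume "x \<in> dom (Q u)"
      then obtain e \<zeta> v where x: "x = (e, \<zeta>)" "Q u (e, \<zeta>) = Some v" by (cases x) auto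
      have "push (w (tp \<gamma> u)) (Q u) (w (tp \<gamma> u) e, \<zeta>) = Some v" using push_apply[OF wi[OF tpT(1)[OF u]]] x(2) by metis
      moreover have "push (w (tp \<gamma> u)) (Q u) \<subseteq>\<^sub>m q3" using q0u[OF u] q03(1) map_le_trans by blast
      ultimately have "q3 (w (tp \<gamma> u) e, \<zeta>) = Some v" unfolding map_le_def by (metis domI)
      then show "Q u x = R u x" using x by (simp add: R_def pull_def)
    qed
    have Rep: "R u (ep j, \<zeta>) = q3 (hh \<gamma> j (u j), \<zeta>)" if "u \<in> PN \<gamma>" "j < n" for u j \<zeta>
      using ep[OF that] by (simp add: R_def pull_def)
    have "P f \<gamma> (\<xi>, \<eta>, R)"
      unfolding P_def lev_def[of "(\<xi>, \<eta>, R)"] spl_def[of "(\<xi>, \<eta>, R)"] cn_def[of "(\<xi>, \<eta>, R)"] fst_conv snd_conv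
    proof (intro conjI ballI allI impI)
      show "spl (f \<delta>) \<lhd> \<xi>" if "\<delta> \<lhd> \<gamma>" for \<delta> using \<eta>0[OF that] q1(3) lt_trans by blast
      show "\<xi> \<unlhd> \<eta>" by (rule \<eta>(1))
      fix u assume u: "u \<in> PN \<gamma>"
      show "R u \<in> QQ" unfolding R_def by (rule pull_cond[OF tpT(1)[OF u] q3C])
      show "R u (ep j, \<zeta>) \<noteq> None \<longleftrightarrow> \<zeta> \<lhd> \<eta>" if j: "j < n" for j \<zeta>
      proof -
        have "(hh \<gamma> j (u j), \<zeta>) \<in> dom q3 \<longleftrightarrow> \<zeta> \<lhd> \<eta>"
        proof -
          have "\<zeta> \<lhd> \<eta>" if "(hh \<gamma> j (u j), \<zeta>) \<in> dom q2" using \<eta>(2) that by force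
          moreover have "(hh \<gamma> j (u j), \<zeta>) \<in> S \<longleftrightarrow> \<zeta> \<lhd> \<eta>" unfolding S_def using j PNm[OF u j] by force
          ultimately show ?thesis unfolding q3_def dom_fill by blast
        qed
        then show ?thesis unfolding Rep[OF u j] by auto
      qed
      show "R u (e, \<zeta>) = R u' (e, \<zeta>)" if "u' \<in> PN \<gamma>" "agree n u u' \<in> \<F> e" for u' e \<zeta>
        using weq[OF u that(1), of e e] that(2) by (simp add: R_def pull_def)
      show "cn (f \<delta>) (cuts n \<delta> u) \<subseteq>\<^sub>m R u" if "\<delta> \<lhd> \<gamma>" for \<delta>
        using Qcn[OF u that] QR[OF u] map_le_trans by blast
      show "R u (ep j, spl (f \<delta>)) = Some (u j \<delta>)" if "\<delta> \<lhd> \<gamma>" "j < n" for \<delta> j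
        using Qbit[OF u that] QR[OF u] unfolding map_le_def by (metis domI)
      show "\<exists>c. Ls F c (R u)" if F: "F \<in> Z \<xi>" for F
      proof -
        have FY: "F \<in> Y" using F by (auto simp: Y_def)
        have v: "valid F (tp \<gamma> u)" by (rule valid[OF FY tpT(1)[OF u]])
        have "(F, tp \<gamma> u) \<in> X" unfolding X_def using F u by force
        then obtain c where "L F (tp \<gamma> u) c q2" using q2X by blast
        then have "L F (tp \<gamma> u) c q3" using L_open[OF _ _ _ q23 q3C] v unfolding valid_def by blast
        \<comment> \<open>Pulling back and pushing again restricts \<open>q3\<close> to the support
          of the tuple, and this does not lose the decision.\<close>
        then have "L F (tp \<gamma> u) c (push (w (tp \<gamma> u)) (R u))"
          unfolding R_def push_pull by (rule support_restrict[OF ws[OF tpT(1)[OF u]] FY v q3C])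
        then have "Ls F c (R u)" unfolding Ls[OF u] R_def using FY pull_cond[OF tpT(1)[OF u] q3C] by blast
        then show ?thesis by blast
      qed
      show "F \<xi> (\<lambda>j. row (R u) (ep j) \<xi>) = c"
        if \<delta>: "\<delta> \<lhd> \<gamma>" and F: "F \<in> Z (lev (f \<delta>))" and c: "Ls F c (cn (f \<delta>) (cuts n \<delta> u))" for \<delta> F c
      proof -
        have "(F, tp \<gamma> u, c) \<in> I" unfolding cc_uniq[OF \<delta> F u c] I_def using u \<delta> F by force
        note I = q1I[OF this]
        have "row (R u) (ep j) \<xi> = row q1 (tp \<gamma> u j) \<xi>" if j: "j < n" for j
        proof -
          have "row (R u) (ep j) \<xi> = row q3 (tp \<gamma> u j) \<xi>" unfolding row_def Rep[OF u j] tpj[OF j] ..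
          then show ?thesis using row_mono[OF q03(2)] I j by metis
        qed
        then have "F \<xi> (\<lambda>j. row (R u) (ep j) \<xi>) = F \<xi> (\<lambda>j. row q1 (tp \<gamma> u j) \<xi>)"
          using F by (intro colouring_cong[OF YF]) (auto simp: Y_def)
        then show ?thesis using I by simp
      qed
    qed
    then show "\<exists>S. P f \<gamma> S" by blast
  qed
  then obtain f where f: "\<And>\<gamma>. P f \<gamma> (f \<gamma>)" by blast
  define l where "l \<gamma> = lev (f \<gamma>)" for \<gamma>
  define s where "s \<gamma> = spl (f \<gamma>)" for \<gamma>
  define \<phi> where "\<phi> j \<gamma> x = row (cn (f \<gamma>) (cst x)) (ep j) (l \<gamma>)" for j \<gamma> x
  have f1: "l \<gamma> \<unlhd> s \<gamma>" "\<delta> \<lhd> \<gamma> \<Longrightarrow> s \<delta> \<lhd> l \<gamma>" for \<gamma> \<delta> using f[of \<gamma>] unfolding P_def l_def s_def by auto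
  have f2: "cn (f \<delta>) (cuts n \<delta> u) \<subseteq>\<^sub>m cn (f \<gamma>) u" "j < n \<Longrightarrow> cn (f \<gamma>) u (ep j, s \<delta>) = Some (u j \<delta>)"
    if "\<delta> \<lhd> \<gamma>" "u \<in> PN \<gamma>" for \<gamma> \<delta> u j using f[of \<gamma>] that unfolding P_def s_def by auto
  have f3: "cn (f \<gamma>) u (ep j, \<zeta>) \<noteq> None \<longleftrightarrow> \<zeta> \<lhd> s \<gamma>" if "u \<in> PN \<gamma>" "j < n" for \<gamma> u j \<zeta>
    using f[of \<gamma>] that unfolding P_def s_def by auto
  have f5: "cn (f \<gamma>) u (e, \<zeta>) = cn (f \<gamma>) u' (e, \<zeta>)" if "u \<in> PN \<gamma>" "u' \<in> PN \<gamma>" "agree n u u' \<in> \<F> e" for \<gamma> u u' e \<zeta>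
    using f[of \<gamma>] that unfolding P_def by auto
  have f6: "\<exists>c. Ls F c (cn (f \<gamma>) u)" if "u \<in> PN \<gamma>" "F \<in> Z (l \<gamma>)" for \<gamma> u F
    using f[of \<gamma>] that unfolding P_def l_def by auto
  have f7: "F (l \<gamma>) (\<lambda>j. row (cn (f \<gamma>) u) (ep j) (l \<gamma>)) = c"
    if "\<delta> \<lhd> \<gamma>" "u \<in> PN \<gamma>" "F \<in> Z (l \<delta>)" "Ls F c (cn (f \<delta>) (cuts n \<delta> u))" for \<gamma> \<delta> u F c
    using f[of \<gamma>] that unfolding P_def l_def by auto
  have cut_cst: "cuts n \<delta> (cst x) = cst (cut \<delta> x)" for \<delta> x unfolding cuts_def cst_def by (rule restrict_ext) simp
  have below: "cn (f \<gamma>) (cst x) (ep j, \<zeta>) = cn (f \<delta>) (cst (cut \<delta> x)) (ep j, \<zeta>)"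
    if "\<delta> \<lhd> \<gamma>" "x \<in> node \<gamma>" "j < n" "\<zeta> \<lhd> s \<delta>" for \<gamma> \<delta> x j \<zeta>
  proof -
    have "cn (f \<delta>) (cst (cut \<delta> x)) (ep j, \<zeta>) \<noteq> None" using f3[OF cstP[OF cut_node] that(3)] that(4) by blast
    then show ?thesis using f2(1)[OF that(1) cstP[OF that(2)]] unfolding cut_cst map_le_def by (metis domIff)
  qed
  have "tree_embedding n l s \<phi>" unfolding tree_embedding_def
  proof (intro conjI allI impI ballI)
    show "l \<gamma> \<unlhd> s \<gamma>" for \<gamma> by (rule f1)
    show "s \<gamma> \<lhd> l \<gamma>'" if "\<gamma> \<lhd> \<gamma>'" for \<gamma> \<gamma>' using f1(2)[OF that] .
    show "\<phi> j \<gamma> x \<in> node (l \<gamma>)" for j \<gamma> x by (simp add: \<phi>_def row_def node_def)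
    fix j \<gamma> \<gamma>' x assume j: "j < n" and x: "x \<in> node \<gamma>'" and g: "\<gamma> \<lhd> \<gamma>'"
    show "cut (l \<gamma>) (\<phi> j \<gamma>' x) = \<phi> j \<gamma> (cut \<gamma> x)"
    proof (rule ext)
      fix \<zeta>
      show "cut (l \<gamma>) (\<phi> j \<gamma>' x) \<zeta> = \<phi> j \<gamma> (cut \<gamma> x) \<zeta>"
      proof (cases "\<zeta> \<lhd> l \<gamma>")
        case True
        then have "\<zeta> \<lhd> s \<gamma>" using f1(1) O.less_le_trans by blast
        moreover have "\<zeta> \<lhd> l \<gamma>'" using \<open>\<zeta> \<lhd> s \<gamma>\<close> f1(2)[OF g] lt_trans by blast
        ultimately show ?thesis using below[OF g x j] True by (simp add: cut_def \<phi>_def row_def)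
      qed (simp add: cut_def \<phi>_def row_def)
    qed
    show "\<phi> j \<gamma>' x (s \<gamma>) = x \<gamma>"
      using f2(2)[OF g cstP[OF x] j] f1(2)[OF g] j by (simp add: \<phi>_def row_def cst_def)
  next
    fix j \<gamma> \<gamma>1 \<gamma>2 x1 x2 assume a: "j < n" "x1 \<in> node \<gamma>1" "x2 \<in> node \<gamma>2" "\<gamma> \<lhd> \<gamma>1" "\<gamma> \<lhd> \<gamma>2" "cut \<gamma> x1 = cut \<gamma> x2"
    show "cut (s \<gamma>) (\<phi> j \<gamma>1 x1) = cut (s \<gamma>) (\<phi> j \<gamma>2 x2)"
    proof (rule cut_eqI)
      fix \<zeta> assume z: "\<zeta> \<lhd> s \<gamma>"
      then have "\<zeta> \<lhd> l \<gamma>1" "\<zeta> \<lhd> l \<gamma>2" using f1(2)[OF a(4)] f1(2)[OF a(5)] lt_trans by blast+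
      then show "\<phi> j \<gamma>1 x1 \<zeta> = \<phi> j \<gamma>2 x2 \<zeta>"
        using below[OF a(4,2,1) z] below[OF a(5,3,1) z] a(6) by (simp add: \<phi>_def row_def)
    qed
  qed
  moreover have "F (l \<mu>) (\<lambda>j. \<phi> j \<mu> (v j)) = F (l \<mu>') (\<lambda>j. \<phi> j \<mu>' (v' j))"
    if F: "F \<in> Z (l m)" and m: "m \<lhd> \<mu>" "m \<lhd> \<mu>'"
      and v: "\<forall>j<n. v j \<in> node \<mu> \<and> v' j \<in> node \<mu>' \<and> cut m (v j) = cut m (v' j)" for m \<mu> \<mu>' F v v'
  proof -
    define u where "u = restrict v {..<n}" define u' where "u' = restrict v' {..<n}"
    have u: "u \<in> PN \<mu>" "u' \<in> PN \<mu>'" using v by (auto simp: u_def u'_def PN_def)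
    have cu: "cuts n m u = cuts n m u'" unfolding cuts_def u_def u'_def using v by (intro restrict_ext) simp
    have cF: "colouring n F" using F by (auto intro: Z(2))
    have cm: "cuts n m u \<in> PN m" using cuts_node[of n m u] by (simp add: PN_def)
    obtain c where c: "Ls F c (cn (f m) (cuts n m u))" using f6[OF cm F] by blast
    have "row (cn (f \<mu>) (cst (x j))) (ep j) (l \<mu>) = row (cn (f \<mu>) x) (ep j) (l \<mu>)" if x: "x \<in> PN \<mu>" and j: "j < n" for x \<mu> j
    proof -
      have "agree n (cst (x j)) x \<in> \<F> (ep j)"
        unfolding ep_agree[OF cstP[OF PNm[OF x j]] x j] using j by (simp add: cst_def)
      then show ?thesis unfolding row_def using f5[OF cstP[OF PNm[OF x j]] x] by metis
    qed
    note coh = this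
    have "F (l \<mu>) (\<lambda>j. \<phi> j \<mu> (v j)) = F (l \<mu>) (\<lambda>j. row (cn (f \<mu>) u) (ep j) (l \<mu>))"
      by (rule colouring_cong[OF cF]) (use coh[OF u(1)] in \<open>simp add: \<phi>_def u_def\<close>)
    also have "\<dots> = c" by (rule f7[OF m(1) u(1) F c])
    also have "c = F (l \<mu>') (\<lambda>j. row (cn (f \<mu>') u') (ep j) (l \<mu>'))"
      using f7[OF m(2) u(2) F] c unfolding cu by simp
    also have "\<dots> = F (l \<mu>') (\<lambda>j. \<phi> j \<mu>' (v' j))"
      by (rule colouring_cong[OF cF]) (use coh[OF u(2)] in \<open>simp add: \<phi>_def u'_def\<close>)
    finally show ?thesis .
  qed
  ultimately show ?thesis by blast
qed

section \<open>Level-homogeneous subtrees\<close>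

context inacc_wo
begin

text \<open>A node of level \<open>\<gamma>\<close> is sent to the union of the images of its
  restrictions, with its bits inserted at the earlier levels, and then extended by
  \<open>extend\<close>. All nodes of a level are extended at once; this is where the colour
  \<open>c\<close> is obtained for all tuples of them.\<close>

lemma strong_subtree:
  assumes stem: "\<And>j. j < m \<Longrightarrow> stem j \<in> node \<zeta>"
    and extend: "\<And>\<eta>. \<zeta> \<unlhd> \<eta> \<Longrightarrow> \<exists>\<xi> E. \<eta> \<lhd> \<xi> \<and>
      (\<forall>j<m. \<forall>v\<in>node \<eta>. cut \<zeta> v = stem j \<longrightarrow> E j v \<in> node \<xi> \<and> cut \<eta> (E j v) = v) \<and>
      (\<forall>v. (\<forall>j<m. v j \<in> node \<eta> \<and> cut \<zeta> (v j) = stem j) \<longrightarrow> G \<xi> (\<lambda>j. E j (v j)) = c)"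
  shows "\<exists>l \<phi>. tree_embedding m l l \<phi> \<and> (\<forall>\<gamma> v. (\<forall>j<m. v j \<in> node \<gamma>) \<longrightarrow> G (l \<gamma>) (\<lambda>j. \<phi> j \<gamma> (v j)) = c)"
proof -
  define lev where "lev S = fst S" for S :: "'a \<times> (nat \<Rightarrow> ('a \<Rightarrow> bool) \<Rightarrow> 'a \<Rightarrow> bool)"
  define em where "em S = snd S" for S :: "'a \<times> (nat \<Rightarrow> ('a \<Rightarrow> bool) \<Rightarrow> 'a \<Rightarrow> bool)"
  define P where "P f \<gamma> S \<longleftrightarrow> \<zeta> \<unlhd> lev S \<and> (\<forall>\<delta>. \<delta> \<lhd> \<gamma> \<longrightarrow> lev (f \<delta>) \<lhd> lev S) \<and>
     (\<forall>j<m. \<forall>x\<in>node \<gamma>. em S j x \<in> node (lev S) \<and> cut \<zeta> (em S j x) = stem j \<and>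
        (\<forall>\<delta>. \<delta> \<lhd> \<gamma> \<longrightarrow> cut (lev (f \<delta>)) (em S j x) = em (f \<delta>) j (cut \<delta> x) \<and> em S j x (lev (f \<delta>)) = x \<delta>)) \<and>
     (\<forall>v. (\<forall>j<m. v j \<in> node \<gamma>) \<longrightarrow> G (lev S) (\<lambda>j. em S j (v j)) = c)" for f \<gamma> S
  have "\<exists>f. \<forall>\<gamma>. P f \<gamma> (f \<gamma>)"
  proof (rule dependent_wf_choice[OF wf_lt])
    fix f f' :: "'a \<Rightarrow> 'a \<times> (nat \<Rightarrow> ('a \<Rightarrow> bool) \<Rightarrow> 'a \<Rightarrow> bool)" and \<gamma> S
    assume "\<And>z. (z, \<gamma>) \<in> {(x, y). x \<lhd> y} \<Longrightarrow> f z = f' z"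
    then have "\<And>\<delta>. \<delta> \<lhd> \<gamma> \<Longrightarrow> f \<delta> = f' \<delta>" by simp
    then show "P f \<gamma> S = P f' \<gamma> S" unfolding P_def by (simp cong: imp_cong)
  next
    fix \<gamma> f assume "\<And>\<delta>. (\<delta>, \<gamma>) \<in> {(x, y). x \<lhd> y} \<Longrightarrow> P f \<delta> (f \<delta>)"
    then have IH: "P f \<delta> (f \<delta>)" if "\<delta> \<lhd> \<gamma>" for \<delta> using that by simp
    have z: "\<zeta> \<unlhd> lev (f \<delta>)" if "\<delta> \<lhd> \<gamma>" for \<delta> using IH[OF that] unfolding P_def by blast
    have mono: "lev (f \<delta>') \<lhd> lev (f \<delta>)" if "\<delta>' \<lhd> \<delta>" "\<delta> \<lhd> \<gamma>" for \<delta> \<delta>' using IH[OF that(2)] that(1) unfolding P_def by blast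
    have st: "cut \<zeta> (em (f \<delta>) j x) = stem j" if "\<delta> \<lhd> \<gamma>" "j < m" "x \<in> node \<delta>" for \<delta> j x
      using IH[OF that(1)] that(2,3) unfolding P_def by blast
    have co: "cut (lev (f \<delta>')) (em (f \<delta>) j x) = em (f \<delta>') j (cut \<delta>' x)" "em (f \<delta>) j x (lev (f \<delta>')) = x \<delta>'"
      if "\<delta>' \<lhd> \<delta>" "\<delta> \<lhd> \<gamma>" "j < m" "x \<in> node \<delta>" for \<delta> \<delta>' j x
      using IH[OF that(2)] that(1,3,4) unfolding P_def by blast+
    have mono_iff: "\<delta>' \<lhd> \<delta>" if "lev (f \<delta>') \<lhd> lev (f \<delta>)" "\<delta> \<lhd> \<gamma>" "\<delta>' \<lhd> \<gamma>" for \<delta> \<delta>'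
    proof (rule ccontr)
      assume "\<not> \<delta>' \<lhd> \<delta>"
      then have "\<delta>' = \<delta> \<or> \<delta> \<lhd> \<delta>'" using lt_total by blast
      then show False using mono[of \<delta> \<delta>'] that irrefl lt_trans by metis
    qed
    \<comment> \<open>The disjuncts are the stem, the images of the restrictions of
      \<open>x\<close>, and the bits of \<open>x\<close> at the earlier levels. From there up to
      \<open>\<eta>\<close> the node is padded with \<open>False\<close>.\<close>
    define pn where "pn j x z \<longleftrightarrow> z \<lhd> \<zeta> \<and> stem j z \<or> (\<exists>\<delta>. \<delta> \<lhd> \<gamma> \<and> z \<lhd> lev (f \<delta>) \<and> em (f \<delta>) j (cut \<delta> x) z) \<or>
       (\<exists>\<delta>. \<delta> \<lhd> \<gamma> \<and> z = lev (f \<delta>) \<and> x \<delta>)" for j x z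
    have pn_stem: "pn j x z = stem j z" if "z \<lhd> \<zeta>" "j < m" for j x z
    proof -
      have "em (f \<delta>) j (cut \<delta> x) z = stem j z" if "\<delta> \<lhd> \<gamma>" for \<delta>
        using st[OF that \<open>j < m\<close> cut_node, of x] \<open>z \<lhd> \<zeta>\<close> by (metis cut_def)
      moreover have "z \<noteq> lev (f \<delta>)" if "\<delta> \<lhd> \<gamma>" for \<delta> using z[OF that] \<open>z \<lhd> \<zeta>\<close> O.not_le by blast
      ultimately show ?thesis using that(1) unfolding pn_def by blast
    qed
    have pn_em: "pn j x z = em (f \<delta>) j (cut \<delta> x) z" if d: "\<delta> \<lhd> \<gamma>" "z \<lhd> lev (f \<delta>)" "j < m" for j x z \<delta>
    proof (cases "z \<lhd> \<zeta>")
      case True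
      then show ?thesis using pn_stem[OF True d(3)] st[OF d(1,3) cut_node, of x] by (metis cut_def)
    next
      case False
      have 2: "em (f \<delta>') j (cut \<delta>' x) z = em (f \<delta>) j (cut \<delta> x) z" if "\<delta>' \<lhd> \<gamma>" "z \<lhd> lev (f \<delta>')" for \<delta>'
      proof -
        have *: "em (f b) j (cut b x) z = em (f a) j (cut a x) z" if "a \<lhd> b" "b \<lhd> \<gamma>" "z \<lhd> lev (f a)" for a b
        proof -
          have "cut (lev (f a)) (em (f b) j (cut b x)) z = em (f a) j (cut a (cut b x)) z"
            using co(1)[OF that(1,2) d(3) cut_node] by metis
          then show ?thesis using that(1,3) by (simp add: cut_def[of "lev (f a)"] cut_cut le_def)
        qed
        show ?thesis using *[of \<delta>' \<delta>] *[of \<delta> \<delta>'] lt_total[of \<delta> \<delta>'] that d by metis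
      qed
      have 3: "x \<delta>' = em (f \<delta>) j (cut \<delta> x) z" if "\<delta>' \<lhd> \<gamma>" "z = lev (f \<delta>')" for \<delta>'
      proof -
        have l: "\<delta>' \<lhd> \<delta>" using mono_iff[of \<delta>' \<delta>] d(1,2) that by blast
        show ?thesis using co(2)[OF l d(1,3) cut_node, of x] that(2) l by (simp add: cut_def)
      qed
      show ?thesis unfolding pn_def using False 2 3 d by metis
    qed
    have pn_lev: "pn j x (lev (f \<delta>)) = x \<delta>" if d: "\<delta> \<lhd> \<gamma>" "j < m" for j x \<delta>
    proof -
      have 1: "\<not> lev (f \<delta>) \<lhd> \<zeta>" using z[OF d(1)] O.not_less by blast
      have 2: "em (f \<delta>') j (cut \<delta>' x) (lev (f \<delta>)) = x \<delta>" if "\<delta>' \<lhd> \<gamma>" "lev (f \<delta>) \<lhd> lev (f \<delta>')" for \<delta>'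
      proof -
        have l: "\<delta> \<lhd> \<delta>'" using mono_iff[OF that(2,1) d(1)] .
        show ?thesis using co(2)[OF l that(1) d(2) cut_node, of x] l by (simp add: cut_def)
      qed
      have 3: "\<delta>' = \<delta>" if "\<delta>' \<lhd> \<gamma>" "lev (f \<delta>) = lev (f \<delta>')" for \<delta>'
        using mono[of \<delta> \<delta>'] mono[of \<delta>' \<delta>] that d(1) lt_total irrefl by metis
      show ?thesis unfolding pn_def using 1 2 3 d by metis
    qed
    obtain \<eta> where \<eta>: "\<zeta> \<unlhd> \<eta>" "\<And>\<delta>. \<delta> \<lhd> \<gamma> \<Longrightarrow> lev (f \<delta>) \<lhd> \<eta>"
      using exists_above[OF small_image[OF small_seg[of \<gamma>], of "\<lambda>\<delta>. lev (f \<delta>)"], of \<zeta>] by auto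
    have pnN: "pn j x \<in> node \<eta>" if "j < m" for j x
    proof -
      have "z \<lhd> \<eta>" if "pn j x z" for z
        using that \<eta> O.less_le_trans lt_trans unfolding pn_def by blast
      then show ?thesis by (simp add: node_def)
    qed
    have pnC: "cut \<zeta> (pn j x) = stem j" if "j < m" for j x
      using pn_stem[OF _ that] stem[OF that] unfolding cut_def node_def by blast
    obtain \<xi> E where \<xi>: "\<eta> \<lhd> \<xi>"
      and E: "\<forall>j<m. \<forall>v\<in>node \<eta>. cut \<zeta> v = stem j \<longrightarrow> E j v \<in> node \<xi> \<and> cut \<eta> (E j v) = v"
      and EG: "\<forall>v. (\<forall>j<m. v j \<in> node \<eta> \<and> cut \<zeta> (v j) = stem j) \<longrightarrow> G \<xi> (\<lambda>j. E j (v j)) = c"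
      using extend[OF \<eta>(1)] by blast
    have Epn: "E j (pn j x) \<in> node \<xi>" "cut \<eta> (E j (pn j x)) = pn j x" if "j < m" for j x
      using E that pnN[OF that] pnC[OF that] by blast+
    have Ez: "E j (pn j x) z = pn j x z" if "j < m" "z \<lhd> \<eta>" for j x z
      using Epn(2)[OF that(1), of x] that(2) by (metis cut_def)
    have "P f \<gamma> (\<xi>, \<lambda>j x. E j (pn j x))"
      unfolding P_def lev_def[of "(\<xi>, \<lambda>j x. E j (pn j x))"] em_def[of "(\<xi>, \<lambda>j x. E j (pn j x))"] fst_conv snd_conv
    proof (intro conjI allI impI ballI)
      show "\<zeta> \<unlhd> \<xi>" using \<eta>(1) \<xi> O.le_less_trans O.less_imp_le by blast
      show "lev (f \<delta>) \<lhd> \<xi>" if "\<delta> \<lhd> \<gamma>" for \<delta> using \<eta>(2)[OF that] \<xi> lt_trans by blast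
      fix j x assume j: "j < m"
      show "E j (pn j x) \<in> node \<xi>" by (rule Epn(1)[OF j])
      show "cut \<zeta> (E j (pn j x)) = stem j"
        using Epn(2)[OF j, of x] pnC[OF j, of x] cut_cut[OF \<eta>(1)] by metis
      fix \<delta> assume d: "\<delta> \<lhd> \<gamma>"
      show "cut (lev (f \<delta>)) (E j (pn j x)) = em (f \<delta>) j (cut \<delta> x)"
      proof (rule ext)
        fix z
        have "em (f \<delta>) j (cut \<delta> x) \<in> node (lev (f \<delta>))" using IH[OF d] j unfolding P_def by simp
        then have n: "em (f \<delta>) j (cut \<delta> x) z \<Longrightarrow> z \<lhd> lev (f \<delta>)" by (simp add: node_def)
        show "cut (lev (f \<delta>)) (E j (pn j x)) z = em (f \<delta>) j (cut \<delta> x) z"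
        proof (cases "z \<lhd> lev (f \<delta>)")
          case True
          then show ?thesis using Ez[OF j, of z x] pn_em[OF d True j, of x] lt_trans[OF True \<eta>(2)[OF d]] by (simp add: cut_def)
        qed (use n in \<open>auto simp: cut_def\<close>)
      qed
      show "E j (pn j x) (lev (f \<delta>)) = x \<delta>" using Ez[OF j \<eta>(2)[OF d]] pn_lev[OF d j] by simp
    next
      fix v show "G \<xi> (\<lambda>j. E j (pn j (v j))) = c"
        using EG[rule_format, of "\<lambda>j. pn j (v j)"] pnN pnC by simp
    qed
    then show "\<exists>S. P f \<gamma> S" by blast
  qed
  then obtain f where f: "\<And>\<gamma>. P f \<gamma> (f \<gamma>)" by blast
  define l where "l \<gamma> = lev (f \<gamma>)" for \<gamma>
  define \<phi> where "\<phi> j \<gamma> = em (f \<gamma>) j" for j \<gamma>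
  have f1: "\<delta> \<lhd> \<gamma> \<Longrightarrow> l \<delta> \<lhd> l \<gamma>" for \<gamma> \<delta> using f[of \<gamma>] unfolding P_def l_def by blast
  have f2: "\<phi> j \<gamma> x \<in> node (l \<gamma>)" "\<delta> \<lhd> \<gamma> \<Longrightarrow> cut (l \<delta>) (\<phi> j \<gamma> x) = \<phi> j \<delta> (cut \<delta> x) \<and> \<phi> j \<gamma> x (l \<delta>) = x \<delta>"
    if "j < m" "x \<in> node \<gamma>" for j \<gamma> \<delta> x using f[of \<gamma>] that unfolding P_def l_def \<phi>_def by blast+
  have "tree_embedding m l l \<phi>" unfolding tree_embedding_def
  proof (intro conjI allI impI ballI)
    show "l \<gamma> \<unlhd> l \<gamma>" for \<gamma> by (simp add: le_def)
    show "cut (l \<gamma>) (\<phi> j \<gamma>1 x1) = cut (l \<gamma>) (\<phi> j \<gamma>2 x2)"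
      if "j < m" "x1 \<in> node \<gamma>1" "x2 \<in> node \<gamma>2" "\<gamma> \<lhd> \<gamma>1" "\<gamma> \<lhd> \<gamma>2" "cut \<gamma> x1 = cut \<gamma> x2" for j \<gamma> \<gamma>1 \<gamma>2 x1 x2
      using f2(2)[OF that(1,2,4)] f2(2)[OF that(1,3,5)] that(6) by simp
  qed (use f1 f2 in blast)+
  moreover have "\<forall>\<gamma> v. (\<forall>j<m. v j \<in> node \<gamma>) \<longrightarrow> G (l \<gamma>) (\<lambda>j. \<phi> j \<gamma> (v j)) = c"
    using f unfolding P_def l_def \<phi>_def by blast
  ultimately show ?thesis by blast
qed

end

text \<open>With \<open>\<alpha>\<close> fixed, the additional index, which is coordinate
  \<open>0\<close>, varies over the \<open>2^\<kappa>\<close> values of \<open>k\<close>. A delta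
  system of the graphs of deciding conditions leaves \<kappa> of them that agree on common rows,
  have the same limit and the same initial pieces, and do not mention each other's additional index.
  These indices are named by subsets of \<kappa>, so that a \<kappa>-sequence of names is a subset
  of \<kappa> \<times> \<kappa> and can become part of a type.\<close>

lemma (in branch_limits) compatible_conditions:
  fixes k :: "'a set \<Rightarrow> 'l"
  assumes G: "colouring n G" and n: "n = Suc d" and \<alpha>: "\<alpha> \<in> index_tuples d (Lam - N0)"
    and k: "inj k" "range k \<subseteq> Lam - N0"
  shows "\<exists>(b :: 'a \<Rightarrow> 'a set) p \<zeta> stem c. inj b \<and> stem \<in> {..<n} \<rightarrow>\<^sub>E node \<zeta> \<and> (\<forall>i. k (b i) \<notin> \<alpha> ` {..<d} \<and>
      p i \<in> conditions Lam \<and> L G (case_nat (k (b i)) \<alpha>) c (p i) \<and>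
      (\<forall>j<n. (\<forall>z. (case_nat (k (b i)) \<alpha> j, z) \<in> dom (p i) \<longleftrightarrow> z \<lhd> \<zeta>) \<and> row (p i) (case_nat (k (b i)) \<alpha> j) \<zeta> = stem j)) \<and>
      (\<forall>i i'. i \<noteq> i' \<longrightarrow> k (b i) \<notin> fst ` dom (p i')) \<and>
      (\<forall>i i' x v v'. p i x = Some v \<longrightarrow> p i' x = Some v' \<longrightarrow> v = v')"
proof -
  define I where "I = range k - \<alpha> ` {..<d}"
  define tu where "tu \<beta> = case_nat \<beta> \<alpha>" for \<beta>
  have \<alpha>L: "\<alpha> j \<in> Lam - N0" if "j < d" for j using \<alpha> that by (auto simp: index_tuples_def)
  have tuL: "tu \<beta> j \<in> Lam - N0" if "\<beta> \<in> I" "j < n" for \<beta> j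
    using that k(2) \<alpha>L unfolding tu_def I_def n by (auto split: nat.split)
  have "\<exists>p \<zeta> c. p \<in> conditions Lam \<and> L G (tu \<beta>) c p \<and> base_point \<lhd> \<zeta> \<and> (\<forall>j<n. \<forall>z. (tu \<beta> j, z) \<in> dom p \<longleftrightarrow> z \<lhd> \<zeta>)"
    if \<beta>: "\<beta> \<in> I" for \<beta>
  proof -
    have e: "Map.empty \<in> conditions Lam" by (simp add: conditions_def small_finite)
    have tL: "\<forall>j<n. tu \<beta> j \<in> Lam - N0" using tuL[OF \<beta>] by blast
    obtain q c where q: "q \<in> conditions Lam" "L G (tu \<beta>) c q" using L_decides[OF G tL e] by blast
    have "small (snd ` dom q)" using q(1) by (intro small_image) (simp add: conditions_def)
    \<comment> \<open>Starting above \<open>base_point\<close> makes the rows of the tuple nonempty,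
      so the additional index occurs as a row of its own condition, as the delta system
      requires.\<close>
    then obtain \<zeta> where \<zeta>: "sc base_point \<unlhd> \<zeta>" "\<forall>z\<in>snd ` dom q. z \<lhd> \<zeta>" using exists_above by blast
    define S where "S = tu \<beta> ` {..<n} \<times> {z. z \<lhd> \<zeta>}"
    have S: "small S" "S \<subseteq> Lam \<times> UNIV" unfolding S_def
      using tL by (auto intro!: small_Sigma[OF small_image[OF small_finite[OF finite_lessThan]] small_seg])
    have q': "fill q S \<in> conditions Lam" by (rule conditions_fill[OF q(1) S])
    have "L G (tu \<beta>) c (fill q S)" by (rule L_open[OF G tL q(2) fill_le q'])
    moreover have "(tu \<beta> j, z) \<in> dom (fill q S) \<longleftrightarrow> z \<lhd> \<zeta>" if "j < n" for j z
      using \<zeta>(2) that unfolding dom_fill S_def by force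
    moreover have "base_point \<lhd> \<zeta>" using sc_gt \<zeta>(1) O.less_le_trans by blast
    ultimately show ?thesis using q' by blast
  qed
  then obtain p \<zeta> c where p: "\<And>\<beta>. \<beta> \<in> I \<Longrightarrow> p \<beta> \<in> conditions Lam" "\<And>\<beta>. \<beta> \<in> I \<Longrightarrow> L G (tu \<beta>) (c \<beta>) (p \<beta>)"
    "\<And>\<beta>. \<beta> \<in> I \<Longrightarrow> base_point \<lhd> \<zeta> \<beta>" "\<And>\<beta> j z. \<beta> \<in> I \<Longrightarrow> j < n \<Longrightarrow> (tu \<beta> j, z) \<in> dom (p \<beta>) \<longleftrightarrow> z \<lhd> \<zeta> \<beta>"
    by metis
  define st where "st \<beta> = (\<lambda>j\<in>{..<n}. row (p \<beta>) (tu \<beta> j) (\<zeta> \<beta>))" for \<beta>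
  define dat where "dat \<beta> = ((\<zeta> \<beta>, st \<beta>), c \<beta>)" for \<beta>
  define S where "S \<beta> = {(x, v). p \<beta> x = Some v}" for \<beta>
  define loc where "loc = (\<lambda>x :: ('l \<times> 'a) \<times> bool. fst (fst x))"
  have U: "|UNIV :: 'a set| \<le>o |UNIV :: 'a set|" by (rule card_of_mono1) simp
  have B: "|UNIV :: bool set| \<le>o |UNIV :: 'a set|" by (intro small_imp_le small_finite) simp
  have sdom: "small (dom (p \<beta>))" if "\<beta> \<in> I" for \<beta> using p(1)[OF that] by (simp add: conditions_def)
  have locS: "loc ` S \<beta> = fst ` dom (p \<beta>)" for \<beta> unfolding loc_def S_def by force
  have own: "\<beta> \<in> fst ` dom (p \<beta>)" if "\<beta> \<in> I" for \<beta>
  proof -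
    have "(tu \<beta> 0, base_point) \<in> dom (p \<beta>)" using p(3,4)[OF that] n by simp
    then show ?thesis by (force simp: tu_def)
  qed
  have rU: "r \<le>o |UNIV :: 'a set|" using r_ordIso(1) ordIso_imp_ordLeq by blast
  have "\<exists>N \<subseteq> I. \<exists>rt. |UNIV :: 'a set| \<le>o |N| \<and> (\<forall>i\<in>N. \<forall>i'\<in>N. dat i = dat i') \<and>
     (\<forall>i\<in>N. {x \<in> S i. loc x \<in> loc ` rt} = rt \<and> i \<notin> loc ` rt) \<and>
     (\<forall>i\<in>N. \<forall>i'\<in>N. i \<noteq> i' \<longrightarrow> loc ` S i \<inter> loc ` S i' \<subseteq> loc ` rt)"
  proof (rule delta_system[OF kappa_card(1) regular kappa_card(2) rU small_subsets_bound small_subsets_bound, where X = UNIV])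
    show "|{x \<in> UNIV. loc x \<in> R}| \<le>o |UNIV :: 'a set|" if "|R| \<le>o |UNIV :: 'a set|" for R
    proof -
      have "{x \<in> UNIV. loc x \<in> R} = (R \<times> UNIV) \<times> UNIV" by (auto simp: loc_def)
      then show ?thesis using power_Times[OF power_Times[OF that U] B] by simp
    qed
    fix i assume i: "i \<in> I"
    have "S i \<subseteq> (\<lambda>x. (x, the (p i x))) ` dom (p i)" unfolding S_def by force
    then have "small (S i)" using small_surj[OF sdom[OF i]] by blast
    then show "S i \<subseteq> UNIV \<and> small (S i) \<and> i \<in> loc ` S i" using own[OF i] locS by simp
  next
    let ?D = "(SIGMA \<zeta>:UNIV. {..<n} \<rightarrow>\<^sub>E node \<zeta>) \<times> (UNIV :: 'a set)"
    have "(SIGMA \<zeta>:UNIV. {..<n} \<rightarrow>\<^sub>E node \<zeta>) = (\<Union>\<zeta>. {\<zeta>} \<times> ({..<n} \<rightarrow>\<^sub>E node \<zeta>))" by auto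
    moreover have "|\<Union>\<zeta>. {\<zeta>} \<times> ({..<n} \<rightarrow>\<^sub>E node \<zeta>)| \<le>o |UNIV :: 'a set|"
      by (intro card_UN_bound[OF U _ infinite_UNIV] small_imp_le small_Sigma node_tuples_small small_finite) simp
    ultimately have "|SIGMA \<zeta>:UNIV. {..<n} \<rightarrow>\<^sub>E node \<zeta>| \<le>o |UNIV :: 'a set|" by simp
    then have "|?D| \<le>o |UNIV :: 'a set|" by (rule power_Times[OF _ U])
    moreover have "dat ` I \<subseteq> ?D" unfolding dat_def st_def by (auto simp: row_def node_def)
    ultimately show "|dat ` I| \<le>o |UNIV :: 'a set|" by (rule ordLeq_transitive[OF card_of_mono1, rotated])
    show "|UNIV :: 'a set| <o |I|"
    proof (rule ccontr)
      assume "\<not> |UNIV :: 'a set| <o |I|"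
      then have "|I| \<le>o |UNIV :: 'a set|" by (meson card_of_Well_order not_ordLess_iff_ordLeq)
      moreover have "|\<alpha> ` {..<d}| \<le>o |UNIV :: 'a set|" by (intro small_imp_le small_finite) simp
      ultimately have "|I \<union> \<alpha> ` {..<d}| \<le>o |UNIV :: 'a set|" by (intro card_Un_bound infinite_UNIV)
      moreover have "|UNIV :: 'a set set| \<le>o |I \<union> \<alpha> ` {..<d}|"
        using card_of_ordLeqI[OF k(1), of "I \<union> \<alpha> ` {..<d}"] by (auto simp: I_def)
      moreover have "|UNIV :: 'a set| <o |UNIV :: 'a set set|" using card_of_Pow[of "UNIV :: 'a set"] by simp
      ultimately show False by (meson not_ordLess_ordLeq ordLeq_transitive)
    qed
  qed (use U in auto)
  then obtain N rt where N: "N \<subseteq> I" "|UNIV :: 'a set| \<le>o |N|"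
    and dt': "\<forall>i\<in>N. \<forall>i'\<in>N. dat i = dat i'"
    and rt': "\<forall>i\<in>N. {x \<in> S i. loc x \<in> loc ` rt} = rt \<and> i \<notin> loc ` rt"
    and off': "\<forall>i\<in>N. \<forall>i'\<in>N. i \<noteq> i' \<longrightarrow> loc ` S i \<inter> loc ` S i' \<subseteq> loc ` rt"
    by (elim exE conjE) (rule that)
  obtain g where g: "inj_on g (UNIV :: 'a set)" "range g \<subseteq> N" using N(2) by (metis card_of_ordLeq)
  have gN: "g i \<in> N" "g i \<in> I" for i using g(2) N(1) by auto
  define b where "b i = inv k (g i)" for i
  have kb: "k (b i) = g i" for i unfolding b_def using gN(2)[of i] by (auto simp: I_def f_inv_into_f)
  have dat_eq: "dat (g i) = dat (g base_point)" for i using dt' gN(1) by blast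
  have zeq: "\<zeta> (g i) = \<zeta> (g base_point)" "st (g i) = st (g base_point)" "c (g i) = c (g base_point)" for i
    using dat_eq[of i] by (simp_all add: dat_def)
  have off: "k (b i) \<notin> fst ` dom (p (g i'))" if "i \<noteq> i'" for i i'
  proof
    assume "k (b i) \<in> fst ` dom (p (g i'))"
    moreover have "g i \<noteq> g i'" using g(1) that by (auto simp: inj_on_def)
    ultimately have "g i \<in> loc ` rt" using off' gN(1) own[OF gN(2)[of i]] unfolding kb locS by blast
    then show False using rt' gN(1) by blast
  qed
  have comp: "v = v'" if v: "p (g i) x = Some v" "p (g i') x = Some v'" for i i' x v v'
  proof (cases "g i = g i'")
    case False
    have mem: "(x, v) \<in> S (g i)" "(x, v') \<in> S (g i')" using v by (auto simp: S_def)
    have "fst x \<in> loc ` S (g i)" "fst x \<in> loc ` S (g i')" unfolding locS using v by (auto intro: imageI)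
    then have l: "fst x \<in> loc ` rt" using off' gN(1) False by blast
    have "(x, v) \<in> {y \<in> S (g i). loc y \<in> loc ` rt}" using mem l by (simp add: loc_def)
    then have "(x, v) \<in> rt" using rt' gN(1)[of i] by simp
    then have "(x, v) \<in> {y \<in> S (g i'). loc y \<in> loc ` rt}" using rt' gN(1)[of i'] by simp
    then show ?thesis using v by (simp add: S_def)
  qed (use v in simp)
  show ?thesis
  proof (intro exI conjI allI impI)
    show "inj b" using g(1) kb by (metis inj_on_def)
    show "st (g base_point) \<in> {..<n} \<rightarrow>\<^sub>E node (\<zeta> (g base_point))" unfolding st_def by (auto simp: row_def node_def)
    fix i
    show "k (b i) \<notin> \<alpha> ` {..<d}" using gN(2)[of i] by (simp add: kb I_def)
    show "p (g i) \<in> conditions Lam" by (rule p(1)[OF gN(2)])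
    show "L G (case_nat (k (b i)) \<alpha>) (c (g base_point)) (p (g i))"
      using p(2)[OF gN(2)[of i]] unfolding kb tu_def zeq[of i] .
    fix j assume j: "j < n"
    show "(case_nat (k (b i)) \<alpha> j, z) \<in> dom (p (g i)) \<longleftrightarrow> z \<lhd> \<zeta> (g base_point)" for z
      using p(4)[OF gN(2)[of i] j] unfolding kb tu_def zeq[of i] .
    have "st (g i) j = row (p (g i)) (tu (g i) j) (\<zeta> (g i))" unfolding st_def using j by simp
    then show "row (p (g i)) (case_nat (k (b i)) \<alpha> j) (\<zeta> (g base_point)) = st (g base_point) j"
      unfolding kb tu_def zeq[of i] by simp
  next
    fix i i' :: 'a assume "i \<noteq> i'"
    then show "k (b i) \<notin> fst ` dom (p (g i'))" by (rule off)
  next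
    fix i i' x v v' assume "p (g i) x = Some v" "p (g i') x = Some v'"
    then show "v = v'" by (rule comp)
  qed
qed

text \<open>The data found for each tuple of \<open>d\<close> indices become part of its type. After
  homogenization all tuples use the same additional indices, so coordinate \<open>0\<close> has an
  index for each node that does not depend on the other coordinates, although only \<open>d\<close>
  coordinates were homogenized. Two conditions are compatible for different tuples by the
  homogeneity of rows, and for different additional indices by the delta system.\<close>

lemma (in branch_limits) level_homogeneous:
  assumes G: "colouring n G" and n: "n = Suc d" and lam: "Lam = Field lam" "big_index lam \<kappa> d"
  shows "\<exists>l \<phi> c. tree_embedding n l l \<phi> \<and> (\<forall>\<gamma> v. (\<forall>j<n. v j \<in> node \<gamma>) \<longrightarrow> G (l \<gamma>) (\<lambda>j. \<phi> j \<gamma> (v j)) = c)"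
proof -
  let ?A = "Lam - N0" and ?T = "index_tuples d (Lam - N0)"
  have "|UNIV :: 'a set set| <o |Lam|" using lam by (simp add: big_index_def)
  then have "|UNIV :: 'a set set| \<le>o |?A|" using big_minus_small[OF _ N0] ordLess_imp_ordLeq by blast
  then obtain k :: "'a set \<Rightarrow> 'l" where k: "inj k" "range k \<subseteq> ?A" by (metis card_of_ordLeq)
  define ok where "ok \<alpha> b p \<zeta> stem c \<longleftrightarrow> inj b \<and> stem \<in> {..<n} \<rightarrow>\<^sub>E node \<zeta> \<and> (\<forall>i. k (b i) \<notin> \<alpha> ` {..<d} \<and>
      p i \<in> conditions Lam \<and> L G (case_nat (k (b i)) \<alpha>) c (p i) \<and>
      (\<forall>j<n. (\<forall>z. (case_nat (k (b i)) \<alpha> j, z) \<in> dom (p i) \<longleftrightarrow> z \<lhd> \<zeta>) \<and> row (p i) (case_nat (k (b i)) \<alpha> j) \<zeta> = stem j)) \<and>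
      (\<forall>i i'. i \<noteq> i' \<longrightarrow> k (b i) \<notin> fst ` dom (p i')) \<and>
      (\<forall>i i' x v v'. p i x = Some v \<longrightarrow> p i' x = Some v' \<longrightarrow> v = v')"
    for \<alpha> and b :: "'a \<Rightarrow> 'a set" and p \<zeta> stem c
  have "\<exists>b p \<zeta> stem c. ok \<alpha> b p \<zeta> stem c" if "\<alpha> \<in> ?T" for \<alpha>
    unfolding ok_def by (rule compatible_conditions[OF G n that k])
  then obtain b p \<zeta> stem c where ok: "\<And>\<alpha>. \<alpha> \<in> ?T \<Longrightarrow> ok \<alpha> (b \<alpha>) (p \<alpha>) (\<zeta> \<alpha>) (stem \<alpha>) (c \<alpha>)" by metis
  have U: "|UNIV :: 'a set| \<le>o |UNIV :: 'a set|" by (rule card_of_mono1) simp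
  have pC: "p \<alpha> i \<in> conditions Lam" if "\<alpha> \<in> ?T" for \<alpha> i using ok[OF that] unfolding ok_def by blast
  have "\<exists>w :: 'a \<Rightarrow> 'l. inj w \<and> range w = (\<Union>i. fst ` dom (p \<alpha> i)) \<union> \<alpha> ` {..<d} \<union> range (\<lambda>i. k (b \<alpha> i))"
    if \<alpha>: "\<alpha> \<in> ?T" for \<alpha>
  proof -
    let ?W = "(\<Union>i. fst ` dom (p \<alpha> i)) \<union> \<alpha> ` {..<d} \<union> range (\<lambda>i. k (b \<alpha> i))"
    have "|\<Union>i. fst ` dom (p \<alpha> i)| \<le>o |UNIV :: 'a set|"
      using pC[OF \<alpha>] by (intro card_UN_bound[OF U _ infinite_UNIV] small_imp_le small_image) (simp add: conditions_def)
    moreover have "|\<alpha> ` {..<d}| \<le>o |UNIV :: 'a set|" by (intro small_imp_le small_finite) simp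
    moreover have "|range (\<lambda>i. k (b \<alpha> i))| \<le>o |UNIV :: 'a set|" by (rule card_of_image)
    ultimately have "|?W| \<le>o |UNIV :: 'a set|" by (intro card_Un_bound infinite_UNIV)
    moreover have "|UNIV :: 'a set| \<le>o |?W|"
    proof (rule card_of_ordLeqI)
      have "inj (b \<alpha>)" using ok[OF \<alpha>] unfolding ok_def by (elim conjE)
      then show "inj_on (\<lambda>i. k (b \<alpha> i)) UNIV" using inj_compose[OF k(1)] by (simp add: comp_def)
    qed auto
    ultimately have "|UNIV :: 'a set| =o |?W|" by (simp add: ordIso_iff_ordLeq)
    then show ?thesis using card_of_ordIso[of "UNIV :: 'a set" ?W] unfolding bij_betw_def by blast
  qed
  then obtain w :: "(nat \<Rightarrow> 'l) \<Rightarrow> 'a \<Rightarrow> 'l" where wi: "\<And>\<alpha>. \<alpha> \<in> ?T \<Longrightarrow> inj (w \<alpha>)" and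
    wr: "\<And>\<alpha>. \<alpha> \<in> ?T \<Longrightarrow> range (w \<alpha>) = (\<Union>i. fst ` dom (p \<alpha> i)) \<union> \<alpha> ` {..<d} \<union> range (\<lambda>i. k (b \<alpha> i))" by metis
  \<comment> \<open>The type contains the names of the additional indices, the conditions on
    abstract rows, the common initial pieces and the limit. Each component is a subset of a set of
    size \<kappa>.\<close>
  define Ty where "Ty \<alpha> = ({(x, y). y \<in> b \<alpha> x}, {(j, e). j < d \<and> w \<alpha> e = \<alpha> j}, {(i, e). w \<alpha> e = k (b \<alpha> i)},
      {(i, (e, z), v). p \<alpha> i (w \<alpha> e, z) = Some v}, {((j, z), y). y = \<zeta> \<alpha> \<and> stem \<alpha> j z}, {c \<alpha>}, {\<zeta> \<alpha>})" for \<alpha>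
  have "|Ty ` ?T| \<le>o |UNIV :: 'a set set|"
  proof -
    let ?U = "UNIV :: 'a set"
    have B: "|UNIV :: bool set| \<le>o |?U|" by (intro small_imp_le small_finite) simp
    have "|Pow (?U \<times> ?U) \<times> Pow ((UNIV :: nat set) \<times> ?U) \<times> Pow (?U \<times> ?U) \<times> Pow (?U \<times> (?U \<times> ?U) \<times> (UNIV :: bool set)) \<times>
        Pow (((UNIV :: nat set) \<times> ?U) \<times> ?U) \<times> Pow ?U \<times> Pow ?U| \<le>o |UNIV :: 'a set set|"
      by (intro power_Times2 power_mono power_Times U nat_le B)
    moreover have "Ty ` ?T \<subseteq> Pow (?U \<times> ?U) \<times> Pow ((UNIV :: nat set) \<times> ?U) \<times> Pow (?U \<times> ?U) \<times> Pow (?U \<times> (?U \<times> ?U) \<times> (UNIV :: bool set)) \<times>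
        Pow (((UNIV :: nat set) \<times> ?U) \<times> ?U) \<times> Pow ?U \<times> Pow ?U" by auto
    ultimately show ?thesis by (rule ordLeq_transitive[OF card_of_mono1, rotated])
  qed
  then have "\<exists>ty \<F>. (\<forall>e E E'. E \<in> \<F> e \<longrightarrow> E \<subseteq> E' \<longrightarrow> E' \<subseteq> {..<d} \<longrightarrow> E' \<in> \<F> e) \<and>
     (\<forall>I :: ('a \<Rightarrow> bool) set. small I \<longrightarrow> (\<exists>h. homogeneous_supports d ?A w Ty ty \<F> I h))"
    using homogeneous_exists[OF lam(2) N0, of w Ty] wi wr unfolding lam(1)[symmetric] by blast
  then obtain ty \<F> where hom: "\<And>I :: ('a \<Rightarrow> bool) set. small I \<Longrightarrow> \<exists>h. homogeneous_supports d ?A w Ty ty \<F> I h"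
    by blast
  have Tyd: "b \<alpha> = b \<alpha>'" "w \<alpha> e = \<alpha> j \<longleftrightarrow> w \<alpha>' e = \<alpha>' j" "p \<alpha> i (w \<alpha> e, z) = p \<alpha>' i (w \<alpha>' e, z)" "\<zeta> \<alpha> = \<zeta> \<alpha>'" "stem \<alpha> = stem \<alpha>'" "c \<alpha> = c \<alpha>'"
    if T: "\<alpha> \<in> ?T" "\<alpha>' \<in> ?T" and eq: "Ty \<alpha> = Ty \<alpha>'" and j: "j < d" for \<alpha> \<alpha>' e j i z
  proof -
    note e = eq[unfolded Ty_def prod.inject]
    have e1: "{(x, y). y \<in> b \<alpha> x} = {(x, y). y \<in> b \<alpha>' x}" using e by (elim conjE)
    have e2: "{(j, e). j < d \<and> w \<alpha> e = \<alpha> j} = {(j, e). j < d \<and> w \<alpha>' e = \<alpha>' j}" using e by (elim conjE)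
    have e3: "{(i, (e, z), v). p \<alpha> i (w \<alpha> e, z) = Some v} = {(i, (e, z), v). p \<alpha>' i (w \<alpha>' e, z) = Some v}"
      using e by (elim conjE)
    have e4: "{((j, z), y). y = \<zeta> \<alpha> \<and> stem \<alpha> j z} = {((j, z), y). y = \<zeta> \<alpha>' \<and> stem \<alpha>' j z}" using e by (elim conjE)
    have "{c \<alpha>} = {c \<alpha>'}" using e by (elim conjE)
    then show "c \<alpha> = c \<alpha>'" by (rule singleton_inject)
    have "{\<zeta> \<alpha>} = {\<zeta> \<alpha>'}" using e by (elim conjE)
    then show e6: "\<zeta> \<alpha> = \<zeta> \<alpha>'" by (rule singleton_inject)
    show "b \<alpha> = b \<alpha>'"
    proof (intro ext set_eqI)
      fix x y have "(x, y) \<in> {(x, y). y \<in> b \<alpha> x} \<longleftrightarrow> (x, y) \<in> {(x, y). y \<in> b \<alpha>' x}" unfolding e1 ..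
      then show "y \<in> b \<alpha> x \<longleftrightarrow> y \<in> b \<alpha>' x" by simp
    qed
    have "(j, e) \<in> {(j, e). j < d \<and> w \<alpha> e = \<alpha> j} \<longleftrightarrow> (j, e) \<in> {(j, e). j < d \<and> w \<alpha>' e = \<alpha>' j}" unfolding e2 ..
    then show "w \<alpha> e = \<alpha> j \<longleftrightarrow> w \<alpha>' e = \<alpha>' j" using j by simp
    have "p \<alpha> i (w \<alpha> e, z) = Some v \<longleftrightarrow> p \<alpha>' i (w \<alpha>' e, z) = Some v" for v
    proof -
      have "(i, (e, z), v) \<in> {(i, (e, z), v). p \<alpha> i (w \<alpha> e, z) = Some v} \<longleftrightarrow> (i, (e, z), v) \<in> {(i, (e, z), v). p \<alpha>' i (w \<alpha>' e, z) = Some v}"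
        unfolding e3 ..
      then show ?thesis by simp
    qed
    then show "p \<alpha> i (w \<alpha> e, z) = p \<alpha>' i (w \<alpha>' e, z)" by (metis not_None_eq)
    show "stem \<alpha> = stem \<alpha>'"
    proof (intro ext)
      fix j z have "((j, z), \<zeta> \<alpha>) \<in> {((j, z), y). y = \<zeta> \<alpha> \<and> stem \<alpha> j z} \<longleftrightarrow> ((j, z), \<zeta> \<alpha>) \<in> {((j, z), y). y = \<zeta> \<alpha>' \<and> stem \<alpha>' j z}"
        unfolding e4 ..
      then show "stem \<alpha> j z = stem \<alpha>' j z" using e6 by simp
    qed
  qed
  \<comment> \<open>A single tuple, from a one-element index set, names the data that all tuples of
    type \<open>ty\<close> have in common.\<close>
  have "small {\<lambda>_ :: 'a. False}" by (rule small_finite) simp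
  from hom[OF this] obtain h0 where h0: "homogeneous_supports d ?A w Ty ty \<F> {\<lambda>_ :: 'a. False} h0" by auto
  define u0 where "u0 = (\<lambda>j\<in>{..<d}. (\<lambda>_ :: 'a. False))"
  define \<alpha>0 where "\<alpha>0 = tuple d h0 u0"
  have "u0 \<in> {..<d} \<rightarrow>\<^sub>E {\<lambda>_. False}" by (auto simp: u0_def)
  then have \<alpha>0: "\<alpha>0 \<in> ?T" "Ty \<alpha>0 = ty" using h0 unfolding homogeneous_supports_def \<alpha>0_def by blast+
  have d: "0 < d" using lam(2) by (simp add: big_index_def)
  let ?\<zeta> = "\<zeta> \<alpha>0" and ?stem = "stem \<alpha>0" and ?c = "c \<alpha>0" and ?b = "b \<alpha>0"
  have stemN: "?stem j \<in> node ?\<zeta>" if "j < n" for j using ok[OF \<alpha>0(1)] that unfolding ok_def by auto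
  have "\<exists>l \<phi>. tree_embedding n l l \<phi> \<and> (\<forall>\<gamma> v. (\<forall>j<n. v j \<in> node \<gamma>) \<longrightarrow> G (l \<gamma>) (\<lambda>j. \<phi> j \<gamma> (v j)) = ?c)"
  proof (rule strong_subtree[where stem = ?stem and \<zeta> = ?\<zeta>])
    show "?stem j \<in> node ?\<zeta>" if "j < n" for j by (rule stemN[OF that])
    fix \<eta> assume \<eta>: "?\<zeta> \<unlhd> \<eta>"
    obtain h where h: "homogeneous_supports d ?A w Ty ty \<F> (node \<eta>) h" using hom[OF small_node] by blast
    define PN where "PN = ({..<d} \<rightarrow>\<^sub>E node \<eta>)"
    define tp where "tp u = tuple d h u" for u
    have tpT: "tp u \<in> ?T" "Ty (tp u) = Ty \<alpha>0" if "u \<in> PN" for u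
      using h that \<alpha>0(2) unfolding homogeneous_supports_def tp_def PN_def by blast+
    have weq: "w (tp u) e = w (tp u') e' \<longleftrightarrow> e = e' \<and> agree d u u' \<in> \<F> e" if "u \<in> PN" "u' \<in> PN" for u u' e e'
      using h that unfolding homogeneous_supports_def tp_def PN_def by blast
    have hinj: "h j x = h j' x' \<Longrightarrow> j = j' \<and> x = x'" if "j < d" "j' < d" "x \<in> node \<eta>" "x' \<in> node \<eta>" for j j' x x'
      using h that unfolding homogeneous_supports_def by blast
    note ty0 = Tyd[OF tpT(1) \<alpha>0(1) tpT(2) d]
    have tpj: "tp u j = h j (u j)" if "j < d" for u j using that by (simp add: tp_def tuple_def)
    have PNm: "u j \<in> node \<eta>" if "u \<in> PN" "j < d" for u j using that by (auto simp: PN_def)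
    define cst where "cst x = (\<lambda>j\<in>{..<d}. x)" for x :: "'a \<Rightarrow> bool"
    have cstP: "cst x \<in> PN" if "x \<in> node \<eta>" for x using that by (auto simp: cst_def PN_def)
    \<comment> \<open>Each node of level \<open>\<eta>\<close> gets its own member of the
      \<kappa>-sequence of additional indices.\<close>
    obtain i0 :: "('a \<Rightarrow> bool) \<Rightarrow> 'a" where i0: "inj_on i0 (node \<eta>)"
      using small_imp_le[OF small_node, of \<eta>] by (metis card_of_ordLeq)
    define \<beta> where "\<beta> v = k (?b (i0 v))" for v
    define pp where "pp v u = p (tp u) (i0 v)" for v u
    have ok': "\<beta> v \<notin> tp u ` {..<d}" "pp v u \<in> conditions Lam" "L G (case_nat (\<beta> v) (tp u)) ?c (pp v u)"
      "\<And>j z. j < n \<Longrightarrow> (case_nat (\<beta> v) (tp u) j, z) \<in> dom (pp v u) \<longleftrightarrow> z \<lhd> ?\<zeta>"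
      "\<And>j. j < n \<Longrightarrow> row (pp v u) (case_nat (\<beta> v) (tp u) j) ?\<zeta> = ?stem j"
      if "u \<in> PN" for v u
    proof -
      have okr: "ok (tp u) ?b (p (tp u)) ?\<zeta> ?stem ?c"
        using ok[OF tpT(1)[OF that]] unfolding ty0(1,4,5,6)[OF that that] .
      note oi = okr[unfolded ok_def, THEN conjunct2, THEN conjunct2, THEN conjunct1, THEN spec, of "i0 v"]
      note o1 = oi[THEN conjunct1] and o2 = oi[THEN conjunct2, THEN conjunct1]
        and o3 = oi[THEN conjunct2, THEN conjunct2, THEN conjunct1] and o4 = oi[THEN conjunct2, THEN conjunct2, THEN conjunct2]
      show "\<beta> v \<notin> tp u ` {..<d}" "pp v u \<in> conditions Lam" "L G (case_nat (\<beta> v) (tp u)) ?c (pp v u)"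
        unfolding \<beta>_def pp_def by (rule o1 o2 o3)+
      fix j assume j: "j < n"
      show "(case_nat (\<beta> v) (tp u) j, z) \<in> dom (pp v u) \<longleftrightarrow> z \<lhd> ?\<zeta>" for z
        using o4[rule_format, OF j, THEN conjunct1, rule_format, of z] unfolding \<beta>_def pp_def .
      show "row (pp v u) (case_nat (\<beta> v) (tp u) j) ?\<zeta> = ?stem j"
        using o4[rule_format, OF j, THEN conjunct2] unfolding \<beta>_def pp_def .
    qed
    have off: "\<beta> v \<notin> fst ` dom (pp v' u)" if "u \<in> PN" "v \<in> node \<eta>" "v' \<in> node \<eta>" "v \<noteq> v'" for v v' u
    proof -
      have "i0 v \<noteq> i0 v'" using i0 that by (auto simp: inj_on_def)
      then show ?thesis using ok[OF tpT(1)[OF that(1)]] ty0(1)[OF that(1,1)] unfolding ok_def \<beta>_def pp_def by auto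
    qed
    have rows: "fst ` dom (pp v u) \<subseteq> range (w (tp u))" if "u \<in> PN" for v u
      unfolding wr[OF tpT(1)[OF that]] pp_def by blast
    have \<beta>_inj: "v = v'" if "\<beta> v = \<beta> v'" "v \<in> node \<eta>" "v' \<in> node \<eta>" for v v'
    proof -
      have "?b (i0 v) = ?b (i0 v')" using that(1) k(1) unfolding \<beta>_def inj_def by blast
      then have "i0 v = i0 v'" using ok[OF \<alpha>0(1)] unfolding ok_def inj_def by blast
      then show ?thesis using i0 that by (auto simp: inj_on_def)
    qed
    \<comment> \<open>A common row has the same position in both enumerations; equality of types
      then allows \<open>u'\<close> to be replaced by \<open>u\<close>, and for a single tuple the
      conditions are compatible.\<close>
    have comp_pp: "x = x'" if u: "u \<in> PN" "u' \<in> PN" and v: "pp v u (l, z) = Some x" "pp v' u' (l, z) = Some x'" for u u' v v' l z x x'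
    proof -
      have l: "l \<in> fst ` dom (pp v u)" "l \<in> fst ` dom (pp v' u')" using v by force+
      obtain e where e1: "l = w (tp u) e" using subsetD[OF rows[OF u(1)] l(1)] by (elim rangeE)
      obtain e' where e2: "l = w (tp u') e'" using subsetD[OF rows[OF u(2)] l(2)] by (elim rangeE)
      note e = e1 e2
      then have "e = e'" using weq[OF u, of e e'] by simp
      then have "pp v' u (w (tp u) e, z) = Some x'"
        using v(2) e(2) ty0(3)[OF u(1,1), of "i0 v'" e z] ty0(3)[OF u(2,2), of "i0 v'" e z] unfolding pp_def by simp
      then show ?thesis using v(1) e(1) ok[OF tpT(1)[OF u(1)]] unfolding ok_def pp_def by blast
    qed
    \<comment> \<open>\<open>h j x\<close> is the \<open>j\<close>-th index of the constant tuple
      \<open>cst x\<close>, and the position of the \<open>j\<close>-th index belongs to the type.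
      So if this row occurs in the enumeration for \<open>u\<close>, it stands at the position of
      the \<open>j\<close>-th index of \<open>u\<close>.\<close>
    have hrow: "u j = x" if u: "u \<in> PN" and j: "j < d" "x \<in> node \<eta>" and l: "h j x \<in> fst ` dom (pp v u)" for u v j x
    proof -
      obtain e where e: "w (tp u) e = h j x" using rows[OF u] l by (metis imageE subsetD)
      note cx = cstP[OF j(2)]
      have hx: "tp (cst x) j = h j x" using tpj[OF j(1)] j(1) by (simp add: cst_def)
      have "tp (cst x) j \<in> range (w (tp (cst x)))" unfolding wr[OF tpT(1)[OF cx]] using j(1) by blast
      then obtain e' where e': "w (tp (cst x)) e' = h j x" unfolding hx by (metis imageE)
      have "e = e'" using weq[OF u cx, of e e'] e e' by simp
      moreover have "w (tp (cst x)) e' = tp (cst x) j" using e' hx by simp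
      then have "w (tp u) e' = tp u j"
        using Tyd(2)[OF tpT(1)[OF u] tpT(1)[OF cx] _ j(1), of e'] tpT(2)[OF u] tpT(2)[OF cx] by simp
      ultimately have "h j (u j) = h j x" using e tpj[OF j(1), of u] by simp
      then show ?thesis using hinj[OF j(1,1) PNm[OF u j(1)] j(2)] by simp
    qed
    \<comment> \<open>The bits of a node from the stem level up to \<open>\<eta>\<close>. They
      cannot clash with the conditions \<open>pp\<close>, in which the rows of the indices end
      exactly at the stem level.\<close>
    define rx where "rx l x = (\<lambda>(l', z). if l' = l \<and> ?\<zeta> \<unlhd> z \<and> z \<lhd> \<eta> then Some (x z) else None)" for l :: 'l and x :: "'a \<Rightarrow> bool"
    define A where "A = (\<lambda>(v, u). pp v u) ` (node \<eta> \<times> PN) \<union> (\<lambda>v. rx (\<beta> v) v) ` node \<eta> \<union>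
        (\<lambda>(j, x). rx (h j x) x) ` ({..<d} \<times> node \<eta>)"
    have cmp_rx: "\<not> (z \<lhd> \<eta> \<and> ?\<zeta> \<unlhd> z \<and> (l, z) \<in> dom (pp v u))"
      if u: "u \<in> PN" and v: "v \<in> node \<eta>" and l: "(\<exists>v'\<in>node \<eta>. l = \<beta> v') \<or> (\<exists>j<d. \<exists>x\<in>node \<eta>. l = h j x)" for u v l z
    proof
      assume a: "z \<lhd> \<eta> \<and> ?\<zeta> \<unlhd> z \<and> (l, z) \<in> dom (pp v u)"
      then have f: "l \<in> fst ` dom (pp v u)" by force
      have "\<exists>j<n. l = case_nat (\<beta> v) (tp u) j"
        using l
      proof (elim disjE bexE exE conjE)
        fix v' assume "v' \<in> node \<eta>" "l = \<beta> v'"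
        then have "v' = v" using off[OF u] v f by blast
        then show ?thesis using \<open>l = \<beta> v'\<close> n by (intro exI[of _ 0]) simp
      next
        fix j x assume j: "j < d" "x \<in> node \<eta>" "l = h j x"
        then have "u j = x" using hrow[OF u j(1,2)] f by blast
        then show ?thesis using j tpj[OF j(1), of u] n by (intro exI[of _ "Suc j"]) simp
      qed
      then have "z \<lhd> ?\<zeta>" using ok'(4)[OF u] a by blast
      then show False using a O.not_le by blast
    qed
    have \<beta>h: "\<beta> v \<noteq> h j x" if "j < d" "x \<in> node \<eta>" for v j x
    proof -
      have "tp (cst x) j \<in> tp (cst x) ` {..<d}" using that(1) by simp
      moreover have "tp (cst x) j = h j x" using tpj[OF that(1), of "cst x"] that(1) by (simp add: cst_def)
      ultimately show ?thesis using ok'(1)[OF cstP[OF that(2)], of v] by metis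
    qed
    have "compatible A" unfolding compatible_def
    proof (intro ballI allI impI)
      fix g g' y x x' assume g: "g \<in> A" "g' \<in> A" "g y = Some x" "g' y = Some x'"
      obtain l z where y: "y = (l, z)" by (cases y)
      have cases: "(\<exists>v u. v \<in> node \<eta> \<and> u \<in> PN \<and> g = pp v u) \<or> (z \<lhd> \<eta> \<and> ?\<zeta> \<unlhd> z \<and>
          ((\<exists>v'\<in>node \<eta>. l = \<beta> v' \<and> x = v' z) \<or> (\<exists>j<d. \<exists>a\<in>node \<eta>. l = h j a \<and> x = a z)))"
        if "g \<in> A" "g y = Some x" for g x
        using that unfolding A_def y by (auto simp: rx_def split: if_splits)
      show "x = x'"
        using cases[OF g(1,3)] cases[OF g(2,4)]
      proof (elim disjE[of "\<exists>v u. _ v u"])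
        assume "\<exists>v u. v \<in> node \<eta> \<and> u \<in> PN \<and> g = pp v u" "\<exists>v u. v \<in> node \<eta> \<and> u \<in> PN \<and> g' = pp v u"
        then show ?thesis using comp_pp g(3,4) y by blast
      next
        assume "\<exists>v u. v \<in> node \<eta> \<and> u \<in> PN \<and> g = pp v u" "z \<lhd> \<eta> \<and> ?\<zeta> \<unlhd> z \<and>
          ((\<exists>v'\<in>node \<eta>. l = \<beta> v' \<and> x' = v' z) \<or> (\<exists>j<d. \<exists>a\<in>node \<eta>. l = h j a \<and> x' = a z))"
        then show ?thesis using cmp_rx[of _ _ l z] g(3) y by blast
      next
        assume "\<exists>v u. v \<in> node \<eta> \<and> u \<in> PN \<and> g' = pp v u" "z \<lhd> \<eta> \<and> ?\<zeta> \<unlhd> z \<and>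
          ((\<exists>v'\<in>node \<eta>. l = \<beta> v' \<and> x = v' z) \<or> (\<exists>j<d. \<exists>a\<in>node \<eta>. l = h j a \<and> x = a z))"
        then show ?thesis using cmp_rx[of _ _ l z] g(4) y by blast
      next
        assume a: "z \<lhd> \<eta> \<and> ?\<zeta> \<unlhd> z \<and>
          ((\<exists>v'\<in>node \<eta>. l = \<beta> v' \<and> x = v' z) \<or> (\<exists>j<d. \<exists>a\<in>node \<eta>. l = h j a \<and> x = a z))"
          "z \<lhd> \<eta> \<and> ?\<zeta> \<unlhd> z \<and>
          ((\<exists>v'\<in>node \<eta>. l = \<beta> v' \<and> x' = v' z) \<or> (\<exists>j<d. \<exists>a\<in>node \<eta>. l = h j a \<and> x' = a z))"
        then show ?thesis
        proof (elim conjE disjE bexE exE)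
          fix v v' assume "v \<in> node \<eta>" "l = \<beta> v" "x = v z" "v' \<in> node \<eta>" "l = \<beta> v'" "x' = v' z"
          then show ?thesis using \<beta>_inj[of v v'] by simp
        next
          fix v j b assume "v \<in> node \<eta>" "l = \<beta> v" "j < d" "b \<in> node \<eta>" "l = h j b"
          then show ?thesis using \<beta>h[of j b v] by simp
        next
          fix v j b assume "v \<in> node \<eta>" "l = \<beta> v" "j < d" "b \<in> node \<eta>" "l = h j b"
          then show ?thesis using \<beta>h[of j b v] by simp
        next
          fix j b j' b' assume "j < d" "b \<in> node \<eta>" "l = h j b" "x = b z" "j' < d" "b' \<in> node \<eta>" "l = h j' b'" "x' = b' z"
          then show ?thesis using hinj[of j j' b b'] by simp
        qed
      qed
    qed
    note up = merge_upper[OF this]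
    have \<beta>L: "\<beta> v \<in> Lam - N0" for v using k(2) by (auto simp: \<beta>_def)
    have hL: "h j x \<in> Lam - N0" if "j < d" "x \<in> node \<eta>" for j x
    proof -
      have "tp (cst x) j \<in> Lam - N0" using tpT(1)[OF cstP[OF that(2)]] that(1) by (auto simp: index_tuples_def)
      then show ?thesis using tpj[OF that(1), of "cst x"] that(1) by (simp add: cst_def)
    qed
    have rxC: "rx l x \<in> conditions Lam" if "l \<in> Lam - N0" for l x
    proof -
      have "dom (rx l x) \<subseteq> {l} \<times> {z. z \<lhd> \<eta>}" by (auto simp: rx_def split: if_splits)
      moreover have "small ({l} \<times> {z. z \<lhd> \<eta>})" by (rule small_Sigma[OF small_finite small_seg]) simp
      ultimately show ?thesis using that small_mono unfolding conditions_def by blast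
    qed
    have PNs: "small PN" unfolding PN_def by (rule node_tuples_small)
    have AC: "merge A \<in> conditions Lam"
    proof (rule conditions_merge)
      show "small A" unfolding A_def
        by (intro small_Un small_image small_Sigma small_node PNs small_finite[OF finite_lessThan])
      show "A \<subseteq> conditions Lam" unfolding A_def using ok'(2) rxC \<beta>L hL by auto
    qed
    define I where "I = (\<lambda>(v, u). (G, case_nat (\<beta> v) (tp u), ?c)) ` (node \<eta> \<times> PN)"
    have Is: "small I" unfolding I_def by (intro small_image small_Sigma small_node PNs)
    have IL: "\<forall>(F, \<alpha>, c)\<in>I. colouring n F \<and> (\<forall>j<n. \<alpha> j \<in> Lam - N0) \<and> L F \<alpha> c (merge A)"
    proof -
      have "(\<forall>j<n. case_nat (\<beta> v) (tp u) j \<in> Lam - N0) \<and> L G (case_nat (\<beta> v) (tp u)) ?c (merge A)"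
        if v: "v \<in> node \<eta>" and u: "u \<in> PN" for v u
      proof -
        have m: "\<forall>j<n. case_nat (\<beta> v) (tp u) j \<in> Lam - N0"
          using \<beta>L[of v] hL PNm[OF u] tpj unfolding n by (auto split: nat.split)
        have "pp v u \<in> A" using v u unfolding A_def by force
        then show ?thesis using m L_open[OF G m ok'(3)[OF u] up AC] by blast
      qed
      then show ?thesis using G unfolding I_def by auto
    qed
    obtain q \<xi> where q: "q \<in> conditions Lam" "merge A \<subseteq>\<^sub>m q" "\<eta> \<lhd> \<xi>"
      and qI': "\<forall>(F, \<alpha>, c)\<in>I. (\<forall>j<n. full q (\<alpha> j) \<xi>) \<and> F \<xi> (\<lambda>j. row q (\<alpha> j) \<xi>) = c"
      using L_pick[OF AC Is IL, of \<eta>] by (elim bexE exE conjE)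
    have qI: "(\<forall>j<n. full q (case_nat (\<beta> v) (tp u) j) \<xi>) \<and> G \<xi> (\<lambda>j. row q (case_nat (\<beta> v) (tp u) j) \<xi>) = ?c"
      if "v \<in> node \<eta>" "u \<in> PN" for v u
    proof -
      have "(G, case_nat (\<beta> v) (tp u), ?c) \<in> I" using that unfolding I_def by force
      from bspec[OF qI' this] show ?thesis by simp
    qed
    have Aq: "q (l, z) = Some x" if "g \<in> A" "g (l, z) = Some x" for g l z x
      using map_le_trans[OF up[OF that(1)] q(2)] that(2) unfolding map_le_def by (metis domI)
    define E where "E j v = row q (case j of 0 \<Rightarrow> \<beta> v | Suc j' \<Rightarrow> h j' v) \<xi>" for j v
    have cutE: "cut \<eta> (row q l \<xi>) = x"
      if x: "x \<in> node \<eta>" "cut ?\<zeta> x = ?stem j" and j: "j < n" and l: "rx l x \<in> A"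
        and vu: "v \<in> node \<eta>" "u \<in> PN" "case_nat (\<beta> v) (tp u) j = l" for l x j v u
    proof (rule ext)
      fix z
      show "cut \<eta> (row q l \<xi>) z = x z"
      proof (cases "z \<lhd> \<eta>")
        case zl: True
        have z\<xi>: "z \<lhd> \<xi>" using zl q(3) lt_trans by blast
        show ?thesis
        proof (cases "z \<lhd> ?\<zeta>")
          case True
          have "(l, z) \<in> dom (pp v u)" using ok'(4)[OF vu(2) j, of v z] vu(3) True by simp
          then obtain y where y: "pp v u (l, z) = Some y" by auto
          have "pp v u \<in> A" using vu unfolding A_def by force
          then have "q (l, z) = Some y" using Aq y by blast
          moreover have "?stem j z = y" using ok'(5)[OF vu(2) j, of v, symmetric] vu(3) y True by (simp add: row_def)
          moreover have "x z = ?stem j z" using x(2)[symmetric] True by (simp add: cut_def)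
          ultimately show ?thesis using zl z\<xi> by (simp add: cut_def row_def)
        next
          case False
          then have "rx l x (l, z) = Some (x z)" using zl by (simp add: rx_def O.not_less)
          then have "q (l, z) = Some (x z)" using Aq l by blast
          then show ?thesis using zl z\<xi> by (simp add: cut_def row_def)
        qed
      qed (use x(1) in \<open>auto simp: cut_def node_def\<close>)
    qed
    have F: "(\<lambda>_. False) \<in> node \<eta>" by (simp add: node_def)
    show "\<exists>\<xi> E. \<eta> \<lhd> \<xi> \<and>
      (\<forall>j<n. \<forall>v\<in>node \<eta>. cut ?\<zeta> v = ?stem j \<longrightarrow> E j v \<in> node \<xi> \<and> cut \<eta> (E j v) = v) \<and>
      (\<forall>v. (\<forall>j<n. v j \<in> node \<eta> \<and> cut ?\<zeta> (v j) = ?stem j) \<longrightarrow> G \<xi> (\<lambda>j. E j (v j)) = ?c)"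
    proof (intro exI[of _ \<xi>] exI[of _ E] conjI allI ballI impI)
      show "\<eta> \<lhd> \<xi>" by (rule q(3))
      fix j v assume j: "j < n" and v: "v \<in> node \<eta>" and st: "cut ?\<zeta> v = ?stem j"
      show "E j v \<in> node \<xi>" by (simp add: E_def row_def node_def)
      show "cut \<eta> (E j v) = v"
      proof (cases j)
        case 0
        have "rx (\<beta> v) v \<in> A" using v unfolding A_def by blast
        then show ?thesis using cutE[OF v st j _ v cstP[OF F], of "\<beta> v"] 0 by (simp add: E_def)
      next
        case (Suc j')
        then have j': "j' < d" using j n by simp
        have "rx (h j' v) v \<in> A" using v j' unfolding A_def by force
        then show ?thesis using cutE[OF v st j _ v cstP[OF v], of "h j' v"] Suc j' tpj[OF j', of "cst v"]
          by (simp add: E_def cst_def)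
      qed
    next
      fix v assume v: "\<forall>j<n. v j \<in> node \<eta> \<and> cut ?\<zeta> (v j) = ?stem j"
      define u where "u = (\<lambda>j\<in>{..<d}. v (Suc j))"
      have u: "u \<in> PN" using v n by (auto simp: u_def PN_def)
      have "v 0 \<in> node \<eta>" using v n by simp
      have "G \<xi> (\<lambda>j. E j (v j)) = G \<xi> (\<lambda>j. row q (case_nat (\<beta> (v 0)) (tp u) j) \<xi>)"
      proof (rule colouring_cong[OF G])
        fix j assume "j < n"
        then show "E j (v j) = row q (case_nat (\<beta> (v 0)) (tp u) j) \<xi>"
          using tpj[of "j - 1" u] n by (cases j) (simp_all add: E_def u_def)
      qed
      then show "G \<xi> (\<lambda>j. E j (v j)) = ?c" using qI[OF \<open>v 0 \<in> node \<eta>\<close> u] by simp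
    qed
  qed
  then show ?thesis by blast
qed

section \<open>Colourings of tuples of nodes of different levels\<close>

context inacc_wo
begin

section \<open>Properties and composition of tree embeddings\<close>

lemma te_mono:
  assumes "tree_embedding m l s \<phi>"
  shows "\<gamma> \<lhd> \<delta> \<Longrightarrow> l \<gamma> \<lhd> l \<delta>" "l \<gamma> \<lhd> l \<delta> \<longleftrightarrow> \<gamma> \<lhd> \<delta>" "\<gamma> \<unlhd> \<delta> \<Longrightarrow> l \<gamma> \<unlhd> l \<delta>" "l \<gamma> = l \<delta> \<longleftrightarrow> \<gamma> = \<delta>"
    "l \<gamma> \<unlhd> s \<gamma>" "\<gamma> \<lhd> \<delta> \<Longrightarrow> s \<gamma> \<lhd> l \<delta>"
proof -
  note t = assms[unfolded tree_embedding_def]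
  have 1: "l \<gamma> \<unlhd> s \<gamma>" and 2: "\<gamma> \<lhd> \<delta> \<Longrightarrow> s \<gamma> \<lhd> l \<delta>" for \<gamma> \<delta>
    using t[THEN conjunct1] t[THEN conjunct2, THEN conjunct1] by blast+
  then have 3: "\<gamma> \<lhd> \<delta> \<Longrightarrow> l \<gamma> \<lhd> l \<delta>" for \<gamma> \<delta> using O.le_less_trans by blast
  show "l \<gamma> \<unlhd> s \<gamma>" "\<gamma> \<lhd> \<delta> \<Longrightarrow> s \<gamma> \<lhd> l \<delta>" "\<gamma> \<lhd> \<delta> \<Longrightarrow> l \<gamma> \<lhd> l \<delta>" using 1 2 3 by blast+
  show 4: "l \<gamma> \<lhd> l \<delta> \<longleftrightarrow> \<gamma> \<lhd> \<delta>" for \<gamma> \<delta> using 3 lt_total irrefl lt_trans by metis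
  show "\<gamma> \<unlhd> \<delta> \<Longrightarrow> l \<gamma> \<unlhd> l \<delta>" using 3 unfolding le_def by blast
  show "l \<gamma> = l \<delta> \<longleftrightarrow> \<gamma> = \<delta>" using 4 lt_total irrefl by metis
qed

lemma te_node: "tree_embedding m l s \<phi> \<Longrightarrow> j < m \<Longrightarrow> x \<in> node \<gamma> \<Longrightarrow> \<phi> j \<gamma> x \<in> node (l \<gamma>)"
  unfolding tree_embedding_def by blast

lemma te_cut: "tree_embedding m l s \<phi> \<Longrightarrow> j < m \<Longrightarrow> x \<in> node \<gamma>' \<Longrightarrow> \<gamma> \<lhd> \<gamma>' \<Longrightarrow> cut (l \<gamma>) (\<phi> j \<gamma>' x) = \<phi> j \<gamma> (cut \<gamma> x)"
  unfolding tree_embedding_def by blast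

lemma te_split: "tree_embedding m l s \<phi> \<Longrightarrow> j < m \<Longrightarrow> x \<in> node \<gamma>' \<Longrightarrow> \<gamma> \<lhd> \<gamma>' \<Longrightarrow> \<phi> j \<gamma>' x (s \<gamma>) = x \<gamma>"
  unfolding tree_embedding_def by blast

lemma te_agree:
  assumes "tree_embedding m l s \<phi>" "j < m" "x1 \<in> node \<gamma>1" "x2 \<in> node \<gamma>2" "\<gamma> \<lhd> \<gamma>1" "\<gamma> \<lhd> \<gamma>2" "cut \<gamma> x1 = cut \<gamma> x2"
  shows "cut (s \<gamma>) (\<phi> j \<gamma>1 x1) = cut (s \<gamma>) (\<phi> j \<gamma>2 x2)"
  by (rule assms(1)[unfolded tree_embedding_def, THEN conjunct2, THEN conjunct2, THEN conjunct2, THEN conjunct2,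
      rule_format, OF assms(2-7)])

lemma te_comp:
  assumes a: "tree_embedding m l s \<phi>" and b: "tree_embedding m l' s' \<phi>'"
  shows "tree_embedding m (\<lambda>\<gamma>. l (l' \<gamma>)) (\<lambda>\<gamma>. s (s' \<gamma>)) (\<lambda>j \<gamma> x. \<phi> j (l' \<gamma>) (\<phi>' j \<gamma> x))"
  unfolding tree_embedding_def
proof (intro conjI allI impI ballI)
  show "l (l' \<gamma>) \<unlhd> s (s' \<gamma>)" for \<gamma>
    using te_mono(3)[OF a te_mono(5)[OF b]] te_mono(5)[OF a] O.order_trans by blast
  show "s (s' \<gamma>) \<lhd> l (l' \<gamma>')" if "\<gamma> \<lhd> \<gamma>'" for \<gamma> \<gamma>' by (rule te_mono(6)[OF a te_mono(6)[OF b that]])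
  show "\<phi> j (l' \<gamma>) (\<phi>' j \<gamma> x) \<in> node (l (l' \<gamma>))" if "j < m" "x \<in> node \<gamma>" for j \<gamma> x
    by (rule te_node[OF a that(1) te_node[OF b that]])
  fix j \<gamma> \<gamma>' x assume j: "j < m" and x: "x \<in> node \<gamma>'" and g: "\<gamma> \<lhd> \<gamma>'"
  note n = te_node[OF b j x]
  show "cut (l (l' \<gamma>)) (\<phi> j (l' \<gamma>') (\<phi>' j \<gamma>' x)) = \<phi> j (l' \<gamma>) (\<phi>' j \<gamma> (cut \<gamma> x))"
    using te_cut[OF a j n te_mono(1)[OF b g]] te_cut[OF b j x g] by simp
  show "\<phi> j (l' \<gamma>') (\<phi>' j \<gamma>' x) (s (s' \<gamma>)) = x \<gamma>"
    using te_split[OF a j n te_mono(6)[OF b g]] te_split[OF b j x g] by simp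
next
  fix j \<gamma> \<gamma>1 \<gamma>2 x1 x2 assume h: "j < m" "x1 \<in> node \<gamma>1" "x2 \<in> node \<gamma>2" "\<gamma> \<lhd> \<gamma>1" "\<gamma> \<lhd> \<gamma>2" "cut \<gamma> x1 = cut \<gamma> x2"
  show "cut (s (s' \<gamma>)) (\<phi> j (l' \<gamma>1) (\<phi>' j \<gamma>1 x1)) = cut (s (s' \<gamma>)) (\<phi> j (l' \<gamma>2) (\<phi>' j \<gamma>2 x2))"
    by (rule te_agree[OF a h(1) te_node[OF b h(1,2)] te_node[OF b h(1,3)] te_mono(6)[OF b h(4)] te_mono(6)[OF b h(5)]
       te_agree[OF b h]])
qed

lemma te_id: "tree_embedding m (\<lambda>\<gamma>. \<gamma>) (\<lambda>\<gamma>. \<gamma>) (\<lambda>j \<gamma> x. x)"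
  unfolding tree_embedding_def by (auto simp: le_def)

section \<open>Pullbacks of colourings, and dependence on the nodes above a level\<close>

definition pull_col :: "((nat \<Rightarrow> 'a) \<Rightarrow> (nat \<Rightarrow> 'a \<Rightarrow> bool) \<Rightarrow> 'a) \<Rightarrow> ('a \<Rightarrow> 'a) \<Rightarrow> (nat \<Rightarrow> 'a \<Rightarrow> ('a \<Rightarrow> bool) \<Rightarrow> 'a \<Rightarrow> bool) \<Rightarrow>
    (nat \<Rightarrow> 'a) \<Rightarrow> (nat \<Rightarrow> 'a \<Rightarrow> bool) \<Rightarrow> 'a" where
  "pull_col f l \<phi> = (\<lambda>g x. f (\<lambda>j. l (g j)) (\<lambda>j. \<phi> j (g j) (x j)))"

definition node_col :: "nat \<Rightarrow> ((nat \<Rightarrow> 'a) \<Rightarrow> (nat \<Rightarrow> 'a \<Rightarrow> bool) \<Rightarrow> 'a) \<Rightarrow> bool" where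
  "node_col m f \<longleftrightarrow> (\<forall>g x g' x'. (\<forall>j<m. g j = g' j \<and> x j = x' j) \<longrightarrow> f g x = f g' x') \<and> (\<exists>D. \<forall>g x. f g x \<lhd> D)"

text \<open>The nodes in \<open>J\<close>, of level at most \<open>\<mu>\<close>, enter as they are;
  of the others, which lie above \<open>\<mu>\<close>, only the restrictions to \<open>\<mu>\<close>
  and the order of the levels may matter. If \<open>J\<close> contains all coordinates this says
  nothing new; for singletons it reduces the colouring to nodes of one common level.\<close>

definition determined :: "nat \<Rightarrow> nat set \<Rightarrow> ((nat \<Rightarrow> 'a) \<Rightarrow> (nat \<Rightarrow> 'a \<Rightarrow> bool) \<Rightarrow> 'a) \<Rightarrow> bool" where
  "determined m J f \<longleftrightarrow> (\<forall>g x g' x' \<mu>.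
     (\<forall>j<m. x j \<in> node (g j) \<and> x' j \<in> node (g' j)) \<longrightarrow>
     (\<forall>j\<in>J. g j = g' j \<and> x j = x' j \<and> g j \<unlhd> \<mu>) \<longrightarrow>
     (\<forall>j<m. j \<notin> J \<longrightarrow> \<mu> \<lhd> g j \<and> \<mu> \<lhd> g' j \<and> cut \<mu> (x j) = cut \<mu> (x' j)) \<longrightarrow>
     (\<forall>i<m. \<forall>j<m. i \<notin> J \<longrightarrow> j \<notin> J \<longrightarrow> (i \<noteq> j \<longrightarrow> g i \<noteq> g j) \<and> (g i \<lhd> g j \<longleftrightarrow> g' i \<lhd> g' j)) \<longrightarrow>
     f g x = f g' x')"

lemma node_col_cong: "node_col m f \<Longrightarrow> (\<And>j. j < m \<Longrightarrow> g j = g' j) \<Longrightarrow> (\<And>j. j < m \<Longrightarrow> x j = x' j) \<Longrightarrow> f g x = f g' x'"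
  unfolding node_col_def by simp

lemma node_col_pull: "node_col m f \<Longrightarrow> node_col m (pull_col f l \<phi>)"
proof -
  assume f: "node_col m f"
  then obtain D where "\<And>g x. f g x \<lhd> D" unfolding node_col_def by blast
  then show ?thesis unfolding node_col_def pull_col_def
    by (intro conjI allI impI exI[of _ D] node_col_cong[OF f]) simp_all
qed

text \<open>Tree embeddings preserve the order of levels and commute with restriction. What has been
  achieved for one \<open>J\<close> therefore survives the passage to further subtrees, and the
  finitely many sets \<open>J\<close> can be treated one by one.\<close>

lemma determined_pull:
  assumes f: "determined m J f" and te: "tree_embedding m l s \<phi>" and J: "J \<subseteq> {..<m}"
  shows "determined m J (pull_col f l \<phi>)"
  unfolding determined_def pull_col_def
proof (intro allI impI)
  fix g x g' x' \<mu>
  assume n: "\<forall>j<m. x j \<in> node (g j) \<and> x' j \<in> node (g' j)"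
    and eq: "\<forall>j\<in>J. g j = g' j \<and> x j = x' j \<and> g j \<unlhd> \<mu>"
    and ct: "\<forall>j<m. j \<notin> J \<longrightarrow> \<mu> \<lhd> g j \<and> \<mu> \<lhd> g' j \<and> cut \<mu> (x j) = cut \<mu> (x' j)"
    and o: "\<forall>i<m. \<forall>j<m. i \<notin> J \<longrightarrow> j \<notin> J \<longrightarrow> (i \<noteq> j \<longrightarrow> g i \<noteq> g j) \<and> (g i \<lhd> g j \<longleftrightarrow> g' i \<lhd> g' j)"
  show "f (\<lambda>j. l (g j)) (\<lambda>j. \<phi> j (g j) (x j)) = f (\<lambda>j. l (g' j)) (\<lambda>j. \<phi> j (g' j) (x' j))"
  proof (rule f[unfolded determined_def, rule_format, where \<mu> = "l \<mu>"])
    fix j assume j: "j < m"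
    show "\<phi> j (g j) (x j) \<in> node (l (g j)) \<and> \<phi> j (g' j) (x' j) \<in> node (l (g' j))"
      using te_node[OF te j] n j by blast
  next
    fix j assume "j \<in> J"
    then have h: "g j = g' j" "x j = x' j" "g j \<unlhd> \<mu>" using eq by auto
    show "l (g j) = l (g' j) \<and> \<phi> j (g j) (x j) = \<phi> j (g' j) (x' j) \<and> l (g j) \<unlhd> l \<mu>"
      using te_mono(3)[OF te h(3)] h(1,2) by simp
  next
    fix j assume j: "j < m" "j \<notin> J"
    then have h: "\<mu> \<lhd> g j" "\<mu> \<lhd> g' j" "cut \<mu> (x j) = cut \<mu> (x' j)" using ct by blast+
    show "l \<mu> \<lhd> l (g j) \<and> l \<mu> \<lhd> l (g' j) \<and> cut (l \<mu>) (\<phi> j (g j) (x j)) = cut (l \<mu>) (\<phi> j (g' j) (x' j))"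
      using te_mono(1)[OF te h(1)] te_mono(1)[OF te h(2)] te_cut[OF te j(1) _ h(1)] te_cut[OF te j(1) _ h(2)] n j(1) h(3) by simp
  next
    fix i j assume "i < m" "j < m" "i \<notin> J" "j \<notin> J"
    then show "(i \<noteq> j \<longrightarrow> l (g i) \<noteq> l (g j)) \<and> (l (g i) \<lhd> l (g j) \<longleftrightarrow> l (g' i) \<lhd> l (g' j))"
      using o unfolding te_mono(2,4)[OF te] by blast
  qed
qed

definition rank :: "nat \<Rightarrow> nat set \<Rightarrow> (nat \<Rightarrow> 'a) \<Rightarrow> nat \<Rightarrow> nat" where
  "rank m J g j = card {i. i < m \<and> i \<notin> J \<and> g i \<lhd> g j}"

lemma rank_less_iff:
  assumes "i < m" "i \<notin> J" "j < m" "j \<notin> J"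
  shows "rank m J g i < rank m J g j \<longleftrightarrow> g i \<lhd> g j"
proof -
  have fin: "finite {i. i < m \<and> i \<notin> J \<and> g i \<lhd> a}" for a by simp
  have 1: "rank m J g i < rank m J g j" if "g i \<lhd> g j" "i < m" "i \<notin> J" for i j
    unfolding rank_def
  proof (rule psubset_card_mono[OF fin])
    have "{k. k < m \<and> k \<notin> J \<and> g k \<lhd> g i} \<subseteq> {k. k < m \<and> k \<notin> J \<and> g k \<lhd> g j}" using that lt_trans by blast
    moreover have "i \<in> {k. k < m \<and> k \<notin> J \<and> g k \<lhd> g j}" "i \<notin> {k. k < m \<and> k \<notin> J \<and> g k \<lhd> g i}" using that irrefl by auto
    ultimately show "{k. k < m \<and> k \<notin> J \<and> g k \<lhd> g i} \<subset> {k. k < m \<and> k \<notin> J \<and> g k \<lhd> g j}" by blast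
  qed
  show ?thesis
  proof
    assume r: "rank m J g i < rank m J g j"
    show "g i \<lhd> g j"
    proof (rule ccontr)
      assume "\<not> g i \<lhd> g j"
      then have "g i = g j \<or> g j \<lhd> g i" using lt_total by blast
      then show False using 1[of j i] assms r by (auto simp: rank_def)
    qed
  qed (use 1 assms in blast)
qed

lemma rank_bound: "j < m \<Longrightarrow> j \<notin> J \<Longrightarrow> rank m J g j < m"
proof -
  assume j: "j < m" "j \<notin> J"
  have "{i. i < m \<and> i \<notin> J \<and> g i \<lhd> g j} \<subset> {..<m}" using j irrefl by blast
  then have "card {i. i < m \<and> i \<notin> J \<and> g i \<lhd> g j} < card {..<m}" by (rule psubset_card_mono[rotated]) simp
  then show ?thesis by (simp add: rank_def)
qed

text \<open>If \<open>f\<close> is determined by the nodes up to the \<open>i0\<close>-th, the nodes above may be replaced by the canonical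
  ones of level \<open>l (g i0) + rank\<close>.\<close>

lemma determined_sample:
  assumes f: "determined m (insert i0 J) f" and te: "tree_embedding m l s \<phi>" and J: "J \<subseteq> {..<m}" and i0: "i0 < m" "i0 \<notin> J"
    and n: "\<And>j. j < m \<Longrightarrow> x j \<in> node (g j)" and JJ: "\<And>j. j \<in> J \<Longrightarrow> g j \<lhd> g i0"
    and min: "\<And>j. j < m \<Longrightarrow> j \<notin> J \<Longrightarrow> j \<noteq> i0 \<Longrightarrow> g i0 \<lhd> g j"
    and inj: "\<And>i j. i < m \<Longrightarrow> j < m \<Longrightarrow> i \<notin> J \<Longrightarrow> j \<notin> J \<Longrightarrow> i \<noteq> j \<Longrightarrow> g i \<noteq> g j"
  shows "pull_col f l \<phi> g x = f (\<lambda>j. if j \<in> J then l (g j) else (sc ^^ rank m J g j) (l (g i0)))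
     (\<lambda>j. if j \<in> J then \<phi> j (g j) (x j) else \<phi> j (g i0) (cut (g i0) (x j)))"
proof -
  let ?g = "\<lambda>j. if j \<in> J then l (g j) else (sc ^^ rank m J g j) (l (g i0))"
  let ?x = "\<lambda>j. if j \<in> J then \<phi> j (g j) (x j) else \<phi> j (g i0) (cut (g i0) (x j))"
  have r0: "rank m J g i0 = 0"
  proof -
    have "{i. i < m \<and> i \<notin> J \<and> g i \<lhd> g i0} = {}" using min irrefl lt_trans by blast
    then show ?thesis unfolding rank_def by simp
  qed
  show ?thesis unfolding pull_col_def
  proof (rule f[unfolded determined_def, rule_format, where \<mu> = "l (g i0)"])
    fix j assume j: "j < m"
    have "\<phi> j (g i0) (cut (g i0) (x j)) \<in> node ((sc ^^ rank m J g j) (l (g i0)))"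
      by (rule node_mono[OF sc_pow_ge te_node[OF te j cut_node]])
    then show "\<phi> j (g j) (x j) \<in> node (l (g j)) \<and> ?x j \<in> node (?g j)"
      using te_node[OF te j n[OF j]] by simp
  next
    fix j assume "j \<in> insert i0 J"
    moreover have "l (g j) \<unlhd> l (g i0)" if "j \<in> J" using te_mono(1)[OF te JJ[OF that]] by (simp add: le_def)
    moreover have "cut (g i0) (x i0) = x i0" by (rule cut_id[OF n[OF i0(1)]]) (simp add: le_def)
    ultimately show "l (g j) = ?g j \<and> \<phi> j (g j) (x j) = ?x j \<and> l (g j) \<unlhd> l (g i0)"
      using i0(2) r0 by (auto simp: le_def)
  next
    fix j assume j: "j < m" "j \<notin> insert i0 J"
    then have h: "g i0 \<lhd> g j" using min by blast
    have "0 < rank m J g j" using rank_less_iff[OF i0, of j g] j h r0 by simp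
    then have "l (g i0) \<lhd> (sc ^^ rank m J g j) (l (g i0))" using sc_pow_mono[of 0 "rank m J g j"] by simp
    moreover have "cut (l (g i0)) (\<phi> j (g i0) (cut (g i0) (x j))) = \<phi> j (g i0) (cut (g i0) (x j))"
      by (rule cut_id[OF te_node[OF te j(1) cut_node]]) (simp add: le_def)
    ultimately show "l (g i0) \<lhd> l (g j) \<and> l (g i0) \<lhd> ?g j \<and> cut (l (g i0)) (\<phi> j (g j) (x j)) = cut (l (g i0)) (?x j)"
      using te_mono(1)[OF te h] te_cut[OF te j(1) n[OF j(1)] h] j(2) by simp
  next
    fix i j assume ij: "i < m" "j < m" "i \<notin> insert i0 J" "j \<notin> insert i0 J"
    then show "(i \<noteq> j \<longrightarrow> l (g i) \<noteq> l (g j)) \<and> (l (g i) \<lhd> l (g j) \<longleftrightarrow> ?g i \<lhd> ?g j)"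
      using inj[of i j] rank_less_iff[of i m J j g] unfolding te_mono(2,4)[OF te] by (simp add: sc_pow_less_iff)
  qed
qed

section \<open>Freezing a coordinate, and the reduction to a common level\<close>

definition skip :: "nat \<Rightarrow> nat \<Rightarrow> nat" where "skip k i = (if i < k then i else Suc i)"
definition unskip :: "nat \<Rightarrow> nat \<Rightarrow> nat" where "unskip k j = (if j < k then j else j - 1)"

lemma skip_unskip: "j \<noteq> k \<Longrightarrow> skip k (unskip k j) = j" "j \<noteq> k \<Longrightarrow> j < Suc d \<Longrightarrow> k < Suc d \<Longrightarrow> unskip k j < d"
    "i < d \<Longrightarrow> skip k i < Suc d"
  by (auto simp: skip_def unskip_def)

text \<open>The embedding for the one coordinate on which the \<open>d\<close>-dimensional result is
  silent: it writes the bits at the prescribed splitting levels and is \<open>False\<close>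
  elsewhere.\<close>

definition zero_pad :: "('a \<Rightarrow> 'a) \<Rightarrow> 'a \<Rightarrow> ('a \<Rightarrow> bool) \<Rightarrow> 'a \<Rightarrow> bool" where
  "zero_pad s \<gamma> x = (\<lambda>z. \<exists>\<zeta>. \<zeta> \<lhd> \<gamma> \<and> z = s \<zeta> \<and> x \<zeta>)"

lemma te_extend:
  assumes te: "tree_embedding d l s \<phi>" and k: "k < Suc d"
  shows "tree_embedding (Suc d) l s (\<lambda>j. if j = k then zero_pad s else \<phi> (unskip k j))"
proof -
  note m = te_mono[OF te]
  have s_iff: "\<zeta> \<lhd> \<gamma>" if "s \<zeta> \<lhd> l \<gamma>" for \<zeta> \<gamma>
  proof (rule ccontr)
    assume "\<not> \<zeta> \<lhd> \<gamma>"
    then have "l \<gamma> \<unlhd> l \<zeta>" using m(3) lt_total unfolding le_def by blast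
    then show False using that m(5)[of \<zeta>] O.order_trans O.not_le by blast
  qed
  have s_mono: "s \<zeta> \<lhd> s \<gamma>" if "\<zeta> \<lhd> \<gamma>" for \<zeta> \<gamma> using m(6)[OF that] m(5) O.less_le_trans by blast
  have s_less: "\<zeta> \<lhd> \<gamma>" if "s \<zeta> \<lhd> s \<gamma>" for \<zeta> \<gamma> using s_mono lt_total that irrefl lt_trans by metis
  have s_inj: "s \<zeta> = s \<gamma> \<longleftrightarrow> \<zeta> = \<gamma>" for \<zeta> \<gamma> using s_mono lt_total irrefl by metis
  have u: "unskip k j < d" if "j < Suc d" "j \<noteq> k" for j using skip_unskip(2) that k by blast
  let ?\<phi> = "\<lambda>j. if j = k then zero_pad s else \<phi> (unskip k j)"
  show ?thesis unfolding tree_embedding_def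
  proof (intro conjI allI impI ballI)
    show "l \<gamma> \<unlhd> s \<gamma>" for \<gamma> by (rule m(5))
    show "s \<gamma> \<lhd> l \<gamma>'" if "\<gamma> \<lhd> \<gamma>'" for \<gamma> \<gamma>' by (rule m(6)[OF that])
    show "?\<phi> j \<gamma> x \<in> node (l \<gamma>)" if "j < Suc d" "x \<in> node \<gamma>" for j \<gamma> x
      using te_node[OF te u[OF that(1)] that(2)] m(6) by (auto simp: zero_pad_def node_def)
    fix j \<gamma> \<gamma>' x assume j: "j < Suc d" and x: "x \<in> node \<gamma>'" and g: "\<gamma> \<lhd> \<gamma>'"
    have "cut (l \<gamma>) (zero_pad s \<gamma>' x) = zero_pad s \<gamma> (cut \<gamma> x)"
    proof (rule ext)
      fix z show "cut (l \<gamma>) (zero_pad s \<gamma>' x) z = zero_pad s \<gamma> (cut \<gamma> x) z"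
        unfolding cut_def zero_pad_def using s_iff m(6) g lt_trans by metis
    qed
    then show "cut (l \<gamma>) (?\<phi> j \<gamma>' x) = ?\<phi> j \<gamma> (cut \<gamma> x)" using te_cut[OF te u[OF j] x g] by simp
    have "zero_pad s \<gamma>' x (s \<gamma>) = x \<gamma>" unfolding zero_pad_def s_inj using g by blast
    then show "?\<phi> j \<gamma>' x (s \<gamma>) = x \<gamma>" using te_split[OF te u[OF j] x g] by simp
  next
    fix j \<gamma> \<gamma>1 \<gamma>2 x1 x2 assume h: "j < Suc d" "x1 \<in> node \<gamma>1" "x2 \<in> node \<gamma>2" "\<gamma> \<lhd> \<gamma>1" "\<gamma> \<lhd> \<gamma>2" "cut \<gamma> x1 = cut \<gamma> x2"
    have "cut (s \<gamma>) (zero_pad s \<gamma>1 x1) = cut (s \<gamma>) (zero_pad s \<gamma>2 x2)"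
    proof (rule cut_eqI)
      fix z assume z: "z \<lhd> s \<gamma>"
      have "x1 \<zeta> = x2 \<zeta> \<and> \<zeta> \<lhd> \<gamma>1 \<and> \<zeta> \<lhd> \<gamma>2" if "z = s \<zeta>" for \<zeta>
        using s_less[of \<zeta> \<gamma>] z that cut_eqD[OF h(6)] lt_trans h(4,5) by blast
      then show "zero_pad s \<gamma>1 x1 z = zero_pad s \<gamma>2 x2 z" unfolding zero_pad_def by blast
    qed
    then show "cut (s \<gamma>) (?\<phi> j \<gamma>1 x1) = cut (s \<gamma>) (?\<phi> j \<gamma>2 x2)"
      using te_agree[OF te u[OF h(1)] h(2,3,4,5,6)] by simp
  qed
qed

text \<open>Let \<open>i0\<close> be the lowest node outside \<open>J\<close>. By the hypothesis for
  \<open>insert i0 J\<close> the higher nodes may be replaced by their restrictions to the level of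
  \<open>i0\<close>, placed at \<open>sc\<close>-iterates of that level in the right order. This
  leaves a colouring at one common level, in \<open>d\<close> coordinates because \<open>k\<close>
  is frozen, with the nodes in \<open>J\<close> and the ranking as parameters, and
  \<open>tail_cone\<close> applies to all choices of the parameters together.\<close>

lemma determined_step:
  assumes bl: "branch_limits r Lam N0 d L" and lam: "Lam = Field lam" "big_index lam \<kappa> d"
    and f: "node_col (Suc d) f" and J: "J \<subseteq> {..<Suc d}" "k \<in> J" "J \<noteq> {..<Suc d}"
    and det: "\<And>i. i < Suc d \<Longrightarrow> i \<notin> J \<Longrightarrow> determined (Suc d) (insert i J) f"
  shows "\<exists>l s \<phi>. tree_embedding (Suc d) l s \<phi> \<and> determined (Suc d) J (pull_col f l \<phi>)"
proof -
  interpret branch_limits r Lam N0 d L by (rule bl)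
  let ?m = "Suc d"
  have k: "k < ?m" using J by blast
  define F where "F lz xz \<rho> = (\<lambda>\<xi> v. f (\<lambda>j. if j \<in> J then lz j else (sc ^^ \<rho> j) \<xi>)
      (\<lambda>j. if j \<in> J then xz j else v (unskip k j)))" for lz :: "nat \<Rightarrow> 'a" and xz :: "nat \<Rightarrow> 'a \<Rightarrow> bool" and \<rho> :: "nat \<Rightarrow> nat"
  \<comment> \<open>The parameters available at level \<open>\<eta>\<close>, fewer than \<kappa> of
    them: frozen levels and nodes up to \<open>\<eta>\<close>, and rankings of the remaining
    nodes.\<close>
  define Z where "Z \<eta> = (\<lambda>(lz, xz, \<rho>). F lz xz \<rho>) `
      ((J \<rightarrow>\<^sub>E {\<zeta>. \<zeta> \<unlhd> \<eta>}) \<times> (J \<rightarrow>\<^sub>E node \<eta>) \<times> ({..<?m} \<rightarrow>\<^sub>E {..<?m}))" for \<eta>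
  have finJ: "small J" using J(1) finite_subset by (intro small_finite) blast
  have Zs: "small (Z \<eta>)" for \<eta> unfolding Z_def
    by (intro small_image small_Sigma small_PiE finJ seg_le small_node small_finite[OF finite_lessThan])
  have ZF: "colouring d F'" if "F' \<in> Z \<eta>" for F' \<eta>
  proof -
    obtain lz xz \<rho> where F': "F' = F lz xz \<rho>" using \<open>F' \<in> Z \<eta>\<close> unfolding Z_def by auto
    obtain D where D: "\<And>g x. f g x \<lhd> D" using f unfolding node_col_def by blast
    have "F lz xz \<rho> \<xi> t = F lz xz \<rho> \<xi> t'" if "\<forall>i<d. t i = t' i" for \<xi> t t'
      unfolding F_def
    proof (rule node_col_cong[OF f])
      fix j assume "j < ?m"
      then have "j \<notin> J \<Longrightarrow> unskip k j < d" using skip_unskip(2)[of j k d] k J(2) by metis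
      then show "(if j \<in> J then xz j else t (unskip k j)) = (if j \<in> J then xz j else t' (unskip k j))" using that by simp
    qed simp
    then show ?thesis unfolding colouring_def F'
      by (intro conjI allI impI exI[of _ D]) (auto simp: F_def D)
  qed
  have "\<exists>l s \<phi>. tree_embedding d l s \<phi> \<and> (\<forall>m \<mu> \<mu>' F v v'. F \<in> Z (l m) \<longrightarrow> m \<lhd> \<mu> \<longrightarrow> m \<lhd> \<mu>' \<longrightarrow>
      (\<forall>j<d. v j \<in> node \<mu> \<and> v' j \<in> node \<mu>' \<and> cut m (v j) = cut m (v' j)) \<longrightarrow>
      F (l \<mu>) (\<lambda>j. \<phi> j \<mu> (v j)) = F (l \<mu>') (\<lambda>j. \<phi> j \<mu>' (v' j)))"
    by (rule tail_cone[OF Zs ZF lam])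
  then obtain l s \<phi>0 where te0: "tree_embedding d l s \<phi>0" and tail: "\<forall>m \<mu> \<mu>' F v v'. F \<in> Z (l m) \<longrightarrow> m \<lhd> \<mu> \<longrightarrow> m \<lhd> \<mu>' \<longrightarrow>
      (\<forall>j<d. v j \<in> node \<mu> \<and> v' j \<in> node \<mu>' \<and> cut m (v j) = cut m (v' j)) \<longrightarrow>
      F (l \<mu>) (\<lambda>j. \<phi>0 j \<mu> (v j)) = F (l \<mu>') (\<lambda>j. \<phi>0 j \<mu>' (v' j))"
    by (elim exE conjE) (rule that)
  define \<phi> where "\<phi> = (\<lambda>j. if j = k then zero_pad s else \<phi>0 (unskip k j))"
  have te: "tree_embedding ?m l s \<phi>" unfolding \<phi>_def by (rule te_extend[OF te0 k])
  have "determined ?m J (pull_col f l \<phi>)"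
    unfolding determined_def
  proof (intro allI impI)
    fix g x g' x' \<mu>
    assume n: "\<forall>j<?m. x j \<in> node (g j) \<and> x' j \<in> node (g' j)"
      and eq: "\<forall>j\<in>J. g j = g' j \<and> x j = x' j \<and> g j \<unlhd> \<mu>"
      and ct: "\<forall>j<?m. j \<notin> J \<longrightarrow> \<mu> \<lhd> g j \<and> \<mu> \<lhd> g' j \<and> cut \<mu> (x j) = cut \<mu> (x' j)"
      and o: "\<forall>i<?m. \<forall>j<?m. i \<notin> J \<longrightarrow> j \<notin> J \<longrightarrow> (i \<noteq> j \<longrightarrow> g i \<noteq> g j) \<and> (g i \<lhd> g j \<longleftrightarrow> g' i \<lhd> g' j)"
    let ?C = "{j. j < ?m \<and> j \<notin> J}"
    have "?C \<noteq> {}" using J(1,3) by blast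
    then have "\<exists>z. z \<in> g ` ?C" by blast
    then obtain z where z: "z \<in> g ` ?C" "\<And>y. y \<lhd> z \<Longrightarrow> y \<notin> g ` ?C"
      using O.exists_least_iff[of "\<lambda>z. z \<in> g ` ?C"] by blast
    obtain i0 where i0: "i0 < ?m" "i0 \<notin> J" "z = g i0" using z(1) by blast
    have min: "g i0 \<lhd> g j" if "j < ?m" "j \<notin> J" "j \<noteq> i0" for j
    proof -
      have "\<not> g j \<lhd> g i0" using z(2)[of "g j"] that i0(3) by blast
      moreover have "g j \<noteq> g i0" using o that i0(1,2) by blast
      ultimately show ?thesis using lt_total by blast
    qed
    have min': "g' i0 \<lhd> g' j" if "j < ?m" "j \<notin> J" "j \<noteq> i0" for j using min[OF that] o that i0(1,2) by blast
    have inj: "g i \<noteq> g j" if "i < ?m" "j < ?m" "i \<notin> J" "j \<notin> J" "i \<noteq> j" for i j using o that by blast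
    have inj': "g' i \<noteq> g' j" if "i < ?m" "j < ?m" "i \<notin> J" "j \<notin> J" "i \<noteq> j" for i j
    proof -
      have "g i \<lhd> g j \<or> g j \<lhd> g i" using inj[OF that] lt_total by blast
      then have "g' i \<lhd> g' j \<or> g' j \<lhd> g' i" using o that by blast
      then show ?thesis using irrefl by metis
    qed
    have rk: "rank ?m J g j = rank ?m J g' j" if "j < ?m" "j \<notin> J" for j
    proof -
      have "{i. i < ?m \<and> i \<notin> J \<and> g i \<lhd> g j} = {i. i < ?m \<and> i \<notin> J \<and> g' i \<lhd> g' j}" using o that by blast
      then show ?thesis unfolding rank_def by simp
    qed
    define lz where "lz = (\<lambda>j\<in>J. l (g j))"
    define xz where "xz = (\<lambda>j\<in>J. \<phi> j (g j) (x j))"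
    define \<rho> where "\<rho> = (\<lambda>j\<in>{..<?m}. if j \<in> J then 0 else rank ?m J g j)"
    have mem: "F lz xz \<rho> \<in> Z (l \<mu>)"
    proof -
      have "lz \<in> J \<rightarrow>\<^sub>E {\<zeta>. \<zeta> \<unlhd> l \<mu>}" unfolding lz_def using te_mono(3)[OF te] eq by auto
      moreover have "xz \<in> J \<rightarrow>\<^sub>E node (l \<mu>)"
      proof -
        have "\<phi> j (g j) (x j) \<in> node (l \<mu>)" if "j \<in> J" for j
        proof -
          have j: "j < ?m" using that J(1) by blast
          show ?thesis using node_mono[OF te_mono(3)[OF te] te_node[OF te j]] n j eq that by blast
        qed
        then show ?thesis unfolding xz_def by auto
      qed
      moreover have "\<rho> \<in> {..<?m} \<rightarrow>\<^sub>E {..<?m}" unfolding \<rho>_def using rank_bound by auto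
      ultimately show ?thesis unfolding Z_def by (intro image_eqI[of _ _ "(lz, xz, \<rho>)"]) simp_all
    qed
    have val: "pull_col f l \<phi> h y = F lz xz \<rho> (l (h i0)) (\<lambda>i. \<phi>0 i (h i0) (cut (h i0) (y (skip k i))))"
      if ny: "\<And>j. j < ?m \<Longrightarrow> y j \<in> node (h j)" and hJ: "\<And>j. j \<in> J \<Longrightarrow> h j = g j \<and> y j = x j"
        and hm: "\<And>j. j < ?m \<Longrightarrow> j \<notin> J \<Longrightarrow> j \<noteq> i0 \<Longrightarrow> h i0 \<lhd> h j"
        and hi: "\<And>i j. i < ?m \<Longrightarrow> j < ?m \<Longrightarrow> i \<notin> J \<Longrightarrow> j \<notin> J \<Longrightarrow> i \<noteq> j \<Longrightarrow> h i \<noteq> h j"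
        and hr: "\<And>j. j < ?m \<Longrightarrow> j \<notin> J \<Longrightarrow> rank ?m J h j = rank ?m J g j" and h0: "\<mu> \<lhd> h i0" for h y
    proof -
      have hl: "h j \<lhd> h i0" if "j \<in> J" for j using hJ[OF that] eq that h0 O.le_less_trans by metis
      have s: "pull_col f l \<phi> h y = f (\<lambda>j. if j \<in> J then l (h j) else (sc ^^ rank ?m J h j) (l (h i0)))
          (\<lambda>j. if j \<in> J then \<phi> j (h j) (y j) else \<phi> j (h i0) (cut (h i0) (y j)))"
        by (rule determined_sample[OF det[OF i0(1,2)] te J(1) i0(1,2)]) (fact ny hl hm hi)+
      show ?thesis unfolding s F_def
      proof (rule node_col_cong[OF f])
        fix j assume j: "j < ?m"
        show "(if j \<in> J then l (h j) else (sc ^^ rank ?m J h j) (l (h i0))) = (if j \<in> J then lz j else (sc ^^ \<rho> j) (l (h i0)))"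
        proof (cases "j \<in> J")
          case True
          then show ?thesis using hJ[OF True] by (simp add: lz_def)
        next
          case False
          then show ?thesis using hr[OF j False] j by (simp add: \<rho>_def)
        qed
        have jk: "j \<noteq> k" if "j \<notin> J" using J(2) that by blast
        have "skip k (unskip k j) = j" if "j \<notin> J" by (rule skip_unskip(1)[OF jk[OF that]])
        with jk show "(if j \<in> J then \<phi> j (h j) (y j) else \<phi> j (h i0) (cut (h i0) (y j))) =
          (if j \<in> J then xz j else \<phi>0 (unskip k j) (h i0) (cut (h i0) (y (skip k (unskip k j)))))"
          using hJ by (simp add: xz_def \<phi>_def)
      qed
    qed
    have \<mu>: "\<mu> \<lhd> g i0" "\<mu> \<lhd> g' i0" using ct i0(1,2) by blast+
    have v1: "pull_col f l \<phi> g x = F lz xz \<rho> (l (g i0)) (\<lambda>i. \<phi>0 i (g i0) (cut (g i0) (x (skip k i))))"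
      by (rule val) (use n min inj \<mu> in auto)
    have v2: "pull_col f l \<phi> g' x' = F lz xz \<rho> (l (g' i0)) (\<lambda>i. \<phi>0 i (g' i0) (cut (g' i0) (x' (skip k i))))"
      by (rule val) (use n eq min' inj' rk \<mu> in auto)
    have "F lz xz \<rho> (l (g i0)) (\<lambda>i. \<phi>0 i (g i0) (cut (g i0) (x (skip k i)))) =
        F lz xz \<rho> (l (g' i0)) (\<lambda>i. \<phi>0 i (g' i0) (cut (g' i0) (x' (skip k i))))"
    proof (rule tail[rule_format, OF mem \<mu>])
      fix i assume i: "i < d"
      have j: "skip k i < ?m" by (rule skip_unskip(3)[OF i])
      have "cut \<mu> (x (skip k i)) = cut \<mu> (x' (skip k i))"
        using ct eq j by (cases "skip k i \<in> J") auto
      then show "cut (g i0) (x (skip k i)) \<in> node (g i0) \<and> cut (g' i0) (x' (skip k i)) \<in> node (g' i0) \<and>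
          cut \<mu> (cut (g i0) (x (skip k i))) = cut \<mu> (cut (g' i0) (x' (skip k i)))"
        using \<mu> by (simp add: cut_cut le_def)
    qed
    then show "pull_col f l \<phi> g x = pull_col f l \<phi> g' x'" unfolding v1 v2 .
  qed
  then show ?thesis using te by blast
qed

lemma pull_pull: "pull_col (pull_col f l \<phi>) l' \<phi>' = pull_col f (\<lambda>\<gamma>. l (l' \<gamma>)) (\<lambda>j \<gamma> x. \<phi> j (l' \<gamma>) (\<phi>' j \<gamma> x))"
  by (simp add: pull_col_def)

text \<open>Induction on the number of coordinates outside \<open>J\<close>. Sets of one size are
  treated one after the other, using their supersets with one more element. \<open>J\<close> stays
  nonempty, since the step needs a frozen coordinate.\<close>

lemma determined_all:
  assumes bl: "branch_limits r Lam N0 d L" and lam: "Lam = Field lam" "big_index lam \<kappa> d" and f: "node_col (Suc d) f"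
  shows "\<exists>l s \<phi>. tree_embedding (Suc d) l s \<phi> \<and>
     (\<forall>J. J \<subseteq> {..<Suc d} \<longrightarrow> J \<noteq> {} \<longrightarrow> Suc d \<le> card J + n \<longrightarrow> determined (Suc d) J (pull_col f l \<phi>))"
proof (induction n)
  case 0
  have "determined (Suc d) J f" if "J \<subseteq> {..<Suc d}" "Suc d \<le> card J" for J
  proof -
    have "J = {..<Suc d}" using that by (intro card_subset_eq) (auto dest: card_mono[rotated])
    then show ?thesis unfolding determined_def by (intro allI impI node_col_cong[OF f]) auto
  qed
  moreover have "pull_col f (\<lambda>\<gamma>. \<gamma>) (\<lambda>j \<gamma> x. x) = f" by (simp add: pull_col_def)
  ultimately show ?case using te_id by (intro exI[of _ "\<lambda>\<gamma>. \<gamma>"] exI[of _ "\<lambda>j \<gamma> x. x"]) auto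
next
  case (Suc n)
  let ?m = "Suc d"
  define big where "big g \<longleftrightarrow> (\<forall>J. J \<subseteq> {..<?m} \<longrightarrow> J \<noteq> {} \<longrightarrow> ?m \<le> card J + n \<longrightarrow> determined ?m J g)" for g
  have step: "\<exists>l s \<phi>. tree_embedding ?m l s \<phi> \<and> big (pull_col f l \<phi>) \<and> (\<forall>J\<in>S. determined ?m J (pull_col f l \<phi>))"
    if "finite S" "S \<subseteq> {J. J \<subseteq> {..<?m} \<and> J \<noteq> {} \<and> card J + Suc n = ?m}" for S
    using that
  proof (induction S rule: finite_induct)
    case empty
    then show ?case using Suc by (auto simp: big_def)
  next
    case (insert J S)
    then obtain l s \<phi> where IH: "tree_embedding ?m l s \<phi>" "big (pull_col f l \<phi>)" "\<forall>J\<in>S. determined ?m J (pull_col f l \<phi>)"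
      by auto
    have J: "J \<subseteq> {..<?m}" "J \<noteq> {}" "card J + Suc n = ?m" using insert.prems by auto
    then obtain k where k: "k \<in> J" by blast
    have fJ: "finite J" using J(1) finite_subset by blast
    have "determined ?m (Set.insert i J) (pull_col f l \<phi>)" if "i < ?m" "i \<notin> J" for i
    proof (rule IH(2)[unfolded big_def, rule_format])
      show "?m \<le> card (Set.insert i J) + n" using J(3) that(2) fJ by simp
    qed (use J(1) that(1) in auto)
    moreover have "J \<noteq> {..<?m}"
    proof
      assume "J = {..<?m}"
      then have "card J = ?m" by simp
      then show False using J(3) by linarith
    qed
    ultimately obtain l' s' \<phi>' where new: "tree_embedding ?m l' s' \<phi>'" "determined ?m J (pull_col (pull_col f l \<phi>) l' \<phi>')"
      using determined_step[OF bl lam node_col_pull[OF f] J(1) k] by blast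
    have "big (pull_col (pull_col f l \<phi>) l' \<phi>')" using IH(2) determined_pull[OF _ new(1)] unfolding big_def by blast
    moreover have "\<forall>J'\<in>S. determined ?m J' (pull_col (pull_col f l \<phi>) l' \<phi>')"
      using IH(3) determined_pull[OF _ new(1)] insert.prems by blast
    ultimately show ?case using new te_comp[OF IH(1) new(1)] unfolding pull_pull by blast
  qed
  have "finite {J. J \<subseteq> {..<?m} \<and> J \<noteq> {} \<and> card J + Suc n = ?m}" by simp
  from step[OF this subset_refl] obtain l s \<phi> where te: "tree_embedding ?m l s \<phi>" and 1: "big (pull_col f l \<phi>)"
    and 2: "\<forall>J\<in>{J. J \<subseteq> {..<?m} \<and> J \<noteq> {} \<and> card J + Suc n = ?m}. determined ?m J (pull_col f l \<phi>)" by (elim exE conjE)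
  have "determined ?m J (pull_col f l \<phi>)" if "J \<subseteq> {..<?m}" "J \<noteq> {}" "?m \<le> card J + Suc n" for J
  proof (cases "card J + Suc n = ?m")
    case True then show ?thesis using 2 that by blast
  next
    case False then show ?thesis using 1 that unfolding big_def by auto
  qed
  then show ?case using te by blast
qed

text \<open>A colouring determined by its lowest node depends only on the restrictions to the level
  of that node and on the ranking. The colours for all rankings are coded into one colouring
  \<open>G\<close> of nodes of a common level, which \<open>level_homogeneous\<close> makes
  constant; only here do all \<open>d + 1\<close> coordinates vary.\<close>

theorem canonical_subtrees:
  assumes bl: "branch_limits r Lam N0 d L" "branch_limits r Lam N0' (Suc d) L'"
    and lam: "Lam = Field lam" "big_index lam \<kappa> d" and f: "node_col (Suc d) f"
  shows "\<exists>l s \<phi> c. tree_embedding (Suc d) l s \<phi> \<and> (\<forall>g x. (\<forall>j<Suc d. x j \<in> node (g j)) \<longrightarrow> inj_on g {..<Suc d} \<longrightarrow>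
     pull_col f l \<phi> g x = c (restrict (rank (Suc d) {} g) {..<Suc d}))"
proof -
  let ?m = "Suc d"
  obtain l s \<phi> where te: "tree_embedding ?m l s \<phi>" and det0: "\<forall>J. J \<subseteq> {..<?m} \<longrightarrow> J \<noteq> {} \<longrightarrow> ?m \<le> card J + ?m \<longrightarrow> determined ?m J (pull_col f l \<phi>)"
    using determined_all[OF bl(1) lam f, of ?m] by (elim exE conjE)
  define f1 where "f1 = pull_col f l \<phi>"
  have det: "determined ?m {k} f1" if "k < ?m" for k using det0[rule_format, of "{k}"] that unfolding f1_def by simp
  have f1: "node_col ?m f1" unfolding f1_def by (rule node_col_pull[OF f])
  obtain D where D: "\<And>g x. f1 g x \<lhd> D" using f1 unfolding node_col_def by blast
  define R where "R = ({..<?m} \<rightarrow>\<^sub>E {..<?m})"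
  define V where "V = (R \<rightarrow>\<^sub>E {z. z \<lhd> D})"
  have "finite R" unfolding R_def by (rule finite_PiE) simp_all
  then have "small V" unfolding V_def by (rule small_PiE[OF small_finite small_seg])
  then obtain e where e: "inj_on e V" "e ` V \<subseteq> (UNIV :: 'a set)" using small_imp_le by (metis card_of_ordLeq)
  obtain D' where D': "\<And>v. v \<in> V \<Longrightarrow> e v \<lhd> D'" using small_bounded_fun[OF \<open>small V\<close>, of e] by blast
  define G where "G \<xi> v = e (\<lambda>\<rho>\<in>R. f1 (\<lambda>j. (sc ^^ \<rho> j) \<xi>) v)" for \<xi> v
  have GV: "(\<lambda>\<rho>\<in>R. f1 (\<lambda>j. (sc ^^ \<rho> j) \<xi>) v) \<in> V" for \<xi> v unfolding V_def using D by auto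
  have colG: "colouring ?m G" unfolding colouring_def
  proof (intro conjI allI impI)
    fix \<xi> t t' assume "\<forall>j<?m. (t :: nat \<Rightarrow> 'a \<Rightarrow> bool) j = t' j"
    then have "f1 (\<lambda>j. (sc ^^ \<rho> j) \<xi>) t = f1 (\<lambda>j. (sc ^^ \<rho> j) \<xi>) t'" for \<rho> by (intro node_col_cong[OF f1]) auto
    then show "G \<xi> t = G \<xi> t'" by (simp add: G_def)
  next
    show "\<exists>D. \<forall>\<xi> t. G \<xi> t \<lhd> D" using D' GV unfolding G_def by blast
  qed
  obtain l2 \<phi>2 c2 where te2: "tree_embedding ?m l2 l2 \<phi>2" and
    c2: "\<forall>\<gamma> v. (\<forall>j<?m. v j \<in> node \<gamma>) \<longrightarrow> G (l2 \<gamma>) (\<lambda>j. \<phi>2 j \<gamma> (v j)) = c2"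
    using branch_limits.level_homogeneous[OF bl(2) colG refl lam] by (elim exE conjE) (rule that)
  define c where "c \<rho> = inv_into V e c2 \<rho>" for \<rho>
  have "pull_col f1 l2 \<phi>2 g x = c (restrict (rank ?m {} g) {..<?m})"
    if x: "\<forall>j<?m. x j \<in> node (g j)" and g: "inj_on g {..<?m}" for g x
  proof -
    have "\<exists>z. z \<in> g ` {..<?m}" by blast
    then obtain z where z: "z \<in> g ` {..<?m}" "\<And>y. y \<lhd> z \<Longrightarrow> y \<notin> g ` {..<?m}"
      using O.exists_least_iff[of "\<lambda>z. z \<in> g ` {..<?m}"] by blast
    obtain k where k: "k < ?m" "z = g k" using z(1) by blast
    have inj: "g i \<noteq> g j" if "i < ?m" "j < ?m" "i \<noteq> j" for i j using g that by (auto simp: inj_on_def)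
    have min: "g k \<lhd> g j" if "j < ?m" "j \<noteq> k" for j
      using z(2)[of "g j"] k inj[OF that(1) k(1) that(2)] lt_total[of "g k" "g j"] that(1) by fastforce
    let ?\<rho> = "restrict (rank ?m {} g) {..<?m}"
    have \<rho>R: "?\<rho> \<in> R" unfolding R_def using rank_bound[of _ ?m "{}" g] by auto
    have "pull_col f1 l2 \<phi>2 g x = f1 (\<lambda>j. (sc ^^ rank ?m {} g j) (l2 (g k))) (\<lambda>j. \<phi>2 j (g k) (cut (g k) (x j)))"
      using determined_sample[OF _ te2, of k "{}" f1 x g] det[OF k(1)] k(1) x min inj by simp
    also have "\<dots> = f1 (\<lambda>j. (sc ^^ ?\<rho> j) (l2 (g k))) (\<lambda>j. \<phi>2 j (g k) (cut (g k) (x j)))"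
      by (rule node_col_cong[OF f1]) auto
    also have "\<dots> = (\<lambda>\<rho>\<in>R. f1 (\<lambda>j. (sc ^^ \<rho> j) (l2 (g k))) (\<lambda>j. \<phi>2 j (g k) (cut (g k) (x j)))) ?\<rho>"
      using \<rho>R by simp
    also have "\<dots> = c ?\<rho>"
    proof -
      have "e (\<lambda>\<rho>\<in>R. f1 (\<lambda>j. (sc ^^ \<rho> j) (l2 (g k))) (\<lambda>j. \<phi>2 j (g k) (cut (g k) (x j)))) = c2"
        using c2[rule_format, of "\<lambda>j. cut (g k) (x j)" "g k"] by (simp add: G_def)
      then have "inv_into V e c2 = (\<lambda>\<rho>\<in>R. f1 (\<lambda>j. (sc ^^ \<rho> j) (l2 (g k))) (\<lambda>j. \<phi>2 j (g k) (cut (g k) (x j))))"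
        using inv_into_f_f[OF e(1) GV] by blast
      then show ?thesis unfolding c_def by simp
    qed
    finally show ?thesis .
  qed
  then show ?thesis using te_comp[OF te te2] unfolding f1_def pull_pull by blast
qed

end

section \<open>Linear orders\<close>

locale inacc_linorder = inacc_wo r for r :: "'q::linorder rel"
begin

text \<open>The tree is mapped into a saturated order in such a way that, for \<open>\<eta> \<lhd> \<gamma>\<close>, the value at a node
  of level \<open>\<gamma>\<close> is above the value at its restriction to \<open>\<eta>\<close> iff it branches to the right there.\<close>

lemma tree_to_order:
  assumes sat: "saturated r (UNIV :: 'q set)"
  shows "\<exists>e :: 'q \<Rightarrow> ('q \<Rightarrow> bool) \<Rightarrow> 'q. \<forall>\<gamma> x \<eta>. \<eta> \<lhd> \<gamma> \<longrightarrow>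
     (if x \<eta> then e \<eta> (cut \<eta> x) < e \<gamma> x else e \<gamma> x < e \<eta> (cut \<eta> x))"
proof -
  define P where "P f \<gamma> S \<longleftrightarrow> (\<forall>x \<eta>. \<eta> \<lhd> \<gamma> \<longrightarrow> (if x \<eta> then f \<eta> (cut \<eta> x) < S x else S x < f \<eta> (cut \<eta> x)))"
    for f :: "'q \<Rightarrow> ('q \<Rightarrow> bool) \<Rightarrow> 'q" and \<gamma> :: 'q and S :: "('q \<Rightarrow> bool) \<Rightarrow> 'q"
  have "\<exists>f. \<forall>\<gamma>. P f \<gamma> (f \<gamma>)"
  proof (rule dependent_wf_choice[OF wf_lt])
    fix f f' :: "'q \<Rightarrow> ('q \<Rightarrow> bool) \<Rightarrow> 'q" and \<gamma> S assume "\<And>z. (z, \<gamma>) \<in> {(x, y). x \<lhd> y} \<Longrightarrow> f z = f' z"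
    then have "\<And>\<delta>. \<delta> \<lhd> \<gamma> \<Longrightarrow> f \<delta> = f' \<delta>" by simp
    then show "P f \<gamma> S = P f' \<gamma> S" unfolding P_def by (simp cong: imp_cong)
  next
    fix \<gamma> f assume "\<And>\<delta>. (\<delta>, \<gamma>) \<in> {(x, y). x \<lhd> y} \<Longrightarrow> P f \<delta> (f \<delta>)"
    then have IH: "P f \<delta> (f \<delta>)" if "\<delta> \<lhd> \<gamma>" for \<delta> using that by simp
    have "\<exists>c. \<forall>\<eta>. \<eta> \<lhd> \<gamma> \<longrightarrow> (if x \<eta> then f \<eta> (cut \<eta> x) < c else c < f \<eta> (cut \<eta> x))" for x
    proof -
      let ?A = "(\<lambda>\<eta>. f \<eta> (cut \<eta> x)) ` {\<eta>. \<eta> \<lhd> \<gamma> \<and> x \<eta>}" and ?B = "(\<lambda>\<eta>. f \<eta> (cut \<eta> x)) ` {\<eta>. \<eta> \<lhd> \<gamma> \<and> \<not> x \<eta>}"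
      have sm: "small ?A" "small ?B" by (intro small_image small_mono[OF _ small_seg[of \<gamma>]]; blast)+
      have less: "f \<eta> (cut \<eta> x) < f \<eta>' (cut \<eta>' x)" if h: "\<eta> \<lhd> \<gamma>" "x \<eta>" "\<eta>' \<lhd> \<gamma>" "\<not> x \<eta>'" for \<eta> \<eta>'
      proof -
        have "\<eta> \<noteq> \<eta>'" using h by blast
        then consider "\<eta> \<lhd> \<eta>'" | "\<eta>' \<lhd> \<eta>" using lt_total by blast
        then show ?thesis
        proof cases
          case 1
          then have "cut \<eta> (cut \<eta>' x) = cut \<eta> x" "cut \<eta>' x \<eta>" using h by (simp_all add: cut_cut le_def) (simp add: cut_def)
          then show ?thesis using IH[OF h(3)] 1 unfolding P_def by metis
        next
          case 2
          then have "cut \<eta>' (cut \<eta> x) = cut \<eta>' x" "\<not> cut \<eta> x \<eta>'" using h by (simp_all add: cut_cut le_def) (simp add: cut_def)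
          then show ?thesis using IH[OF h(1)] 2 unfolding P_def by metis
        qed
      qed
      then have "\<forall>a\<in>?A. \<forall>b\<in>?B. a < b" by auto
      then have "\<exists>c\<in>UNIV. (\<forall>a\<in>?A. a < c) \<and> (\<forall>b\<in>?B. c < b)"
        by (intro sat[unfolded saturated_def, rule_format] conjI subset_UNIV sm)
      then obtain c where "\<forall>a\<in>?A. a < c" "\<forall>b\<in>?B. c < b" by (elim bexE conjE) (rule that)
      then show ?thesis by (intro exI[of _ c]) auto
    qed
    then have "\<exists>S. \<forall>x. \<forall>\<eta>. \<eta> \<lhd> \<gamma> \<longrightarrow> (if x \<eta> then f \<eta> (cut \<eta> x) < S x else S x < f \<eta> (cut \<eta> x))"
      by (intro choice allI)
    then show "\<exists>S. P f \<gamma> S" unfolding P_def .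
  qed
  then show ?thesis unfolding P_def by blast
qed

text \<open>There has to be room above each level for the two places of the code and for the
  different lengths in different coordinates. All finite iterates of \<open>sc\<close> are left
  free, which is possible because \<kappa> is uncountable and regular.\<close>

lemma sparse_levels: "\<exists>Lv. \<forall>\<gamma> \<delta> n. \<delta> \<lhd> \<gamma> \<longrightarrow> (sc ^^ n) (Lv \<delta>) \<lhd> Lv \<gamma>"
proof -
  have "\<exists>f. \<forall>\<gamma>. (\<lambda>f \<gamma> y. \<forall>\<delta> n. \<delta> \<lhd> \<gamma> \<longrightarrow> (sc ^^ n) (f \<delta>) \<lhd> y) f \<gamma> (f \<gamma>)"
  proof (rule dependent_wf_choice[OF wf_lt])
    fix f :: "'q \<Rightarrow> 'q" and \<gamma>
    have "small ({\<delta>. \<delta> \<lhd> \<gamma>} \<times> (UNIV :: nat set))" by (intro small_Sigma small_seg small_countable)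
    then obtain y where "\<forall>p\<in>{\<delta>. \<delta> \<lhd> \<gamma>} \<times> UNIV. (\<lambda>(\<delta>, n). (sc ^^ n) (f \<delta>)) p \<lhd> y"
      using small_bounded_fun by blast
    then show "\<exists>y. \<forall>\<delta> n. \<delta> \<lhd> \<gamma> \<longrightarrow> (sc ^^ n) (f \<delta>) \<lhd> y" by auto
  qed auto
  then show ?thesis by simp
qed

text \<open>The point \<open>\<gamma>\<close> of the linear order is coded by its comparisons with all earlier points, each of
  them being written twice; the final \<open>01\<close> puts it between the cones \<open>00\<close> and \<open>11\<close> of later points.\<close>

definition point_code :: "('q \<Rightarrow> 'q) \<Rightarrow> 'q \<Rightarrow> 'q \<Rightarrow> bool" where
  "point_code Lv \<gamma> = (\<lambda>z. (\<exists>\<xi>. \<xi> \<lhd> \<gamma> \<and> (z = Lv \<xi> \<or> z = sc (Lv \<xi>)) \<and> \<xi> < \<gamma>) \<or> z = sc (Lv \<gamma>))"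

text \<open>Let \<open>\<xi>\<close> be the earliest point that equals \<open>\<gamma>\<close> or
  \<open>\<gamma>'\<close> or separates them; below \<open>Lv \<xi>\<close> the codes agree. There
  \<open>\<gamma>\<close> and \<open>\<gamma>'\<close> have the digits \<open>00\<close> and
  \<open>01\<close> if \<open>\<xi> = \<gamma>'\<close>, the digits \<open>01\<close> and
  \<open>11\<close> if \<open>\<xi> = \<gamma>\<close>, and \<open>00\<close> and \<open>11\<close>
  if \<open>\<xi>\<close> lies strictly between them.\<close>

lemma point_code_differ:
  assumes Lv: "\<And>\<gamma> \<delta> n. \<delta> \<lhd> \<gamma> \<Longrightarrow> (sc ^^ n) (Lv \<delta>) \<lhd> Lv \<gamma>" and less: "\<gamma> < \<gamma>'"
  shows "\<exists>\<zeta>. \<zeta> \<lhd> (sc ^^ 2) (Lv \<gamma>) \<and> \<zeta> \<lhd> (sc ^^ 2) (Lv \<gamma>') \<and> cut \<zeta> (point_code Lv \<gamma>) = cut \<zeta> (point_code Lv \<gamma>') \<and>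
     \<not> point_code Lv \<gamma> \<zeta> \<and> point_code Lv \<gamma>' \<zeta>"
proof -
  have L0: "Lv \<delta> \<lhd> Lv \<gamma>" and L1: "sc (Lv \<delta>) \<lhd> Lv \<gamma>" if "\<delta> \<lhd> \<gamma>" for \<gamma> \<delta>
    using Lv[OF that, of 0] Lv[OF that, of 1] by simp_all
  have L2: "Lv \<delta> \<lhd> sc (Lv \<delta>)" "sc (Lv \<delta>) \<lhd> (sc ^^ 2) (Lv \<delta>)" for \<delta> using sc_gt by (simp_all add: numeral_2_eq_2)
  have L2': "Lv \<delta> \<lhd> (sc ^^ 2) (Lv \<delta>)" for \<delta> using L2 lt_trans by blast
  have Lle: "Lv \<delta> \<unlhd> Lv \<gamma>" if "\<delta> \<unlhd> \<gamma>" for \<gamma> \<delta> using that L0 unfolding le_def by blast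
  have below: "point_code Lv b z \<longleftrightarrow> (\<exists>\<xi>'. \<xi>' \<lhd> \<xi> \<and> (z = Lv \<xi>' \<or> z = sc (Lv \<xi>')) \<and> \<xi>' < b)"
    if b: "\<xi> \<unlhd> b" and z: "z \<lhd> Lv \<xi>" for b \<xi> z
  proof -
    have "z \<noteq> sc (Lv b)"
    proof
      assume "z = sc (Lv b)"
      then have "Lv b \<lhd> Lv \<xi>" using z L2(1)[of b] lt_trans by blast
      then show False using Lle[OF b] O.not_le by blast
    qed
    moreover have "\<xi>' \<lhd> \<xi>" if "z = Lv \<xi>' \<or> z = sc (Lv \<xi>')" for \<xi>'
    proof (rule ccontr)
      assume "\<not> \<xi>' \<lhd> \<xi>"
      then have "Lv \<xi> \<unlhd> Lv \<xi>'" using Lle O.not_less by blast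
      then have "Lv \<xi> \<unlhd> z" using that L2(1)[of \<xi>'] unfolding le_def by (metis lt_trans)
      then show False using z O.not_le by blast
    qed
    moreover have "\<xi>' \<lhd> b" if "\<xi>' \<lhd> \<xi>" for \<xi>' using that b O.less_le_trans by blast
    ultimately show ?thesis unfolding point_code_def by blast
  qed
  have Linj: "a = b" if "Lv a = Lv b" for a b using L0 that lt_total irrefl by metis
  have sne: "Lv a \<noteq> sc (Lv b)" for a b
  proof
    assume e: "Lv a = sc (Lv b)"
    show False using lt_total[of a b] L0[of a b] L1[of b a] L2(1)[of b] e irrefl lt_trans by metis
  qed
  have at: "point_code Lv b (Lv \<xi>) \<longleftrightarrow> \<xi> \<lhd> b \<and> \<xi> < b" for b \<xi>
    unfolding point_code_def using Linj sne by metis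
  have sinj: "a = b" if "sc (Lv a) = sc (Lv b)" for a b
    using lt_total[of a b] L1[of a b] L1[of b a] L2(1)[of a] L2(1)[of b] that irrefl lt_trans by metis
  have at': "point_code Lv b (sc (Lv \<xi>)) \<longleftrightarrow> \<xi> = b \<or> \<xi> \<lhd> b \<and> \<xi> < b" for b \<xi>
    unfolding point_code_def using sinj sne by metis
  define Q where "Q \<xi> \<longleftrightarrow> \<xi> \<unlhd> \<gamma> \<and> \<xi> \<unlhd> \<gamma>' \<and> (\<xi> = \<gamma> \<or> \<xi> = \<gamma>' \<or> (\<xi> < \<gamma>) \<noteq> (\<xi> < \<gamma>'))" for \<xi>
  have "\<exists>\<xi>. Q \<xi>"
  proof (cases "\<gamma> \<unlhd> \<gamma>'")
    case True then show ?thesis by (intro exI[of _ \<gamma>]) (simp add: Q_def le_def)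
  next
    case False then show ?thesis by (intro exI[of _ \<gamma>']) (auto simp: Q_def le_def lt_total)
  qed
  then obtain \<xi> where \<xi>: "Q \<xi>" "\<And>y. y \<lhd> \<xi> \<Longrightarrow> \<not> Q y" using O.exists_least_iff[of Q] by blast
  have le: "\<xi> \<unlhd> \<gamma>" "\<xi> \<unlhd> \<gamma>'" using \<xi>(1) by (simp_all add: Q_def)
  have same: "\<xi>' < \<gamma> \<longleftrightarrow> \<xi>' < \<gamma>'" if "\<xi>' \<lhd> \<xi>" for \<xi>'
  proof -
    have "\<xi>' \<unlhd> \<gamma>" "\<xi>' \<unlhd> \<gamma>'" using that le O.less_le_trans O.less_imp_le by blast+
    then show ?thesis using \<xi>(2)[OF that] unfolding Q_def by blast
  qed
  have agr: "point_code Lv \<gamma> z = point_code Lv \<gamma>' z" if "z \<lhd> Lv \<xi>" for z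
    unfolding below[OF le(1) that] below[OF le(2) that] using same by blast
  show ?thesis
  proof (cases "\<xi> = \<gamma>'")
    case True
    have gg: "\<gamma>' \<lhd> \<gamma>" using le(1) less True unfolding le_def by auto
    show ?thesis
    proof (intro exI[of _ "sc (Lv \<gamma>')"] conjI)
      show "sc (Lv \<gamma>') \<lhd> (sc ^^ 2) (Lv \<gamma>)" using L1[OF gg] L2'[of \<gamma>] lt_trans by blast
      show "sc (Lv \<gamma>') \<lhd> (sc ^^ 2) (Lv \<gamma>')" by (rule L2(2))
      show "\<not> point_code Lv \<gamma> (sc (Lv \<gamma>'))" "point_code Lv \<gamma>' (sc (Lv \<gamma>'))" unfolding at' using less gg irrefl by auto
      show "cut (sc (Lv \<gamma>')) (point_code Lv \<gamma>) = cut (sc (Lv \<gamma>')) (point_code Lv \<gamma>')"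
      proof (rule cut_eqI)
        fix z assume z: "z \<lhd> sc (Lv \<gamma>')"
        show "point_code Lv \<gamma> z = point_code Lv \<gamma>' z"
        proof (cases "z \<lhd> Lv \<gamma>'")
          case True
          then show ?thesis using agr \<open>\<xi> = \<gamma>'\<close> by blast
        next
          case False
          have "\<not> point_code Lv \<gamma>' z"
          proof
            assume "point_code Lv \<gamma>' z"
            then obtain a where "a \<lhd> \<gamma>'" "z = Lv a \<or> z = sc (Lv a)" using z irrefl unfolding point_code_def by blast
            then show False using L0[of a \<gamma>'] L1[of a \<gamma>'] False by blast
          qed
          moreover have "\<not> point_code Lv \<gamma> z"
          proof
            assume "point_code Lv \<gamma> z"
            then consider a where "a \<lhd> \<gamma>" "z = Lv a \<or> z = sc (Lv a)" "a < \<gamma>" | "z = sc (Lv \<gamma>)" unfolding point_code_def by blast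
            then show False
            proof cases
              case 1
              have "a \<noteq> \<gamma>'" using 1(3) less by auto
              moreover have "\<not> a \<lhd> \<gamma>'" using L0[of a \<gamma>'] L1[of a \<gamma>'] False 1(2) by blast
              ultimately have "\<gamma>' \<lhd> a" using lt_total by blast
              then have "sc (Lv \<gamma>') \<lhd> z" using L1[of \<gamma>' a] L2(1)[of a] 1(2) lt_trans by blast
              then show False using z irrefl lt_trans by blast
            next
              case 2
              then have "sc (Lv \<gamma>') \<lhd> z" using L1[OF gg] L2(1)[of \<gamma>] lt_trans by blast
              then show False using z irrefl lt_trans by blast
            qed
          qed
          ultimately show ?thesis by blast
        qed
      qed
    qed
  next
    case False
    then have g': "\<xi> \<lhd> \<gamma>'" using le(2) by (simp add: le_def)
    have lt': "\<xi> < \<gamma>'" and nlt: "\<not> (\<xi> \<lhd> \<gamma> \<and> \<xi> < \<gamma>)"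
      using \<xi>(1) less False irrefl unfolding Q_def by auto
    show ?thesis
    proof (intro exI[of _ "Lv \<xi>"] conjI)
      show "Lv \<xi> \<lhd> (sc ^^ 2) (Lv \<gamma>)" "Lv \<xi> \<lhd> (sc ^^ 2) (Lv \<gamma>')"
        using Lle[OF le(1)] Lle[OF le(2)] L2' O.le_less_trans by blast+
      show "cut (Lv \<xi>) (point_code Lv \<gamma>) = cut (Lv \<xi>) (point_code Lv \<gamma>')" by (rule cut_eqI) (rule agr)
      show "\<not> point_code Lv \<gamma> (Lv \<xi>)" "point_code Lv \<gamma>' (Lv \<xi>)" unfolding at using g' lt' nlt by auto
    qed
  qed
qed

lemma point_code_node:
  assumes Lv: "\<And>\<gamma> \<delta> n. \<delta> \<lhd> \<gamma> \<Longrightarrow> (sc ^^ n) (Lv \<delta>) \<lhd> Lv \<gamma>"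
  shows "point_code Lv \<gamma> \<in> node ((sc ^^ (2 + j)) (Lv \<gamma>))"
proof -
  have t: "sc (Lv \<gamma>) \<lhd> (sc ^^ (2 + j)) (Lv \<gamma>)" using sc_pow_mono[of 1 "2 + j" "Lv \<gamma>"] by simp
  have "Lv \<xi> \<lhd> sc (Lv \<gamma>)" "sc (Lv \<xi>) \<lhd> sc (Lv \<gamma>)" if "\<xi> \<lhd> \<gamma>" for \<xi>
  proof -
    have "Lv \<xi> \<lhd> Lv \<gamma>" "sc (Lv \<xi>) \<lhd> Lv \<gamma>" using Lv[OF that, of 0] Lv[OF that, of 1] by simp_all
    then show "Lv \<xi> \<lhd> sc (Lv \<gamma>)" "sc (Lv \<xi>) \<lhd> sc (Lv \<gamma>)" using lt_trans[OF _ sc_gt] by blast+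
  qed
  then show ?thesis unfolding node_def point_code_def using t lt_trans by blast
qed

text \<open>In coordinate \<open>j\<close> the point \<open>\<gamma>\<close> is coded by a node of
  level \<open>(sc ^^ (2 + j)) (Lv \<gamma>)\<close>: the code ends with the place
  \<open>sc (Lv \<gamma>)\<close>, and the summand \<open>j\<close> makes the levels in different
  coordinates distinct even for equal points. So the ranking of the levels is always a
  permutation.\<close>

lemma bounded_colours:
  assumes sat: "saturated r (UNIV :: 'q set)"
    and f: "\<And>x. f x \<lhd> D" "\<And>x y. (\<And>j. j < Suc d \<Longrightarrow> x j = y j) \<Longrightarrow> f x = f y"
    and can: "\<And>h :: (nat \<Rightarrow> 'q) \<Rightarrow> (nat \<Rightarrow> 'q \<Rightarrow> bool) \<Rightarrow> 'q. node_col (Suc d) h \<Longrightarrow>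
       \<exists>l s \<phi> c. tree_embedding (Suc d) l s \<phi> \<and> (\<forall>g x. (\<forall>j<Suc d. x j \<in> node (g j)) \<longrightarrow> inj_on g {..<Suc d} \<longrightarrow>
         pull_col h l \<phi> g x = c (restrict (rank (Suc d) {} g) {..<Suc d}))"
  shows "\<exists>(G :: nat \<Rightarrow> 'q \<Rightarrow> 'q) c. (\<forall>j<Suc d. strict_mono (G j)) \<and>
     (\<forall>y. \<exists>p. p permutes {..<Suc d} \<and> f (\<lambda>j. G j (y j)) = c (restrict p {..<Suc d}))"
proof -
  let ?m = "Suc d"
  obtain e :: "'q \<Rightarrow> ('q \<Rightarrow> bool) \<Rightarrow> 'q" where
    e: "\<And>\<gamma> x \<eta>. \<eta> \<lhd> \<gamma> \<Longrightarrow> (if x \<eta> then e \<eta> (cut \<eta> x) < e \<gamma> x else e \<gamma> x < e \<eta> (cut \<eta> x))"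
    using tree_to_order[OF sat] by blast
  obtain Lv where Lv: "\<And>\<gamma> \<delta> n. \<delta> \<lhd> \<gamma> \<Longrightarrow> (sc ^^ n) (Lv \<delta>) \<lhd> Lv \<gamma>" using sparse_levels by blast
  define h where "h g x = f (\<lambda>j. e (g j) (x j))" for g :: "nat \<Rightarrow> 'q" and x :: "nat \<Rightarrow> 'q \<Rightarrow> bool"
  have "node_col ?m h" unfolding node_col_def h_def
    by (intro conjI allI impI exI[of _ D] f) simp
  note h = can[OF this]
  then obtain l s \<phi> c where te: "tree_embedding ?m l s \<phi>" and
    c: "\<forall>g x. (\<forall>j<?m. x j \<in> node (g j)) \<longrightarrow> inj_on g {..<?m} \<longrightarrow>
         pull_col h l \<phi> g x = c (restrict (rank ?m {} g) {..<?m})"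
    using h by (elim exE conjE) (rule that)
  define len where "len j \<gamma> = (sc ^^ (2 + j)) (Lv \<gamma>)" for j \<gamma>
  define G where "G j \<gamma> = e (l (len j \<gamma>)) (\<phi> j (len j \<gamma>) (point_code Lv \<gamma>))" for j \<gamma>
  have pn: "point_code Lv \<gamma> \<in> node (len j \<gamma>)" for j \<gamma> unfolding len_def by (rule point_code_node[OF Lv])
  have "strict_mono (G j)" if j: "j < ?m" for j
  proof (rule strict_monoI)
    fix \<gamma> \<gamma>' :: 'q assume "\<gamma> < \<gamma>'"
    then have "\<exists>\<zeta>. \<zeta> \<lhd> (sc ^^ 2) (Lv \<gamma>) \<and> \<zeta> \<lhd> (sc ^^ 2) (Lv \<gamma>') \<and>
        cut \<zeta> (point_code Lv \<gamma>) = cut \<zeta> (point_code Lv \<gamma>') \<and> \<not> point_code Lv \<gamma> \<zeta> \<and> point_code Lv \<gamma>' \<zeta>"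
      by (intro point_code_differ Lv)
    then obtain \<zeta> where z: "\<zeta> \<lhd> (sc ^^ 2) (Lv \<gamma>)" "\<zeta> \<lhd> (sc ^^ 2) (Lv \<gamma>')"
      "cut \<zeta> (point_code Lv \<gamma>) = cut \<zeta> (point_code Lv \<gamma>')" "\<not> point_code Lv \<gamma> \<zeta>" "point_code Lv \<gamma>' \<zeta>"
      by (elim exE conjE) (rule that)
    have l2: "(sc ^^ 2) (Lv a) \<unlhd> len j a" for a unfolding len_def using sc_pow_mono[of 2 "2 + j" "Lv a"] by (cases j) (auto simp: le_def)
    have zl: "\<zeta> \<lhd> len j \<gamma>" "\<zeta> \<lhd> len j \<gamma>'" using z(1,2) l2 O.less_le_trans by blast+
    let ?y = "\<phi> j (len j \<gamma>) (point_code Lv \<gamma>)" and ?y' = "\<phi> j (len j \<gamma>') (point_code Lv \<gamma>')"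
    have y: "\<not> ?y (s \<zeta>)" "?y' (s \<zeta>)"
      using te_split[OF te j pn zl(1)] te_split[OF te j pn zl(2)] z(4,5) by simp_all
    have eq: "cut (s \<zeta>) ?y = cut (s \<zeta>) ?y'" by (rule te_agree[OF te j pn pn zl z(3)])
    \<comment> \<open>The two images branch at level \<open>s \<zeta>\<close>, and the value of
      \<open>e\<close> at the branching node separates their values.\<close>
    have "G j \<gamma> < e (s \<zeta>) (cut (s \<zeta>) ?y)" unfolding G_def using e[OF te_mono(6)[OF te zl(1)], of ?y] y(1) by simp
    also have "\<dots> < G j \<gamma>'" unfolding G_def eq using e[OF te_mono(6)[OF te zl(2)], of ?y'] y(2) by simp
    finally show "G j \<gamma> < G j \<gamma>'" .
  qed
  moreover have "\<exists>p. p permutes {..<?m} \<and> f (\<lambda>j. G j (y j)) = c (restrict p {..<?m})" for y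
  proof -
    define g where "g j = len j (y j)" for j
    have ne: "len i a \<noteq> len j b" if "i \<noteq> j" for i j a b
    proof (cases "a = b")
      case True
      have "2 + i < 2 + j \<or> 2 + j < 2 + i" using that by linarith
      then show ?thesis unfolding len_def True using sc_pow_less_iff[of "2 + i" "Lv b" "2 + j"] sc_pow_less_iff[of "2 + j" "Lv b" "2 + i"] irrefl
        by metis
    next
      case False
      then consider "a \<lhd> b" | "b \<lhd> a" using lt_total by blast
      then show ?thesis
      proof cases
        case 1
        then have "len i a \<lhd> len j b" unfolding len_def using Lv[OF 1] sc_pow_ge O.less_le_trans by blast
        then show ?thesis using irrefl by metis
      next
        case 2
        then have "len j b \<lhd> len i a" unfolding len_def using Lv[OF 2] sc_pow_ge O.less_le_trans by blast
        then show ?thesis using irrefl by metis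
      qed
    qed
    have inj: "inj_on g {..<?m}" unfolding g_def using ne by (meson inj_onI)
    let ?\<rho> = "rank ?m {} g"
    have "inj_on ?\<rho> {..<?m}"
    proof (rule inj_onI)
      fix i j assume ij: "i \<in> {..<?m}" "j \<in> {..<?m}" "?\<rho> i = ?\<rho> j"
      then have "\<not> g i \<lhd> g j" "\<not> g j \<lhd> g i"
        using rank_less_iff[of i ?m "{}" j g] rank_less_iff[of j ?m "{}" i g] by auto
      then have "g i = g j" using lt_total by blast
      then show "i = j" using inj ij by (auto simp: inj_on_def)
    qed
    moreover have "?\<rho> ` {..<?m} \<subseteq> {..<?m}" using rank_bound[of _ ?m "{}" g] by auto
    ultimately have b: "bij_betw ?\<rho> {..<?m} {..<?m}" by (simp add: bij_betw_def endo_inj_surj)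
    define p where "p = (\<lambda>j. if j \<in> {..<?m} then ?\<rho> j else j)"
    have "bij_betw p {..<?m} {..<?m}" using b by (rule bij_betw_cong[THEN iffD1, rotated]) (simp add: p_def)
    then have "p permutes {..<?m}" by (rule bij_imp_permutes) (auto simp: p_def)
    moreover have "restrict p {..<?m} = restrict ?\<rho> {..<?m}" by (rule restrict_ext) (simp add: p_def)
    moreover have "pull_col h l \<phi> g (\<lambda>j. point_code Lv (y j)) = c (restrict ?\<rho> {..<?m})"
      by (rule c[rule_format, OF _ inj]) (simp add: g_def pn)
    moreover have "pull_col h l \<phi> g (\<lambda>j. point_code Lv (y j)) = f (\<lambda>j. G j (y j))"
      unfolding pull_col_def h_def G_def g_def ..
    ultimately show ?thesis by metis
  qed
  ultimately show ?thesis by blast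
qed

text \<open>Some colour \<open>c\<close> occurs in every small refinement of some gap
  \<open>(A, B)\<close>. Otherwise the colours are excluded one after the other by shrinking gaps,
  and a point in the gap of stage \<open>D\<close> has no colour left. Inside the gap found, a copy
  of the order is built recursively from points of colour \<open>c\<close>.\<close>

lemma one_dimensional:
  assumes sat: "saturated r (UNIV :: 'q set)" and f: "\<And>x :: 'q. (f x :: 'q) \<lhd> D"
  shows "\<exists>(G :: 'q \<Rightarrow> 'q) c. strict_mono G \<and> (\<forall>x. f (G x) = c)"
proof -
  define PB where "PB A B \<longleftrightarrow> small A \<and> small B \<and> (\<forall>a\<in>A. \<forall>b\<in>B. a < b)" for A B :: "'q set"
  define btw where "btw A B x \<longleftrightarrow> (\<forall>a\<in>A. a < x) \<and> (\<forall>b\<in>B. x < b)" for A B and x :: 'q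
  have sat': "\<exists>x. btw A B x" if "PB A B" for A B
  proof -
    have "\<exists>x\<in>UNIV. (\<forall>a\<in>A. a < x) \<and> (\<forall>b\<in>B. x < b)"
      by (rule sat[unfolded saturated_def, rule_format]) (use that in \<open>simp_all add: PB_def\<close>)
    then show ?thesis unfolding btw_def by blast
  qed
  have "\<exists>A B c. PB A B \<and> (\<forall>A' B'. PB A' B' \<longrightarrow> A \<subseteq> A' \<longrightarrow> B \<subseteq> B' \<longrightarrow> (\<exists>x. f x = c \<and> btw A' B' x))"
  proof (rule ccontr)
    assume "\<not> ?thesis"
    then have no: "\<exists>A' B'. PB A' B' \<and> A \<subseteq> A' \<and> B \<subseteq> B' \<and> (\<forall>x. btw A' B' x \<longrightarrow> f x \<noteq> c)" if "PB A B" for A B c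
      using that by blast
    define P where "P h c S \<longleftrightarrow> PB (fst S) (snd S) \<and> (\<forall>b. b \<lhd> c \<longrightarrow> fst (h b) \<subseteq> fst S \<and> snd (h b) \<subseteq> snd S) \<and>
       (\<forall>x. btw (fst S) (snd S) x \<longrightarrow> f x \<noteq> c)" for h :: "'q \<Rightarrow> 'q set \<times> 'q set" and c S
    have "\<exists>h. \<forall>c. P h c (h c)"
    proof (rule dependent_wf_choice[OF wf_lt])
      fix h h' :: "'q \<Rightarrow> 'q set \<times> 'q set" and c S assume "\<And>z. (z, c) \<in> {(x, y). x \<lhd> y} \<Longrightarrow> h z = h' z"
      then have "\<And>\<delta>. \<delta> \<lhd> c \<Longrightarrow> h \<delta> = h' \<delta>" by simp
      then show "P h c S = P h' c S" unfolding P_def by (simp cong: imp_cong)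
    next
      fix c h assume "\<And>b. (b, c) \<in> {(x, y). x \<lhd> y} \<Longrightarrow> P h b (h b)"
      then have IH: "P h b (h b)" if "b \<lhd> c" for b using that by simp
      let ?A = "\<Union>b\<in>{b. b \<lhd> c}. fst (h b)" and ?B = "\<Union>b\<in>{b. b \<lhd> c}. snd (h b)"
      have pb: "PB (fst (h b)) (snd (h b))" if "b \<lhd> c" for b using IH[OF that] unfolding P_def by blast
      have mono: "fst (h b) \<subseteq> fst (h b') \<and> snd (h b) \<subseteq> snd (h b')" if "b \<lhd> b'" "b' \<lhd> c" for b b'
        using IH[OF that(2)] that(1) unfolding P_def by blast
      have "PB ?A ?B" unfolding PB_def
      proof (intro conjI ballI)
        show "small ?A" "small ?B" using pb unfolding PB_def by (auto intro!: small_UN small_seg)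
        fix x y assume "x \<in> ?A" "y \<in> ?B"
        then obtain b b' where b: "b \<lhd> c" "x \<in> fst (h b)" "b' \<lhd> c" "y \<in> snd (h b')" by blast
        define t where "t = (if b \<lhd> b' then b' else b)"
        have "t \<lhd> c" "x \<in> fst (h t)" "y \<in> snd (h t)"
          using b mono[of b b'] mono[of b' b] lt_total[of b b'] unfolding t_def by auto
        then show "x < y" using pb[of t] unfolding PB_def by blast
      qed
      then obtain A' B' where "PB A' B'" "?A \<subseteq> A'" "?B \<subseteq> B'" "\<forall>x. btw A' B' x \<longrightarrow> f x \<noteq> c" using no[of ?A ?B c] by blast
      then have "P h c (A', B')" unfolding P_def fst_conv snd_conv by blast
      then show "\<exists>S. P h c S" by blast
    qed
    then obtain h where h: "\<And>c. P h c (h c)" by blast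
    then obtain x where x: "btw (fst (h D)) (snd (h D)) x" using sat' unfolding P_def by blast
    have "fst (h (f x)) \<subseteq> fst (h D) \<and> snd (h (f x)) \<subseteq> snd (h D)" using h[of D] f[of x] unfolding P_def by blast
    then have "btw (fst (h (f x))) (snd (h (f x))) x" using x unfolding btw_def by blast
    then show False using h[of "f x"] unfolding P_def by blast
  qed
  then obtain A B c where AB: "PB A B" and
    good: "\<forall>A' B'. PB A' B' \<longrightarrow> A \<subseteq> A' \<longrightarrow> B \<subseteq> B' \<longrightarrow> (\<exists>x. f x = c \<and> btw A' B' x)"
    by (elim exE conjE) (rule that)
  define P where "P g \<gamma> y \<longleftrightarrow> f y = c \<and> btw A B y \<and> (\<forall>\<delta>. \<delta> \<lhd> \<gamma> \<longrightarrow> (\<delta> < \<gamma> \<longrightarrow> g \<delta> < y) \<and> (\<gamma> < \<delta> \<longrightarrow> y < g \<delta>))"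
    for g :: "'q \<Rightarrow> 'q" and \<gamma> y
  have "\<exists>g. \<forall>\<gamma>. P g \<gamma> (g \<gamma>)"
  proof (rule dependent_wf_choice[OF wf_lt])
    fix g g' :: "'q \<Rightarrow> 'q" and \<gamma> y assume "\<And>z. (z, \<gamma>) \<in> {(x, y). x \<lhd> y} \<Longrightarrow> g z = g' z"
    then have "\<And>\<delta>. \<delta> \<lhd> \<gamma> \<Longrightarrow> g \<delta> = g' \<delta>" by simp
    then show "P g \<gamma> y = P g' \<gamma> y" unfolding P_def by (simp cong: imp_cong)
  next
    fix \<gamma> g assume "\<And>b. (b, \<gamma>) \<in> {(x, y). x \<lhd> y} \<Longrightarrow> P g b (g b)"
    then have IH: "P g b (g b)" if "b \<lhd> \<gamma>" for b using that by simp
    let ?A = "A \<union> g ` {\<delta>. \<delta> \<lhd> \<gamma> \<and> \<delta> < \<gamma>}" and ?B = "B \<union> g ` {\<delta>. \<delta> \<lhd> \<gamma> \<and> \<gamma> < \<delta>}"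
    have bt: "btw A B (g \<delta>)" if "\<delta> \<lhd> \<gamma>" for \<delta> using IH[OF that] unfolding P_def by blast
    have mono: "g \<delta> < g \<delta>'" if "\<delta> \<lhd> \<gamma>" "\<delta>' \<lhd> \<gamma>" "\<delta> < \<delta>'" for \<delta> \<delta>'
    proof -
      have "\<delta> \<lhd> \<delta>' \<or> \<delta>' \<lhd> \<delta>" using lt_total[of \<delta> \<delta>'] that(3) by auto
      then show ?thesis using IH[OF that(1)] IH[OF that(2)] that(3) unfolding P_def by blast
    qed
    have "PB ?A ?B" unfolding PB_def
    proof (intro conjI ballI)
      show "small ?A" "small ?B" using AB unfolding PB_def
        by (auto intro!: small_Un[OF _ small_image[OF small_mono[OF _ small_seg[of \<gamma>]]]])
      fix a b assume "a \<in> ?A" "b \<in> ?B"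
      then show "a < b"
      proof (elim UnE imageE)
        fix \<delta> \<delta>' assume "a = g \<delta>" "\<delta> \<in> {\<delta>. \<delta> \<lhd> \<gamma> \<and> \<delta> < \<gamma>}" "b = g \<delta>'" "\<delta>' \<in> {\<delta>. \<delta> \<lhd> \<gamma> \<and> \<gamma> < \<delta>}"
        then show ?thesis using mono[of \<delta> \<delta>'] by auto
      qed (use AB bt in \<open>auto simp: PB_def btw_def\<close>)
    qed
    then have "\<exists>y. f y = c \<and> btw ?A ?B y" by (intro good[rule_format]) auto
    then obtain y where y: "f y = c" "btw ?A ?B y" by blast
    then have "P g \<gamma> y" unfolding P_def btw_def by auto
    then show "\<exists>y. P g \<gamma> y" by blast
  qed
  then obtain g where g: "\<And>\<gamma>. P g \<gamma> (g \<gamma>)" by blast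
  have "strict_mono g"
  proof (rule strict_monoI)
    fix x y :: 'q assume "x < y"
    moreover have "x \<lhd> y \<or> y \<lhd> x" using lt_total[of x y] \<open>x < y\<close> by auto
    ultimately show "g x < g y" using g[of x] g[of y] unfolding P_def by blast
  qed
  moreover have "\<forall>x. f (g x) = c" using g unfolding P_def by blast
  ultimately show ?thesis by (intro exI[of _ g] exI[of _ c] conjI)
qed

text \<open>The components are chosen in the order prescribed by \<open>p\<close>, each above the
  earlier ones, which is possible because a set that is not small is unbounded.\<close>

lemma all_permutations:
  assumes X: "\<And>j. j < m \<Longrightarrow> \<not> small (X j)" and p: "p permutes {..<m}"
  shows "\<exists>x :: nat \<Rightarrow> 'q. (\<forall>j<m. x j \<in> X j) \<and> (\<forall>j<m. rank m {} x j = p j)"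
proof -
  have "\<exists>x. (\<forall>j<m. p j < k \<longrightarrow> x j \<in> X j) \<and> (\<forall>i<m. \<forall>j<m. p i < p j \<longrightarrow> p j < k \<longrightarrow> x i \<lhd> x j)" for k
  proof (induction k)
    case (Suc k)
    then obtain x where x: "\<forall>j<m. p j < k \<longrightarrow> x j \<in> X j" "\<forall>i<m. \<forall>j<m. p i < p j \<longrightarrow> p j < k \<longrightarrow> x i \<lhd> x j" by blast
    show ?case
    proof (cases "\<exists>j<m. p j = k")
      case True
      then obtain j0 where j0: "j0 < m" "p j0 = k" by blast
      have uniq: "j = j0" if "p j = k" for j using permutes_inj[OF p] j0(2) that by (auto simp: inj_def)
      obtain \<eta> where \<eta>: "\<forall>y\<in>x ` {..<m}. y \<lhd> \<eta>" using small_bounded[OF small_finite, of "x ` {..<m}"] by auto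
      have "\<exists>y\<in>X j0. \<not> y \<lhd> \<eta>" using X[OF j0(1)] bounded_small by blast
      then obtain y where y: "y \<in> X j0" "\<eta> \<unlhd> y" using O.not_less by blast
      let ?x = "x(j0 := y)"
      have a: "?x j \<in> X j" if "j < m" "p j < Suc k" for j
        using x(1) y(1) uniq[of j] that by (cases "j = j0") auto
      have b: "?x i \<lhd> ?x j" if "i < m" "j < m" "p i < p j" "p j < Suc k" for i j
      proof -
        have i: "i \<noteq> j0" using that j0(2) by auto
        show ?thesis
        proof (cases "j = j0")
          case True
          then show ?thesis using i \<eta> that(1) y(2) O.less_le_trans by auto
        next
          case False
          then have "p j < k" using that(4) uniq[of j] by (metis less_Suc_eq)
          then show ?thesis using x(2) that i False by simp
        qed
      qed
      show ?thesis using a b by blast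
    next
      case False
      then show ?thesis using x by (metis less_Suc_eq)
    qed
  qed simp
  from this[of m] obtain x where x: "\<forall>j<m. p j < m \<longrightarrow> x j \<in> X j" "\<forall>i<m. \<forall>j<m. p i < p j \<longrightarrow> p j < m \<longrightarrow> x i \<lhd> x j" by blast
  have pm: "p j < m" if "j < m" for j using permutes_in_image[OF p, of j] that by simp
  have iff: "x i \<lhd> x j \<longleftrightarrow> p i < p j" if "i < m" "j < m" for i j
  proof
    assume a: "x i \<lhd> x j"
    show "p i < p j"
    proof (rule ccontr)
      assume "\<not> p i < p j"
      then have "p i = p j \<or> p j < p i" by auto
      then show False
      proof
        assume "p i = p j"
        then have "i = j" using permutes_inj[OF p] by (auto simp: inj_def)
        then show False using a irrefl by blast
      next
        assume "p j < p i"
        then have "x j \<lhd> x i" using x(2) that pm by blast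
        then show False using a irrefl lt_trans by blast
      qed
    qed
  qed (use x(2) that pm in blast)
  have "rank m {} x j = p j" if j: "j < m" for j
  proof -
    have "{i. i < m \<and> i \<notin> {} \<and> x i \<lhd> x j} = {i \<in> {..<m}. p i < p j}" using iff j by auto
    moreover have "p ` {i \<in> {..<m}. p i < p j} = {..<p j}"
    proof
      show "{..<p j} \<subseteq> p ` {i \<in> {..<m}. p i < p j}"
      proof
        fix k assume k: "k \<in> {..<p j}"
        then have "k \<in> {..<m}" using pm[OF j] by simp
        then obtain i where "i \<in> {..<m}" "p i = k" using permutes_image[OF p] by (metis imageE)
        then show "k \<in> p ` {i \<in> {..<m}. p i < p j}" using k by auto
      qed
    qed auto
    moreover have "card (p ` {i \<in> {..<m}. p i < p j}) = card {i \<in> {..<m}. p i < p j}"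
      by (rule card_image) (use permutes_inj[OF p] in \<open>auto simp: inj_on_def inj_def\<close>)
    ultimately show ?thesis unfolding rank_def by simp
  qed
  then show ?thesis using x(1) pm by blast
qed

end

section \<open>Polarized colourings of the saturated order\<close>

lemma inaccessible_ordIso:
  assumes \<kappa>: "inaccessible \<kappa>" and iso: "\<kappa> =o r"
  shows "inaccessible r"
proof -
  have C: "Card_order \<kappa>" "regularCard \<kappa>" "natLeq <o \<kappa>" using \<kappa> by (simp_all add: inaccessible_def)
  have Cr: "Card_order r" using C(1) iso by (rule Card_order_ordIso2)
  have "Cinfinite \<kappa>" using inaccessible_infinite[OF \<kappa>] C(1) by (simp add: cinfinite_def)
  then have reg: "regularCard r" using regularCard_ordIso[OF iso] C(2) by blast
  have less: "|A| <o \<kappa> \<longleftrightarrow> |A| <o r" for A :: "'x set"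
    using ordLess_ordIso_trans[OF _ iso] ordLess_ordIso_trans[OF _ ordIso_symmetric[OF iso]] by blast
  have "|Pow A| <o r" if A: "A \<subseteq> Field r" "|A| <o r" for A
  proof -
    have "|Field r| =o |Field \<kappa>|"
      using card_of_cong[OF iso] ordIso_symmetric by blast
    then obtain g where g: "bij_betw g (Field r) (Field \<kappa>)" using card_of_ordIso by blast
    have g: "bij_betw g A (g ` A)" "g ` A \<subseteq> Field \<kappa>"
      using g A(1) by (auto simp: bij_betw_def inj_on_subset)
    have "|g ` A| <o \<kappa>" using less A(2) card_of_image ordLeq_ordLess_trans by blast
    then have "|Pow (g ` A)| <o \<kappa>" using \<kappa> g(2) by (simp add: inaccessible_def)
    moreover have "|Pow A| =o |Pow (g ` A)|" using bij_betw_Pow[OF g(1)] card_of_ordIso by blast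
    ultimately show ?thesis using less ordIso_ordLess_trans by blast
  qed
  then show ?thesis using Cr reg ordLess_ordIso_trans[OF C(3) iso] by (simp add: inaccessible_def)
qed

text \<open>A bijection with \<open>Field \<kappa>\<close> carries the well-order of \<kappa> over
  to the type; it is not related to the linear order there.\<close>

lemma saturated_order_type:
  fixes \<kappa> :: "'k rel"
  assumes \<kappa>: "inaccessible \<kappa>" and Q: "is_Q_kappa \<kappa> TYPE('q::linorder)"
  shows "\<exists>(r :: 'q rel) i. inacc_linorder r \<and> r =o \<kappa> \<and> saturated r (UNIV :: 'q set) \<and> bij_betw i UNIV (Field \<kappa>) \<and>
    (\<forall>x y. inacc_wo.lt r x y \<longleftrightarrow> i x \<in> underS \<kappa> (i y))"
proof -
  have C: "Card_order \<kappa>" using \<kappa> by (simp add: inaccessible_def)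
  have "|UNIV :: 'q set| =o |Field \<kappa>|"
    using Q card_of_Field_ordIso[OF C] ordIso_symmetric ordIso_transitive unfolding is_Q_kappa_def by blast
  then obtain i :: "'q \<Rightarrow> 'k" where i: "bij_betw i UNIV (Field \<kappa>)" using card_of_ordIso by blast
  define j where "j = inv_into UNIV i"
  have j: "bij_betw j (Field \<kappa>) UNIV" unfolding j_def using i by (rule bij_betw_inv_into)
  have ji: "j (i x) = x" and ij: "k \<in> Field \<kappa> \<Longrightarrow> i (j k) = k" for x k
    using i unfolding j_def by (simp_all add: bij_betw_inv_into_left bij_betw_inv_into_right)
  define r where "r = dir_image \<kappa> j"
  have "\<kappa> =o r" unfolding r_def
    by (rule dir_image_ordIso) (use C j in \<open>auto simp: bij_betw_def card_order_on_well_order_on\<close>)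
  note iso = this ordIso_symmetric[OF this]
  have "Field r = UNIV" unfolding r_def dir_image_Field using j by (simp add: bij_betw_def)
  then have wo: "inacc_wo r" using inaccessible_ordIso[OF \<kappa> iso(1)] by unfold_locales
  then interpret inacc_linorder r unfolding inacc_linorder_def .
  have "|A| <o r \<longleftrightarrow> |A| <o \<kappa>" for A :: "'q set"
    using ordLess_ordIso_trans[OF _ iso(1)] ordLess_ordIso_trans[OF _ iso(2)] by blast
  then have "saturated r (UNIV :: 'q set)" using Q unfolding is_Q_kappa_def saturated_def by simp
  moreover have "inacc_wo.lt r x y \<longleftrightarrow> i x \<in> underS \<kappa> (i y)" for x y
  proof -
    have "(x, y) \<in> r \<longleftrightarrow> (i x, i y) \<in> \<kappa>"
    proof
      assume "(x, y) \<in> r"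
      then obtain a b where ab: "x = j a" "y = j b" "(a, b) \<in> \<kappa>" unfolding r_def dir_image_def by blast
      then have "a \<in> Field \<kappa>" "b \<in> Field \<kappa>" by (auto simp: Field_def)
      then show "(i x, i y) \<in> \<kappa>" using ab ij by simp
    next
      assume "(i x, i y) \<in> \<kappa>"
      then have "(j (i x), j (i y)) \<in> r" unfolding r_def dir_image_def by blast
      then show "(x, y) \<in> r" by (simp add: ji)
    qed
    moreover have "x \<noteq> y \<longleftrightarrow> i x \<noteq> i y" by (metis ji)
    ultimately show ?thesis unfolding lt_def underS_def by blast
  qed
  ultimately show ?thesis using inacc_linorder_axioms iso(2) i by blast
qed

text \<open>If \<open>lam\<close> could be injected into the colours, an \<open>n\<close>-set could
  be coloured by one of its elements, and two disjoint \<open>n\<close>-subsets of a homogeneous set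
  would get different colours.\<close>

lemma arrow_source_large:
  assumes \<kappa>: "infinite (Field \<kappa>)" "Card_order \<kappa>" and arr: "arrows lam \<kappa> n \<mu>" and n: "0 < n" and \<mu>: "Card_order \<mu>"
  shows "\<mu> <o |Field lam|"
proof (rule ccontr)
  assume "\<not> ?thesis"
  then have "|Field lam| \<le>o \<mu>"
    using \<mu> by (simp add: not_ordLess_iff_ordLeq card_order_on_well_order_on card_of_Well_order)
  then have "|Field lam| \<le>o |Field \<mu>|"
    using card_of_Field_ordIso[OF \<mu>] ordIso_symmetric ordLeq_ordIso_trans by blast
  then obtain \<iota> where \<iota>: "inj_on \<iota> (Field lam)" "\<iota> ` Field lam \<subseteq> Field \<mu>" by (meson card_of_ordLeq)
  define el where "el s = (SOME x. x \<in> s)" for s :: "'b set"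
  have el: "el s \<in> s" if "s \<in> [B]\<^bsup>n\<^esup>" for s B
  proof -
    have "s \<noteq> {}" using that n by (auto simp: nsets_def)
    then show ?thesis unfolding el_def by (simp add: some_in_eq)
  qed
  have "(\<lambda>s. \<iota> (el s)) \<in> [Field lam]\<^bsup>n\<^esup> \<rightarrow> Field \<mu>"
  proof
    fix s assume s: "s \<in> [Field lam]\<^bsup>n\<^esup>"
    then have "el s \<in> Field lam" using el[OF s] by (auto simp: nsets_def)
    then show "\<iota> (el s) \<in> Field \<mu>" using \<iota>(2) by blast
  qed
  from arr[unfolded arrows_def, rule_format, OF this]
  obtain H c where H: "H \<subseteq> Field lam" "|H| =o \<kappa>" and c: "\<forall>s\<in>[H]\<^bsup>n\<^esup>. \<iota> (el s) = c" by blast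
  have "|H| =o |Field \<kappa>|" using H(2) card_of_Field_ordIso[OF \<kappa>(2)] ordIso_symmetric ordIso_transitive by blast
  then have inf: "infinite H" using \<kappa>(1) card_of_ordIso_finite by blast
  then obtain s where s: "finite s" "card s = n" "s \<subseteq> H" using infinite_arbitrarily_large by blast
  have "infinite (H - s)" using inf s(1) by simp
  then obtain t where t: "finite t" "card t = n" "t \<subseteq> H - s" using infinite_arbitrarily_large by blast
  have st: "s \<in> [H]\<^bsup>n\<^esup>" "t \<in> [H]\<^bsup>n\<^esup>" using s t by (auto simp: nsets_def)
  have in': "el s \<in> s" "el t \<in> t" using el st by blast+
  have "el s \<in> Field lam" "el t \<in> Field lam" using in' s(3) t(3) H(1) by auto
  moreover have "el s \<noteq> el t" using in' t(3) by auto
  ultimately  show False using c st \<iota>(1) by (metis inj_onD)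
qed

lemma (in inacc_wo) big_indexI:
  assumes \<kappa>: "inaccessible \<kappa>" "r =o \<kappa>" and lam: "Card_order lam" and d: "1 \<le> d"
    and arr: "arrows lam \<kappa> (2 * d) (ctwo ^c \<kappa>) \<or> (d = 1 \<and> lam =o cardSuc (ctwo ^c \<kappa>))"
  shows "big_index lam \<kappa> d"
proof -
  have "ctwo ^c \<kappa> <o |Field lam|"
    using arr
  proof
    assume "arrows lam \<kappa> (2 * d) (ctwo ^c \<kappa>)"
    then show ?thesis
      by (rule arrow_source_large[rotated 2])
        (use d inaccessible_infinite[OF \<kappa>(1)] \<kappa>(1) in \<open>simp_all add: Card_order_cexp inaccessible_def\<close>)
  next
    assume "d = 1 \<and> lam =o cardSuc (ctwo ^c \<kappa>)"
    then have "cardSuc (ctwo ^c \<kappa>) =o lam" using ordIso_symmetric by blast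
    then have "cardSuc (ctwo ^c \<kappa>) =o |Field lam|"
      using card_of_Field_ordIso[OF lam] ordIso_symmetric ordIso_transitive by blast
    then show ?thesis using cardSuc_greater[OF Card_order_cexp] ordLess_ordIso_trans by blast
  qed
  then have "|UNIV :: 'a set set| <o |Field lam|" using power_cexp[OF \<kappa>(2)] ordIso_ordLess_trans by blast
  then show ?thesis using assms by (auto simp: big_index_def)
qed

context inacc_linorder
begin

lemma has_type_eta_range: "strict_mono G \<Longrightarrow> has_type_eta (range (G :: 'q \<Rightarrow> 'q))"
  unfolding has_type_eta_def by blast

lemma has_type_eta_large: "has_type_eta (X :: 'q set) \<Longrightarrow> \<not> small X"
proof
  assume "has_type_eta X" "small X"
  then obtain g :: "'q \<Rightarrow> 'q" where g: "strict_mono g" "range g = X" unfolding has_type_eta_def by blast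
  have "small (UNIV :: 'q set)"
    by (rule small_inj[OF strict_mono_imp_inj_on[OF g(1)], where B = X]) (use g(2) \<open>small X\<close> in auto)
  then show False using r_ordIso(1) not_ordLess_ordIso ordIso_symmetric by blast
qed

text \<open>For \<open>d = 0\<close> this is the indivisibility of the saturated order; for larger
  \<open>d\<close> the colour is a function of the permutation that ranks the levels.\<close>

lemma few_colours:
  assumes sat: "saturated r (UNIV :: 'q set)"
    and bl: "branch_limits r (Field lam) N0 d L" "branch_limits r (Field lam) N0' (Suc d) L'"
    and big: "1 \<le> d \<Longrightarrow> big_index lam \<kappa> d"
    and f: "\<And>x :: nat \<Rightarrow> 'q. f x \<lhd> D" "\<And>x y. (\<And>j. j < Suc d \<Longrightarrow> x j = y j) \<Longrightarrow> f x = f y"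
  shows "\<exists>X C. (\<forall>j\<le>d. has_type_eta (X j)) \<and> finite C \<and> card C \<le> fact (Suc d) \<and>
     (\<forall>x. (\<forall>j\<le>d. x j \<in> X j) \<longrightarrow> f x \<in> C)"
proof (cases "d = 0")
  case True
  obtain G :: "'q \<Rightarrow> 'q" and c where G: "strict_mono G" "\<forall>x. f (\<lambda>_. G x) = c"
    using one_dimensional[OF sat, of "\<lambda>z. f (\<lambda>_. z)", OF f(1)] by (elim exE conjE) (rule that)
  have "f x \<in> {c}" if x: "\<forall>j\<le>d. x j \<in> range G" for x
  proof -
    obtain z where z: "x 0 = G z" using x by blast
    have "f x = f (\<lambda>_. G z)" by (rule f(2)) (simp add: True z)
    then show ?thesis using G(2) by simp
  qed
  then show ?thesis using has_type_eta_range[OF G(1)] by (intro exI[of _ "\<lambda>_. range G"] exI[of _ "{c}"]) (simp add: True)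
next
  case False
  then have "big_index lam \<kappa> d" using big by simp
  note can = canonical_subtrees[OF bl refl this]
  have "\<exists>(G :: nat \<Rightarrow> 'q \<Rightarrow> 'q) c. (\<forall>j<Suc d. strict_mono (G j)) \<and>
     (\<forall>y. \<exists>p. p permutes {..<Suc d} \<and> f (\<lambda>j. G j (y j)) = c (restrict p {..<Suc d}))"
  proof (rule bounded_colours[OF sat])
    show "f x \<lhd> D" for x by (rule f(1))
    show "f x = f y" if "\<And>j. j < Suc d \<Longrightarrow> x j = y j" for x y using that by (rule f(2))
  qed (rule can)
  then obtain G :: "nat \<Rightarrow> 'q \<Rightarrow> 'q" and c where G: "\<forall>j<Suc d. strict_mono (G j)"
    and c: "\<forall>y. \<exists>p. p permutes {..<Suc d} \<and> f (\<lambda>j. G j (y j)) = c (restrict p {..<Suc d})" by (elim exE conjE) (rule that)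
  let ?C = "(\<lambda>p. c (restrict p {..<Suc d})) ` {p. p permutes {..<Suc d}}"
  have fin: "finite {p. p permutes {..<Suc d}}" by (rule finite_permutations) simp
  have "card ?C \<le> card {p. p permutes {..<Suc d}}" using fin by (rule card_image_le)
  then have "card ?C \<le> fact (Suc d)" using card_permutations[of "{..<Suc d}" "Suc d"] by simp
  moreover have "f x \<in> ?C" if x: "\<forall>j\<le>d. x j \<in> range (G j)" for x
  proof -
    have "\<forall>j. \<exists>z. j \<le> d \<longrightarrow> x j = G j z" using x by blast
    then obtain y where y: "\<forall>j. j \<le> d \<longrightarrow> x j = G j (y j)" by metis
    have "f x = f (\<lambda>j. G j (y j))" by (rule f(2)) (simp add: y)
    then show ?thesis using c by auto
  qed
  moreover have "has_type_eta (range (G j))" if "j \<le> d" for j using G that by (intro has_type_eta_range) simp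
  ultimately show ?thesis using fin by (intro exI[of _ "\<lambda>j. range (G j)"] exI[of _ ?C]) blast
qed

text \<open>A tuple is coloured by its ranking in the well-order, ties allowed, and the finitely
  many rankings are coded by iterates of \<open>sc\<close> below
  \<open>(sc ^^ n) base_point\<close>. Those without ties are the \<open>(d + 1)!\<close>
  permutations.\<close>

lemma many_colours:
  "\<exists>D f. (\<forall>x :: nat \<Rightarrow> 'q. f x \<lhd> (D :: 'q)) \<and>
     (\<forall>X. (\<forall>j\<le>d. has_type_eta (X j)) \<longrightarrow> (\<exists>C. card C = fact (Suc d) \<and> C \<subseteq> f ` (\<Pi>\<^sub>E j\<in>{..d}. X j)))"
proof -
  let ?m = "Suc d"
  have "finite ({..<?m} \<rightarrow>\<^sub>E {..<?m})" by (intro finite_PiE) auto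
  from finite_imp_inj_to_nat_seg[OF this]
  obtain k and n :: nat where k: "k ` ({..<?m} \<rightarrow>\<^sub>E {..<?m}) = {i. i < n}" "inj_on k ({..<?m} \<rightarrow>\<^sub>E {..<?m})" by blast
  define code where "code p = (sc ^^ k (restrict p {..<?m})) (base_point :: 'q)" for p
  define f where "f x = code (rank ?m {} x)" for x :: "nat \<Rightarrow> 'q"
  have "f x \<lhd> (sc ^^ n) base_point" for x
  proof -
    have "restrict (rank ?m {} x) {..<?m} \<in> {..<?m} \<rightarrow>\<^sub>E {..<?m}" using rank_bound[of _ ?m "{}" x] by auto
    then have "k (restrict (rank ?m {} x) {..<?m}) < n" using k(1) by blast
    then show ?thesis unfolding f_def code_def by (rule sc_pow_mono)
  qed
  moreover have "\<exists>C. card C = fact ?m \<and> C \<subseteq> f ` (\<Pi>\<^sub>E j\<in>{..d}. X j)" if X: "\<forall>j\<le>d. has_type_eta (X j)" for X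
  proof (intro exI[of _ "code ` {p. p permutes {..<?m}}"] conjI)
    have "inj_on code {p. p permutes {..<?m}}"
    proof (rule inj_onI)
      fix p q assume pq: "p \<in> {p. p permutes {..<?m}}" "q \<in> {p. p permutes {..<?m}}" "code p = code q"
      let ?p = "restrict p {..<?m}" and ?q = "restrict q {..<?m}"
      have "k ?p = k ?q" using pq(3) irrefl sc_pow_mono[of "k ?p" "k ?q" base_point] sc_pow_mono[of "k ?q" "k ?p" base_point]
        unfolding code_def by (metis linorder_neqE_nat)
      moreover have "?p \<in> {..<?m} \<rightarrow>\<^sub>E {..<?m}" "?q \<in> {..<?m} \<rightarrow>\<^sub>E {..<?m}"
        using pq(1,2) permutes_in_image[of _ "{..<?m}"] by (intro restrict_PiE_iff[THEN iffD2]; blast)+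
      ultimately have eq: "?p = ?q" using k(2) by (simp add: inj_on_def)
      show "p = q"
      proof
        fix j show "p j = q j"
        proof (cases "j \<in> {..<?m}")
          case True then show ?thesis using fun_cong[OF eq, of j] by simp
        next
          case False then show ?thesis using pq(1,2) by (simp add: permutes_def)
        qed
      qed
    qed
    then show "card (code ` {p. p permutes {..<?m}}) = fact ?m"
      using card_permutations[of "{..<?m}" ?m] by (simp add: card_image)
    show "code ` {p. p permutes {..<?m}} \<subseteq> f ` (\<Pi>\<^sub>E j\<in>{..d}. X j)"
    proof (rule image_subsetI)
      fix p assume "p \<in> {p. p permutes {..<?m}}"
      then have p: "p permutes {..<?m}" by simp
      have large: "\<not> small (X j)" if "j < ?m" for j using X that has_type_eta_large by simp
      have "\<exists>x. (\<forall>j<?m. x j \<in> X j) \<and> (\<forall>j<?m. rank ?m {} x j = p j)"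
        by (rule all_permutations[OF _ p]) (rule large)
      then obtain x where x: "\<forall>j<?m. x j \<in> X j" "\<forall>j<?m. rank ?m {} x j = p j" by (elim exE conjE) (rule that)
      let ?x = "restrict x {..d}"
      have "rank ?m {} ?x j = p j" if j: "j < ?m" for j
      proof -
        have "{i. i < ?m \<and> i \<notin> {} \<and> ?x i \<lhd> ?x j} = {i. i < ?m \<and> i \<notin> {} \<and> x i \<lhd> x j}" using j by auto
        then show ?thesis using x(2) j unfolding rank_def by simp
      qed
      then have "restrict (rank ?m {} ?x) {..<?m} = restrict p {..<?m}" by (intro restrict_ext) simp
      then have "code p = f ?x" unfolding f_def code_def by simp
      moreover have "?x \<in> (\<Pi>\<^sub>E j\<in>{..d}. X j)" using x(1) by auto
      ultimately show "code p \<in> f ` (\<Pi>\<^sub>E j\<in>{..d}. X j)" by (rule image_eqI)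
    qed
  qed
  ultimately show ?thesis by blast
qed

end

text \<open>As \<open>card\<close> is 0 on infinite sets, the upper bound comes with finiteness, and
  the lower bound is claimed for finite images, an infinite image having more elements than any
  number.\<close>

theorem theorem1p1:
  fixes d :: nat and \<kappa> :: "'k rel" and lam :: "'l rel"
  assumes "inaccessible \<kappa>"
    and "Card_order lam" and "cinfinite lam"
    and "arrows lam \<kappa> (2 * d) (ctwo ^c \<kappa>) \<or> (d = 1 \<and> lam =o cardSuc (ctwo ^c \<kappa>))"
    and "measurable_in_Add_extension \<kappa> lam"
    and "is_Q_kappa \<kappa> TYPE('q::linorder)"
  shows "(\<forall>\<delta> \<in> Field \<kappa>. \<forall>f \<in> ({..d} \<rightarrow>\<^sub>E (UNIV :: 'q set)) \<rightarrow> underS \<kappa> \<delta>.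
            \<exists>X :: nat \<Rightarrow> 'q set. (\<forall>j\<le>d. has_type_eta (X j)) \<and>
              finite (f ` (\<Pi>\<^sub>E j\<in>{..d}. X j)) \<and>
              card (f ` (\<Pi>\<^sub>E j\<in>{..d}. X j)) \<le> fact (d + 1))
       \<and> (\<exists>\<delta> \<in> Field \<kappa>. \<exists>f \<in> ({..d} \<rightarrow>\<^sub>E (UNIV :: 'q set)) \<rightarrow> underS \<kappa> \<delta>.
            \<forall>X :: nat \<Rightarrow> 'q set. (\<forall>j\<le>d. has_type_eta (X j)) \<longrightarrow>
              (finite (f ` (\<Pi>\<^sub>E j\<in>{..d}. X j)) \<longrightarrow>
               card (f ` (\<Pi>\<^sub>E j\<in>{..d}. X j)) > fact (d + 1) - 1))"
proof -
  obtain r :: "'q rel" and i :: "'q \<Rightarrow> 'k" where lin: "inacc_linorder r" and r\<kappa>: "r =o \<kappa>" and sat: "saturated r (UNIV :: 'q set)"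
    and i: "bij_betw i UNIV (Field \<kappa>)" and lt: "\<forall>x y. inacc_wo.lt r x y \<longleftrightarrow> i x \<in> underS \<kappa> (i y)"
    using saturated_order_type[OF assms(1,6)] by (elim exE conjE) (rule that)
  interpret inacc_linorder r by (rule lin)
  show ?thesis
  proof (intro conjI ballI)
    fix \<delta> f assume \<delta>: "\<delta> \<in> Field \<kappa>" and f: "f \<in> ({..d} \<rightarrow>\<^sub>E (UNIV :: 'q set)) \<rightarrow> underS \<kappa> \<delta>"
    \<comment> \<open>Colours are moved from \<open>underS \<kappa> \<delta>\<close> to the type,
      and the domain is widened from extensional to arbitrary functions.\<close>
    define f0 where "f0 x = inv_into UNIV i (f (restrict x {..d}))" for x
    have fr: "f (restrict x {..d}) \<in> underS \<kappa> \<delta>" for x by (rule funcset_mem[OF f]) simp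
    then have "f (restrict x {..d}) \<in> Field \<kappa>" for x by (auto simp: underS_def Field_def)
    then have i0: "i (f0 x) = f (restrict x {..d})" for x
      unfolding f0_def using i by (simp add: bij_betw_inv_into_right)
    have i\<delta>: "i (inv_into UNIV i \<delta>) = \<delta>" using i \<delta> by (simp add: bij_betw_inv_into_right)
    have f0: "inacc_wo.lt r (f0 x) (inv_into UNIV i \<delta>)" for x using lt fr[of x] i0[of x] i\<delta> by simp
    have loc: "f0 x = f0 y" if "\<And>j. j < Suc d \<Longrightarrow> x j = y j" for x y
    proof -
      have "restrict x {..d} = restrict y {..d}" by (rule restrict_ext) (simp add: that)
      then show ?thesis by (simp add: f0_def)
    qed
    have bl: "\<exists>N0 L. branch_limits r (Field lam) N0 n L" for n
      by (rule branch_limits_exist[OF assms(1) r\<kappa> assms(5) i lt[rule_format]])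
    \<comment> \<open>Limits are taken for \<open>d\<close>-tuples, as \<open>tail_cone\<close>
      needs, and for \<open>(d + 1)\<close>-tuples, as \<open>level_homogeneous\<close>
      needs.\<close>
    obtain N0 L where bl1: "branch_limits r (Field lam) N0 d L" using bl by blast
    obtain N0' L' where bl2: "branch_limits r (Field lam) N0' (Suc d) L'" using bl by blast
    have "\<exists>X C. (\<forall>j\<le>d. has_type_eta (X j)) \<and> finite C \<and> card C \<le> fact (Suc d) \<and>
       (\<forall>x. (\<forall>j\<le>d. x j \<in> X j) \<longrightarrow> f0 x \<in> C)"
    proof (rule few_colours[OF sat bl1 bl2])
      show "big_index lam \<kappa> d" if "1 \<le> d" by (rule big_indexI[OF assms(1) r\<kappa> assms(2) that assms(4)])
      show "f0 x = f0 y" if "\<And>j. j < Suc d \<Longrightarrow> x j = y j" for x y using that by (rule loc)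
    qed (rule f0)
    then obtain X C where X: "\<forall>j\<le>d. has_type_eta (X j)" and C: "finite C" "card C \<le> fact (Suc d)"
      and sub: "\<forall>x. (\<forall>j\<le>d. x j \<in> X j) \<longrightarrow> f0 x \<in> C" by (elim exE conjE) (rule that)
    have im: "f ` (\<Pi>\<^sub>E j\<in>{..d}. X j) \<subseteq> i ` C"
    proof (rule image_subsetI)
      fix x assume x: "x \<in> (\<Pi>\<^sub>E j\<in>{..d}. X j)"
      then have "f0 x \<in> C" using sub by (auto simp: PiE_def Pi_def)
      moreover have "f x = i (f0 x)" using i0[of x] x by (simp add: PiE_restrict)
      ultimately show "f x \<in> i ` C" by simp
    qed
    have "card (f ` (\<Pi>\<^sub>E j\<in>{..d}. X j)) \<le> card (i ` C)" using im C(1) by (intro card_mono) auto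
    also have "\<dots> \<le> card C" using C(1) by (rule card_image_le)
    finally have "card (f ` (\<Pi>\<^sub>E j\<in>{..d}. X j)) \<le> fact (d + 1)" using C(2) by simp
    moreover have "finite (f ` (\<Pi>\<^sub>E j\<in>{..d}. X j))" using im C(1) finite_subset by blast
    ultimately show "\<exists>X :: nat \<Rightarrow> 'q set. (\<forall>j\<le>d. has_type_eta (X j)) \<and>
        finite (f ` (\<Pi>\<^sub>E j\<in>{..d}. X j)) \<and> card (f ` (\<Pi>\<^sub>E j\<in>{..d}. X j)) \<le> fact (d + 1)"
      using X by blast
  next
    obtain D :: 'q and f where f: "\<forall>x :: nat \<Rightarrow> 'q. inacc_wo.lt r (f x) D" and
      many: "\<forall>X. (\<forall>j\<le>d. has_type_eta (X j)) \<longrightarrow> (\<exists>C. card C = fact (Suc d) \<and> C \<subseteq> f ` (\<Pi>\<^sub>E j\<in>{..d}. X j))"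
      using many_colours[of d] by (elim exE conjE) (rule that)
    have inj: "inj i" using i by (simp add: bij_betw_def)
    show "\<exists>\<delta> \<in> Field \<kappa>. \<exists>f \<in> ({..d} \<rightarrow>\<^sub>E (UNIV :: 'q set)) \<rightarrow> underS \<kappa> \<delta>.
            \<forall>X :: nat \<Rightarrow> 'q set. (\<forall>j\<le>d. has_type_eta (X j)) \<longrightarrow>
              (finite (f ` (\<Pi>\<^sub>E j\<in>{..d}. X j)) \<longrightarrow>
               card (f ` (\<Pi>\<^sub>E j\<in>{..d}. X j)) > fact (d + 1) - 1)"
    proof (intro bexI[of _ "i D"] bexI[of _ "\<lambda>x. i (f x)"] allI impI)
      fix X :: "nat \<Rightarrow> 'q set"
      assume X: "\<forall>j\<le>d. has_type_eta (X j)" and fin: "finite ((\<lambda>x. i (f x)) ` (\<Pi>\<^sub>E j\<in>{..d}. X j))"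
      obtain C where C: "card C = fact (Suc d)" "C \<subseteq> f ` (\<Pi>\<^sub>E j\<in>{..d}. X j)" using many X by blast
      have "i ` C \<subseteq> (\<lambda>x. i (f x)) ` (\<Pi>\<^sub>E j\<in>{..d}. X j)" using C(2) by blast
      then have "card (i ` C) \<le> card ((\<lambda>x. i (f x)) ` (\<Pi>\<^sub>E j\<in>{..d}. X j))" using fin by (intro card_mono)
      moreover have "card (i ` C) = fact (d + 1)" using C(1) inj by (simp add: card_image inj_on_subset)
      moreover have "fact (d + 1) > (0 :: nat)" by (rule fact_gt_zero)
      ultimately show "card ((\<lambda>x. i (f x)) ` (\<Pi>\<^sub>E j\<in>{..d}. X j)) > fact (d + 1) - 1" by linarith
    next
      show "(\<lambda>x. i (f x)) \<in> ({..d} \<rightarrow>\<^sub>E (UNIV :: 'q set)) \<rightarrow> underS \<kappa> (i D)" using f lt by simp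
      show "i D \<in> Field \<kappa>" using i by (auto simp: bij_betw_def)
    qed
  qed
qed

end
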